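(* Let $G$ be an abelian group, let $k$ be a commutative $G$-ring, let $\delta\in k$, and let $n$ be an odd positive integer. Let $G\mathcal{B}_n(\delta)$ be the $G$-Brauer algebra over $k$. There is an isomorphism of graded $k$-modules $$\mathrm{Tor}_{\star}^{G\mathcal{B}_n(\delta)}(\mathbf{1},\mathbf{1})\cong \mathrm{Tor}_{\star}^{k[G^n\rtimes\Sigma_n]}(\mathbf{1},\mathbf{1})=H_{\star}(G^n\rtimes\Sigma_n,k),$$ where the symmetric group $\Sigma_n$ acts on $G^n$ by permuting the factors.
   Context: A commutative $G$-ring is a unital commutative ring $k$ together with a group homomorphism $G\to\mathrm{Aut}(k)$ to the group of ring automorphisms; the action of $g\in G$ on $\lambda\in k$ is written $g\lambda$. A $G$-Brauer $n$-diagram is a graph on two columns (left and right) of $n$ nodes in which each node is connected to exactly one other node by an edge (left-to-left, right-to-right and left-to-right edges are all allowed), and each edge is labelled by an element of $G$. The $G$-Brauer algebra $G\mathcal{B}_n(\delta)$ consists of formal $k$-linear combinations of $G$-Brauer $n$-diagrams. The product $x\cdot y$ of two diagrams is the $k$-bilinear extension of: identify the right-hand nodes of $x$ with the left-hand nodes of $y$, forget the middle nodes, label each edge formed by concatenation with the product of the group elements along it, and replace each closed loop formed in the middle by a factor $g\delta\in k$, where $g\in G$ is the product of all the labels on the loop. The trivial module $\mathbf{1}$ of $G\mathcal{B}_n(\delta)$ is a copy of $k$ (as a left and as a right module) on which diagrams with no left-to-left and no right-to-right connections act as $1$ and all other diagrams act as $0$. For the (untwisted) group algebra $k[G^n\rtimes\Sigma_n]$,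 $\mathbf{1}$ is $k$ with every group element acting as $1$. *)

theory Defs
  imports "HOL-Algebra.Module" "HOL-Algebra.QuotRing" "HOL-Algebra.Product_Groups"
    "HOL-Algebra.Sym_Groups" "HOL-Library.FSet"
begin

section \<open>Linear algebra over a ring\<close>

text \<open>
  Left and right modules over a possibly noncommutative ring are encoded by the library's
  \<open>module\<close> record, whose ring multiplication and unit are irrelevant and left unspecified.
  For a right module the term \<open>a \<odot>\<^bsub>M\<^esub> m\<close> stands for $m \cdot a$.
  A \<open>k\<close>-algebra is a \<open>module\<close> record over \<open>k\<close> whose multiplication and unit are meaningful.
\<close>

definition free_module :: "('r, 'c) ring_scheme \<Rightarrow> 'x set \<Rightarrow> ('r, 'x \<Rightarrow> 'r) module" where
  "free_module R X =
    \<lparr>carrier = {f. (\<forall>x\<in>X. f x \<in> carrier R) \<and> (\<forall>x. x \<notin> X \<longrightarrow> f x = \<zero>\<^bsub>R\<^esub>) \<and> finite {x. f x \<noteq> \<zero>\<^bsub>R\<^esub>}},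
     monoid.mult = undefined, one = undefined,
     zero = (\<lambda>x. \<zero>\<^bsub>R\<^esub>),
     add = (\<lambda>f g x. f x \<oplus>\<^bsub>R\<^esub> g x),
     smult = (\<lambda>a f x. a \<otimes>\<^bsub>R\<^esub> f x)\<rparr>"

definition basis_vec :: "('r, 'c) ring_scheme \<Rightarrow> 'x \<Rightarrow> 'x \<Rightarrow> 'r" where
  "basis_vec R x = (\<lambda>y. if y = x then \<one>\<^bsub>R\<^esub> else \<zero>\<^bsub>R\<^esub>)"

text \<open>The \<open>R\<close>-linear map from a free module to \<open>M\<close> that sends each basis element \<open>x\<close> to \<open>v x\<close>.\<close>

definition lin_ext ::
  "('r, 'c) ring_scheme \<Rightarrow> ('r, 'm, 'd) module_scheme \<Rightarrow> ('x \<Rightarrow> 'm) \<Rightarrow> ('x \<Rightarrow> 'r) \<Rightarrow> 'm" where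
  "lin_ext R M v f = (\<Oplus>\<^bsub>M\<^esub>x\<in>{x. f x \<noteq> \<zero>\<^bsub>R\<^esub>}. f x \<odot>\<^bsub>M\<^esub> v x)"

definition mod_span ::
  "('r, 'c) ring_scheme \<Rightarrow> ('r, 'm, 'd) module_scheme \<Rightarrow> 'm set \<Rightarrow> 'm set" where
  "mod_span R M S = \<Inter>{H. submodule H R M \<and> S \<subseteq> H}"

text \<open>The scalar \<open>c\<close> acts on cosets by \<open>c (N + x) = N + c x\<close>.\<close>

definition quot_module :: "('r, 'm, 'd) module_scheme \<Rightarrow> 'm set \<Rightarrow> ('r, 'm set) module" where
  "quot_module M N =
    \<lparr>carrier = a_rcosets\<^bsub>M\<^esub> N, monoid.mult = undefined, one = undefined,
     zero = N,
     add = (\<lambda>C D. C <+>\<^bsub>M\<^esub> D),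
     smult = (\<lambda>c C. \<Union>x\<in>C. N +>\<^bsub>M\<^esub> (c \<odot>\<^bsub>M\<^esub> x))\<rparr>"

definition mod_isomorphic ::
  "('r, 'c) ring_scheme \<Rightarrow> ('r, 'm, 'd) module_scheme \<Rightarrow> ('r, 'n, 'e) module_scheme \<Rightarrow> bool" where
  "mod_isomorphic R M N \<longleftrightarrow> (\<exists>h. bij_betw h (carrier M) (carrier N) \<and>
     (\<forall>x\<in>carrier M. \<forall>y\<in>carrier M. h (x \<oplus>\<^bsub>M\<^esub> y) = h x \<oplus>\<^bsub>N\<^esub> h y) \<and>
     (\<forall>c\<in>carrier R. \<forall>x\<in>carrier M. h (c \<odot>\<^bsub>M\<^esub> x) = c \<odot>\<^bsub>N\<^esub> h x))"

text \<open>
  A chain complex consists of modules \<open>C i\<close> and maps \<open>D i\<close> from \<open>C (Suc i)\<close> to \<open>C i\<close>;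
  the complex is zero in negative degrees.
\<close>

fun cycles :: "(nat \<Rightarrow> ('r, 'm) module) \<Rightarrow> (nat \<Rightarrow> 'm \<Rightarrow> 'm) \<Rightarrow> nat \<Rightarrow> 'm set" where
  "cycles C D 0 = carrier (C 0)"
| "cycles C D (Suc i) = {x \<in> carrier (C (Suc i)). D i x = \<zero>\<^bsub>C i\<^esub>}"

definition homology ::
  "(nat \<Rightarrow> ('r, 'm) module) \<Rightarrow> (nat \<Rightarrow> 'm \<Rightarrow> 'm) \<Rightarrow> nat \<Rightarrow> ('r, 'm set) module" where
  "homology C D i = quot_module ((C i)\<lparr>carrier := cycles C D i\<rparr>) (D i ` carrier (C (Suc i)))"


section \<open>Tensor products over a \<open>k\<close>-algebra\<close>

text \<open>
  For a right \<open>A\<close>-module \<open>M\<close> and a left \<open>A\<close>-module \<open>P\<close>, the tensor product of \<open>M\<close> and \<open>P\<close> over \<open>A\<close>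
  is the quotient of the free \<open>k\<close>-module on pairs by the usual relations. The last family makes
  the \<open>k\<close>-action the one induced by \<open>k \<rightarrow> A\<close>.
\<close>

definition tensor_rels ::
  "('k, 'c) ring_scheme \<Rightarrow> ('k, 'a, 'd) module_scheme \<Rightarrow> ('a, 'm, 'e) module_scheme \<Rightarrow>
   ('a, 'p, 'f) module_scheme \<Rightarrow> ('m \<times> 'p \<Rightarrow> 'k) set" where
  "tensor_rels k A M P =
    (let F = free_module k (carrier M \<times> carrier P); b = (\<lambda>m p. basis_vec k (m, p)) in
     mod_span k F
      ({b (m \<oplus>\<^bsub>M\<^esub> m') p \<ominus>\<^bsub>F\<^esub> (b m p \<oplus>\<^bsub>F\<^esub> b m' p) | m m' p.
          m \<in> carrier M \<and> m' \<in> carrier M \<and> p \<in> carrier P} \<union>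
       {b m (p \<oplus>\<^bsub>P\<^esub> p') \<ominus>\<^bsub>F\<^esub> (b m p \<oplus>\<^bsub>F\<^esub> b m p') | m p p'.
          m \<in> carrier M \<and> p \<in> carrier P \<and> p' \<in> carrier P} \<union>
       {b (a \<odot>\<^bsub>M\<^esub> m) p \<ominus>\<^bsub>F\<^esub> b m (a \<odot>\<^bsub>P\<^esub> p) | a m p.
          a \<in> carrier A \<and> m \<in> carrier M \<and> p \<in> carrier P} \<union>
       {c \<odot>\<^bsub>F\<^esub> b m p \<ominus>\<^bsub>F\<^esub> b ((c \<odot>\<^bsub>A\<^esub> \<one>\<^bsub>A\<^esub>) \<odot>\<^bsub>M\<^esub> m) p | c m p.
          c \<in> carrier k \<and> m \<in> carrier M \<and> p \<in> carrier P}))"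

definition tensor ::
  "('k, 'c) ring_scheme \<Rightarrow> ('k, 'a, 'd) module_scheme \<Rightarrow> ('a, 'm, 'e) module_scheme \<Rightarrow>
   ('a, 'p, 'f) module_scheme \<Rightarrow> ('k, ('m \<times> 'p \<Rightarrow> 'k) set) module" where
  "tensor k A M P = quot_module (free_module k (carrier M \<times> carrier P)) (tensor_rels k A M P)"

text \<open>The map \<open>id \<otimes> h\<close> induced on cosets by an \<open>A\<close>-linear map \<open>h\<close> from \<open>P\<close> to \<open>Q\<close>.\<close>

definition tensor_map ::
  "('k, 'c) ring_scheme \<Rightarrow> ('k, 'a, 'd) module_scheme \<Rightarrow> ('a, 'm, 'e) module_scheme \<Rightarrow>
   ('a, 'q, 'f) module_scheme \<Rightarrow> ('p \<Rightarrow> 'q) \<Rightarrow>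
   ('m \<times> 'p \<Rightarrow> 'k) set \<Rightarrow> ('m \<times> 'q \<Rightarrow> 'k) set" where
  "tensor_map k A M Q h C =
    (let F = free_module k (carrier M \<times> carrier Q) in
     \<Union>f\<in>C. tensor_rels k A M Q +>\<^bsub>F\<^esub> lin_ext k F (\<lambda>(m, p). basis_vec k (m, h p)) f)"


section \<open>Tor\<close>

text \<open>
  Tor is computed from the canonical free resolution of the left module \<open>N\<close>: \<open>F\<^sub>0\<close> is the free
  \<open>A\<close>-module on the underlying set of \<open>N\<close>, and each \<open>F\<^bsub>i+1\<^esub>\<close> is the free \<open>A\<close>-module on the underlying
  set of the kernel of the preceding map (the augmentation to \<open>N\<close> if \<open>i = 0\<close>).
  So that all \<open>F\<^sub>i\<close> inhabit one type, the generator of \<open>F\<^bsub>i+1\<^esub>\<close> belonging to a finitely supported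
  function in the kernel is named by the graph of that function on its support.
\<close>

datatype ('a, 'n) gen = Base 'n | Comb "(('a, 'n) gen \<times> 'a) fset"

definition gen_of_fun :: "('a, 'c) ring_scheme \<Rightarrow> (('a, 'n) gen \<Rightarrow> 'a) \<Rightarrow> ('a, 'n) gen" where
  "gen_of_fun A f = Comb (Abs_fset {(x, f x) | x. f x \<noteq> \<zero>\<^bsub>A\<^esub>})"

definition res_aug ::
  "('a, 'c) ring_scheme \<Rightarrow> ('a, 'n, 'd) module_scheme \<Rightarrow> (('a, 'n) gen \<Rightarrow> 'a) \<Rightarrow> 'n" where
  "res_aug A N = lin_ext A N (inv_into (carrier N) Base)"

text \<open>
  The differential into the free module on \<open>X\<close>. It sends the generator named after \<open>f\<close> to \<open>f\<close>.
\<close>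

definition res_diff ::
  "('a, 'c) ring_scheme \<Rightarrow> ('a, 'n) gen set \<Rightarrow> (('a, 'n) gen \<Rightarrow> 'a) \<Rightarrow> (('a, 'n) gen \<Rightarrow> 'a)" where
  "res_diff A X =
    lin_ext A (free_module A X) (inv_into (carrier (free_module A X)) (gen_of_fun A))"

fun res_gens ::
  "('a, 'c) ring_scheme \<Rightarrow> ('a, 'n, 'd) module_scheme \<Rightarrow> nat \<Rightarrow> ('a, 'n) gen set" where
  "res_gens A N 0 = Base ` carrier N"
| "res_gens A N (Suc 0) =
     gen_of_fun A ` {f \<in> carrier (free_module A (res_gens A N 0)). res_aug A N f = \<zero>\<^bsub>N\<^esub>}"
| "res_gens A N (Suc (Suc i)) =
     gen_of_fun A ` {f \<in> carrier (free_module A (res_gens A N (Suc i))).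
       res_diff A (res_gens A N i) f = \<zero>\<^bsub>free_module A (res_gens A N i)\<^esub>}"

definition Tor ::
  "('k, 'c) ring_scheme \<Rightarrow> ('k, 'a, 'd) module_scheme \<Rightarrow> ('a, 'm, 'e) module_scheme \<Rightarrow>
   ('a, 'n, 'f) module_scheme \<Rightarrow> nat \<Rightarrow>
   ('k, ('m \<times> (('a, 'n) gen \<Rightarrow> 'a) \<Rightarrow> 'k) set set) module" where
  "Tor k A M N = homology
     (\<lambda>i. tensor k A M (free_module A (res_gens A N i)))
     (\<lambda>i. tensor_map k A M (free_module A (res_gens A N i)) (res_diff A (res_gens A N i)))"


section \<open>Algebras with a basis, group algebras, group homology\<close>

text \<open>
  The free \<open>k\<close>-module on \<open>X\<close> with the \<open>k\<close>-bilinear extension of a product of basis elements.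
\<close>

definition based_algebra ::
  "('k, 'c) ring_scheme \<Rightarrow> 'x set \<Rightarrow> ('x \<Rightarrow> 'x \<Rightarrow> 'x \<Rightarrow> 'k) \<Rightarrow> 'x \<Rightarrow> ('k, 'x \<Rightarrow> 'k) module" where
  "based_algebra k X prd e =
    (let F = free_module k X in
     F\<lparr>monoid.mult := (\<lambda>f g. lin_ext k F (\<lambda>x. lin_ext k F (\<lambda>y. prd x y) g) f), one := basis_vec k e\<rparr>)"

text \<open>
  A copy of \<open>k\<close> on which the basis elements satisfying \<open>U\<close> act as \<open>1\<close> and all others act as \<open>0\<close>.
  As \<open>k\<close> is commutative, the same record serves as a left and as a right module.
\<close>

definition basis_action_module ::
  "('k, 'c) ring_scheme \<Rightarrow> ('x \<Rightarrow> bool) \<Rightarrow> ('x \<Rightarrow> 'k, 'k) module" where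
  "basis_action_module k U =
    \<lparr>carrier = carrier k, monoid.mult = undefined, one = undefined, zero = \<zero>\<^bsub>k\<^esub>, add = add k,
     smult = (\<lambda>f c. (\<Oplus>\<^bsub>k\<^esub>x\<in>{x. f x \<noteq> \<zero>\<^bsub>k\<^esub> \<and> U x}. f x) \<otimes>\<^bsub>k\<^esub> c)\<rparr>"

definition group_algebra ::
  "('k, 'c) ring_scheme \<Rightarrow> ('h, 'd) monoid_scheme \<Rightarrow> ('k, 'h \<Rightarrow> 'k) module" where
  "group_algebra k H =
    based_algebra k (carrier H) (\<lambda>x y. basis_vec k (x \<otimes>\<^bsub>H\<^esub> y)) \<one>\<^bsub>H\<^esub>"

definition group_trivial :: "('k, 'c) ring_scheme \<Rightarrow> ('h \<Rightarrow> 'k, 'k) module" where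
  "group_trivial k = basis_action_module k (\<lambda>_. True)"

text \<open>
  Group homology with coefficients in \<open>k\<close>, on which the group acts trivially, as the homology of
  the inhomogeneous bar complex. Its differential sends $[x_1|\dots|x_i]$ to
  $[x_2|\dots|x_i] + \sum_{0<j<i} (-1)^j [x_1|\dots|x_j x_{j+1}|\dots|x_i] + (-1)^i [x_1|\dots|x_{i-1}]$.
\<close>

definition bar_chains ::
  "('k, 'c) ring_scheme \<Rightarrow> ('h, 'd) monoid_scheme \<Rightarrow> nat \<Rightarrow> ('k, 'h list \<Rightarrow> 'k) module" where
  "bar_chains k H i = free_module k {xs. length xs = i \<and> set xs \<subseteq> carrier H}"

definition bar_face :: "('h, 'd) monoid_scheme \<Rightarrow> nat \<Rightarrow> 'h list \<Rightarrow> 'h list" where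
  "bar_face H j xs =
    (if j = 0 then tl xs
     else if j = length xs then butlast xs
     else take (j - 1) xs @ [xs ! (j - 1) \<otimes>\<^bsub>H\<^esub> xs ! j] @ drop (j + 1) xs)"

definition bar_diff ::
  "('k, 'c) ring_scheme \<Rightarrow> ('h, 'd) monoid_scheme \<Rightarrow> nat \<Rightarrow> ('h list \<Rightarrow> 'k) \<Rightarrow> ('h list \<Rightarrow> 'k)" where
  "bar_diff k H i = (let C = bar_chains k H i in
     lin_ext k C (\<lambda>xs. \<Oplus>\<^bsub>C\<^esub>j\<in>{0..Suc i}.
       ((\<ominus>\<^bsub>k\<^esub> \<one>\<^bsub>k\<^esub>) [^]\<^bsub>k\<^esub> j) \<odot>\<^bsub>C\<^esub> basis_vec k (bar_face H j xs)))"

definition group_homology ::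
  "('k, 'c) ring_scheme \<Rightarrow> ('h, 'd) monoid_scheme \<Rightarrow> nat \<Rightarrow> ('k, ('h list \<Rightarrow> 'k) set) module" where
  "group_homology k H = homology (bar_chains k H) (bar_diff k H)"


section \<open>The group \<open>G\<^sup>n \<rtimes> \<Sigma>\<^sub>n\<close>\<close>

definition semidirect ::
  "('n, 'c) monoid_scheme \<Rightarrow> ('h, 'd) monoid_scheme \<Rightarrow> ('h \<Rightarrow> 'n \<Rightarrow> 'n) \<Rightarrow> ('n \<times> 'h) monoid" where
  "semidirect N H act =
    \<lparr>carrier = carrier N \<times> carrier H,
     monoid.mult = (\<lambda>(a, s) (b, t). (a \<otimes>\<^bsub>N\<^esub> act s b, s \<otimes>\<^bsub>H\<^esub> t)),
     one = (\<one>\<^bsub>N\<^esub>, \<one>\<^bsub>H\<^esub>)\<rparr>"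

definition permute_factors :: "nat \<Rightarrow> (nat \<Rightarrow> nat) \<Rightarrow> (nat \<Rightarrow> 'g) \<Rightarrow> (nat \<Rightarrow> 'g)" where
  "permute_factors n s a = (\<lambda>i\<in>{1..n}. a (inv_into UNIV s i))"

definition wreath :: "('g, 'c) monoid_scheme \<Rightarrow> nat \<Rightarrow> ((nat \<Rightarrow> 'g) \<times> (nat \<Rightarrow> nat)) monoid" where
  "wreath G n = semidirect (product_group {1..n} (\<lambda>_. G)) (sym_group n) (permute_factors n)"


section \<open>\<open>G\<close>-Brauer algebras\<close>

locale comm_G_ring = G?: group G + k?: cring k
  for G (structure) and k (structure) +
  fixes act :: "'a \<Rightarrow> 'c \<Rightarrow> 'c"
  assumes act_aut: "g \<in> carrier G \<Longrightarrow> act g \<in> ring_iso k k"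
    and act_mult: "\<lbrakk>g \<in> carrier G; h \<in> carrier G; x \<in> carrier k\<rbrakk> \<Longrightarrow>
      act (g \<otimes>\<^bsub>G\<^esub> h) x = act g (act h x)"

text \<open>
  A labelled graph is the set of its labelled edges. Middle nodes occur only while a product of
  diagrams is being formed.
\<close>

datatype node = Lft nat | Mid nat | Rgt nat

type_synonym 'g diagram = "(node set \<times> 'g) set"

definition outer_nodes :: "nat \<Rightarrow> node set" where
  "outer_nodes n = Lft ` {1..n} \<union> Rgt ` {1..n}"

definition brauer_diagrams :: "('g, 'c) monoid_scheme \<Rightarrow> nat \<Rightarrow> 'g diagram set" where
  "brauer_diagrams G n =
    {D. (\<forall>(e, g)\<in>D. e \<subseteq> outer_nodes n \<and> card e = 2 \<and> g \<in> carrier G) \<and>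
        (\<forall>v\<in>outer_nodes n. \<exists>!d. d \<in> D \<and> v \<in> fst d)}"

definition brauer_id :: "('g, 'c) monoid_scheme \<Rightarrow> nat \<Rightarrow> 'g diagram" where
  "brauer_id G n = (\<lambda>i. ({Lft i, Rgt i}, \<one>\<^bsub>G\<^esub>)) ` {1..n}"

fun right_to_mid :: "node \<Rightarrow> node" where
  "right_to_mid (Rgt i) = Mid i"
| "right_to_mid v = v"

fun left_to_mid :: "node \<Rightarrow> node" where
  "left_to_mid (Lft i) = Mid i"
| "left_to_mid v = v"

definition relabel :: "(node \<Rightarrow> node) \<Rightarrow> 'g diagram \<Rightarrow> 'g diagram" where
  "relabel r D = (\<lambda>(e, g). (r ` e, g)) ` D"

text \<open>
  The connected components, as node sets, of the three-column graph obtained by gluing \<open>x\<close> to \<open>y\<close>: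
  paths between outer nodes, and closed loops through middle nodes only.
\<close>

definition glued_components :: "nat \<Rightarrow> 'g diagram \<Rightarrow> 'g diagram \<Rightarrow> node set set" where
  "glued_components n x y =
    (outer_nodes n \<union> Mid ` {1..n}) //
      {(u, v). \<exists>d \<in> relabel right_to_mid x \<union> relabel left_to_mid y. u \<in> fst d \<and> v \<in> fst d}\<^sup>*"

text \<open>
  The product of all labels in a component. As \<open>G\<close> is abelian, neither the order nor the direction
  of traversal matters. The edges coming from \<open>x\<close> and from \<open>y\<close> are kept apart, since an edge of \<open>x\<close>
  and an edge of \<open>y\<close> may join the same two middle nodes and carry the same label.
\<close>

definition component_label ::
  "('g, 'c) monoid_scheme \<Rightarrow> 'g diagram \<Rightarrow> 'g diagram \<Rightarrow> node set \<Rightarrow> 'g" where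
  "component_label G x y C =
    finprod G snd {d \<in> relabel right_to_mid x. fst d \<subseteq> C} \<otimes>\<^bsub>G\<^esub>
    finprod G snd {d \<in> relabel left_to_mid y. fst d \<subseteq> C}"

definition brauer_compose ::
  "('g, 'c) monoid_scheme \<Rightarrow> nat \<Rightarrow> 'g diagram \<Rightarrow> 'g diagram \<Rightarrow> 'g diagram" where
  "brauer_compose G n x y =
    {(C \<inter> outer_nodes n, component_label G x y C) | C.
      C \<in> glued_components n x y \<and> C \<inter> outer_nodes n \<noteq> {}}"

definition loop_factor ::
  "('g, 'c) monoid_scheme \<Rightarrow> ('k, 'd) ring_scheme \<Rightarrow> ('g \<Rightarrow> 'k \<Rightarrow> 'k) \<Rightarrow> 'k \<Rightarrow> nat \<Rightarrow>
   'g diagram \<Rightarrow> 'g diagram \<Rightarrow> 'k" where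
  "loop_factor G k act \<delta> n x y =
    (\<Otimes>\<^bsub>k\<^esub>C\<in>{C \<in> glued_components n x y. C \<inter> outer_nodes n = {}}.
       act (component_label G x y C) \<delta>)"

definition brauer_algebra ::
  "('g, 'c) monoid_scheme \<Rightarrow> ('k, 'd) ring_scheme \<Rightarrow> ('g \<Rightarrow> 'k \<Rightarrow> 'k) \<Rightarrow> 'k \<Rightarrow> nat \<Rightarrow>
   ('k, 'g diagram \<Rightarrow> 'k) module" where
  "brauer_algebra G k act \<delta> n =
    based_algebra k (brauer_diagrams G n)
      (\<lambda>x y. loop_factor G k act \<delta> n x y
         \<odot>\<^bsub>free_module k (brauer_diagrams G n)\<^esub> basis_vec k (brauer_compose G n x y))
      (brauer_id G n)"

definition brauer_trivial :: "('k, 'c) ring_scheme \<Rightarrow> ('g diagram \<Rightarrow> 'k, 'k) module" where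
  "brauer_trivial k =
    basis_action_module k (\<lambda>D. \<forall>d\<in>D. \<not> fst d \<subseteq> range Lft \<and> \<not> fst d \<subseteq> range Rgt)"

end

theory Submission imports Defs begin

text \<open>
  Order the diagrams by the number of their left-to-left edges, which does not decrease under
  multiplication. The diagrams with \<open>j\<close> or more such edges span two-sided ideals, and the quotient by
  the ideal \<open>j = 1\<close> is the group algebra of \<open>G\<^sup>n \<rtimes> \<Sigma>\<^sub>n\<close>. As \<open>n\<close> is odd, every diagram \<open>x\<close> has a left
  node that lies on no left-to-left edge; with its help one finds diagrams that fix every diagram
  with the same left-to-left edges as \<open>x\<close> and whose product has at least as many such edges as \<open>x\<close>.
  It follows that any exact complex of free modules over the Brauer algebra remains exact in
  positive rank, so that reducing the canonical resolution of \<open>\<one>\<close> modulo the ideal yields a free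
  resolution over the group algebra, which is compared with the bar resolution.
  The argument only uses the product on the basis; it is carried out for algebras with a basis that
  is closed under multiplication up to scalars, of which the group algebra itself is a trivial case.
\<close>

section \<open>Modules over a ring\<close>

text \<open>The obstacle is that \<open>\<delta>\<close> is arbitrary. To reproduce a left-to-left
  edge of a diagram, the obvious factor on the left has a link on the same two nodes in either
  column; glued to the diagram it closes a loop and costs a scalar \<open>act g \<delta>\<close>,
  which need not be invertible. A left node on no left-to-left edge supplies a strand that can be
  led through the edge of the other factor instead, so that no loop arises and the scalar is one.
  When all left nodes are paired there is no such strand. Exactness in positive rank makes the
  reduction harmless: a cycle modulo the ideal has its boundary in the ideal, this boundary is also
  the boundary of an element of the ideal, and the difference is a genuine cycle, hence a boundary.
  The ideal acts as zero on the trivial module, so tensoring with that module over the algebra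
  agrees with taking coinvariants of the reduced complex. Both Tor modules of the theorem are
  identified with group homology and thereby with each other. The algebras are not commutative, so
  their modules are taken in \<open>lmod\<close> rather than in \<open>module\<close>.\<close>

locale lmod = R?: ring R + M?: abelian_group M for R (structure) and M (structure) +
  assumes smult_closed [simp, intro]:
      "\<lbrakk>a \<in> carrier R; x \<in> carrier M\<rbrakk> \<Longrightarrow> a \<odot>\<^bsub>M\<^esub> x \<in> carrier M"
    and smult_l_distr:
      "\<lbrakk>a \<in> carrier R; b \<in> carrier R; x \<in> carrier M\<rbrakk> \<Longrightarrow>
      (a \<oplus>\<^bsub>R\<^esub> b) \<odot>\<^bsub>M\<^esub> x = a \<odot>\<^bsub>M\<^esub> x \<oplus>\<^bsub>M\<^esub> b \<odot>\<^bsub>M\<^esub> x"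
    and smult_r_distr:
      "\<lbrakk>a \<in> carrier R; x \<in> carrier M; y \<in> carrier M\<rbrakk> \<Longrightarrow>
      a \<odot>\<^bsub>M\<^esub> (x \<oplus>\<^bsub>M\<^esub> y) = a \<odot>\<^bsub>M\<^esub> x \<oplus>\<^bsub>M\<^esub> a \<odot>\<^bsub>M\<^esub> y"
    and smult_assoc1:
      "\<lbrakk>a \<in> carrier R; b \<in> carrier R; x \<in> carrier M\<rbrakk> \<Longrightarrow>
      (a \<otimes>\<^bsub>R\<^esub> b) \<odot>\<^bsub>M\<^esub> x = a \<odot>\<^bsub>M\<^esub> (b \<odot>\<^bsub>M\<^esub> x)"
    and smult_one [simp]: "x \<in> carrier M \<Longrightarrow> \<one>\<^bsub>R\<^esub> \<odot>\<^bsub>M\<^esub> x = x"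
begin

lemma smult_l_null [simp]: "x \<in> carrier M \<Longrightarrow> \<zero>\<^bsub>R\<^esub> \<odot>\<^bsub>M\<^esub> x = \<zero>\<^bsub>M\<^esub>"
  using smult_l_distr[of "\<zero>\<^bsub>R\<^esub>" "\<zero>\<^bsub>R\<^esub>" x] M.add.r_cancel_one' by fastforce

lemma smult_r_null [simp]: "a \<in> carrier R \<Longrightarrow> a \<odot>\<^bsub>M\<^esub> \<zero>\<^bsub>M\<^esub> = \<zero>\<^bsub>M\<^esub>"
  using smult_r_distr[of a "\<zero>\<^bsub>M\<^esub>" "\<zero>\<^bsub>M\<^esub>"] M.add.r_cancel_one' by fastforce

lemma smult_l_minus:
  assumes "a \<in> carrier R" "x \<in> carrier M"
  shows "(\<ominus>\<^bsub>R\<^esub> a) \<odot>\<^bsub>M\<^esub> x = \<ominus>\<^bsub>M\<^esub> (a \<odot>\<^bsub>M\<^esub> x)"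
proof (rule M.minus_equality[symmetric])
  show "(\<ominus>\<^bsub>R\<^esub> a) \<odot>\<^bsub>M\<^esub> x \<oplus>\<^bsub>M\<^esub> a \<odot>\<^bsub>M\<^esub> x = \<zero>\<^bsub>M\<^esub>"
    using assms by (simp add: R.l_neg flip: smult_l_distr)
qed (use assms in auto)

lemma smult_r_minus:
  assumes "a \<in> carrier R" "x \<in> carrier M"
  shows "a \<odot>\<^bsub>M\<^esub> (\<ominus>\<^bsub>M\<^esub> x) = \<ominus>\<^bsub>M\<^esub> (a \<odot>\<^bsub>M\<^esub> x)"
proof (rule M.minus_equality[symmetric])
  show "a \<odot>\<^bsub>M\<^esub> (\<ominus>\<^bsub>M\<^esub> x) \<oplus>\<^bsub>M\<^esub> a \<odot>\<^bsub>M\<^esub> x = \<zero>\<^bsub>M\<^esub>"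
    using assms by (simp add: M.l_neg flip: smult_r_distr)
qed (use assms in auto)

lemma finsum_smult:
  "\<lbrakk>finite A; a \<in> carrier R; f \<in> A \<rightarrow> carrier M\<rbrakk> \<Longrightarrow>
     a \<odot>\<^bsub>M\<^esub> (\<Oplus>\<^bsub>M\<^esub>i\<in>A. f i) = (\<Oplus>\<^bsub>M\<^esub>i\<in>A. a \<odot>\<^bsub>M\<^esub> f i)"
  by (induct set: finite) (simp_all add: Pi_def smult_r_distr)

end

lemma (in abelian_group) minus_eq_zero_iff:
  "\<lbrakk>x \<in> carrier G; y \<in> carrier G\<rbrakk> \<Longrightarrow> x \<ominus> y = \<zero> \<longleftrightarrow> x = y"
  by (metis a_minus_def a_inv_closed add.inv_comm minus_equality minus_minus r_neg)

lemma (in abelian_group) minus_add_cancel: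
  "\<lbrakk>x \<in> carrier G; y \<in> carrier G\<rbrakk> \<Longrightarrow> (x \<ominus> y) \<oplus> y = x"
  by (simp add: a_minus_def a_assoc l_neg)

definition lin_map ::
  "('r, 'c) ring_scheme \<Rightarrow> ('r, 'm, 'd) module_scheme \<Rightarrow> ('r, 'n, 'e) module_scheme \<Rightarrow> ('m \<Rightarrow> 'n) \<Rightarrow> bool" where
  "lin_map R M N f \<longleftrightarrow> f \<in> carrier M \<rightarrow> carrier N \<and>
     (\<forall>x\<in>carrier M. \<forall>y\<in>carrier M. f (x \<oplus>\<^bsub>M\<^esub> y) = f x \<oplus>\<^bsub>N\<^esub> f y) \<and>
     (\<forall>c\<in>carrier R. \<forall>x\<in>carrier M. f (c \<odot>\<^bsub>M\<^esub> x) = c \<odot>\<^bsub>N\<^esub> f x)"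

lemma lin_mapI:
  assumes "\<And>x. x \<in> carrier M \<Longrightarrow> f x \<in> carrier N"
    and "\<And>x y. \<lbrakk>x \<in> carrier M; y \<in> carrier M\<rbrakk> \<Longrightarrow> f (x \<oplus>\<^bsub>M\<^esub> y) = f x \<oplus>\<^bsub>N\<^esub> f y"
    and "\<And>c x. \<lbrakk>c \<in> carrier R; x \<in> carrier M\<rbrakk> \<Longrightarrow> f (c \<odot>\<^bsub>M\<^esub> x) = c \<odot>\<^bsub>N\<^esub> f x"
  shows "lin_map R M N f"
  using assms unfolding lin_map_def by blast

lemma lin_map_closed: "lin_map R M N f \<Longrightarrow> x \<in> carrier M \<Longrightarrow> f x \<in> carrier N"
  and lin_map_add: "lin_map R M N f \<Longrightarrow> x \<in> carrier M \<Longrightarrow> y \<in> carrier M \<Longrightarrow>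
    f (x \<oplus>\<^bsub>M\<^esub> y) = f x \<oplus>\<^bsub>N\<^esub> f y"
  and lin_map_smult: "lin_map R M N f \<Longrightarrow> c \<in> carrier R \<Longrightarrow> x \<in> carrier M \<Longrightarrow>
    f (c \<odot>\<^bsub>M\<^esub> x) = c \<odot>\<^bsub>N\<^esub> f x"
  unfolding lin_map_def by blast+

lemma lin_map_zero:
  assumes "lmod R M" "lmod R N" "lin_map R M N f"
  shows "f \<zero>\<^bsub>M\<^esub> = \<zero>\<^bsub>N\<^esub>"
proof -
  interpret M: lmod R M by fact
  interpret N: lmod R N by fact
  have "f (\<zero>\<^bsub>R\<^esub> \<odot>\<^bsub>M\<^esub> \<zero>\<^bsub>M\<^esub>) = \<zero>\<^bsub>R\<^esub> \<odot>\<^bsub>N\<^esub> f \<zero>\<^bsub>M\<^esub>"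
    by (rule lin_map_smult[OF assms(3)]) auto
  then show ?thesis using lin_map_closed[OF assms(3)] by simp
qed

lemma lin_map_neg:
  assumes "lmod R M" "lmod R N" "lin_map R M N f" "x \<in> carrier M"
  shows "f (\<ominus>\<^bsub>M\<^esub> x) = \<ominus>\<^bsub>N\<^esub> f x"
proof -
  interpret M: lmod R M by fact
  interpret N: lmod R N by fact
  have "f (\<ominus>\<^bsub>M\<^esub> x) \<oplus>\<^bsub>N\<^esub> f x = \<zero>\<^bsub>N\<^esub>"
    using assms lin_map_add[OF assms(3), of "\<ominus>\<^bsub>M\<^esub> x" x] lin_map_zero[OF assms(1-3)]
    by (simp add: M.M.l_neg)
  then show ?thesis using lin_map_closed[OF assms(3)] assms(4)
    by (metis M.M.a_inv_closed N.M.minus_equality)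
qed

lemma lin_map_minus:
  assumes "lmod R M" "lmod R N" "lin_map R M N f" "x \<in> carrier M" "y \<in> carrier M"
  shows "f (x \<ominus>\<^bsub>M\<^esub> y) = f x \<ominus>\<^bsub>N\<^esub> f y"
proof -
  interpret M: lmod R M by fact
  show ?thesis
    unfolding a_minus_def
    using assms lin_map_add[OF assms(3), of x "\<ominus>\<^bsub>M\<^esub> y"] lin_map_neg[OF assms(1-3), of y] by simp
qed

lemma lin_map_finsum:
  assumes "lmod R M" "lmod R N" "lin_map R M N f" "finite A" "g \<in> A \<rightarrow> carrier M"
  shows "f (\<Oplus>\<^bsub>M\<^esub>i\<in>A. g i) = (\<Oplus>\<^bsub>N\<^esub>i\<in>A. f (g i))"
proof -
  interpret M: lmod R M by fact
  interpret N: lmod R N by fact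
  show ?thesis using assms(4,5)
  proof (induct set: finite)
    case empty
    then show ?case by (simp add: lin_map_zero[OF assms(1-3)])
  next
    case (insert a A)
    then have "(\<lambda>i. f (g i)) \<in> A \<rightarrow> carrier N" "f (g a) \<in> carrier N"
      using lin_map_closed[OF assms(3)] by (auto simp: Pi_def)
    moreover have "finsum M g A \<in> carrier M" "g a \<in> carrier M"
      using insert by (auto intro!: M.M.finsum_closed)
    ultimately show ?case
      using insert by (simp add: M.M.finsum_insert N.M.finsum_insert lin_map_add[OF assms(3)])
  qed
qed

lemma lin_map_comp:
  "lin_map R M N f \<Longrightarrow> lin_map R N Q g \<Longrightarrow> lin_map R M Q (\<lambda>x. g (f x))"
  by (rule lin_mapI) (simp_all add: lin_map_closed lin_map_add lin_map_smult)

lemma lin_map_diff: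
  assumes "lmod R N" "lin_map R M N f" "lin_map R M N g"
  shows "lin_map R M N (\<lambda>x. f x \<ominus>\<^bsub>N\<^esub> g x)"
proof -
  interpret N: lmod R N by fact
  show ?thesis
    by (rule lin_mapI) (simp_all add: assms(2,3)[THEN lin_map_closed] assms(2,3)[THEN lin_map_add]
      assms(2,3)[THEN lin_map_smult] N.smult_r_distr N.smult_r_minus N.M.minus_add N.M.a_ac a_minus_def)
qed

text \<open>Moving \<open>a\<close> past the scalar of the linearity condition requires a
  commutative base ring.\<close>

lemma lin_map_const_smult:
  assumes "cring R" "lmod R N" "lin_map R M N f" "a \<in> carrier R"
  shows "lin_map R M N (\<lambda>x. a \<odot>\<^bsub>N\<^esub> f x)"
proof -
  interpret N: lmod R N by fact
  interpret R: cring R by fact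
  show ?thesis
    using assms(4)
    by (intro lin_mapI) (simp_all add: lin_map_closed[OF assms(3)] lin_map_add[OF assms(3)]
      lin_map_smult[OF assms(3)] N.smult_r_distr R.m_comm flip: N.smult_assoc1)
qed

text \<open>A product in \<open>based_algebra\<close> is a sum over the support of the left factor;
  this makes it linear in the right factor.\<close>

lemma lin_map_finsum_maps:
  assumes "lmod R N" "finite A" "\<And>i. i \<in> A \<Longrightarrow> lin_map R M N (F i)"
  shows "lin_map R M N (\<lambda>x. \<Oplus>\<^bsub>N\<^esub>i\<in>A. F i x)"
proof -
  interpret N: lmod R N by fact
  have c: "x \<in> carrier M \<Longrightarrow> i \<in> A \<Longrightarrow> F i x \<in> carrier N" for x i
    using lin_map_closed[OF assms(3)] by blast
  show ?thesis
  proof (rule lin_mapI)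
    fix x y assume xy: "x \<in> carrier M" "y \<in> carrier M"
    have "(\<Oplus>\<^bsub>N\<^esub>i\<in>A. F i (x \<oplus>\<^bsub>M\<^esub> y)) = (\<Oplus>\<^bsub>N\<^esub>i\<in>A. F i x \<oplus>\<^bsub>N\<^esub> F i y)"
      by (rule N.M.finsum_cong') (use xy c lin_map_add[OF assms(3)] in auto)
    then show "(\<Oplus>\<^bsub>N\<^esub>i\<in>A. F i (x \<oplus>\<^bsub>M\<^esub> y)) = (\<Oplus>\<^bsub>N\<^esub>i\<in>A. F i x) \<oplus>\<^bsub>N\<^esub> (\<Oplus>\<^bsub>N\<^esub>i\<in>A. F i y)"
      using xy c by (simp add: N.M.finsum_addf Pi_def)
  next
    fix a x assume ax: "a \<in> carrier R" "x \<in> carrier M"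
    have "(\<Oplus>\<^bsub>N\<^esub>i\<in>A. F i (a \<odot>\<^bsub>M\<^esub> x)) = (\<Oplus>\<^bsub>N\<^esub>i\<in>A. a \<odot>\<^bsub>N\<^esub> F i x)"
      by (rule N.M.finsum_cong') (use ax c lin_map_smult[OF assms(3)] in auto)
    then show "(\<Oplus>\<^bsub>N\<^esub>i\<in>A. F i (a \<odot>\<^bsub>M\<^esub> x)) = a \<odot>\<^bsub>N\<^esub> (\<Oplus>\<^bsub>N\<^esub>i\<in>A. F i x)"
      using ax c assms(2) by (simp add: N.finsum_smult Pi_def)
  qed (auto intro!: N.M.finsum_closed c)
qed

section \<open>Free modules and their universal property\<close>

lemma free_module_simps [simp]:
  "zero (free_module R X) = (\<lambda>x. \<zero>\<^bsub>R\<^esub>)"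
  "add (free_module R X) f g = (\<lambda>x. f x \<oplus>\<^bsub>R\<^esub> g x)"
  "smult (free_module R X) a f = (\<lambda>x. a \<otimes>\<^bsub>R\<^esub> f x)"
  by (simp_all add: free_module_def)

lemma free_module_carrier:
  "f \<in> carrier (free_module R X) \<longleftrightarrow>
    (\<forall>x\<in>X. f x \<in> carrier R) \<and> (\<forall>x. x \<notin> X \<longrightarrow> f x = \<zero>\<^bsub>R\<^esub>) \<and> finite {x. f x \<noteq> \<zero>\<^bsub>R\<^esub>}"
  by (simp add: free_module_def)

lemma free_module_outside: "f \<in> carrier (free_module R X) \<Longrightarrow> x \<notin> X \<Longrightarrow> f x = \<zero>\<^bsub>R\<^esub>"
  by (simp add: free_module_carrier)

lemma free_module_finite: "f \<in> carrier (free_module R X) \<Longrightarrow> finite {x. f x \<noteq> \<zero>\<^bsub>R\<^esub>}"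
  by (simp add: free_module_carrier)

lemma free_module_support: "f \<in> carrier (free_module R X) \<Longrightarrow> {x. f x \<noteq> \<zero>\<^bsub>R\<^esub>} \<subseteq> X"
  by (auto simp add: free_module_carrier)

context ring
begin

lemma free_module_value [simp]: "f \<in> carrier (free_module R X) \<Longrightarrow> f x \<in> carrier R"
  by (cases "x \<in> X") (auto simp: free_module_carrier)

lemma free_moduleI:
  assumes "\<And>x. f x \<in> carrier R" "\<And>x. x \<notin> S \<Longrightarrow> f x = \<zero>" "finite S" "S \<subseteq> X"
  shows "f \<in> carrier (free_module R X)"
  unfolding free_module_carrier using assms
  by (auto intro: finite_subset[of _ S])

lemma free_module_abelian_group: "abelian_group (free_module R X)"
proof (rule abelian_groupI)
  fix f g assume fg: "f \<in> carrier (free_module R X)" "g \<in> carrier (free_module R X)"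
  show "f \<oplus>\<^bsub>free_module R X\<^esub> g \<in> carrier (free_module R X)"
    by (rule free_moduleI[of _ "{x. f x \<noteq> \<zero>} \<union> {x. g x \<noteq> \<zero>}"])
      (use fg in \<open>auto dest: free_module_support intro: free_module_finite\<close>)
next
  show "\<zero>\<^bsub>free_module R X\<^esub> \<in> carrier (free_module R X)" by (simp add: free_module_carrier)
next
  fix f assume f: "f \<in> carrier (free_module R X)"
  have "(\<lambda>x. \<ominus> f x) \<in> carrier (free_module R X)"
    by (rule free_moduleI[of _ "{x. f x \<noteq> \<zero>}"])
      (use f in \<open>auto dest: free_module_support intro: free_module_finite\<close>)
  then show "\<exists>y\<in>carrier (free_module R X). y \<oplus>\<^bsub>free_module R X\<^esub> f = \<zero>\<^bsub>free_module R X\<^esub>"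
    by (rule bexI[rotated]) (use f in \<open>auto simp: l_neg\<close>)
qed (auto simp: a_ac)

lemma free_module_lmod: "lmod R (free_module R X)"
proof -
  interpret M: abelian_group "free_module R X" by (rule free_module_abelian_group)
  show ?thesis
  proof
    fix a f assume "a \<in> carrier R" "f \<in> carrier (free_module R X)"
    then show "a \<odot>\<^bsub>free_module R X\<^esub> f \<in> carrier (free_module R X)"
      by (intro free_moduleI[of _ "{x. f x \<noteq> \<zero>}"])
        (auto dest: free_module_support intro: free_module_finite)
  qed (auto simp: l_distr r_distr m_assoc fun_eq_iff)
qed

lemma free_module_add_closed [simp]:
  "f \<in> carrier (free_module R X) \<Longrightarrow> g \<in> carrier (free_module R X) \<Longrightarrow>
    (\<lambda>x. f x \<oplus> g x) \<in> carrier (free_module R X)"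
  using abelian_group.axioms(1)[OF free_module_abelian_group, THEN abelian_monoid.a_closed, of f X g]
  by simp

lemma free_module_smult_closed [simp]:
  "a \<in> carrier R \<Longrightarrow> f \<in> carrier (free_module R X) \<Longrightarrow>
    (\<lambda>x. a \<otimes> f x) \<in> carrier (free_module R X)"
  using lmod.smult_closed[OF free_module_lmod, of a f X] by simp

lemma free_module_zero_closed [simp]: "(\<lambda>x. \<zero>) \<in> carrier (free_module R X)"
  by (simp add: free_module_carrier)

lemma free_module_neg:
  assumes f: "f \<in> carrier (free_module R X)"
  shows "\<ominus>\<^bsub>free_module R X\<^esub> f = (\<lambda>x. \<ominus> f x)"
proof -
  interpret M: abelian_group "free_module R X" by (rule free_module_abelian_group)
  have "(\<lambda>x. \<ominus> f x) \<in> carrier (free_module R X)"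
    by (rule free_moduleI[of _ "{x. f x \<noteq> \<zero>}"])
      (use f in \<open>auto dest: free_module_support intro: free_module_finite\<close>)
  moreover have "(\<lambda>x. \<ominus> f x) \<oplus>\<^bsub>free_module R X\<^esub> f = \<zero>\<^bsub>free_module R X\<^esub>"
    using f by (auto simp: l_neg)
  ultimately show ?thesis using f M.minus_equality by blast
qed

lemma free_module_minus:
  "f \<in> carrier (free_module R X) \<Longrightarrow> g \<in> carrier (free_module R X) \<Longrightarrow>
    f \<ominus>\<^bsub>free_module R X\<^esub> g = (\<lambda>x. f x \<ominus> g x)"
  unfolding a_minus_def free_module_neg free_module_simps ..

lemma free_module_minus_closed [simp]:
  "f \<in> carrier (free_module R X) \<Longrightarrow> g \<in> carrier (free_module R X) \<Longrightarrow>
    (\<lambda>x. f x \<ominus> g x) \<in> carrier (free_module R X)"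
  using abelian_group.minus_closed[OF free_module_abelian_group, of f X g]
  by (simp only: free_module_minus)

lemma basis_vec_closed [simp]: "x \<in> X \<Longrightarrow> basis_vec R x \<in> carrier (free_module R X)"
  by (rule free_moduleI[of _ "{x}"]) (auto simp: basis_vec_def)

lemma free_module_restrict [simp]:
  assumes "f \<in> carrier (free_module R X)"
  shows "(\<lambda>x. if P x then f x else \<zero>) \<in> carrier (free_module R X)"
  by (rule free_moduleI[of _ "{x. f x \<noteq> \<zero>}"])
    (use assms in \<open>auto dest: free_module_support intro: free_module_finite\<close>)

text \<open>The induction runs over a finite set containing the support; clearing the coordinate at
  one point of that set splits off one multiple of a basis vector.\<close>

lemma free_induct [consumes 1, case_names zero add]:
  assumes f: "f \<in> carrier (free_module R X)"
    and 0: "P (\<lambda>x. \<zero>)"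
    and step: "\<And>f a x. \<lbrakk>f \<in> carrier (free_module R X); a \<in> carrier R; x \<in> X; P f\<rbrakk> \<Longrightarrow>
      P (\<lambda>y. f y \<oplus> a \<otimes> basis_vec R x y)"
  shows "P f"
proof -
  have "P f" if "finite S" "f \<in> carrier (free_module R X)" "{x. f x \<noteq> \<zero>} \<subseteq> S" for S f
    using that
  proof (induct arbitrary: f rule: finite_induct)
    case empty
    then have "f = (\<lambda>x. \<zero>)" by auto
    then show ?case using 0 by simp
  next
    case (insert s S)
    define g where "g = (\<lambda>x. if x \<noteq> s then f x else \<zero>)"
    have g: "g \<in> carrier (free_module R X)" unfolding g_def using insert(4) by simp
    have "P g" by (rule insert(3)[OF g]) (use insert(5) in \<open>auto simp: g_def\<close>)
    show ?case
    \<comment> \<open>The finite set only has to contain the support, so \<open>s\<close> may lie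
      outside \<open>X\<close>; there \<open>f\<close> vanishes and nothing is split off.\<close>
    proof (cases "s \<in> X")
      case True
      have "f = (\<lambda>y. g y \<oplus> f s \<otimes> basis_vec R s y)"
        using insert(4) by (auto simp: g_def basis_vec_def fun_eq_iff)
      then show ?thesis using step[OF g _ True \<open>P g\<close>, of "f s"] insert(4) by simp
    next
      case False
      then have "f = g" using insert(4) by (auto simp: g_def free_module_carrier)
      then show ?thesis using \<open>P g\<close> by simp
    qed
  qed
  then show ?thesis using f free_module_finite by blast
qed

text \<open>The standard tool from here on: an identity is turned into the equality of two linear
  maps and is then checked on basis vectors.\<close>

lemma lin_map_free_eqI:
  assumes "lmod R M" "lin_map R (free_module R X) M F" "lin_map R (free_module R X) M F'"
    and "\<And>x. x \<in> X \<Longrightarrow> F (basis_vec R x) = F' (basis_vec R x)"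
    and "f \<in> carrier (free_module R X)"
  shows "F f = F' f"
  using assms(5)
proof (induct rule: free_induct)
  case zero
  then show ?case
    using lin_map_zero[OF free_module_lmod assms(1,2)] lin_map_zero[OF free_module_lmod assms(1,3)]
    by simp
next
  case (add f a x)
  have "F' (f \<oplus>\<^bsub>free_module R X\<^esub> a \<odot>\<^bsub>free_module R X\<^esub> basis_vec R x)
    = F (f \<oplus>\<^bsub>free_module R X\<^esub> a \<odot>\<^bsub>free_module R X\<^esub> basis_vec R x)"
    using add lin_map_add[OF assms(2), of f "a \<odot>\<^bsub>free_module R X\<^esub> basis_vec R x"]
      lin_map_add[OF assms(3), of f "a \<odot>\<^bsub>free_module R X\<^esub> basis_vec R x"]
      lin_map_smult[OF assms(2), of a "basis_vec R x"]
      lin_map_smult[OF assms(3), of a "basis_vec R x"] assms(4)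
    by simp
  then show ?case by simp
qed

text \<open>The sum in \<open>lin_ext\<close> runs over the support of its argument, which changes
  under addition and scaling; linearity needs one common index set.\<close>

lemma lin_ext_superset:
  assumes "lmod R M" "finite S" "{x. f x \<noteq> \<zero>} \<subseteq> S" "\<And>x. x \<in> S \<Longrightarrow> f x \<in> carrier R"
    "\<And>x. x \<in> S \<Longrightarrow> v x \<in> carrier M"
  shows "lin_ext R M v f = (\<Oplus>\<^bsub>M\<^esub>x\<in>S. f x \<odot>\<^bsub>M\<^esub> v x)"
proof -
  interpret M: lmod R M by fact
  show ?thesis unfolding lin_ext_def
    by (rule M.M.add.finprod_mono_neutral_cong_left) (use assms in auto)
qed

lemma lin_ext_lin_map:
  assumes "lmod R M" and v: "\<And>x. x \<in> X \<Longrightarrow> v x \<in> carrier M"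
  shows "lin_map R (free_module R X) M (lin_ext R M v)"
proof -
  interpret M: lmod R M by fact
  have sum: "lin_ext R M v f = (\<Oplus>\<^bsub>M\<^esub>x\<in>S. f x \<odot>\<^bsub>M\<^esub> v x)"
    if "f \<in> carrier (free_module R X)" "finite S" "S \<subseteq> X" "{x. f x \<noteq> \<zero>} \<subseteq> S" for f S
    by (rule lin_ext_superset) (use that assms in auto)
  show ?thesis
  proof (rule lin_mapI)
    fix f assume f: "f \<in> carrier (free_module R X)"
    then show "lin_ext R M v f \<in> carrier M"
      unfolding lin_ext_def using v free_module_support[OF f] by (intro M.M.finsum_closed) auto
  next
    fix f g assume f: "f \<in> carrier (free_module R X)" and g: "g \<in> carrier (free_module R X)"
    define S where "S = {x. f x \<noteq> \<zero>} \<union> {x. g x \<noteq> \<zero>}"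
    have S: "finite S" "S \<subseteq> X" "{x. f x \<noteq> \<zero>} \<subseteq> S" "{x. g x \<noteq> \<zero>} \<subseteq> S" "{x. f x \<oplus> g x \<noteq> \<zero>} \<subseteq> S"
      unfolding S_def using f g by (auto dest: free_module_support intro: free_module_finite)
    have "lin_ext R M v (\<lambda>x. f x \<oplus> g x) = (\<Oplus>\<^bsub>M\<^esub>x\<in>S. f x \<odot>\<^bsub>M\<^esub> v x \<oplus>\<^bsub>M\<^esub> g x \<odot>\<^bsub>M\<^esub> v x)"
      unfolding sum[OF free_module_add_closed[OF f g] S(1,2,5)]
      by (rule M.M.finsum_cong') (use f g S v in \<open>auto simp: M.smult_l_distr subset_iff\<close>)
    also have "\<dots> = lin_ext R M v f \<oplus>\<^bsub>M\<^esub> lin_ext R M v g"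
      using f g S v by (subst M.M.finsum_addf) (auto simp: sum subset_iff)
    finally show "lin_ext R M v (f \<oplus>\<^bsub>free_module R X\<^esub> g) = lin_ext R M v f \<oplus>\<^bsub>M\<^esub> lin_ext R M v g"
      by simp
  next
    fix a f assume a: "a \<in> carrier R" and f: "f \<in> carrier (free_module R X)"
    define S where "S = {x. f x \<noteq> \<zero>}"
    have S: "finite S" "S \<subseteq> X" "{x. f x \<noteq> \<zero>} \<subseteq> S" "{x. a \<otimes> f x \<noteq> \<zero>} \<subseteq> S"
      unfolding S_def using f a by (auto dest: free_module_support intro: free_module_finite)
    have "lin_ext R M v (\<lambda>x. a \<otimes> f x) = (\<Oplus>\<^bsub>M\<^esub>x\<in>S. a \<odot>\<^bsub>M\<^esub> (f x \<odot>\<^bsub>M\<^esub> v x))"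
      unfolding sum[OF free_module_smult_closed[OF a f] S(1,2,4)]
      by (rule M.M.finsum_cong') (use a f S v in \<open>auto simp: M.smult_assoc1 subset_iff\<close>)
    also have "\<dots> = a \<odot>\<^bsub>M\<^esub> lin_ext R M v f"
      using a f S v by (subst M.finsum_smult[symmetric]) (auto simp: sum subset_iff)
    finally show "lin_ext R M v (a \<odot>\<^bsub>free_module R X\<^esub> f) = a \<odot>\<^bsub>M\<^esub> lin_ext R M v f"
      by simp
  qed
qed

lemma lin_ext_basis:
  assumes "lmod R M" "v x \<in> carrier M"
  shows "lin_ext R M v (basis_vec R x) = v x"
proof -
  interpret M: lmod R M by fact
  have "lin_ext R M v (basis_vec R x) = (\<Oplus>\<^bsub>M\<^esub>y\<in>{x}. basis_vec R x y \<odot>\<^bsub>M\<^esub> v y)"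
    by (rule lin_ext_superset) (use assms in \<open>auto simp: basis_vec_def\<close>)
  then show ?thesis using assms by (simp add: basis_vec_def)
qed

lemma lin_map_free_eq_lin_ext:
  assumes "lmod R M" "lin_map R (free_module R X) M F" "f \<in> carrier (free_module R X)"
  shows "F f = lin_ext R M (\<lambda>x. F (basis_vec R x)) f"
proof -
  have c: "x \<in> X \<Longrightarrow> F (basis_vec R x) \<in> carrier M" for x
    using lin_map_closed[OF assms(2)] by simp
  show ?thesis
    by (rule lin_map_free_eqI[OF assms(1,2) lin_ext_lin_map[OF assms(1) c] _ assms(3)])
      (simp_all add: lin_ext_basis[OF assms(1), of "\<lambda>x. F (basis_vec R x)"] c)
qed

end

lemma (in cring) lmod_imp_module:
  assumes "lmod R M"
  shows "module R M"
proof -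
  interpret M: lmod R M by fact
  show ?thesis
    by (rule moduleI[OF is_cring M.M.abelian_group_axioms])
      (simp_all add: M.smult_l_distr M.smult_r_distr M.smult_assoc1)
qed

section \<open>Homology of complexes\<close>

lemma module_imp_lmod:
  assumes "module R M"
  shows "lmod R M"
proof -
  interpret M: module R M by fact
  show ?thesis
    by (intro lmod.intro lmod_axioms.intro M.R.ring_axioms M.M.abelian_group_axioms)
      (simp_all add: M.smult_l_distr M.smult_r_distr M.smult_assoc1)
qed

section \<open>Quotients by a submodule\<close>

locale submod = module R M + submodule N R M for R (structure) and M (structure) and N
begin

lemma abelian_subgroup: "abelian_subgroup N M"
  by (rule abelian_subgroupI3) (auto intro: additive_subgroup.intro subgroup_axioms M.abelian_group_axioms)

sublocale sub: abelian_subgroup N M by (rule abelian_subgroup)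

lemma quot_carrier: "C \<in> carrier (quot_module M N) \<longleftrightarrow> (\<exists>x\<in>carrier M. C = N +>\<^bsub>M\<^esub> x)"
  by (auto simp: quot_module_def A_RCOSETS_def' )

lemma coset_self: "x \<in> carrier M \<Longrightarrow> x \<in> N +>\<^bsub>M\<^esub> x"
  using sub.a_subset sub.zero_closed by (force simp: a_r_coset_def')

lemma coset_eq_iff:
  assumes "x \<in> carrier M" "y \<in> carrier M"
  shows "N +>\<^bsub>M\<^esub> x = N +>\<^bsub>M\<^esub> y \<longleftrightarrow> (\<exists>n\<in>N. x = n \<oplus>\<^bsub>M\<^esub> y)"
proof
  assume "N +>\<^bsub>M\<^esub> x = N +>\<^bsub>M\<^esub> y"
  then show "\<exists>n\<in>N. x = n \<oplus>\<^bsub>M\<^esub> y" using coset_self[OF assms(1)] by (auto simp: a_r_coset_def')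
next
  assume "\<exists>n\<in>N. x = n \<oplus>\<^bsub>M\<^esub> y"
  then have "x \<in> N +>\<^bsub>M\<^esub> y" by (auto simp: a_r_coset_def')
  then show "N +>\<^bsub>M\<^esub> x = N +>\<^bsub>M\<^esub> y"
    using assms sub.a_repr_independence' M.a_repr_independence sub.a_subgroup by blast
qed

lemma coset_eq_self_iff: "x \<in> carrier M \<Longrightarrow> N +>\<^bsub>M\<^esub> x = N \<longleftrightarrow> x \<in> N"
  using coset_self sub.a_rcos_const by fastforce

lemma quot_add:
  assumes "x \<in> carrier M" "y \<in> carrier M"
  shows "(N +>\<^bsub>M\<^esub> x) \<oplus>\<^bsub>quot_module M N\<^esub> (N +>\<^bsub>M\<^esub> y) = N +>\<^bsub>M\<^esub> (x \<oplus>\<^bsub>M\<^esub> y)"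
  using assms by (simp add: quot_module_def sub.a_rcos_sum)

lemma quot_smult:
  assumes a: "a \<in> carrier R" and x: "x \<in> carrier M"
  shows "a \<odot>\<^bsub>quot_module M N\<^esub> (N +>\<^bsub>M\<^esub> x) = N +>\<^bsub>M\<^esub> (a \<odot>\<^bsub>M\<^esub> x)"
proof -
  have "N +>\<^bsub>M\<^esub> (a \<odot>\<^bsub>M\<^esub> y) = N +>\<^bsub>M\<^esub> (a \<odot>\<^bsub>M\<^esub> x)" if y: "y \<in> N +>\<^bsub>M\<^esub> x" for y
  proof -
    obtain n where n: "n \<in> N" "y = n \<oplus>\<^bsub>M\<^esub> x" using y by (auto simp: a_r_coset_def')
    have nc: "n \<in> carrier M" using n sub.a_subset by auto
    have "a \<odot>\<^bsub>M\<^esub> y = a \<odot>\<^bsub>M\<^esub> n \<oplus>\<^bsub>M\<^esub> a \<odot>\<^bsub>M\<^esub> x" "a \<odot>\<^bsub>M\<^esub> n \<in> N"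
      using n nc a x by (simp_all add: smult_r_distr)
    then show ?thesis using coset_eq_iff[of "a \<odot>\<^bsub>M\<^esub> y" "a \<odot>\<^bsub>M\<^esub> x"] a x nc n by auto
  qed
  \<comment> \<open>The scalar action on cosets is a union over representatives. All its members are
    the same coset, and there is at least one.\<close>
  then have "(\<Union>y\<in>N +>\<^bsub>M\<^esub> x. N +>\<^bsub>M\<^esub> (a \<odot>\<^bsub>M\<^esub> y)) = (\<Union>y\<in>N +>\<^bsub>M\<^esub> x. N +>\<^bsub>M\<^esub> (a \<odot>\<^bsub>M\<^esub> x))"
    by (intro SUP_cong) auto
  also have "\<dots> = N +>\<^bsub>M\<^esub> (a \<odot>\<^bsub>M\<^esub> x)" using coset_self[OF x] by blast
  finally show ?thesis by (simp only: quot_module_def module.simps)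
qed

lemma quot_zero: "\<zero>\<^bsub>quot_module M N\<^esub> = N +>\<^bsub>M\<^esub> \<zero>\<^bsub>M\<^esub>"
  using coset_eq_self_iff[of "\<zero>\<^bsub>M\<^esub>"] by (simp add: quot_module_def)

lemma quot_module_module: "module R (quot_module M N)"
proof (rule moduleI[OF R.cring_axioms])
  show "abelian_group (quot_module M N)"
  proof (rule abelian_groupI)
    fix C assume "C \<in> carrier (quot_module M N)"
    then obtain x where x: "x \<in> carrier M" "C = N +>\<^bsub>M\<^esub> x" by (auto simp: quot_carrier)
    have "(N +>\<^bsub>M\<^esub> (\<ominus>\<^bsub>M\<^esub> x)) \<oplus>\<^bsub>quot_module M N\<^esub> C = \<zero>\<^bsub>quot_module M N\<^esub>"
      using x by (simp add: quot_add quot_zero M.l_neg)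
    then show "\<exists>y\<in>carrier (quot_module M N). y \<oplus>\<^bsub>quot_module M N\<^esub> C = \<zero>\<^bsub>quot_module M N\<^esub>"
      using x quot_carrier by blast
  qed (auto simp: quot_carrier quot_add quot_zero M.a_ac)
qed (auto simp: quot_carrier quot_add quot_smult smult_l_distr smult_r_distr smult_assoc1)

lemma coset_lin_map: "lin_map R M (quot_module M N) (\<lambda>x. N +>\<^bsub>M\<^esub> x)"
  by (rule lin_mapI) (auto simp: quot_carrier quot_add quot_smult)

end

lemma mod_isomorphic_sym:
  assumes "module R M" "mod_isomorphic R M N"
  shows "mod_isomorphic R N M"
proof -
  interpret M: module R M by fact
  obtain h where h: "bij_betw h (carrier M) (carrier N)"
    and add: "\<And>x y. x \<in> carrier M \<Longrightarrow> y \<in> carrier M \<Longrightarrow> h (x \<oplus>\<^bsub>M\<^esub> y) = h x \<oplus>\<^bsub>N\<^esub> h y"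
    and sm: "\<And>c x. c \<in> carrier R \<Longrightarrow> x \<in> carrier M \<Longrightarrow> h (c \<odot>\<^bsub>M\<^esub> x) = c \<odot>\<^bsub>N\<^esub> h x"
    using assms(2) by (auto simp: mod_isomorphic_def)
  define g where "g = inv_into (carrier M) h"
  have g: "bij_betw g (carrier N) (carrier M)" unfolding g_def using h by (rule bij_betw_inv_into)
  have gh: "g (h x) = x" if "x \<in> carrier M" for x
    using that h by (simp add: g_def bij_betw_def inv_into_f_f)
  have gc: "g y \<in> carrier M" and hg: "h (g y) = y" if "y \<in> carrier N" for y
    using that h g by (auto simp: g_def bij_betw_def f_inv_into_f inv_into_into)
  show ?thesis unfolding mod_isomorphic_def
  proof (intro exI[of _ g] conjI ballI g)
    fix x y assume "x \<in> carrier N" "y \<in> carrier N"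
    then show "g (x \<oplus>\<^bsub>N\<^esub> y) = g x \<oplus>\<^bsub>M\<^esub> g y"
      using add[of "g x" "g y"] gh[of "g x \<oplus>\<^bsub>M\<^esub> g y"] gc hg by simp
  next
    fix c x assume "c \<in> carrier R" "x \<in> carrier N"
    then show "g (c \<odot>\<^bsub>N\<^esub> x) = c \<odot>\<^bsub>M\<^esub> g x"
      using sm[of c "g x"] gh[of "c \<odot>\<^bsub>M\<^esub> g x"] gc hg by simp
  qed
qed

lemma mod_isomorphic_trans:
  assumes "mod_isomorphic R M N" "mod_isomorphic R N Q"
  shows "mod_isomorphic R M Q"
proof -
  obtain h where h: "bij_betw h (carrier M) (carrier N)"
    and ha: "\<And>x y. x \<in> carrier M \<Longrightarrow> y \<in> carrier M \<Longrightarrow> h (x \<oplus>\<^bsub>M\<^esub> y) = h x \<oplus>\<^bsub>N\<^esub> h y"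
    and hs: "\<And>c x. c \<in> carrier R \<Longrightarrow> x \<in> carrier M \<Longrightarrow> h (c \<odot>\<^bsub>M\<^esub> x) = c \<odot>\<^bsub>N\<^esub> h x"
    using assms(1) by (auto simp: mod_isomorphic_def)
  obtain g where g: "bij_betw g (carrier N) (carrier Q)"
    and ga: "\<And>x y. x \<in> carrier N \<Longrightarrow> y \<in> carrier N \<Longrightarrow> g (x \<oplus>\<^bsub>N\<^esub> y) = g x \<oplus>\<^bsub>Q\<^esub> g y"
    and gs: "\<And>c x. c \<in> carrier R \<Longrightarrow> x \<in> carrier N \<Longrightarrow> g (c \<odot>\<^bsub>N\<^esub> x) = c \<odot>\<^bsub>Q\<^esub> g x"
    using assms(2) by (auto simp: mod_isomorphic_def)
  have hc: "x \<in> carrier M \<Longrightarrow> h x \<in> carrier N" for x using h by (auto simp: bij_betw_def)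
  show ?thesis unfolding mod_isomorphic_def
    by (rule exI[of _ "g \<circ> h"]) (simp add: bij_betw_trans[OF h g] ha hs ga gs hc)
qed

text \<open>The conditions speak of representatives, so that no application has to handle cosets:
  \<open>inj\<close> makes \<open>N\<close> the preimage of \<open>N'\<close>, and
  \<open>surj\<close> says that \<open>N'\<close> and the image of \<open>f\<close> together span
  \<open>M'\<close>.\<close>

lemma quot_module_mod_isomorphic:
  assumes "submod R M N" "submod R M' N'"
    and f: "lin_map R M M' f"
    and inj: "\<And>x. x \<in> carrier M \<Longrightarrow> f x \<in> N' \<longleftrightarrow> x \<in> N"
    and surj: "\<And>y. y \<in> carrier M' \<Longrightarrow> \<exists>x\<in>carrier M. \<exists>n\<in>N'. y = n \<oplus>\<^bsub>M'\<^esub> f x"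
  shows "mod_isomorphic R (quot_module M N) (quot_module M' N')"
proof -
  interpret M: submod R M N by fact
  interpret M': submod R M' N' by fact
  note fc = lin_map_closed[OF f]
  define h where "h C = N' +>\<^bsub>M'\<^esub> f (SOME x. x \<in> carrier M \<and> C = N +>\<^bsub>M\<^esub> x)" for C
  \<comment> \<open>Read from right to left this makes \<open>h\<close> well defined, from left to
    right injective.\<close>
  have eq: "N' +>\<^bsub>M'\<^esub> f x = N' +>\<^bsub>M'\<^esub> f y \<longleftrightarrow> N +>\<^bsub>M\<^esub> x = N +>\<^bsub>M\<^esub> y"
    if xy: "x \<in> carrier M" "y \<in> carrier M" for x y
  proof -
    note L = module_imp_lmod[OF M.module_axioms] module_imp_lmod[OF M'.module_axioms] f
    have d: "x \<ominus>\<^bsub>M\<^esub> y \<in> carrier M" using xy by simp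
    have 1: "f x = n \<oplus>\<^bsub>M'\<^esub> f y \<longleftrightarrow> n = f (x \<ominus>\<^bsub>M\<^esub> y)" if "n \<in> N'" for n
      using M'.M.add.inv_solve_right'[of n "f x" "f y"] lin_map_minus[OF L xy] that xy fc M'.sub.a_subset
      by (auto simp: a_minus_def)
    have 2: "x = n \<oplus>\<^bsub>M\<^esub> y \<longleftrightarrow> n = x \<ominus>\<^bsub>M\<^esub> y" if "n \<in> N" for n
      using M.M.add.inv_solve_right'[of n x y] that xy M.sub.a_subset by (auto simp: a_minus_def)
    have "(\<exists>n\<in>N'. f x = n \<oplus>\<^bsub>M'\<^esub> f y) \<longleftrightarrow> f (x \<ominus>\<^bsub>M\<^esub> y) \<in> N'" using 1 by metis
    moreover have "(\<exists>n\<in>N. x = n \<oplus>\<^bsub>M\<^esub> y) \<longleftrightarrow> x \<ominus>\<^bsub>M\<^esub> y \<in> N" using 2 by metis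
    ultimately show ?thesis
      unfolding M.coset_eq_iff[OF xy] M'.coset_eq_iff[OF fc[OF xy(1)] fc[OF xy(2)]]
      using inj[OF d] by simp
  qed
  have h: "h (N +>\<^bsub>M\<^esub> x) = N' +>\<^bsub>M'\<^esub> f x" if x: "x \<in> carrier M" for x
  proof -
    have "\<exists>y. y \<in> carrier M \<and> N +>\<^bsub>M\<^esub> x = N +>\<^bsub>M\<^esub> y" using x by blast
    from someI_ex[OF this] show ?thesis unfolding h_def using eq x by auto
  qed
  show ?thesis unfolding mod_isomorphic_def
  proof (intro exI[of _ h] conjI ballI)
    show "bij_betw h (carrier (quot_module M N)) (carrier (quot_module M' N'))"
      unfolding bij_betw_def
    proof
      show "inj_on h (carrier (quot_module M N))"
        by (rule inj_onI) (auto simp: M.quot_carrier h eq)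
      show "h ` carrier (quot_module M N) = carrier (quot_module M' N')"
      proof safe
        fix C assume "C \<in> carrier (quot_module M N)"
        then show "h C \<in> carrier (quot_module M' N')"
          using fc by (auto simp: M.quot_carrier M'.quot_carrier h)
      next
        fix C assume "C \<in> carrier (quot_module M' N')"
        then obtain y where y: "y \<in> carrier M'" "C = N' +>\<^bsub>M'\<^esub> y" by (auto simp: M'.quot_carrier)
        obtain x n where x: "x \<in> carrier M" "n \<in> N'" "y = n \<oplus>\<^bsub>M'\<^esub> f x" using surj[OF y(1)] by blast
        then have "C = h (N +>\<^bsub>M\<^esub> x)" using M'.coset_eq_iff[of y "f x"] y fc h by auto
        then show "C \<in> h ` carrier (quot_module M N)" using x M.quot_carrier by blast
      qed
    qed
  next
    fix C D assume "C \<in> carrier (quot_module M N)" "D \<in> carrier (quot_module M N)"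
    then show "h (C \<oplus>\<^bsub>quot_module M N\<^esub> D) = h C \<oplus>\<^bsub>quot_module M' N'\<^esub> h D"
      by (auto simp: M.quot_carrier M.quot_add M'.quot_add h fc lin_map_add[OF f])
  next
    fix c C assume "c \<in> carrier R" "C \<in> carrier (quot_module M N)"
    then show "h (c \<odot>\<^bsub>quot_module M N\<^esub> C) = c \<odot>\<^bsub>quot_module M' N'\<^esub> h C"
      by (auto simp: M.quot_carrier M.quot_smult M'.quot_smult h fc lin_map_smult[OF f])
  qed
qed

section \<open>Chain complexes and maps between their homology modules\<close>

definition chain_complex ::
  "('r, 'c) ring_scheme \<Rightarrow> (nat \<Rightarrow> ('r, 'm) module) \<Rightarrow> (nat \<Rightarrow> 'm \<Rightarrow> 'm) \<Rightarrow> bool" where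
  "chain_complex R C D \<longleftrightarrow> (\<forall>i. module R (C i)) \<and> (\<forall>i. lin_map R (C (Suc i)) (C i) (D i)) \<and>
     (\<forall>i. \<forall>x\<in>carrier (C (Suc (Suc i))). D i (D (Suc i) x) = \<zero>\<^bsub>C i\<^esub>)"

context
  fixes R C D assumes cc: "chain_complex R C D"
begin

lemma cc_module: "module R (C i)" and cc_lin: "lin_map R (C (Suc i)) (C i) (D i)"
  and cc_comp: "x \<in> carrier (C (Suc (Suc i))) \<Longrightarrow> D i (D (Suc i) x) = \<zero>\<^bsub>C i\<^esub>"
  using cc unfolding chain_complex_def by auto

lemma cycles_subset: "cycles C D i \<subseteq> carrier (C i)"
  by (cases i) auto

lemma cycles_submodule: "submodule (cycles C D i) R (C i)"
proof -
  interpret Ci: module R "C i" by (rule cc_module)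
  show ?thesis
  proof (cases i)
    case 0
    then show ?thesis using Ci.carrier_is_submodule by simp
  next
    case (Suc j)
    interpret Cj: module R "C j" by (rule cc_module)
    note L = module_imp_lmod[OF cc_module[of i], unfolded Suc] module_imp_lmod[OF cc_module[of j]] cc_lin[of j]
    show ?thesis
      by (rule Ci.submoduleI) (use Suc in \<open>auto simp: lin_map_zero[OF L] lin_map_neg[OF L]
          lin_map_add[OF L(3)] lin_map_smult[OF L(3)] Suc
          Ci.M.zero_closed[unfolded Suc] Ci.M.a_inv_closed[unfolded Suc]
          Ci.M.a_closed[unfolded Suc] Ci.smult_closed[unfolded Suc]\<close>)
  qed
qed

lemma boundaries_subset: "D i ` carrier (C (Suc i)) \<subseteq> cycles C D i"
  by (cases i) (auto intro: lin_map_closed[OF cc_lin] simp: cc_comp)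

lemma cycles_module: "module R ((C i)\<lparr>carrier := cycles C D i\<rparr>)"
  by (rule submodule.submodule_is_module[OF cycles_submodule cc_module])

lemma boundaries_submod: "submod R ((C i)\<lparr>carrier := cycles C D i\<rparr>) (D i ` carrier (C (Suc i)))"
proof -
  interpret Ci: module R "C i" by (rule cc_module)
  interpret Cs: module R "C (Suc i)" by (rule cc_module)
  interpret Z: module R "(C i)\<lparr>carrier := cycles C D i\<rparr>" by (rule cycles_module)
  let ?B = "D i ` carrier (C (Suc i))"
  note L = module_imp_lmod[OF cc_module[of "Suc i"]] module_imp_lmod[OF cc_module[of i]] cc_lin[of i]
  have "\<ominus>\<^bsub>(C i)\<lparr>carrier := cycles C D i\<rparr>\<^esub> D i x = D i (\<ominus>\<^bsub>C (Suc i)\<^esub> x)"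
    if x: "x \<in> carrier (C (Suc i))" for x
  proof (rule Z.M.minus_equality)
    have "D i (\<ominus>\<^bsub>C (Suc i)\<^esub> x) \<oplus>\<^bsub>C i\<^esub> D i x = D i (\<ominus>\<^bsub>C (Suc i)\<^esub> x \<oplus>\<^bsub>C (Suc i)\<^esub> x)"
      using x lin_map_add[OF L(3)] by simp
    then show "D i (\<ominus>\<^bsub>C (Suc i)\<^esub> x) \<oplus>\<^bsub>(C i)\<lparr>carrier := cycles C D i\<rparr>\<^esub> D i x = \<zero>\<^bsub>(C i)\<lparr>carrier := cycles C D i\<rparr>\<^esub>"
      using x by (simp add: Cs.M.l_neg lin_map_zero[OF L])
  qed (use x subsetD[OF boundaries_subset, OF imageI, of _ i] in auto)
  moreover have "\<zero>\<^bsub>C i\<^esub> \<in> ?B" using lin_map_zero[OF L] Cs.M.zero_closed by force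
  moreover have "a \<oplus>\<^bsub>C i\<^esub> b \<in> ?B" if "a \<in> ?B" "b \<in> ?B" for a b
    using that by (auto simp flip: lin_map_add[OF L(3)])
  moreover have "c \<odot>\<^bsub>C i\<^esub> a \<in> ?B" if "a \<in> ?B" "c \<in> carrier R" for a c
    using that by (auto simp flip: lin_map_smult[OF L(3)])
  ultimately have "submodule ?B R ((C i)\<lparr>carrier := cycles C D i\<rparr>)"
    using boundaries_subset by (intro Z.submoduleI) auto
  then show ?thesis by (intro submod.intro Z.module_axioms)
qed

lemma homology_module: "module R (homology C D i)"
  unfolding homology_def by (rule submod.quot_module_module[OF boundaries_submod])

end

text \<open>Injectivity and surjectivity are required only in the degree at hand and in terms of
  cycles and boundaries, which is the form in which a homotopy inverse delivers them.\<close>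

lemma homology_mod_isomorphic:
  assumes cc: "chain_complex R C D" "chain_complex R C' D'"
    and F: "\<And>i. lin_map R (C i) (C' i) (F i)"
    and comm: "\<And>i x. x \<in> carrier (C (Suc i)) \<Longrightarrow> D' i (F (Suc i) x) = F i (D i x)"
    and inj: "\<And>x. \<lbrakk>x \<in> cycles C D i; F i x \<in> D' i ` carrier (C' (Suc i))\<rbrakk> \<Longrightarrow> x \<in> D i ` carrier (C (Suc i))"
    and surj: "\<And>y. y \<in> cycles C' D' i \<Longrightarrow>
      \<exists>x\<in>cycles C D i. \<exists>b\<in>carrier (C' (Suc i)). y = D' i b \<oplus>\<^bsub>C' i\<^esub> F i x"
  shows "mod_isomorphic R (homology C D i) (homology C' D' i)"
  unfolding homology_def
proof (rule quot_module_mod_isomorphic[OF boundaries_submod[OF cc(1)] boundaries_submod[OF cc(2)]])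
  have cyc: "F i x \<in> cycles C' D' i" if "x \<in> cycles C D i" for x
  proof (cases i)
    case 0
    then show ?thesis using that lin_map_closed[OF F[of i]] by simp
  next
    case (Suc j)
    then show ?thesis
      using that comm[of x j] lin_map_closed[OF F[of i]]
        lin_map_zero[OF cc_module[OF cc(1), THEN module_imp_lmod] cc_module[OF cc(2), THEN module_imp_lmod] F]
      by simp
  qed
  show "lin_map R ((C i)\<lparr>carrier := cycles C D i\<rparr>) ((C' i)\<lparr>carrier := cycles C' D' i\<rparr>) (F i)"
    using cyc cycles_subset[OF cc(1), of i] lin_map_add[OF F[of i]] lin_map_smult[OF F[of i]]
    by (intro lin_mapI) (auto simp: subset_iff)
  show "x \<in> carrier ((C i)\<lparr>carrier := cycles C D i\<rparr>) \<Longrightarrow>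
      F i x \<in> D' i ` carrier (C' (Suc i)) \<longleftrightarrow> x \<in> D i ` carrier (C (Suc i))" for x
    using inj[of x] comm[symmetric] lin_map_closed[OF F[of "Suc i"]] by auto
  show "y \<in> carrier ((C' i)\<lparr>carrier := cycles C' D' i\<rparr>) \<Longrightarrow>
      \<exists>x\<in>carrier ((C i)\<lparr>carrier := cycles C D i\<rparr>). \<exists>n\<in>D' i ` carrier (C' (Suc i)).
        y = n \<oplus>\<^bsub>(C' i)\<lparr>carrier := cycles C' D' i\<rparr>\<^esub> F i x" for y
    using surj[of y] by auto
qed

text \<open>For the comparison of two descriptions of the bar differential, which are shown to agree
  on chains only.\<close>

lemma homology_cong:
  assumes "\<And>i x. x \<in> carrier (C (Suc i)) \<Longrightarrow> D i x = D' i x"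
  shows "homology C D i = homology C D' i"
proof -
  have "D i ` carrier (C (Suc i)) = D' i ` carrier (C (Suc i))" using assms by simp
  moreover have "cycles C D i = cycles C D' i" by (cases i) (auto simp: assms)
  ultimately show ?thesis unfolding homology_def by simp
qed

section \<open>Free resolutions over a group algebra\<close>

text \<open>The ground ring as a module over itself: the target that \<open>lin_map\<close> needs
  for augmentations and for evaluation at a basis element.\<close>

definition scalar_module :: "('k, 'c) ring_scheme \<Rightarrow> ('k, 'k) module" where
  "scalar_module k = \<lparr>carrier = carrier k, monoid.mult = undefined, one = undefined,
     zero = \<zero>\<^bsub>k\<^esub>, add = add k, smult = monoid.mult k\<rparr>"

lemma scalar_module_simps [simp]:
  "carrier (scalar_module k) = carrier k" "zero (scalar_module k) = \<zero>\<^bsub>k\<^esub>"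
  "add (scalar_module k) = add k" "smult (scalar_module k) = monoid.mult k"
  by (simp_all add: scalar_module_def)

lemma (in ring) scalar_module_lmod: "lmod R (scalar_module R)"
proof -
  have "abelian_group (scalar_module R)"
    by (rule abelian_groupI) (auto simp: a_ac intro: bexI[of _ "\<ominus> _"] l_neg)
  then show ?thesis
    by (intro lmod.intro lmod_axioms.intro ring_axioms) (auto simp: l_distr r_distr m_assoc)
qed

locale kH = k: cring k + H: group H for k :: "('k, 'c) ring_scheme" and H :: "('h, 'd) monoid_scheme"
begin

text \<open>The free left module on \<open>X\<close> over the group algebra of \<open>H\<close>,
  kept as the free \<open>k\<close>-module on all translates of the generators. The group algebra
  then acts through the translations \<open>hact\<close>, and it need not be formed itself.\<close>

abbreviation FH :: "'x set \<Rightarrow> ('k, 'h \<times> 'x \<Rightarrow> 'k) module" where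
  "FH X \<equiv> free_module k (carrier H \<times> X)"

abbreviation FX :: "'x set \<Rightarrow> ('k, 'x \<Rightarrow> 'k) module" where
  "FX X \<equiv> free_module k X"

lemma FH_lmod: "lmod k (FH X)" and FX_lmod: "lmod k (FX X)" and FX_module: "module k (FX X)"
  by (rule k.free_module_lmod k.lmod_imp_module)+

text \<open>Translating a function pulls its argument back, hence the inverse; a basis vector at
  \<open>(g, x)\<close> moves to the one at \<open>(h g, x)\<close>. The value off the carrier of
  \<open>H\<close> is zero so that the result stays in \<open>FH X\<close>.\<close>

definition hact :: "'h \<Rightarrow> ('h \<times> 'x \<Rightarrow> 'k) \<Rightarrow> 'h \<times> 'x \<Rightarrow> 'k" where
  "hact h f = (\<lambda>(g, x). if g \<in> carrier H then f (inv\<^bsub>H\<^esub> h \<otimes>\<^bsub>H\<^esub> g, x) else \<zero>\<^bsub>k\<^esub>)"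

lemma hact_closed:
  assumes h: "h \<in> carrier H" and f: "f \<in> carrier (FH X)"
  shows "hact h f \<in> carrier (FH X)"
proof (rule k.free_moduleI)
  let ?S = "(\<lambda>(g, x). (h \<otimes>\<^bsub>H\<^esub> g, x)) ` {z. f z \<noteq> \<zero>\<^bsub>k\<^esub>}"
  show "finite ?S" using f by (auto dest: free_module_finite)
  show "?S \<subseteq> carrier H \<times> X" using free_module_support[OF f] h by auto
  show "hact h f z \<in> carrier k" for z
    using f by (auto simp: hact_def split: prod.split)
  show "hact h f z = \<zero>\<^bsub>k\<^esub>" if z: "z \<notin> ?S" for z
  proof (rule ccontr)
    obtain g x where gx: "z = (g, x)" by (cases z)
    assume "hact h f z \<noteq> \<zero>\<^bsub>k\<^esub>"
    then have g: "g \<in> carrier H" "f (inv\<^bsub>H\<^esub> h \<otimes>\<^bsub>H\<^esub> g, x) \<noteq> \<zero>\<^bsub>k\<^esub>"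
      by (auto simp: hact_def gx split: if_splits)
    then have "z = (\<lambda>(g, x). (h \<otimes>\<^bsub>H\<^esub> g, x)) (inv\<^bsub>H\<^esub> h \<otimes>\<^bsub>H\<^esub> g, x)"
      using h by (simp add: gx flip: H.m_assoc)
    then show False using z g by blast
  qed
qed

lemma hact_lin: "h \<in> carrier H \<Longrightarrow> lin_map k (FH X) (FH X) (hact h)"
  by (rule lin_mapI, erule (1) hact_closed) (auto simp: hact_def fun_eq_iff)

lemma hact_basis:
  assumes "h \<in> carrier H" "g \<in> carrier H"
  shows "hact h (basis_vec k (g, x)) = basis_vec k (h \<otimes>\<^bsub>H\<^esub> g, x)"
proof -
  have "inv\<^bsub>H\<^esub> h \<otimes>\<^bsub>H\<^esub> g' = g \<longleftrightarrow> g' = h \<otimes>\<^bsub>H\<^esub> g" if "g' \<in> carrier H" for g'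
    using assms that H.inv_solve_left'[of g h g'] by simp
  then show ?thesis
    using assms by (auto simp: hact_def basis_vec_def fun_eq_iff)
qed

lemma hact_hact:
  "g \<in> carrier H \<Longrightarrow> h \<in> carrier H \<Longrightarrow> hact g (hact h f) = hact (g \<otimes>\<^bsub>H\<^esub> h) f"
  by (simp add: hact_def fun_eq_iff H.inv_mult_group H.m_assoc)

lemma hact_one: "f \<in> carrier (FH X) \<Longrightarrow> hact \<one>\<^bsub>H\<^esub> f = f"
  using free_module_outside[of f k "carrier H \<times> X"] by (simp add: hact_def fun_eq_iff)

text \<open>These are the linear maps over the group algebra.\<close>

definition equivariant :: "'x set \<Rightarrow> 'y set \<Rightarrow> (('h \<times> 'x \<Rightarrow> 'k) \<Rightarrow> ('h \<times> 'y \<Rightarrow> 'k)) \<Rightarrow> bool" where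
  "equivariant X Y L \<longleftrightarrow> lin_map k (FH X) (FH Y) L \<and>
     (\<forall>h\<in>carrier H. \<forall>f\<in>carrier (FH X). L (hact h f) = hact h (L f))"

lemma equivariant_lin: "equivariant X Y L \<Longrightarrow> lin_map k (FH X) (FH Y) L"
  by (simp add: equivariant_def)

lemma equivariant_hact: "equivariant X Y L \<Longrightarrow> h \<in> carrier H \<Longrightarrow> f \<in> carrier (FH X) \<Longrightarrow>
    L (hact h f) = hact h (L f)"
  by (simp add: equivariant_def)

lemma equivariant_closed: "equivariant X Y L \<Longrightarrow> f \<in> carrier (FH X) \<Longrightarrow> L f \<in> carrier (FH Y)"
  by (rule lin_map_closed[OF equivariant_lin])

lemma equivariant_comp:
  assumes "equivariant X Y L" "equivariant Y Z L'"
  shows "equivariant X Z (\<lambda>f. L' (L f))"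
  unfolding equivariant_def
  using lin_map_comp[OF equivariant_lin equivariant_lin, OF assms] assms
  by (simp add: equivariant_hact equivariant_closed[OF assms(1)])

lemma equivariant_id: "equivariant X X (\<lambda>f. f)"
  unfolding equivariant_def by (auto intro: lin_mapI)

lemma equivariant_diff:
  assumes "equivariant X Y L" "equivariant X Y L'"
  shows "equivariant X Y (\<lambda>f. L f \<ominus>\<^bsub>FH Y\<^esub> L' f)"
  unfolding equivariant_def
proof (intro conjI ballI)
  show "lin_map k (FH X) (FH Y) (\<lambda>f. L f \<ominus>\<^bsub>FH Y\<^esub> L' f)"
    by (rule lin_map_diff[OF FH_lmod equivariant_lin equivariant_lin]) fact+
  fix h f assume "h \<in> carrier H" "f \<in> carrier (FH X)"
  then show "L (hact h f) \<ominus>\<^bsub>FH Y\<^esub> L' (hact h f) = hact h (L f \<ominus>\<^bsub>FH Y\<^esub> L' f)"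
    using assms by (simp add: equivariant_hact equivariant_closed
      lin_map_minus[OF FH_lmod FH_lmod hact_lin])
qed

lemma equivariant_eqI:
  assumes "equivariant X Y L" "equivariant X Y L'"
    and "\<And>x. x \<in> X \<Longrightarrow> L (basis_vec k (\<one>\<^bsub>H\<^esub>, x)) = L' (basis_vec k (\<one>\<^bsub>H\<^esub>, x))"
    and "f \<in> carrier (FH X)"
  shows "L f = L' f"
proof (rule k.lin_map_free_eqI[OF FH_lmod equivariant_lin equivariant_lin _ assms(4)])
  fix z assume "z \<in> carrier H \<times> X"
  then obtain h x where z: "z = (h, x)" "h \<in> carrier H" "x \<in> X" by auto
  then have "basis_vec k z = hact h (basis_vec k (\<one>\<^bsub>H\<^esub>, x))" by (simp add: hact_basis)
  then show "L (basis_vec k z) = L' (basis_vec k z)"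
    using z assms by (simp add: equivariant_hact)
qed fact+

text \<open>The universal property of a free module over the group algebra: the values at the unit
  translates of the generators are prescribed freely, and the others are their translates.\<close>

definition hext :: "'y set \<Rightarrow> ('x \<Rightarrow> 'h \<times> 'y \<Rightarrow> 'k) \<Rightarrow> ('h \<times> 'x \<Rightarrow> 'k) \<Rightarrow> 'h \<times> 'y \<Rightarrow> 'k" where
  "hext Y v = lin_ext k (FH Y) (\<lambda>(h, x). hact h (v x))"

lemma hext_basis':
  "v x \<in> carrier (FH Y) \<Longrightarrow> h \<in> carrier H \<Longrightarrow> hext Y v (basis_vec k (h, x)) = hact h (v x)"
  unfolding hext_def by (subst k.lin_ext_basis[OF FH_lmod]) (simp_all add: hact_closed)

lemma hext_basis: "v x \<in> carrier (FH Y) \<Longrightarrow> hext Y v (basis_vec k (\<one>\<^bsub>H\<^esub>, x)) = v x"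
  by (simp add: hext_basis' hact_one)

lemma hext_equivariant:
  assumes v: "\<And>x. x \<in> X \<Longrightarrow> v x \<in> carrier (FH Y)"
  shows "equivariant X Y (hext Y v)"
proof -
  have lin: "lin_map k (FH X) (FH Y) (hext Y v)"
    unfolding hext_def by (rule k.lin_ext_lin_map[OF FH_lmod]) (auto simp: v hact_closed)
  have "hext Y v (hact h f) = hact h (hext Y v f)" if h: "h \<in> carrier H" and f: "f \<in> carrier (FH X)" for h f
  proof (rule k.lin_map_free_eqI[OF FH_lmod lin_map_comp[OF hact_lin[OF h] lin]
        lin_map_comp[OF lin hact_lin[OF h]] _ f])
    fix z assume "z \<in> carrier H \<times> X"
    then show "hext Y v (hact h (basis_vec k z)) = hact h (hext Y v (basis_vec k z))"
      using h v by (auto simp: hact_basis hext_basis' hact_hact)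
  qed
  with lin show ?thesis by (simp add: equivariant_def)
qed

section \<open>Coinvariants, that is, the tensor product with the trivial module\<close>

definition coinv :: "'x set \<Rightarrow> ('h \<times> 'x \<Rightarrow> 'k) \<Rightarrow> 'x \<Rightarrow> 'k" where
  "coinv X = lin_ext k (FX X) (\<lambda>(h, x). basis_vec k x)"

text \<open>A section of \<open>coinv\<close> that is linear over \<open>k\<close> but in general
  does not respect translations. It is therefore used only in front of an equivariant map that is
  followed by \<open>coinv\<close>.\<close>

definition unit_sec :: "'x set \<Rightarrow> ('x \<Rightarrow> 'k) \<Rightarrow> 'h \<times> 'x \<Rightarrow> 'k" where
  "unit_sec X = lin_ext k (FH X) (\<lambda>x. basis_vec k (\<one>\<^bsub>H\<^esub>, x))"

lemma coinv_lin: "lin_map k (FH X) (FX X) (coinv X)"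
  unfolding coinv_def by (rule k.lin_ext_lin_map[OF FX_lmod]) auto

lemma coinv_basis: "x \<in> X \<Longrightarrow> coinv X (basis_vec k (h, x)) = basis_vec k x"
  unfolding coinv_def by (subst k.lin_ext_basis[OF FX_lmod]) auto

lemma unit_sec_lin: "lin_map k (FX X) (FH X) (unit_sec X)"
  unfolding unit_sec_def by (rule k.lin_ext_lin_map[OF FH_lmod]) auto

lemma unit_sec_basis: "x \<in> X \<Longrightarrow> unit_sec X (basis_vec k x) = basis_vec k (\<one>\<^bsub>H\<^esub>, x)"
  unfolding unit_sec_def by (subst k.lin_ext_basis[OF FH_lmod]) auto

lemma coinv_unit_sec: "g \<in> carrier (FX X) \<Longrightarrow> coinv X (unit_sec X g) = g"
  by (rule k.lin_map_free_eqI[OF FX_lmod lin_map_comp[OF unit_sec_lin coinv_lin]])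
    (auto intro: lin_mapI simp: unit_sec_basis coinv_basis)

lemma coinv_hact:
  assumes h: "h \<in> carrier H" and "f \<in> carrier (FH X)"
  shows "coinv X (hact h f) = coinv X f"
  by (rule k.lin_map_free_eqI[OF FX_lmod lin_map_comp[OF hact_lin[OF h] coinv_lin] coinv_lin])
    (use assms in \<open>auto simp: hact_basis coinv_basis\<close>)

text \<open>Going down by \<open>coinv\<close> and up by \<open>unit_sec\<close> replaces
  \<open>(h, x)\<close> by the unit translate of \<open>x\<close>. The lost \<open>h\<close> would
  reappear as a translation of the value of \<open>L\<close>, which the outer \<open>coinv\<close>
  does not see. This is what makes \<open>coinv_map\<close> functorial.\<close>

lemma coinv_equivariant:
  assumes L: "equivariant X Y L" and f: "f \<in> carrier (FH X)"
  shows "coinv Y (L (unit_sec X (coinv X f))) = coinv Y (L f)"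
proof (rule k.lin_map_free_eqI[OF FX_lmod _ _ _ f])
  show "lin_map k (FH X) (FX Y) (\<lambda>f. coinv Y (L (unit_sec X (coinv X f))))"
    by (intro lin_map_comp[OF _ coinv_lin] lin_map_comp[OF _ equivariant_lin[OF L]]
        lin_map_comp[OF coinv_lin unit_sec_lin])
  show "lin_map k (FH X) (FX Y) (\<lambda>f. coinv Y (L f))"
    by (intro lin_map_comp[OF _ coinv_lin] equivariant_lin[OF L])
  fix z assume "z \<in> carrier H \<times> X"
  then obtain h x where z: "z = (h, x)" "h \<in> carrier H" "x \<in> X" by auto
  have "L (basis_vec k z) = hact h (L (basis_vec k (\<one>\<^bsub>H\<^esub>, x)))"
    using z equivariant_hact[OF L, of h "basis_vec k (\<one>\<^bsub>H\<^esub>, x)"] by (simp add: hact_basis)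
  then show "coinv Y (L (unit_sec X (coinv X (basis_vec k z)))) = coinv Y (L (basis_vec k z))"
    using z equivariant_closed[OF L] by (simp add: coinv_basis unit_sec_basis coinv_hact)
qed

definition coinv_map :: "'x set \<Rightarrow> 'y set \<Rightarrow> (('h \<times> 'x \<Rightarrow> 'k) \<Rightarrow> ('h \<times> 'y \<Rightarrow> 'k)) \<Rightarrow> ('x \<Rightarrow> 'k) \<Rightarrow> 'y \<Rightarrow> 'k" where
  "coinv_map X Y L g = coinv Y (L (unit_sec X g))"

lemma coinv_map_lin: "equivariant X Y L \<Longrightarrow> lin_map k (FX X) (FX Y) (coinv_map X Y L)"
  unfolding coinv_map_def
  by (intro lin_map_comp[OF _ coinv_lin] lin_map_comp[OF unit_sec_lin] equivariant_lin)

lemma unit_sec_closed: "g \<in> carrier (FX X) \<Longrightarrow> unit_sec X g \<in> carrier (FH X)"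
  by (rule lin_map_closed[OF unit_sec_lin])

lemma coinv_map_comp:
  assumes "equivariant X Y L" "equivariant Y Z L'" "g \<in> carrier (FX X)"
  shows "coinv_map Y Z L' (coinv_map X Y L g) = coinv_map X Z (\<lambda>f. L' (L f)) g"
  unfolding coinv_map_def
  by (rule coinv_equivariant[OF assms(2) equivariant_closed[OF assms(1) unit_sec_closed[OF assms(3)]]])

end

section \<open>Free resolutions of the trivial module over the group algebra\<close>

locale free_resolution = kH k H for k :: "('k, 'c) ring_scheme" and H :: "('h, 'd) monoid_scheme" +
  fixes X :: "nat \<Rightarrow> 'x set" and d :: "nat \<Rightarrow> ('h \<times> 'x \<Rightarrow> 'k) \<Rightarrow> 'h \<times> 'x \<Rightarrow> 'k"
    and aug :: "('h \<times> 'x \<Rightarrow> 'k) \<Rightarrow> 'k"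
  assumes d_equivariant: "equivariant (X (Suc i)) (X i) (d i)"
    and aug_lin: "lin_map k (FH (X 0)) (scalar_module k) aug"
    and aug_hact: "\<lbrakk>h \<in> carrier H; f \<in> carrier (FH (X 0))\<rbrakk> \<Longrightarrow> aug (hact h f) = aug f"
    and aug_surj: "\<exists>u\<in>carrier (FH (X 0)). aug u = \<one>\<^bsub>k\<^esub>"
    and exact_0: "f \<in> carrier (FH (X 0)) \<Longrightarrow> aug f = \<zero>\<^bsub>k\<^esub> \<longleftrightarrow> f \<in> d 0 ` carrier (FH (X (Suc 0)))"
    and exact_Suc: "f \<in> carrier (FH (X (Suc i))) \<Longrightarrow>
      d i f = (\<lambda>z. \<zero>\<^bsub>k\<^esub>) \<longleftrightarrow> f \<in> d (Suc i) ` carrier (FH (X (Suc (Suc i))))"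
begin

text \<open>The augmentation plays the part of a differential out of degree 0, so that lifting
  arguments need no separate first step.\<close>

definition cyc :: "nat \<Rightarrow> ('h \<times> 'x \<Rightarrow> 'k) \<Rightarrow> bool" where
  "cyc i f \<longleftrightarrow> (case i of 0 \<Rightarrow> aug f = \<zero>\<^bsub>k\<^esub> | Suc j \<Rightarrow> d j f = (\<lambda>z. \<zero>\<^bsub>k\<^esub>))"

lemma cyc_iff: "f \<in> carrier (FH (X i)) \<Longrightarrow> cyc i f \<longleftrightarrow> f \<in> d i ` carrier (FH (X (Suc i)))"
  unfolding cyc_def using exact_0 exact_Suc by (cases i) auto

lemma d_closed: "f \<in> carrier (FH (X (Suc i))) \<Longrightarrow> d i f \<in> carrier (FH (X i))"
  by (rule equivariant_closed[OF d_equivariant])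

lemma cyc_d: "f \<in> carrier (FH (X (Suc i))) \<Longrightarrow> cyc i (d i f)"
  by (simp add: cyc_iff d_closed)

text \<open>Free modules are projective: preimages of the values at the generators are chosen by
  exactness and extended equivariantly.\<close>

lemma lift:
  assumes w: "equivariant Z (X i) w" and c: "\<And>f. f \<in> carrier (FH Z) \<Longrightarrow> cyc i (w f)"
  shows "\<exists>v. equivariant Z (X (Suc i)) v \<and> (\<forall>f\<in>carrier (FH Z). d i (v f) = w f)"
proof -
  have "\<exists>q. q \<in> carrier (FH (X (Suc i))) \<and> d i q = w (basis_vec k (\<one>\<^bsub>H\<^esub>, x))" if "x \<in> Z" for x
    using c[of "basis_vec k (\<one>\<^bsub>H\<^esub>, x)"] that equivariant_closed[OF w, of "basis_vec k (\<one>\<^bsub>H\<^esub>, x)"]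
    by (auto simp: cyc_iff)
  then obtain q where q: "\<And>x. x \<in> Z \<Longrightarrow> q x \<in> carrier (FH (X (Suc i)))"
    "\<And>x. x \<in> Z \<Longrightarrow> d i (q x) = w (basis_vec k (\<one>\<^bsub>H\<^esub>, x))" by metis
  have e: "equivariant Z (X (Suc i)) (hext (X (Suc i)) q)" by (rule hext_equivariant[OF q(1)])
  have "d i (hext (X (Suc i)) q f) = w f" if "f \<in> carrier (FH Z)" for f
    by (rule equivariant_eqI[OF equivariant_comp[OF e d_equivariant] w _ that])
      (simp add: hext_basis q)
  with e show ?thesis by blast
qed

abbreviation cdiff :: "nat \<Rightarrow> ('x \<Rightarrow> 'k) \<Rightarrow> 'x \<Rightarrow> 'k" where
  "cdiff i \<equiv> coinv_map (X (Suc i)) (X i) (d i)"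

lemma coinv_complex: "chain_complex k (\<lambda>i. FX (X i)) cdiff"
proof -
  have "cdiff i (cdiff (Suc i) x) = (\<lambda>x. \<zero>\<^bsub>k\<^esub>)" if "x \<in> carrier (FX (X (Suc (Suc i))))" for i x
  proof -
    have u: "unit_sec (X (Suc (Suc i))) x \<in> carrier (FH (X (Suc (Suc i))))"
      by (rule unit_sec_closed[OF that])
    have "d i (d (Suc i) (unit_sec (X (Suc (Suc i))) x)) = (\<lambda>z. \<zero>\<^bsub>k\<^esub>)"
      using exact_Suc[OF d_closed[OF u]] u by blast
    then show ?thesis
      using coinv_map_comp[OF d_equivariant d_equivariant that]
        lin_map_zero[OF FH_lmod FX_lmod coinv_lin] by (simp add: coinv_map_def)
  qed
  then show ?thesis
    unfolding chain_complex_def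
    by (simp add: FX_module coinv_map_lin[OF d_equivariant])
qed

end

section \<open>Comparison maps between two resolutions\<close>

locale free_resolution_pair =
  P: free_resolution k H X d aug + Q: free_resolution k H Y d' aug'
  for k :: "('k, 'c) ring_scheme" and H :: "('h, 'd) monoid_scheme"
    and X :: "nat \<Rightarrow> 'x set" and d aug and Y :: "nat \<Rightarrow> 'y set" and d' aug'
begin

definition chain_map :: "(nat \<Rightarrow> ('h \<times> 'x \<Rightarrow> 'k) \<Rightarrow> 'h \<times> 'y \<Rightarrow> 'k) \<Rightarrow> bool" where
  "chain_map u \<longleftrightarrow> (\<forall>i. P.equivariant (X i) (Y i) (u i)) \<and>
     (\<forall>f\<in>carrier (P.FH (X 0)). aug' (u 0 f) = aug f) \<and>
     (\<forall>i. \<forall>f\<in>carrier (P.FH (X (Suc i))). d' i (u (Suc i) f) = u i (d i f))"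

text \<open>The comparison theorem. The components are chosen one after the other;
  \<open>good\<close> records what the next choice needs, namely that cycles go to cycles.\<close>

lemma chain_map_exists: "\<exists>u. chain_map u"
proof -
  define good where "good n u \<longleftrightarrow> P.equivariant (X n) (Y n) u \<and>
    (n = 0 \<longrightarrow> (\<forall>f\<in>carrier (P.FH (X 0)). aug' (u f) = aug f)) \<and>
    (\<forall>f\<in>carrier (P.FH (X n)). P.cyc n f \<longrightarrow> Q.cyc n (u f))" for n u
  have "\<exists>u. \<forall>n. good n (u n) \<and> (\<forall>f\<in>carrier (P.FH (X (Suc n))). d' n (u (Suc n) f) = u n (d n f))"
  proof (rule dependent_nat_choice)
    obtain q where q: "q \<in> carrier (P.FH (Y 0))" "aug' q = \<one>\<^bsub>k\<^esub>" using Q.aug_surj by blast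
    \<comment> \<open>As \<open>q\<close> has augmentation one, the multiple of \<open>q\<close> by
      the augmentation of a generator has the same augmentation as that generator.\<close>
    define v where "v x = aug (basis_vec k (\<one>\<^bsub>H\<^esub>, x)) \<odot>\<^bsub>P.FH (Y 0)\<^esub> q" for x
    have a: "x \<in> X 0 \<Longrightarrow> aug (basis_vec k (\<one>\<^bsub>H\<^esub>, x)) \<in> carrier k" for x
      using lin_map_closed[OF P.aug_lin, of "basis_vec k (\<one>\<^bsub>H\<^esub>, x)"] by simp
    have v: "x \<in> X 0 \<Longrightarrow> v x \<in> carrier (P.FH (Y 0))" for x
      using a q by (simp add: v_def)
    let ?u = "P.hext (Y 0) v"
    have e: "P.equivariant (X 0) (Y 0) ?u" by (rule P.hext_equivariant[OF v])
    have "aug' (?u f) = aug f" if "f \<in> carrier (P.FH (X 0))" for f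
    proof (rule P.k.lin_map_free_eqI[OF P.k.scalar_module_lmod
          lin_map_comp[OF P.equivariant_lin[OF e] Q.aug_lin] P.aug_lin _ that])
      fix z assume "z \<in> carrier H \<times> X 0"
      then obtain h x where z: "z = (h, x)" "h \<in> carrier H" "x \<in> X 0" by auto
      have "aug (basis_vec k z) = aug (basis_vec k (\<one>\<^bsub>H\<^esub>, x))"
        using z P.aug_hact[of h "basis_vec k (\<one>\<^bsub>H\<^esub>, x)"] by (simp add: P.hact_basis)
      moreover have "aug' (v x) = aug (basis_vec k (\<one>\<^bsub>H\<^esub>, x))"
        using lin_map_smult[OF Q.aug_lin a[OF z(3)] q(1)] q(2) a[OF z(3)] by (simp add: v_def)
      ultimately show "aug' (?u (basis_vec k z)) = aug (basis_vec k z)"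
        using z v by (simp add: P.hext_basis' Q.aug_hact)
    qed
    with e have "good 0 ?u" by (simp add: good_def P.cyc_def Q.cyc_def)
    then show "\<exists>u. good 0 u" by blast
  next
    fix u n assume u: "good n u"
    have e: "P.equivariant (X (Suc n)) (Y n) (\<lambda>f. u (d n f))"
      by (rule P.equivariant_comp[OF P.d_equivariant]) (use u in \<open>simp add: good_def\<close>)
    have "Q.cyc n (u (d n f))" if "f \<in> carrier (P.FH (X (Suc n)))" for f
      using u that P.cyc_d P.d_closed by (simp add: good_def)
    from Q.lift[OF e this] obtain v where v: "P.equivariant (X (Suc n)) (Y (Suc n)) v"
      "\<And>f. f \<in> carrier (P.FH (X (Suc n))) \<Longrightarrow> d' n (v f) = u (d n f)" by blast
    \<comment> \<open>For a cycle \<open>f\<close> the new component satisfies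
      \<open>d' n (v f) = u (d n f) = u 0\<close>, so the preservation of cycles comes down to
      \<open>u 0 = 0\<close>.\<close>
    have "u (\<lambda>z. \<zero>\<^bsub>k\<^esub>) = (\<lambda>z. \<zero>\<^bsub>k\<^esub>)"
      using lin_map_zero[OF P.FH_lmod P.FH_lmod, of "X n" "Y n" u] u
      by (simp add: good_def P.equivariant_lin)
    with v have "good (Suc n) v" by (simp add: good_def P.cyc_def Q.cyc_def)
    with v(2) show "\<exists>v. good (Suc n) v \<and> (\<forall>f\<in>carrier (P.FH (X (Suc n))). d' n (v f) = u (d n f))"
      by blast
  qed
  then show ?thesis unfolding chain_map_def good_def by metis
qed

end

section \<open>Homotopies between self-maps of a resolution\<close>

context free_resolution
begin

text \<open>The equation \<open>d s = w - s d\<close> is solved degree by degree: its right-hand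
  side consists of cycles, so \<open>lift\<close> applies.\<close>

lemma null_homotopy:
  assumes w: "\<And>i. equivariant (X i) (X i) (w i)"
    and w0: "\<And>f. f \<in> carrier (FH (X 0)) \<Longrightarrow> aug (w 0 f) = \<zero>\<^bsub>k\<^esub>"
    and wd: "\<And>i f. f \<in> carrier (FH (X (Suc i))) \<Longrightarrow> d i (w (Suc i) f) = w i (d i f)"
  shows "\<exists>s. (\<forall>i. equivariant (X i) (X (Suc i)) (s i)) \<and>
    (\<forall>f\<in>carrier (FH (X 0)). d 0 (s 0 f) = w 0 f) \<and>
    (\<forall>i. \<forall>f\<in>carrier (FH (X (Suc i))).
      d (Suc i) (s (Suc i) f) = w (Suc i) f \<ominus>\<^bsub>FH (X (Suc i))\<^esub> s i (d i f))"
proof -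
  \<comment> \<open>On a cycle the term \<open>s (d f)\<close> vanishes and the homotopy equation
    becomes \<open>d (s f) = w f\<close>. The next degree uses the equation only at boundaries, so
    this much suffices as an invariant; in degree 0 there is no such term and it holds
    everywhere.\<close>
  define good where "good n s \<longleftrightarrow> equivariant (X n) (X (Suc n)) s \<and>
    (\<forall>f\<in>carrier (FH (X n)). n = 0 \<or> cyc n f \<longrightarrow> d n (s f) = w n f)" for n s
  have "\<exists>s. \<forall>n. good n (s n) \<and> (\<forall>f\<in>carrier (FH (X (Suc n))).
      d (Suc n) (s (Suc n) f) = w (Suc n) f \<ominus>\<^bsub>FH (X (Suc n))\<^esub> s n (d n f))"
  proof (rule dependent_nat_choice)
    show "\<exists>s. good 0 s" using lift[OF w[of 0]] w0 unfolding good_def cyc_def by auto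
  next
    fix s n assume s: "good n s"
    let ?w = "\<lambda>f. w (Suc n) f \<ominus>\<^bsub>FH (X (Suc n))\<^esub> s (d n f)"
    have se: "equivariant (X n) (X (Suc n)) s" using s by (simp add: good_def)
    have e: "equivariant (X (Suc n)) (X (Suc n)) ?w"
      by (rule equivariant_diff[OF w equivariant_comp[OF d_equivariant se]])
    have "cyc (Suc n) (?w f)" if f: "f \<in> carrier (FH (X (Suc n)))" for f
    proof -
      have "d n (?w f) = w n (d n f) \<ominus>\<^bsub>FH (X n)\<^esub> d n (s (d n f))"
        using f wd[OF f] equivariant_closed[OF w] equivariant_closed[OF se] d_closed
        by (simp add: lin_map_minus[OF FH_lmod FH_lmod equivariant_lin[OF d_equivariant]])
      also have "d n (s (d n f)) = w n (d n f)"
        using s f cyc_d d_closed by (simp add: good_def)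
      also have "w n (d n f) \<ominus>\<^bsub>FH (X n)\<^esub> w n (d n f) = (\<lambda>z. \<zero>\<^bsub>k\<^esub>)"
        using equivariant_closed[OF w d_closed[OF f]]
          abelian_group.minus_eq_zero_iff[OF k.free_module_abelian_group, of "w n (d n f)"]
        by auto
      finally show ?thesis by (simp add: cyc_def)
    qed
    from lift[OF e this] obtain t where t: "equivariant (X (Suc n)) (X (Suc (Suc n))) t"
      "\<And>f. f \<in> carrier (FH (X (Suc n))) \<Longrightarrow> d (Suc n) (t f) = ?w f" by blast
    have "?w f = w (Suc n) f" if f: "f \<in> carrier (FH (X (Suc n)))" "cyc (Suc n) f" for f
    proof -
      have "s (d n f) = (\<lambda>z. \<zero>\<^bsub>k\<^esub>)"
        using f lin_map_zero[OF FH_lmod FH_lmod equivariant_lin[OF se]] by (simp add: cyc_def)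
      then show ?thesis
        using equivariant_closed[OF w f(1)] by (simp add: k.free_module_minus k.minus_eq)
    qed
    with t have "good (Suc n) t" by (simp add: good_def)
    with t(2) show "\<exists>t. good (Suc n) t \<and> (\<forall>f\<in>carrier (FH (X (Suc n))). d (Suc n) (t f) = ?w f)"
      by blast
  qed
  then show ?thesis unfolding good_def by metis
qed

text \<open>Since \<open>v\<close> lifts the identity, the difference \<open>v - id\<close> is null
  homotopic; \<open>b\<close> is the image of the homotopy in the coinvariants.\<close>

lemma coinv_endomorphism_homotopic_id:
  assumes v: "\<And>i. equivariant (X i) (X i) (v i)"
    and v0: "\<And>f. f \<in> carrier (FH (X 0)) \<Longrightarrow> aug (v 0 f) = aug f"
    and vd: "\<And>i f. f \<in> carrier (FH (X (Suc i))) \<Longrightarrow> d i (v (Suc i) f) = v i (d i f)"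
    and x: "x \<in> cycles (\<lambda>i. FX (X i)) cdiff i"
  shows "\<exists>b\<in>carrier (FX (X (Suc i))). coinv_map (X i) (X i) (v i) x = cdiff i b \<oplus>\<^bsub>FX (X i)\<^esub> x"
proof -
  define w where "w i f = v i f \<ominus>\<^bsub>FH (X i)\<^esub> f" for i f
  have w: "equivariant (X i) (X i) (w i)" for i
    unfolding w_def by (rule equivariant_diff[OF v equivariant_id])
  have "aug (w 0 f) = \<zero>\<^bsub>k\<^esub>" if "f \<in> carrier (FH (X 0))" for f
  proof -
    have "aug (w 0 f) = aug (v 0 f) \<ominus>\<^bsub>scalar_module k\<^esub> aug f"
      unfolding w_def using that equivariant_closed[OF v]
      by (simp add: lin_map_minus[OF FH_lmod k.scalar_module_lmod aug_lin])
    then show ?thesis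
      using that v0 lin_map_closed[OF aug_lin that] abelian_group.minus_eq_zero_iff[of "scalar_module k"]
        k.scalar_module_lmod by (auto simp: lmod_def)
  qed
  moreover have "d i (w (Suc i) f) = w i (d i f)" if f: "f \<in> carrier (FH (X (Suc i)))" for i f
    unfolding w_def using f equivariant_closed[OF v] vd
    by (simp add: lin_map_minus[OF FH_lmod FH_lmod equivariant_lin[OF d_equivariant]])
  ultimately obtain s where s: "\<And>i. equivariant (X i) (X (Suc i)) (s i)"
    and s0: "\<And>f. f \<in> carrier (FH (X 0)) \<Longrightarrow> d 0 (s 0 f) = w 0 f"
    and sd: "\<And>i f. f \<in> carrier (FH (X (Suc i))) \<Longrightarrow>
      d (Suc i) (s (Suc i) f) = w (Suc i) f \<ominus>\<^bsub>FH (X (Suc i))\<^esub> s i (d i f)"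
    using null_homotopy[of w] w by metis
  have xc: "x \<in> carrier (FX (X i))" using cycles_subset[OF coinv_complex] x by blast
  let ?u = "unit_sec (X i) x"
  have u: "?u \<in> carrier (FH (X i))" by (rule unit_sec_closed[OF xc])
  \<comment> \<open>The cycle \<open>x\<close> lives in the coinvariants, and its representative
    \<open>?u\<close> need not be a cycle upstairs. Hence the term \<open>s (d ?u)\<close>
    disappears only after \<open>coinv\<close>, where it is the induced map applied to
    \<open>cdiff j x\<close>, which is zero.\<close>
  have ds: "coinv (X i) (d i (s i ?u)) = coinv (X i) (w i ?u)"
  proof (cases i)
    case 0
    then show ?thesis using s0 u by simp
  next
    case (Suc j)
    have uj: "?u \<in> carrier (FH (X (Suc j)))" using u Suc by simp
    have "coinv (X (Suc j)) (s j (d j ?u)) = coinv_map (X j) (X (Suc j)) (s j) (cdiff j x)"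
      using coinv_map_comp[OF d_equivariant s, of x j] xc Suc by (simp add: coinv_map_def)
    also have "cdiff j x = (\<lambda>z. \<zero>\<^bsub>k\<^esub>)" using x Suc by simp
    also have "coinv_map (X j) (X (Suc j)) (s j) (\<lambda>z. \<zero>\<^bsub>k\<^esub>) = (\<lambda>z. \<zero>\<^bsub>k\<^esub>)"
      using lin_map_zero[OF FX_lmod FX_lmod coinv_map_lin[OF s]] by simp
    finally have z: "coinv (X (Suc j)) (s j (d j ?u)) = (\<lambda>z. \<zero>\<^bsub>k\<^esub>)" .
    have wc: "w (Suc j) ?u \<in> carrier (FH (X (Suc j)))" "s j (d j ?u) \<in> carrier (FH (X (Suc j)))"
      using equivariant_closed[OF w uj] equivariant_closed[OF s d_closed[OF uj]] .
    show ?thesis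
      using sd[OF uj] lin_map_minus[OF FH_lmod FX_lmod coinv_lin wc] z
        lin_map_closed[OF coinv_lin wc(1)] Suc
      by (simp add: k.free_module_minus k.minus_eq)
  qed
  define b where "b = coinv (X (Suc i)) (s i ?u)"
  have bc: "b \<in> carrier (FX (X (Suc i)))"
    unfolding b_def by (rule lin_map_closed[OF coinv_lin equivariant_closed[OF s u]])
  have "cdiff i b = coinv (X i) (w i ?u)"
    unfolding b_def coinv_map_def using coinv_equivariant[OF d_equivariant equivariant_closed[OF s u]] ds
    by simp
  also have "\<dots> = coinv (X i) (v i ?u) \<ominus>\<^bsub>FX (X i)\<^esub> x"
    unfolding w_def using lin_map_minus[OF FH_lmod FX_lmod coinv_lin equivariant_closed[OF v u] u]
      coinv_unit_sec[OF xc] by simp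
  finally have "cdiff i b \<oplus>\<^bsub>FX (X i)\<^esub> x = coinv_map (X i) (X i) (v i) x"
    using abelian_group.minus_add_cancel[OF k.free_module_abelian_group _ xc]
      lin_map_closed[OF coinv_map_lin[OF v] xc] by (simp add: coinv_map_def)
  with bc show ?thesis by metis
qed

end

context free_resolution_pair
begin

text \<open>Both composites of comparison maps lift the identity, so they are the identity up to
  boundaries. One of the two maps induces the isomorphism; the other one serves to prove that it is
  injective and surjective.\<close>

theorem coinv_homology_isomorphic:
  "mod_isomorphic k (homology (\<lambda>i. P.FX (X i)) P.cdiff i) (homology (\<lambda>i. P.FX (Y i)) Q.cdiff i)"
proof -
  interpret R: free_resolution_pair k H Y d' aug' X d aug ..
  obtain u where u: "chain_map u" using chain_map_exists by blast
  obtain v where v: "R.chain_map v" using R.chain_map_exists by blast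
  have ue: "P.equivariant (X i) (Y i) (u i)" and ua: "f \<in> carrier (P.FH (X 0)) \<Longrightarrow> aug' (u 0 f) = aug f"
    and ud: "f \<in> carrier (P.FH (X (Suc i))) \<Longrightarrow> d' i (u (Suc i) f) = u i (d i f)" for i f
    using u by (auto simp: chain_map_def)
  have ve: "P.equivariant (Y i) (X i) (v i)" and va: "g \<in> carrier (P.FH (Y 0)) \<Longrightarrow> aug (v 0 g) = aug' g"
    and vd: "g \<in> carrier (P.FH (Y (Suc i))) \<Longrightarrow> d i (v (Suc i) g) = v i (d' i g)" for i g
    using v by (auto simp: R.chain_map_def)
  let ?u = "\<lambda>i. P.coinv_map (X i) (Y i) (u i)" and ?v = "\<lambda>i. P.coinv_map (Y i) (X i) (v i)"
  have uc: "Q.cdiff i (?u (Suc i) x) = ?u i (P.cdiff i x)" if "x \<in> carrier (P.FX (X (Suc i)))" for i x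
    using that P.unit_sec_closed[OF that] unfolding P.coinv_map_comp[OF ue Q.d_equivariant that]
      P.coinv_map_comp[OF P.d_equivariant ue that] by (simp add: P.coinv_map_def ud)
  have vc: "P.cdiff i (?v (Suc i) y) = ?v i (Q.cdiff i y)" if "y \<in> carrier (P.FX (Y (Suc i)))" for i y
    using that P.unit_sec_closed[OF that] unfolding P.coinv_map_comp[OF ve P.d_equivariant that]
      P.coinv_map_comp[OF Q.d_equivariant ve that] by (simp add: P.coinv_map_def vd)
  have vu: "\<exists>b\<in>carrier (P.FX (X (Suc i))). ?v i (?u i x) = P.cdiff i b \<oplus>\<^bsub>P.FX (X i)\<^esub> x"
    if x: "x \<in> cycles (\<lambda>i. P.FX (X i)) P.cdiff i" for x
  proof -
    have "x \<in> carrier (P.FX (X i))" using x cycles_subset[OF P.coinv_complex] by blast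
    from P.coinv_map_comp[OF ue ve this] show ?thesis
      by (simp only:) (intro P.coinv_endomorphism_homotopic_id[of "\<lambda>i f. v i (u i f)"],
        simp_all add: P.equivariant_comp[OF ue ve] P.equivariant_closed[OF ue] va ua vd ud x)
  qed
  have uv: "\<exists>b\<in>carrier (P.FX (Y (Suc i))). ?u i (?v i x) = Q.cdiff i b \<oplus>\<^bsub>P.FX (Y i)\<^esub> x"
    if x: "x \<in> cycles (\<lambda>i. P.FX (Y i)) Q.cdiff i" for x
  proof -
    have "x \<in> carrier (P.FX (Y i))" using x cycles_subset[OF Q.coinv_complex] by blast
    from P.coinv_map_comp[OF ve ue this] show ?thesis
      by (simp only:) (intro Q.coinv_endomorphism_homotopic_id[of "\<lambda>i f. u i (v i f)"],
        simp_all add: P.equivariant_comp[OF ve ue] P.equivariant_closed[OF ve] va ua vd ud x)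
  qed
  show ?thesis
  proof (rule homology_mod_isomorphic[OF P.coinv_complex Q.coinv_complex, of ?u])
    show "lin_map k (P.FX (X i)) (P.FX (Y i)) (?u i)" for i by (rule P.coinv_map_lin[OF ue])
    show "x \<in> carrier (P.FX (X (Suc i))) \<Longrightarrow> Q.cdiff i (?u (Suc i) x) = ?u i (P.cdiff i x)" for i x
      by (rule uc)
  next
    fix x assume x: "x \<in> cycles (\<lambda>i. P.FX (X i)) P.cdiff i"
      and "?u i x \<in> Q.cdiff i ` carrier (P.FX (Y (Suc i)))"
    then obtain c where c: "c \<in> carrier (P.FX (Y (Suc i)))" "?u i x = Q.cdiff i c" by blast
    obtain b where b: "b \<in> carrier (P.FX (X (Suc i)))" "?v i (?u i x) = P.cdiff i b \<oplus>\<^bsub>P.FX (X i)\<^esub> x"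
      using vu[OF x] by blast
    have xc: "x \<in> carrier (P.FX (X i))" using x cycles_subset[OF P.coinv_complex] by blast
    have vcc: "?v (Suc i) c \<in> carrier (P.FX (X (Suc i)))" by (rule lin_map_closed[OF P.coinv_map_lin[OF ve] c(1)])
    have Db: "P.cdiff i b \<in> carrier (P.FX (X i))" by (rule lin_map_closed[OF P.coinv_map_lin[OF P.d_equivariant] b(1)])
    interpret F: abelian_group "P.FX (X i)" by (rule P.k.free_module_abelian_group)
    interpret F': abelian_group "P.FX (X (Suc i))" by (rule P.k.free_module_abelian_group)
    have "P.cdiff i (?v (Suc i) c) = P.cdiff i b \<oplus>\<^bsub>P.FX (X i)\<^esub> x" using vc[OF c(1)] b(2) c(2) by simp
    \<comment> \<open>If \<open>c\<close> has boundary \<open>u x\<close>, then \<open>v c\<close>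
      has boundary \<open>v (u x)\<close>, which exceeds \<open>x\<close> by the boundary of
      \<open>b\<close>; so \<open>v c - b\<close> has boundary \<open>x\<close>.\<close>
    then have "P.cdiff i (?v (Suc i) c \<ominus>\<^bsub>P.FX (X (Suc i))\<^esub> b) = (P.cdiff i b \<oplus>\<^bsub>P.FX (X i)\<^esub> x) \<ominus>\<^bsub>P.FX (X i)\<^esub> P.cdiff i b"
      using lin_map_minus[OF P.FX_lmod P.FX_lmod P.coinv_map_lin[OF P.d_equivariant] vcc b(1)] by simp
    also have "\<dots> = x"
      using xc Db unfolding a_minus_def by (metis F.a_comm F.a_inv_closed F.r_neg1 F.add.m_closed)
    finally show "x \<in> P.cdiff i ` carrier (P.FX (X (Suc i)))" using F'.minus_closed[OF vcc b(1)] by force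
  next
    fix y assume y: "y \<in> cycles (\<lambda>i. P.FX (Y i)) Q.cdiff i"
    obtain b where b: "b \<in> carrier (P.FX (Y (Suc i)))" "?u i (?v i y) = Q.cdiff i b \<oplus>\<^bsub>P.FX (Y i)\<^esub> y"
      using uv[OF y] by blast
    have yc: "y \<in> carrier (P.FX (Y i))" using y cycles_subset[OF Q.coinv_complex] by blast
    have Db: "Q.cdiff i b \<in> carrier (P.FX (Y i))" by (rule lin_map_closed[OF P.coinv_map_lin[OF Q.d_equivariant] b(1)])
    interpret F: abelian_group "P.FX (Y i)" by (rule P.k.free_module_abelian_group)
    interpret F': abelian_group "P.FX (Y (Suc i))" by (rule P.k.free_module_abelian_group)
    \<comment> \<open>The class of \<open>y\<close> is hit by the class of
      \<open>v y\<close>.\<close>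
    have "?v i y \<in> cycles (\<lambda>i. P.FX (X i)) P.cdiff i"
    proof (cases i)
      case 0
      then show ?thesis using yc lin_map_closed[OF P.coinv_map_lin[OF ve], of y i] by simp
    next
      case (Suc j)
      then show ?thesis using yc y vc[of y j] lin_map_closed[OF P.coinv_map_lin[OF ve], of y i]
          lin_map_zero[OF P.FX_lmod P.FX_lmod P.coinv_map_lin[OF ve], of j] by simp
    qed
    moreover have "y = Q.cdiff i (\<ominus>\<^bsub>P.FX (Y (Suc i))\<^esub> b) \<oplus>\<^bsub>P.FX (Y i)\<^esub> ?u i (?v i y)"
      using b(2) yc Db lin_map_neg[OF P.FX_lmod P.FX_lmod P.coinv_map_lin[OF Q.d_equivariant] b(1)] F.r_neg1
      by metis
    ultimately show "\<exists>x\<in>cycles (\<lambda>i. P.FX (X i)) P.cdiff i. \<exists>b\<in>carrier (P.FX (Y (Suc i))).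
        y = Q.cdiff i b \<oplus>\<^bsub>P.FX (Y i)\<^esub> ?u i x"
      using F'.a_inv_closed[OF b(1)] by blast
  qed
qed

end

section \<open>The bar resolution\<close>

lemma (in lmod) lin_map_scalar_smult:
  assumes "lin_map R N (scalar_module R) a" "v \<in> carrier M"
  shows "lin_map R N M (\<lambda>x. a x \<odot>\<^bsub>M\<^esub> v)"
  using lin_map_closed[OF assms(1)] lin_map_add[OF assms(1)] lin_map_smult[OF assms(1)] assms(2)
  by (intro lin_mapI) (auto simp: smult_l_distr smult_assoc1)

context kH
begin

definition bar_basis :: "nat \<Rightarrow> 'h list set" where
  "bar_basis i = {xs. length xs = i \<and> set xs \<subseteq> carrier H}"

text \<open>A pair \<open>(g, xs)\<close> stands for the generator \<open>xs\<close> with group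
  coefficient \<open>g\<close> on the left. Only the zeroth face touches the coefficient: it
  multiplies the first entry into it.\<close>

definition hface :: "nat \<Rightarrow> 'h \<times> 'h list \<Rightarrow> 'h \<times> 'h list" where
  "hface j = (\<lambda>(g, xs). if j = 0 then (g \<otimes>\<^bsub>H\<^esub> hd xs, tl xs) else (g, bar_face H j xs))"

definition bar_bound :: "nat \<Rightarrow> 'h \<times> 'h list \<Rightarrow> 'h \<times> 'h list \<Rightarrow> 'k" where
  "bar_bound i z = (\<Oplus>\<^bsub>FH (bar_basis i)\<^esub>j\<in>{..Suc i}.
     ((\<ominus>\<^bsub>k\<^esub> \<one>\<^bsub>k\<^esub>) [^]\<^bsub>k\<^esub> j) \<odot>\<^bsub>FH (bar_basis i)\<^esub> basis_vec k (hface j z))"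

definition bar_res :: "nat \<Rightarrow> ('h \<times> 'h list \<Rightarrow> 'k) \<Rightarrow> 'h \<times> 'h list \<Rightarrow> 'k" where
  "bar_res i = hext (bar_basis i) (\<lambda>xs. bar_bound i (\<one>\<^bsub>H\<^esub>, xs))"

definition bar_aug :: "('h \<times> 'h list \<Rightarrow> 'k) \<Rightarrow> 'k" where
  "bar_aug = lin_ext k (scalar_module k) (\<lambda>z. \<one>\<^bsub>k\<^esub>)"

text \<open>The classical contracting homotopy, which moves the group coefficient into the bar. It
  is linear over \<open>k\<close> only, and this is enough for exactness.\<close>

definition bar_homotopy :: "nat \<Rightarrow> ('h \<times> 'h list \<Rightarrow> 'k) \<Rightarrow> 'h \<times> 'h list \<Rightarrow> 'k" where
  "bar_homotopy i = lin_ext k (FH (bar_basis (Suc i))) (\<lambda>(g, xs). basis_vec k (\<one>\<^bsub>H\<^esub>, g # xs))"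

lemma bar_face_closed:
  assumes "xs \<in> bar_basis (Suc i)" "j \<le> Suc i"
  shows "bar_face H j xs \<in> bar_basis i"
proof -
  have l: "length xs = Suc i" "set xs \<subseteq> carrier H" using assms by (auto simp: bar_basis_def)
  show ?thesis
  proof (cases "j = 0 \<or> j = length xs")
    case True
    then show ?thesis using l
      by (auto simp: bar_face_def bar_basis_def dest: in_set_butlastD list.set_sel(2)[rotated])
  next
    case False
    then have j: "j - 1 < length xs" "j < length xs" using l assms by auto
    have "set (take (j - 1) xs) \<subseteq> carrier H" "set (drop (j + 1) xs) \<subseteq> carrier H"
      using l set_take_subset[of "j - 1" xs] set_drop_subset[of "j + 1" xs] by auto
    moreover have "xs ! (j - 1) \<in> carrier H" "xs ! j \<in> carrier H" using j l nth_mem by blast+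
    ultimately show ?thesis
      using j l False by (auto simp: bar_face_def bar_basis_def)
  qed
qed

lemma hface_closed:
  assumes "z \<in> carrier H \<times> bar_basis (Suc i)" "j \<le> Suc i"
  shows "hface j z \<in> carrier H \<times> bar_basis i"
proof -
  obtain g xs where z: "z = (g, xs)" "g \<in> carrier H" "xs \<in> bar_basis (Suc i)" using assms by auto
  then obtain x ys where "xs = x # ys" "x \<in> carrier H" "ys \<in> bar_basis i"
    by (cases xs) (auto simp: bar_basis_def)
  then show ?thesis using bar_face_closed[OF z(3) assms(2)] z by (auto simp: hface_def)
qed

lemma sign_closed [simp]: "(\<ominus>\<^bsub>k\<^esub> \<one>\<^bsub>k\<^esub>) [^]\<^bsub>k\<^esub> (j :: nat) \<in> carrier k" by simp

lemma bar_term_closed: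
  assumes "z \<in> carrier H \<times> bar_basis (Suc i)"
  shows "(\<lambda>j. ((\<ominus>\<^bsub>k\<^esub> \<one>\<^bsub>k\<^esub>) [^]\<^bsub>k\<^esub> j) \<odot>\<^bsub>FH (bar_basis i)\<^esub> basis_vec k (hface j z))
    \<in> {..Suc i} \<rightarrow> carrier (FH (bar_basis i))"
proof
  fix j assume "j \<in> {..Suc i}"
  then show "((\<ominus>\<^bsub>k\<^esub> \<one>\<^bsub>k\<^esub>) [^]\<^bsub>k\<^esub> j) \<odot>\<^bsub>FH (bar_basis i)\<^esub> basis_vec k (hface j z) \<in> carrier (FH (bar_basis i))"
    using lmod.smult_closed[OF FH_lmod sign_closed k.basis_vec_closed[OF hface_closed[OF assms]]] by simp
qed

lemma FH_abelian_group: "abelian_group (FH X)"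
  by (rule k.free_module_abelian_group)

lemma bar_bound_closed:
  assumes "z \<in> carrier H \<times> bar_basis (Suc i)"
  shows "bar_bound i z \<in> carrier (FH (bar_basis i))"
  unfolding bar_bound_def
  by (rule abelian_monoid.finsum_closed[OF abelian_group.axioms(1)[OF FH_abelian_group] bar_term_closed[OF assms]])

lemma lin_map_bar_bound:
  assumes F: "lin_map k (FH (bar_basis i)) N F" and N: "lmod k N"
    and z: "z \<in> carrier H \<times> bar_basis (Suc i)"
  shows "F (bar_bound i z) = (\<Oplus>\<^bsub>N\<^esub>j\<in>{..Suc i}. ((\<ominus>\<^bsub>k\<^esub> \<one>\<^bsub>k\<^esub>) [^]\<^bsub>k\<^esub> j) \<odot>\<^bsub>N\<^esub> F (basis_vec k (hface j z)))"
proof -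
  interpret N: lmod k N by fact
  have c: "j \<in> {..Suc i} \<Longrightarrow> basis_vec k (hface j z) \<in> carrier (FH (bar_basis i))" for j
    using hface_closed[OF z, of j] by simp
  have "F (bar_bound i z) = (\<Oplus>\<^bsub>N\<^esub>j\<in>{..Suc i}.
      F (((\<ominus>\<^bsub>k\<^esub> \<one>\<^bsub>k\<^esub>) [^]\<^bsub>k\<^esub> j) \<odot>\<^bsub>FH (bar_basis i)\<^esub> basis_vec k (hface j z)))"
    unfolding bar_bound_def by (rule lin_map_finsum[OF FH_lmod N F _ bar_term_closed[OF z]]) simp
  also have "\<dots> = (\<Oplus>\<^bsub>N\<^esub>j\<in>{..Suc i}. ((\<ominus>\<^bsub>k\<^esub> \<one>\<^bsub>k\<^esub>) [^]\<^bsub>k\<^esub> j) \<odot>\<^bsub>N\<^esub> F (basis_vec k (hface j z)))"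
    by (rule N.M.finsum_cong')
      (use lin_map_closed[OF F c] lin_map_smult[OF F sign_closed c] in \<open>auto simp del: free_module_simps\<close>)
  finally show ?thesis .
qed

lemma bar_res_equivariant: "equivariant (bar_basis (Suc i)) (bar_basis i) (bar_res i)"
  unfolding bar_res_def by (rule hext_equivariant[OF bar_bound_closed]) simp

lemma bar_res_basis:
  assumes z: "z \<in> carrier H \<times> bar_basis (Suc i)"
  shows "bar_res i (basis_vec k z) = bar_bound i z"
proof -
  obtain g xs where gx: "z = (g, xs)" "g \<in> carrier H" "xs \<in> bar_basis (Suc i)" using z by auto
  have one: "(\<one>\<^bsub>H\<^esub>, xs) \<in> carrier H \<times> bar_basis (Suc i)" using gx by simp
  have "hact g (basis_vec k (hface j (\<one>\<^bsub>H\<^esub>, xs))) = basis_vec k (hface j z)" if "j \<le> Suc i" for j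
  proof -
    obtain x ys where "xs = x # ys" "x \<in> carrier H"
      using gx by (cases xs) (auto simp: bar_basis_def)
    then show ?thesis using gx by (auto simp: hface_def hact_basis)
  qed
  then have "hact g (bar_bound i (\<one>\<^bsub>H\<^esub>, xs)) = bar_bound i z"
    unfolding lin_map_bar_bound[OF hact_lin[OF gx(2)] FH_lmod one]
    unfolding bar_bound_def using bar_term_closed[OF z]
    by (intro abelian_monoid.finsum_cong'[OF abelian_group.axioms(1)[OF FH_abelian_group]]) auto
  then show ?thesis unfolding bar_res_def gx(1)
    using gx(2) bar_bound_closed[OF one] by (simp add: hext_basis' gx)
qed

lemma bar_aug_lin: "lin_map k (FH X) (scalar_module k) bar_aug"
  unfolding bar_aug_def by (rule k.lin_ext_lin_map[OF k.scalar_module_lmod]) simp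

lemma bar_aug_basis: "bar_aug (basis_vec k z) = \<one>\<^bsub>k\<^esub>"
  unfolding bar_aug_def by (rule k.lin_ext_basis[OF k.scalar_module_lmod]) simp

lemma bar_homotopy_lin: "lin_map k (FH (bar_basis i)) (FH (bar_basis (Suc i))) (bar_homotopy i)"
  unfolding bar_homotopy_def by (rule k.lin_ext_lin_map[OF FH_lmod]) (auto simp: bar_basis_def)

lemma bar_homotopy_basis:
  "(g, xs) \<in> carrier H \<times> bar_basis i \<Longrightarrow> bar_homotopy i (basis_vec k (g, xs)) = basis_vec k (\<one>\<^bsub>H\<^esub>, g # xs)"
  unfolding bar_homotopy_def by (subst k.lin_ext_basis[OF FH_lmod]) (auto simp: bar_basis_def)

text \<open>The combinatorial content of the contraction: the faces of positive index of the
  lengthened word are the lengthened faces, while by \<open>hface_0_Cons\<close> the zeroth face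
  undoes the lengthening. The empty word has no faces, so degree 0 is treated apart.\<close>

lemma hface_Suc_Cons:
  assumes "xs \<noteq> []" "j \<le> length xs"
  shows "hface (Suc j) (\<one>\<^bsub>H\<^esub>, g # xs) = (\<one>\<^bsub>H\<^esub>, fst (hface j (g, xs)) # snd (hface j (g, xs)))"
  using assms by (cases xs; cases j) (auto simp: hface_def bar_face_def)

lemma hface_0_Cons: "g \<in> carrier H \<Longrightarrow> hface 0 (\<one>\<^bsub>H\<^esub>, g # xs) = (g, xs)"
  by (simp add: hface_def)

lemma bar_bound_Cons:
  assumes "g \<in> carrier H" "xs \<in> bar_basis i"
  shows "bar_bound i (\<one>\<^bsub>H\<^esub>, g # xs) =
    (\<Oplus>\<^bsub>FH (bar_basis i)\<^esub>j\<in>{..i}. ((\<ominus>\<^bsub>k\<^esub> \<one>\<^bsub>k\<^esub>) [^]\<^bsub>k\<^esub> Suc j) \<odot>\<^bsub>FH (bar_basis i)\<^esub>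
      basis_vec k (hface (Suc j) (\<one>\<^bsub>H\<^esub>, g # xs))) \<oplus>\<^bsub>FH (bar_basis i)\<^esub> basis_vec k (g, xs)"
proof -
  interpret F: abelian_group "FH (bar_basis i)" by (rule FH_abelian_group)
  have z: "(\<one>\<^bsub>H\<^esub>, g # xs) \<in> carrier H \<times> bar_basis (Suc i)" using assms by (auto simp: bar_basis_def)
  have b: "basis_vec k (g, xs) = \<one>\<^bsub>k\<^esub> \<odot>\<^bsub>FH (bar_basis i)\<^esub> basis_vec k (g, xs)"
    using lmod.smult_one[OF FH_lmod k.basis_vec_closed[of "(g, xs)" "carrier H \<times> bar_basis i"]] assms by simp
  show ?thesis
    unfolding bar_bound_def F.finsum_Suc2[OF bar_term_closed[OF z]]
    using b by (simp add: hface_0_Cons[OF assms(1)] del: free_module_simps k.nat_pow_Suc)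
qed

text \<open>The homotopy formula \<open>d s = id - s d\<close>: face 0 of the lengthened word gives
  the identity, and the other faces give the second term.\<close>

lemma bar_homotopy_Suc:
  assumes f: "f \<in> carrier (FH (bar_basis (Suc i)))"
  shows "bar_res (Suc i) (bar_homotopy (Suc i) f) =
    f \<ominus>\<^bsub>FH (bar_basis (Suc i))\<^esub> bar_homotopy i (bar_res i f)"
proof (rule k.lin_map_free_eqI[OF FH_lmod _ _ _ f])
  show "lin_map k (FH (bar_basis (Suc i))) (FH (bar_basis (Suc i)))
      (\<lambda>f. bar_res (Suc i) (bar_homotopy (Suc i) f))"
    by (rule lin_map_comp[OF bar_homotopy_lin equivariant_lin[OF bar_res_equivariant]])
  show "lin_map k (FH (bar_basis (Suc i))) (FH (bar_basis (Suc i)))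
      (\<lambda>f. f \<ominus>\<^bsub>FH (bar_basis (Suc i))\<^esub> bar_homotopy i (bar_res i f))"
    by (rule lin_map_diff[OF FH_lmod equivariant_lin[OF equivariant_id]
        lin_map_comp[OF equivariant_lin[OF bar_res_equivariant] bar_homotopy_lin]])
  fix z assume z: "z \<in> carrier H \<times> bar_basis (Suc i)"
  obtain g xs where gx: "z = (g, xs)" "g \<in> carrier H" "xs \<in> bar_basis (Suc i)" using z by auto
  have xs: "length xs = Suc i" "xs \<noteq> []" using gx by (auto simp: bar_basis_def)
  have z1: "(\<one>\<^bsub>H\<^esub>, g # xs) \<in> carrier H \<times> bar_basis (Suc (Suc i))" using gx by (auto simp: bar_basis_def)
  let ?M = "FH (bar_basis (Suc i))"
  interpret M: lmod k ?M by (rule FH_lmod)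
  let ?t = "\<lambda>j. ((\<ominus>\<^bsub>k\<^esub> \<one>\<^bsub>k\<^esub>) [^]\<^bsub>k\<^esub> j) \<odot>\<^bsub>?M\<^esub> basis_vec k (hface (Suc j) (\<one>\<^bsub>H\<^esub>, g # xs))"
  have bc: "basis_vec k (hface (Suc j) (\<one>\<^bsub>H\<^esub>, g # xs)) \<in> carrier ?M" if "j \<in> {..Suc i}" for j
    using hface_closed[OF z1, of "Suc j"] that by simp
  have tc: "?t \<in> {..Suc i} \<rightarrow> carrier ?M"
    using M.smult_closed[OF sign_closed bc] by blast
  have h: "bar_homotopy i (basis_vec k (hface j z)) = basis_vec k (hface (Suc j) (\<one>\<^bsub>H\<^esub>, g # xs))"
    if "j \<in> {..Suc i}" for j
    using hface_closed[OF z, of j] that gx xs bar_homotopy_basis[of "fst (hface j z)" "snd (hface j z)" i]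
    by (simp add: hface_Suc_Cons)
  have "bar_homotopy i (bar_res i (basis_vec k z)) = (\<Oplus>\<^bsub>?M\<^esub>j\<in>{..Suc i}. ?t j)"
    unfolding bar_res_basis[OF z] lin_map_bar_bound[OF bar_homotopy_lin FH_lmod z]
    by (rule M.M.finsum_cong') (use h tc in auto)
  \<comment> \<open>Lengthening shifts the face index by one, which reverses every sign; this is the
    minus in \<open>id - s d\<close>.\<close>
  moreover have "(\<Oplus>\<^bsub>?M\<^esub>j\<in>{..Suc i}. ((\<ominus>\<^bsub>k\<^esub> \<one>\<^bsub>k\<^esub>) [^]\<^bsub>k\<^esub> Suc j) \<odot>\<^bsub>?M\<^esub>
      basis_vec k (hface (Suc j) (\<one>\<^bsub>H\<^esub>, g # xs))) = (\<Oplus>\<^bsub>?M\<^esub>j\<in>{..Suc i}. (\<ominus>\<^bsub>k\<^esub> \<one>\<^bsub>k\<^esub>) \<odot>\<^bsub>?M\<^esub> ?t j)"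
  proof (rule M.M.finsum_cong')
    fix j assume j: "j \<in> {..Suc i}"
    have "(\<ominus>\<^bsub>k\<^esub> \<one>\<^bsub>k\<^esub>) [^]\<^bsub>k\<^esub> Suc j = (\<ominus>\<^bsub>k\<^esub> \<one>\<^bsub>k\<^esub>) \<otimes>\<^bsub>k\<^esub> (\<ominus>\<^bsub>k\<^esub> \<one>\<^bsub>k\<^esub>) [^]\<^bsub>k\<^esub> j"
      using k.m_comm[of "(\<ominus>\<^bsub>k\<^esub> \<one>\<^bsub>k\<^esub>) [^]\<^bsub>k\<^esub> j" "\<ominus>\<^bsub>k\<^esub> \<one>\<^bsub>k\<^esub>"] by simp
    then show "((\<ominus>\<^bsub>k\<^esub> \<one>\<^bsub>k\<^esub>) [^]\<^bsub>k\<^esub> Suc j) \<odot>\<^bsub>?M\<^esub> basis_vec k (hface (Suc j) (\<one>\<^bsub>H\<^esub>, g # xs)) = (\<ominus>\<^bsub>k\<^esub> \<one>\<^bsub>k\<^esub>) \<odot>\<^bsub>?M\<^esub> ?t j"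
      using M.smult_assoc1[OF _ sign_closed bc[OF j], of "\<ominus>\<^bsub>k\<^esub> \<one>\<^bsub>k\<^esub>"] by (simp del: k.nat_pow_Suc free_module_simps)
  qed (use tc M.smult_closed[of "\<ominus>\<^bsub>k\<^esub> \<one>\<^bsub>k\<^esub>"] in \<open>auto simp del: free_module_simps\<close>)
  moreover have "\<dots> = \<ominus>\<^bsub>?M\<^esub> (\<Oplus>\<^bsub>?M\<^esub>j\<in>{..Suc i}. ?t j)"
    using M.finsum_smult[of "{..Suc i}" "\<ominus>\<^bsub>k\<^esub> \<one>\<^bsub>k\<^esub>" ?t, OF _ _ tc] M.M.finsum_closed[OF tc]
      M.smult_l_minus[of "\<one>\<^bsub>k\<^esub>"] by (simp del: free_module_simps)
  ultimately show "bar_res (Suc i) (bar_homotopy (Suc i) (basis_vec k z)) =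
      basis_vec k z \<ominus>\<^bsub>?M\<^esub> bar_homotopy i (bar_res i (basis_vec k z))"
    using gx M.M.finsum_closed[OF tc] M.M.a_comm z
    by (simp add: bar_homotopy_basis bar_res_basis[OF z1] bar_bound_Cons a_minus_def
        del: free_module_simps k.nat_pow_Suc)
qed

text \<open>In degree 0 the lower homotopy is replaced by the map that sends the ground ring to
  multiples of the unit generator, so the formula reads \<open>d s f = f - aug f 1\<close>; here it
  is evaluated on the kernel of the augmentation.\<close>

lemma bar_homotopy_0:
  assumes f: "f \<in> carrier (FH (bar_basis 0))" and a: "bar_aug f = \<zero>\<^bsub>k\<^esub>"
  shows "bar_res 0 (bar_homotopy 0 f) = f"
proof -
  let ?M = "FH (bar_basis 0)"
  interpret M: lmod k ?M by (rule FH_lmod)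
  have one: "(\<one>\<^bsub>H\<^esub>, []) \<in> carrier H \<times> bar_basis 0" by (simp add: bar_basis_def)
  have r: "lin_map k ?M ?M (\<lambda>f. bar_aug f \<odot>\<^bsub>?M\<^esub> basis_vec k (\<one>\<^bsub>H\<^esub>, []))"
    by (rule M.lin_map_scalar_smult[OF bar_aug_lin k.basis_vec_closed[OF one]])
  have "bar_res 0 (bar_homotopy 0 f) = f \<ominus>\<^bsub>?M\<^esub> bar_aug f \<odot>\<^bsub>?M\<^esub> basis_vec k (\<one>\<^bsub>H\<^esub>, [])"
  proof (rule k.lin_map_free_eqI[OF FH_lmod _ _ _ f])
    show "lin_map k ?M ?M (\<lambda>f. bar_res 0 (bar_homotopy 0 f))"
      by (rule lin_map_comp[OF bar_homotopy_lin equivariant_lin[OF bar_res_equivariant]])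
    show "lin_map k ?M ?M (\<lambda>f. f \<ominus>\<^bsub>?M\<^esub> bar_aug f \<odot>\<^bsub>?M\<^esub> basis_vec k (\<one>\<^bsub>H\<^esub>, []))"
      by (rule lin_map_diff[OF FH_lmod equivariant_lin[OF equivariant_id] r])
    fix z assume z: "z \<in> carrier H \<times> bar_basis 0"
    then obtain g where g: "z = (g, [])" "g \<in> carrier H" by (auto simp: bar_basis_def)
    have z1: "(\<one>\<^bsub>H\<^esub>, [g]) \<in> carrier H \<times> bar_basis (Suc 0)" using g by (auto simp: bar_basis_def)
    have "hface (Suc 0) (\<one>\<^bsub>H\<^esub>, [g]) = (\<one>\<^bsub>H\<^esub>, [])" by (simp add: hface_def bar_face_def)
    then have "bar_res 0 (bar_homotopy 0 (basis_vec k z)) =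
        (\<ominus>\<^bsub>k\<^esub> \<one>\<^bsub>k\<^esub>) \<odot>\<^bsub>?M\<^esub> basis_vec k (\<one>\<^bsub>H\<^esub>, []) \<oplus>\<^bsub>?M\<^esub> basis_vec k z"
      using g z z1 k.basis_vec_closed[OF one] M.M.finsum_insert[of "{}" 0] M.smult_closed[OF _ k.basis_vec_closed[OF one]]
      by (simp add: bar_homotopy_basis bar_res_basis bar_bound_Cons del: free_module_simps)
    then show "bar_res 0 (bar_homotopy 0 (basis_vec k z)) =
        basis_vec k z \<ominus>\<^bsub>?M\<^esub> bar_aug (basis_vec k z) \<odot>\<^bsub>?M\<^esub> basis_vec k (\<one>\<^bsub>H\<^esub>, [])"
      using z k.basis_vec_closed[OF one]
      by (simp add: bar_aug_basis a_minus_def M.smult_l_minus M.M.a_comm del: free_module_simps)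
  qed
  also have "\<dots> = f" using f a M.smult_l_null[OF k.basis_vec_closed[OF one]] by (simp add: a_minus_def del: free_module_simps)
  finally show ?thesis .
qed

lemma bar_aug_res: "f \<in> carrier (FH (bar_basis (Suc 0))) \<Longrightarrow> bar_aug (bar_res 0 f) = \<zero>\<^bsub>k\<^esub>"
proof (rule k.lin_map_free_eqI[OF k.scalar_module_lmod
      lin_map_comp[OF equivariant_lin[OF bar_res_equivariant] bar_aug_lin]])
  interpret N: lmod k "scalar_module k" by (rule k.scalar_module_lmod)
  show "lin_map k (FH (bar_basis (Suc 0))) (scalar_module k) (\<lambda>x. \<zero>\<^bsub>k\<^esub>)" by (rule lin_mapI) auto
  fix z assume z: "z \<in> carrier H \<times> bar_basis (Suc 0)"
  have "bar_aug (bar_res 0 (basis_vec k z)) = (\<Oplus>\<^bsub>scalar_module k\<^esub>j\<in>{..Suc 0}. (\<ominus>\<^bsub>k\<^esub> \<one>\<^bsub>k\<^esub>) [^]\<^bsub>k\<^esub> j)"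
    using z by (simp add: bar_res_basis lin_map_bar_bound[OF bar_aug_lin k.scalar_module_lmod] bar_aug_basis
        cong: N.M.finsum_cong)
  also have "\<dots> = \<zero>\<^bsub>k\<^esub>"
    using N.M.finsum_Suc[of "\<lambda>j. (\<ominus>\<^bsub>k\<^esub> \<one>\<^bsub>k\<^esub>) [^]\<^bsub>k\<^esub> j" 0] N.M.finsum_0[of "\<lambda>j. (\<ominus>\<^bsub>k\<^esub> \<one>\<^bsub>k\<^esub>) [^]\<^bsub>k\<^esub> j"]
    by (simp add: k.l_neg)
  finally show "bar_aug (bar_res 0 (basis_vec k z)) = \<zero>\<^bsub>k\<^esub>" .
qed

lemma zero_equivariant: "equivariant X Y (\<lambda>f z. \<zero>\<^bsub>k\<^esub>)"
  unfolding equivariant_def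
  by (intro conjI ballI lin_mapI) (auto simp: hact_def fun_eq_iff)

text \<open>This avoids the simplicial identities. A generator \<open>x # xs\<close> with unit
  coefficient is \<open>s b\<close> for the basis vector \<open>b\<close> at \<open>(x, xs)\<close>,
  so \<open>d s = id - s d\<close> gives \<open>d d s b = d b - d s d b\<close>. It remains to see
  \<open>d s d = d\<close>, which follows from the same formula and \<open>d d = 0\<close> one
  degree lower; in degree 0 it follows from \<open>bar_homotopy_0\<close>.\<close>

lemma bar_res_res:
  "f \<in> carrier (FH (bar_basis (Suc (Suc i)))) \<Longrightarrow> bar_res i (bar_res (Suc i) f) = (\<lambda>z. \<zero>\<^bsub>k\<^esub>)"
proof (induct i arbitrary: f)
  have key: "bar_res i (bar_res (Suc i) f) = (\<lambda>z. \<zero>\<^bsub>k\<^esub>)"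
    if s: "\<And>f. f \<in> carrier (FH (bar_basis (Suc i))) \<Longrightarrow> bar_res i (bar_homotopy i (bar_res i f)) = bar_res i f"
      and f: "f \<in> carrier (FH (bar_basis (Suc (Suc i))))" for i f
  proof (rule equivariant_eqI[OF equivariant_comp[OF bar_res_equivariant bar_res_equivariant] zero_equivariant _ f])
    fix ys assume "ys \<in> bar_basis (Suc (Suc i))"
    then obtain x xs where ys: "ys = x # xs" "(x, xs) \<in> carrier H \<times> bar_basis (Suc i)"
      by (cases ys) (auto simp: bar_basis_def)
    let ?b = "basis_vec k (x, xs)"
    have b: "?b \<in> carrier (FH (bar_basis (Suc i)))" using ys by simp
    have "bar_res i (bar_res (Suc i) (basis_vec k (\<one>\<^bsub>H\<^esub>, ys))) =
        bar_res i (?b \<ominus>\<^bsub>FH (bar_basis (Suc i))\<^esub> bar_homotopy i (bar_res i ?b))"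
      using bar_homotopy_Suc[OF b] bar_homotopy_basis[OF ys(2)] ys(1) by simp
    also have "\<dots> = bar_res i ?b \<ominus>\<^bsub>FH (bar_basis i)\<^esub> bar_res i ?b"
      using lin_map_minus[OF FH_lmod FH_lmod equivariant_lin[OF bar_res_equivariant] b
          lin_map_closed[OF bar_homotopy_lin equivariant_closed[OF bar_res_equivariant b]]] s[OF b] by simp
    also have "\<dots> = (\<lambda>z. \<zero>\<^bsub>k\<^esub>)"
      using equivariant_closed[OF bar_res_equivariant b] k.free_module_value[OF equivariant_closed[OF bar_res_equivariant b]]
      by (simp add: k.free_module_minus k.minus_eq k.r_neg)
    finally show "bar_res i (bar_res (Suc i) (basis_vec k (\<one>\<^bsub>H\<^esub>, ys))) = (\<lambda>z. \<zero>\<^bsub>k\<^esub>)" .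
  qed
  {
    case 0
    then show ?case
      by (intro key) (simp_all add: bar_homotopy_0 bar_aug_res equivariant_closed[OF bar_res_equivariant])
  next
    case (Suc i)
    have "bar_res (Suc i) (bar_homotopy (Suc i) (bar_res (Suc i) g)) = bar_res (Suc i) g"
      if g: "g \<in> carrier (FH (bar_basis (Suc (Suc i))))" for g
    proof -
      have r: "bar_res (Suc i) g \<in> carrier (FH (bar_basis (Suc i)))"
        by (rule equivariant_closed[OF bar_res_equivariant g])
      have "bar_homotopy i (bar_res i (bar_res (Suc i) g)) = (\<lambda>z. \<zero>\<^bsub>k\<^esub>)"
        using Suc(1)[OF g] lin_map_zero[OF FH_lmod FH_lmod bar_homotopy_lin[of i]] by simp
      then show ?thesis using bar_homotopy_Suc[OF r] r by (simp add: k.free_module_minus k.minus_eq)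
    qed
    from key[OF this Suc(2)] show ?case .
  }
qed

lemma bar_resolution: "free_resolution k H bar_basis bar_res bar_aug"
proof
  show "equivariant (bar_basis (Suc i)) (bar_basis i) (bar_res i)" for i by (rule bar_res_equivariant)
  show "lin_map k (FH (bar_basis 0)) (scalar_module k) bar_aug" by (rule bar_aug_lin)
  show "bar_aug (hact h f) = bar_aug f" if "h \<in> carrier H" "f \<in> carrier (FH (bar_basis 0))" for h f
    by (rule k.lin_map_free_eqI[OF k.scalar_module_lmod lin_map_comp[OF hact_lin bar_aug_lin] bar_aug_lin])
      (use that in \<open>auto simp: hact_basis bar_aug_basis\<close>)
  show "\<exists>u\<in>carrier (FH (bar_basis 0)). bar_aug u = \<one>\<^bsub>k\<^esub>"
    by (rule bexI[of _ "basis_vec k (\<one>\<^bsub>H\<^esub>, [])"]) (auto simp: bar_aug_basis bar_basis_def)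
next
  fix f assume f: "f \<in> carrier (FH (bar_basis 0))"
  show "bar_aug f = \<zero>\<^bsub>k\<^esub> \<longleftrightarrow> f \<in> bar_res 0 ` carrier (FH (bar_basis (Suc 0)))"
    using bar_homotopy_0[OF f] lin_map_closed[OF bar_homotopy_lin f] bar_aug_res
    by (auto intro: rev_image_eqI)
next
  fix f i assume f: "f \<in> carrier (FH (bar_basis (Suc i)))"
  have "bar_res (Suc i) (bar_homotopy (Suc i) f) = f" if "bar_res i f = (\<lambda>z. \<zero>\<^bsub>k\<^esub>)"
    using bar_homotopy_Suc[OF f] that lin_map_zero[OF FH_lmod FH_lmod bar_homotopy_lin[of i]] f
    by (simp add: k.free_module_minus k.minus_eq)
  then show "bar_res i f = (\<lambda>z. \<zero>\<^bsub>k\<^esub>) \<longleftrightarrow> f \<in> bar_res (Suc i) ` carrier (FH (bar_basis (Suc (Suc i))))"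
    using lin_map_closed[OF bar_homotopy_lin f] bar_res_res by (auto intro: rev_image_eqI)
qed

lemma bar_chains_eq: "bar_chains k H i = FX (bar_basis i)"
  by (simp add: bar_chains_def bar_basis_def)

text \<open>Coinvariants forget the group coefficient, and that is the only point in which
  \<open>hface\<close> differs from \<open>bar_face\<close>.\<close>

lemma bar_diff_eq:
  assumes g: "g \<in> carrier (FX (bar_basis (Suc i)))"
  shows "bar_diff k H i g = coinv_map (bar_basis (Suc i)) (bar_basis i) (bar_res i) g"
proof -
  interpret M: lmod k "FX (bar_basis i)" by (rule FX_lmod)
  let ?v = "\<lambda>xs. \<Oplus>\<^bsub>FX (bar_basis i)\<^esub>j\<in>{..Suc i}.
       ((\<ominus>\<^bsub>k\<^esub> \<one>\<^bsub>k\<^esub>) [^]\<^bsub>k\<^esub> j) \<odot>\<^bsub>FX (bar_basis i)\<^esub> basis_vec k (bar_face H j xs)"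
  have v: "coinv (bar_basis i) (bar_bound i (\<one>\<^bsub>H\<^esub>, xs)) = ?v xs" if xs: "xs \<in> bar_basis (Suc i)" for xs
  proof -
    have one: "(\<one>\<^bsub>H\<^esub>, xs) \<in> carrier H \<times> bar_basis (Suc i)" using xs by simp
    have "coinv (bar_basis i) (basis_vec k (hface j (\<one>\<^bsub>H\<^esub>, xs))) = basis_vec k (bar_face H j xs)"
      if "j \<in> {..Suc i}" for j
      using coinv_basis[of "snd (hface j (\<one>\<^bsub>H\<^esub>, xs))" "bar_basis i" "fst (hface j (\<one>\<^bsub>H\<^esub>, xs))"]
        hface_closed[OF one, of j] that by (auto simp: hface_def bar_face_def split: if_splits)
    then show ?thesis
      unfolding lin_map_bar_bound[OF coinv_lin FX_lmod one]
      using M.smult_closed[OF sign_closed k.basis_vec_closed[OF bar_face_closed[OF xs]]]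
      by (intro M.M.finsum_cong') auto
  qed
  have vc: "?v xs \<in> carrier (FX (bar_basis i))" if xs: "xs \<in> bar_basis (Suc i)" for xs
    using M.smult_closed[OF sign_closed k.basis_vec_closed[OF bar_face_closed[OF xs]]]
    by (intro M.M.finsum_closed) auto
  have "lin_ext k (FX (bar_basis i)) ?v g = coinv_map (bar_basis (Suc i)) (bar_basis i) (bar_res i) g"
  proof (rule k.lin_map_free_eqI[OF FX_lmod k.lin_ext_lin_map[OF FX_lmod vc]
        coinv_map_lin[OF bar_res_equivariant] _ g])
    fix xs assume xs: "xs \<in> bar_basis (Suc i)"
    have "lin_ext k (FX (bar_basis i)) ?v (basis_vec k xs) = ?v xs"
      by (rule k.lin_ext_basis[OF FX_lmod, of ?v, OF vc[OF xs]])
    then show "lin_ext k (FX (bar_basis i)) ?v (basis_vec k xs) =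
        coinv_map (bar_basis (Suc i)) (bar_basis i) (bar_res i) (basis_vec k xs)"
      using xs v by (simp add: coinv_map_def unit_sec_basis bar_res_basis del: free_module_simps)
  qed
  then show ?thesis
    by (simp add: bar_diff_def bar_chains_eq Let_def atLeast0AtMost del: free_module_simps)
qed

lemma group_homology_eq:
  "group_homology k H i =
    homology (\<lambda>i. FX (bar_basis i)) (\<lambda>i. coinv_map (bar_basis (Suc i)) (bar_basis i) (bar_res i)) i"
  unfolding group_homology_def bar_chains_eq
  by (rule homology_cong[OF bar_diff_eq])

end

section \<open>Twisted monoid algebras\<close>

text \<open>For support conditions, which pass to sums term by term.\<close>

lemma (in abelian_monoid) finsum_induct_closed:
  assumes "finite S" "P \<zero>" "\<And>x y. \<lbrakk>x \<in> carrier G; y \<in> carrier G; P x; P y\<rbrakk> \<Longrightarrow> P (x \<oplus> y)"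
    and "\<And>i. i \<in> S \<Longrightarrow> g i \<in> carrier G \<and> P (g i)"
  shows "P (\<Oplus>i\<in>S. g i)"
  using assms(1,4)
proof (induct set: finite)
  case (insert a S)
  then show ?case using assms(3)[of "g a" "finsum G g S"] by (auto simp: finsum_insert Pi_def)
qed (simp add: assms(2))

lemma lin_map_id: "lin_map R M M (\<lambda>x. x)"
  by (simp add: lin_map_def)

context ring
begin

text \<open>A function is recovered from its graph on the support, and finiteness of the support
  makes \<open>Abs_fset\<close> faithful on such graphs.\<close>

lemma gen_of_fun_inj: "inj_on (gen_of_fun R) (carrier (free_module R X))"
proof (rule inj_onI)
  fix f g assume f: "f \<in> carrier (free_module R X)" and g: "g \<in> carrier (free_module R X)"
    and eq: "gen_of_fun R f = gen_of_fun R g"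
  have fin: "finite {(x, f x) | x. f x \<noteq> \<zero>}" if "f \<in> carrier (free_module R X)" for f
  proof -
    have "{(x, f x) | x. f x \<noteq> \<zero>} = (\<lambda>x. (x, f x)) ` {x. f x \<noteq> \<zero>}" by auto
    then show ?thesis using free_module_finite[OF that] by simp
  qed
  have "{(x, f x) | x. f x \<noteq> \<zero>} = {(x, g x) | x. g x \<noteq> \<zero>}"
    using eq fin[OF f] fin[OF g] by (simp add: gen_of_fun_def Abs_fset_inject)
  then have "f x \<noteq> \<zero> \<Longrightarrow> f x = g x" "g x \<noteq> \<zero> \<Longrightarrow> f x = g x" for x by blast+
  then show "f = g" by (intro ext) metis
qed

lemma res_diff_lin:
  assumes "Y \<subseteq> gen_of_fun R ` carrier (free_module R X)"
  shows "lin_map R (free_module R Y) (free_module R X) (res_diff R X)"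
  unfolding res_diff_def
  by (rule lin_ext_lin_map[OF free_module_lmod]) (use assms in \<open>auto intro: inv_into_into\<close>)

lemma res_diff_basis:
  "f \<in> carrier (free_module R X) \<Longrightarrow> res_diff R X (basis_vec R (gen_of_fun R f)) = f"
  unfolding res_diff_def
  by (subst lin_ext_basis[OF free_module_lmod]) (simp_all add: inv_into_f_f[OF gen_of_fun_inj])

text \<open>The canonical resolution is exact by construction: an element of the kernel of
  \<open>L\<close> names a generator of the next module, and that generator is sent to it. A general
  \<open>L\<close> covers both the augmentation and the differentials.\<close>

lemma res_diff_exact:
  assumes L: "lin_map R (free_module R X) Z L" and Z: "lmod R Z"
    and Y: "Y = gen_of_fun R ` {f \<in> carrier (free_module R X). L f = \<zero>\<^bsub>Z\<^esub>}"
    and f: "f \<in> carrier (free_module R X)"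
  shows "L f = \<zero>\<^bsub>Z\<^esub> \<longleftrightarrow> f \<in> res_diff R X ` carrier (free_module R Y)"
proof
  assume "L f = \<zero>\<^bsub>Z\<^esub>"
  then have "gen_of_fun R f \<in> Y" using f Y by blast
  then show "f \<in> res_diff R X ` carrier (free_module R Y)"
    using res_diff_basis[OF f] by (metis basis_vec_closed imageI)
next
  interpret Z: lmod R Z by fact
  assume "f \<in> res_diff R X ` carrier (free_module R Y)"
  then obtain g where g: "g \<in> carrier (free_module R Y)" "f = res_diff R X g" by blast
  have l: "lin_map R (free_module R Y) (free_module R X) (res_diff R X)"
    by (rule res_diff_lin) (use Y in auto)
  have "L (res_diff R X g) = \<zero>\<^bsub>Z\<^esub>"
  proof (rule lin_map_free_eqI[OF Z lin_map_comp[OF l L] _ _ g(1)])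
    show "lin_map R (free_module R Y) Z (\<lambda>x. \<zero>\<^bsub>Z\<^esub>)" by (rule lin_mapI) auto
  qed (use Y in \<open>auto simp: res_diff_basis\<close>)
  then show "L f = \<zero>\<^bsub>Z\<^esub>" using g by simp
qed

end

text \<open>For the Brauer algebra, \<open>mu\<close> composes diagrams, \<open>c\<close> collects
  the loop factors, \<open>rk\<close> counts the left links and \<open>lam\<close> is the set of
  labelled left links. The scalars form a cocycle but need not be units. Multiplying on the right
  keeps all left links and may add some, whence \<open>lam_mu\<close>. The list in
  \<open>fixers\<close> does two things at once: it acts as the identity on all elements labelled
  like \<open>x\<close>, and it raises every element to rank at least \<open>rk x\<close>. The
  descending induction on the rank starts above \<open>bound\<close>.\<close>

locale twisted_algebra = kH k H for k :: "('k, 'c) ring_scheme" and H :: "('h, 'd) monoid_scheme" +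
  fixes M :: "'x set" and mu :: "'x \<Rightarrow> 'x \<Rightarrow> 'x" and c :: "'x \<Rightarrow> 'x \<Rightarrow> 'k" and e :: 'x
    and U :: "'x \<Rightarrow> bool" and phi :: "'h \<Rightarrow> 'x" and rk :: "'x \<Rightarrow> nat" and lam :: "'x \<Rightarrow> 'l" and bound :: nat
  assumes mu_closed [simp]: "\<lbrakk>x \<in> M; y \<in> M\<rbrakk> \<Longrightarrow> mu x y \<in> M"
    and mu_assoc: "\<lbrakk>x \<in> M; y \<in> M; z \<in> M\<rbrakk> \<Longrightarrow> mu (mu x y) z = mu x (mu y z)"
    and e_closed [simp]: "e \<in> M"
    and e_left [simp]: "x \<in> M \<Longrightarrow> mu e x = x" and e_right [simp]: "x \<in> M \<Longrightarrow> mu x e = x"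
    and c_closed [simp]: "\<lbrakk>x \<in> M; y \<in> M\<rbrakk> \<Longrightarrow> c x y \<in> carrier k"
    and c_e_left [simp]: "x \<in> M \<Longrightarrow> c e x = \<one>\<^bsub>k\<^esub>" and c_e_right [simp]: "x \<in> M \<Longrightarrow> c x e = \<one>\<^bsub>k\<^esub>"
    and cocycle: "\<lbrakk>x \<in> M; y \<in> M; z \<in> M\<rbrakk> \<Longrightarrow> c x y \<otimes>\<^bsub>k\<^esub> c (mu x y) z = c y z \<otimes>\<^bsub>k\<^esub> c x (mu y z)"
    and U_iff: "x \<in> M \<Longrightarrow> U x \<longleftrightarrow> rk x = 0"
    and phi_bij: "bij_betw phi (carrier H) {x \<in> M. rk x = 0}"
    and phi_mult: "\<lbrakk>g \<in> carrier H; h \<in> carrier H\<rbrakk> \<Longrightarrow> phi (g \<otimes>\<^bsub>H\<^esub> h) = mu (phi g) (phi h)"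
    and phi_one: "phi \<one>\<^bsub>H\<^esub> = e"
    and c_unit: "\<lbrakk>x \<in> M; y \<in> M; rk x = 0; rk y = 0\<rbrakk> \<Longrightarrow> c x y = \<one>\<^bsub>k\<^esub>"
    and rk_left: "\<lbrakk>x \<in> M; y \<in> M\<rbrakk> \<Longrightarrow> rk x \<le> rk (mu x y)"
    and rk_right: "\<lbrakk>x \<in> M; y \<in> M\<rbrakk> \<Longrightarrow> rk y \<le> rk (mu x y)"
    and rk_bound: "x \<in> M \<Longrightarrow> rk x \<le> bound"
    and lam_mu: "\<lbrakk>x \<in> M; y \<in> M\<rbrakk> \<Longrightarrow> lam (mu x y) = lam x \<or> rk x < rk (mu x y)"
    and lam_rk: "\<lbrakk>x \<in> M; y \<in> M; lam x = lam y\<rbrakk> \<Longrightarrow> rk x = rk y"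
    and fixers: "\<lbrakk>x \<in> M; rk x > 0\<rbrakk> \<Longrightarrow> \<exists>es. set es \<subseteq> M \<and>
      (\<forall>y\<in>M. lam y = lam x \<longrightarrow> (\<forall>d\<in>set es. mu d y = y \<and> c d y = \<one>\<^bsub>k\<^esub>)) \<and>
      (\<forall>y\<in>M. rk x \<le> rk (foldr mu es y))"
begin

definition A where
  "A = based_algebra k M (\<lambda>x y. c x y \<odot>\<^bsub>FX M\<^esub> basis_vec k (mu x y)) e"

abbreviation "b \<equiv> basis_vec k"

definition lmul :: "'x \<Rightarrow> ('x \<Rightarrow> 'k) \<Rightarrow> 'x \<Rightarrow> 'k" where
  "lmul x = lin_ext k (FX M) (\<lambda>y. c x y \<odot>\<^bsub>FX M\<^esub> b (mu x y))"

lemma A_simps [simp]: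
  "carrier A = carrier (FX M)" "add A = add (FX M)" "zero A = (\<lambda>x. \<zero>\<^bsub>k\<^esub>)"
  "one A = b e" "smult A = smult (FX M)"
  by (simp_all add: A_def based_algebra_def Let_def)

lemma A_mult: "f \<otimes>\<^bsub>A\<^esub> g = lin_ext k (FX M) (\<lambda>x. lmul x g) f"
  by (simp add: A_def based_algebra_def Let_def lmul_def del: free_module_simps)

lemma cb_closed: "x \<in> M \<Longrightarrow> y \<in> M \<Longrightarrow> c x y \<odot>\<^bsub>FX M\<^esub> b (mu x y) \<in> carrier (FX M)"
  using lmod.smult_closed[OF FX_lmod] by (metis c_closed k.basis_vec_closed mu_closed)

lemma lmul_lin: "x \<in> M \<Longrightarrow> lin_map k (FX M) (FX M) (lmul x)"
  unfolding lmul_def by (rule k.lin_ext_lin_map[OF FX_lmod cb_closed])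

lemma lmul_closed: "x \<in> M \<Longrightarrow> g \<in> carrier (FX M) \<Longrightarrow> lmul x g \<in> carrier (FX M)"
  by (rule lin_map_closed[OF lmul_lin])

lemma lmul_basis: "x \<in> M \<Longrightarrow> y \<in> M \<Longrightarrow> lmul x (b y) = c x y \<odot>\<^bsub>FX M\<^esub> b (mu x y)"
  unfolding lmul_def
  by (rule k.lin_ext_basis[OF FX_lmod, of "\<lambda>y. c x y \<odot>\<^bsub>FX M\<^esub> b (mu x y)" y M, OF cb_closed])

lemma A_mult_lin_left: "g \<in> carrier (FX M) \<Longrightarrow> lin_map k (FX M) (FX M) (\<lambda>f. f \<otimes>\<^bsub>A\<^esub> g)"
  unfolding A_mult by (rule k.lin_ext_lin_map[OF FX_lmod lmul_closed])

lemma A_mult_lin_right: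
  assumes f: "f \<in> carrier (FX M)"
  shows "lin_map k (FX M) (FX M) (\<lambda>g. f \<otimes>\<^bsub>A\<^esub> g)"
  unfolding A_mult lin_ext_def
  by (rule lin_map_finsum_maps[OF FX_lmod free_module_finite[OF f]
      lin_map_const_smult[OF k.is_cring FX_lmod lmul_lin]])
    (use f free_module_support[OF f] in auto)

lemma A_mult_closed: "f \<in> carrier (FX M) \<Longrightarrow> g \<in> carrier (FX M) \<Longrightarrow> f \<otimes>\<^bsub>A\<^esub> g \<in> carrier (FX M)"
  by (rule lin_map_closed[OF A_mult_lin_right])

lemma basis_mult: "x \<in> M \<Longrightarrow> g \<in> carrier (FX M) \<Longrightarrow> b x \<otimes>\<^bsub>A\<^esub> g = lmul x g"
  unfolding A_mult by (rule k.lin_ext_basis[OF FX_lmod, of "\<lambda>x. lmul x g" x M, OF lmul_closed])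

lemma basis_mult_basis: "x \<in> M \<Longrightarrow> y \<in> M \<Longrightarrow> b x \<otimes>\<^bsub>A\<^esub> b y = c x y \<odot>\<^bsub>FX M\<^esub> b (mu x y)"
  by (simp add: basis_mult lmul_basis del: free_module_simps)

text \<open>On basis vectors associativity splits into \<open>mu_assoc\<close> for the elements and
  \<open>cocycle\<close> for the scalars.\<close>

lemma basis_assoc:
  assumes x: "x \<in> M" and y: "y \<in> M" and z: "z \<in> M"
  shows "(b x \<otimes>\<^bsub>A\<^esub> b y) \<otimes>\<^bsub>A\<^esub> b z = b x \<otimes>\<^bsub>A\<^esub> (b y \<otimes>\<^bsub>A\<^esub> b z)"
proof -
  interpret F: lmod k "FX M" by (rule FX_lmod)
  have bc: "\<And>x. x \<in> M \<Longrightarrow> b x \<in> carrier (FX M)" by simp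
  have "(b x \<otimes>\<^bsub>A\<^esub> b y) \<otimes>\<^bsub>A\<^esub> b z = c x y \<odot>\<^bsub>FX M\<^esub> (c (mu x y) z \<odot>\<^bsub>FX M\<^esub> b (mu (mu x y) z))"
    using lin_map_smult[OF A_mult_lin_left[OF bc[OF z]] c_closed[OF x y] bc[OF mu_closed[OF x y]]] x y z
    by (simp only: basis_mult_basis mu_closed)
  also have "\<dots> = c y z \<odot>\<^bsub>FX M\<^esub> (c x (mu y z) \<odot>\<^bsub>FX M\<^esub> b (mu x (mu y z)))"
    using F.smult_assoc1[symmetric] x y z bc[of "mu x (mu y z)"]
    by (simp add: mu_assoc cocycle del: free_module_simps)
  also have "\<dots> = b x \<otimes>\<^bsub>A\<^esub> (b y \<otimes>\<^bsub>A\<^esub> b z)"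
    using lin_map_smult[OF A_mult_lin_right[OF bc[OF x]] c_closed[OF y z] bc[OF mu_closed[OF y z]]] x y z
    by (simp only: basis_mult_basis mu_closed)
  finally show ?thesis .
qed

lemma A_assoc:
  assumes f: "f \<in> carrier (FX M)" and g: "g \<in> carrier (FX M)" and h: "h \<in> carrier (FX M)"
  shows "(f \<otimes>\<^bsub>A\<^esub> g) \<otimes>\<^bsub>A\<^esub> h = f \<otimes>\<^bsub>A\<^esub> (g \<otimes>\<^bsub>A\<^esub> h)"
proof (rule k.lin_map_free_eqI[OF FX_lmod lin_map_comp[OF A_mult_lin_left[OF g] A_mult_lin_left[OF h]]
      A_mult_lin_left[OF A_mult_closed[OF g h]] _ f])
  fix x assume x: "x \<in> M"
  then have bx: "b x \<in> carrier (FX M)" by simp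
  show "(b x \<otimes>\<^bsub>A\<^esub> g) \<otimes>\<^bsub>A\<^esub> h = b x \<otimes>\<^bsub>A\<^esub> (g \<otimes>\<^bsub>A\<^esub> h)"
  proof (rule k.lin_map_free_eqI[OF FX_lmod lin_map_comp[OF A_mult_lin_right[OF bx] A_mult_lin_left[OF h]]
        lin_map_comp[OF A_mult_lin_left[OF h] A_mult_lin_right[OF bx]] _ g])
    fix y assume y: "y \<in> M"
    then have bxy: "b y \<in> carrier (FX M)" "b x \<otimes>\<^bsub>A\<^esub> b y \<in> carrier (FX M)"
      using A_mult_closed[OF bx] by auto
    show "(b x \<otimes>\<^bsub>A\<^esub> b y) \<otimes>\<^bsub>A\<^esub> h = b x \<otimes>\<^bsub>A\<^esub> (b y \<otimes>\<^bsub>A\<^esub> h)"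
      by (rule k.lin_map_free_eqI[OF FX_lmod A_mult_lin_right[OF bxy(2)]
            lin_map_comp[OF A_mult_lin_right[OF bxy(1)] A_mult_lin_right[OF bx]] _ h])
        (rule basis_assoc[OF x y])
  qed
qed

lemma one_basis: "(\<lambda>y. \<one>\<^bsub>k\<^esub> \<otimes>\<^bsub>k\<^esub> b x y) = b x"
  by (auto simp: basis_vec_def)

lemma A_one_left:
  assumes f: "f \<in> carrier (FX M)"
  shows "b e \<otimes>\<^bsub>A\<^esub> f = f"
  by (rule k.lin_map_free_eqI[OF FX_lmod A_mult_lin_right lin_map_id _ f])
    (auto simp: basis_mult_basis one_basis)

lemma A_one_right:
  assumes f: "f \<in> carrier (FX M)"
  shows "f \<otimes>\<^bsub>A\<^esub> b e = f"
  by (rule k.lin_map_free_eqI[OF FX_lmod A_mult_lin_left lin_map_id _ f])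
    (auto simp: basis_mult_basis one_basis)

lemma A_abelian_group: "abelian_group A"
proof -
  interpret F: abelian_group "FX M" by (rule k.free_module_abelian_group)
  show ?thesis
  proof (rule abelian_groupI)
    fix f assume "f \<in> carrier A"
    then show "\<exists>g\<in>carrier A. g \<oplus>\<^bsub>A\<^esub> f = \<zero>\<^bsub>A\<^esub>"
      using F.l_neg[of f] F.a_inv_closed[of f] by (intro bexI[of _ "\<ominus>\<^bsub>FX M\<^esub> f"]) auto
  qed (auto simp: k.a_ac)
qed

lemma A_ring: "ring A"
proof (rule ringI[OF A_abelian_group])
  show "monoid A"
    by (rule monoidI) (auto simp: A_mult_closed A_assoc A_one_left A_one_right)
  fix f g h assume "f \<in> carrier A" "g \<in> carrier A" "h \<in> carrier A"
  then show "(f \<oplus>\<^bsub>A\<^esub> g) \<otimes>\<^bsub>A\<^esub> h = f \<otimes>\<^bsub>A\<^esub> h \<oplus>\<^bsub>A\<^esub> g \<otimes>\<^bsub>A\<^esub> h"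
    and "h \<otimes>\<^bsub>A\<^esub> (f \<oplus>\<^bsub>A\<^esub> g) = h \<otimes>\<^bsub>A\<^esub> f \<oplus>\<^bsub>A\<^esub> h \<otimes>\<^bsub>A\<^esub> g"
    using lin_map_add[OF A_mult_lin_left] lin_map_add[OF A_mult_lin_right] by simp_all
qed

sublocale A: ring A by (rule A_ring)

text \<open>The augmentation by which \<open>A\<close> acts on the trivial module.\<close>

definition eps :: "('x \<Rightarrow> 'k) \<Rightarrow> 'k" where
  "eps f = (\<Oplus>\<^bsub>k\<^esub>x\<in>{x. f x \<noteq> \<zero>\<^bsub>k\<^esub> \<and> U x}. f x)"

lemma finsum_scalar_module: "finsum (scalar_module k) = finsum k"
  by (simp add: finsum_def finprod_def scalar_module_def fun_eq_iff cong: if_cong)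

lemma eps_eq: "f \<in> carrier (FX M) \<Longrightarrow> eps f = lin_ext k (scalar_module k) (\<lambda>x. if U x then \<one>\<^bsub>k\<^esub> else \<zero>\<^bsub>k\<^esub>) f"
  unfolding eps_def lin_ext_def finsum_scalar_module
  by (rule k.add.finprod_mono_neutral_cong_left) (auto dest: free_module_finite)

lemma eps_lin: "lin_map k (FX M) (scalar_module k) eps"
proof -
  have "lin_map k (FX M) (scalar_module k) (lin_ext k (scalar_module k) (\<lambda>x. if U x then \<one>\<^bsub>k\<^esub> else \<zero>\<^bsub>k\<^esub>))"
    by (rule k.lin_ext_lin_map[OF k.scalar_module_lmod]) simp
  then show ?thesis unfolding lin_map_def
    using eps_eq lmod.smult_closed[OF FX_lmod, of _ _ M] by (auto simp: Pi_def)
qed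

lemma eps_closed [simp]: "f \<in> carrier (FX M) \<Longrightarrow> eps f \<in> carrier k"
  using lin_map_closed[OF eps_lin] by simp

lemma eps_basis: "x \<in> M \<Longrightarrow> eps (b x) = (if U x then \<one>\<^bsub>k\<^esub> else \<zero>\<^bsub>k\<^esub>)"
  by (subst eps_eq, simp, subst k.lin_ext_basis[OF k.scalar_module_lmod]) auto

text \<open>Ranks do not drop in products, so the factors of a product of rank 0 have rank 0;
  conversely the elements of rank 0 are the image of the group, which is closed under
  \<open>mu\<close>.\<close>

lemma U_mu: "x \<in> M \<Longrightarrow> y \<in> M \<Longrightarrow> U (mu x y) \<longleftrightarrow> U x \<and> U y"
proof -
  assume xy: "x \<in> M" "y \<in> M"
  have "rk (mu x y) = 0" if "rk x = 0" "rk y = 0"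
  proof -
    have "x \<in> phi ` carrier H" "y \<in> phi ` carrier H"
      using xy that phi_bij by (auto simp: bij_betw_def)
    then obtain g h where "g \<in> carrier H" "x = phi g" "h \<in> carrier H" "y = phi h" by blast
    then have "mu x y = phi (g \<otimes>\<^bsub>H\<^esub> h)" by (simp add: phi_mult)
    then have "mu x y \<in> phi ` carrier H" using \<open>g \<in> carrier H\<close> \<open>h \<in> carrier H\<close> by blast
    then show ?thesis using phi_bij by (auto simp: bij_betw_def)
  qed
  then show ?thesis using rk_left[OF xy] rk_right[OF xy] xy by (auto simp: U_iff)
qed

text \<open>Products with a factor of positive rank are killed on both sides, and between elements
  of rank 0 the scalar is one.\<close>

lemma eps_mult:
  assumes f: "f \<in> carrier (FX M)" and g: "g \<in> carrier (FX M)"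
  shows "eps (f \<otimes>\<^bsub>A\<^esub> g) = eps f \<otimes>\<^bsub>k\<^esub> eps g"
proof -
  interpret S: lmod k "scalar_module k" by (rule k.scalar_module_lmod)
  have r: "lin_map k (FX M) (scalar_module k) (\<lambda>f. eps f \<otimes>\<^bsub>k\<^esub> s)" if "s \<in> carrier k" for s
    using S.lin_map_scalar_smult[OF eps_lin, of s] that by simp
  have l: "lin_map k (FX M) (scalar_module k) (\<lambda>f. s \<otimes>\<^bsub>k\<^esub> eps f)" if "s \<in> carrier k" for s
    using lin_map_const_smult[OF k.is_cring k.scalar_module_lmod eps_lin that] by simp
  show ?thesis
  proof (rule k.lin_map_free_eqI[OF k.scalar_module_lmod lin_map_comp[OF A_mult_lin_left[OF g] eps_lin]
        r[OF eps_closed[OF g]] _ f])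
    fix x assume x: "x \<in> M"
    then have bx: "b x \<in> carrier (FX M)" by simp
    show "eps (b x \<otimes>\<^bsub>A\<^esub> g) = eps (b x) \<otimes>\<^bsub>k\<^esub> eps g"
    proof (rule k.lin_map_free_eqI[OF k.scalar_module_lmod lin_map_comp[OF A_mult_lin_right[OF bx] eps_lin]
          l[OF eps_closed[OF bx]] _ g])
      fix y assume y: "y \<in> M"
      have "eps (c x y \<odot>\<^bsub>FX M\<^esub> b (mu x y)) = c x y \<otimes>\<^bsub>k\<^esub> eps (b (mu x y))"
        using lin_map_smult[OF eps_lin c_closed[OF x y], of "b (mu x y)"] x y
        by (simp del: free_module_simps)
      moreover have "U x \<Longrightarrow> U y \<Longrightarrow> c x y = \<one>\<^bsub>k\<^esub>" using x y c_unit[OF x y] by (simp add: U_iff)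
      ultimately show "eps (b x \<otimes>\<^bsub>A\<^esub> b y) = eps (b x) \<otimes>\<^bsub>k\<^esub> eps (b y)"
        using x y by (simp add: basis_mult_basis eps_basis U_mu del: free_module_simps)
    qed
  qed
qed

abbreviation N where "N \<equiv> basis_action_module k U"

lemma N_simps [simp]: "carrier N = carrier k" "add N = add k" "zero N = \<zero>\<^bsub>k\<^esub>"
  "f \<odot>\<^bsub>N\<^esub> s = eps f \<otimes>\<^bsub>k\<^esub> s"
  by (simp_all add: basis_action_module_def eps_def)

lemma eps_one: "eps (b e) = \<one>\<^bsub>k\<^esub>"
proof -
  have "phi \<one>\<^bsub>H\<^esub> \<in> {x \<in> M. rk x = 0}" using phi_bij by (auto simp: bij_betw_def)
  then show ?thesis by (simp add: eps_basis U_iff phi_one)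
qed

lemma N_lmod: "lmod A N"
proof -
  have "abelian_group N"
    by (rule abelian_groupI) (auto simp: k.a_ac intro: bexI[of _ "\<ominus>\<^bsub>k\<^esub> _"] k.l_neg)
  then show ?thesis
    using lin_map_add[OF eps_lin]
    by (intro lmod.intro lmod_axioms.intro A_ring)
      (auto simp: k.l_distr k.r_distr eps_mult k.m_assoc eps_one)
qed

section \<open>Free modules over the algebra and the supports of their elements\<close>

abbreviation FA :: "'y set \<Rightarrow> ('x \<Rightarrow> 'k, 'y \<Rightarrow> 'x \<Rightarrow> 'k) module" where
  "FA Y \<equiv> free_module A Y"

lemma FA_lmod: "lmod A (FA Y)" by (rule A.free_module_lmod)

text \<open>The first argument of \<open>f\<close> is a generator and the second a basis element of
  \<open>A\<close>. Only the second is restricted, so all coefficients lie in the span of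
  \<open>V\<close>.\<close>

definition supp_in :: "'x set \<Rightarrow> ('y \<Rightarrow> 'x \<Rightarrow> 'k) \<Rightarrow> bool" where
  "supp_in V f \<longleftrightarrow> (\<forall>y m. f y m \<noteq> \<zero>\<^bsub>k\<^esub> \<longrightarrow> m \<in> V)"

lemma FA_value: "f \<in> carrier (FA Y) \<Longrightarrow> f y \<in> carrier (FX M)"
  using A.free_module_value[of f Y y] by simp

lemma FA_value2 [simp]: "f \<in> carrier (FA Y) \<Longrightarrow> f y m \<in> carrier k"
  by (rule k.free_module_value[OF FA_value])

lemma FA_outside: "f \<in> carrier (FA Y) \<Longrightarrow> m \<notin> M \<Longrightarrow> f y m = \<zero>\<^bsub>k\<^esub>"
  by (rule free_module_outside[OF FA_value])

lemma FA_add: "f \<oplus>\<^bsub>FA Y\<^esub> g = (\<lambda>y m. f y m \<oplus>\<^bsub>k\<^esub> g y m)"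
  by simp

lemma FA_minus:
  assumes "f \<in> carrier (FA Y)" "g \<in> carrier (FA Y)"
  shows "f \<ominus>\<^bsub>FA Y\<^esub> g = (\<lambda>y m. f y m \<ominus>\<^bsub>k\<^esub> g y m)"
proof -
  have "f y \<ominus>\<^bsub>A\<^esub> g y = (\<lambda>m. f y m \<ominus>\<^bsub>k\<^esub> g y m)" for y
  proof -
    have v: "f y \<in> carrier (FX M)" "g y \<in> carrier (FX M)" by (rule FA_value; fact)+
    have d: "(\<lambda>m. f y m \<ominus>\<^bsub>k\<^esub> g y m) \<in> carrier A" using v by simp
    have "f y \<ominus>\<^bsub>A\<^esub> g y = ((\<lambda>m. f y m \<ominus>\<^bsub>k\<^esub> g y m) \<oplus>\<^bsub>A\<^esub> g y) \<ominus>\<^bsub>A\<^esub> g y"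
      using assms by (simp add: k.minus_add_cancel)
    also have "\<dots> = (\<lambda>m. f y m \<ominus>\<^bsub>k\<^esub> g y m)"
      using d v[folded A_simps(1)] unfolding a_minus_def[of A]
      by (simp only: A.a_assoc A.r_neg A.r_zero A.a_inv_closed)
    finally show ?thesis .
  qed
  then show ?thesis using assms by (simp add: A.free_module_minus)
qed

lemma supp_in_zero: "supp_in V (\<lambda>y. \<zero>\<^bsub>A\<^esub>)" by (simp add: supp_in_def)

lemma supp_in_add:
  "f \<in> carrier (FA Y) \<Longrightarrow> g \<in> carrier (FA Y) \<Longrightarrow> supp_in V f \<Longrightarrow> supp_in V g \<Longrightarrow> supp_in V (f \<oplus>\<^bsub>FA Y\<^esub> g)"
  unfolding supp_in_def FA_add using k.l_zero k.zero_closed by metis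

lemma supp_in_mono: "supp_in V f \<Longrightarrow> V \<subseteq> W \<Longrightarrow> supp_in W f"
  unfolding supp_in_def by blast

lemma supp_lmul:
  assumes x: "x \<in> M" and g: "g \<in> carrier (FX M)" and W: "\<And>y. g y \<noteq> \<zero>\<^bsub>k\<^esub> \<Longrightarrow> mu x y \<in> W"
  shows "lmul x g m \<noteq> \<zero>\<^bsub>k\<^esub> \<Longrightarrow> m \<in> W"
proof -
  interpret F: lmod k "FX M" by (rule FX_lmod)
  have "\<forall>m. lmul x g m \<noteq> \<zero>\<^bsub>k\<^esub> \<longrightarrow> m \<in> W"
    unfolding lmul_def lin_ext_def
  proof (rule F.M.finsum_induct_closed[OF free_module_finite[OF g]])
    fix y assume "y \<in> {y. g y \<noteq> \<zero>\<^bsub>k\<^esub>}"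
    then have y: "y \<in> M" "mu x y \<in> W" "g y \<in> carrier k" using free_module_support[OF g] g W by auto
    show "g y \<odot>\<^bsub>FX M\<^esub> (c x y \<odot>\<^bsub>FX M\<^esub> b (mu x y)) \<in> carrier (FX M) \<and>
        (\<forall>m. (g y \<odot>\<^bsub>FX M\<^esub> (c x y \<odot>\<^bsub>FX M\<^esub> b (mu x y))) m \<noteq> \<zero>\<^bsub>k\<^esub> \<longrightarrow> m \<in> W)"
      using F.smult_closed[OF y(3) cb_closed[OF x y(1)]] x y by (auto simp: basis_vec_def split: if_splits)
  qed (auto, metis k.l_zero k.zero_closed)
  then show "lmul x g m \<noteq> \<zero>\<^bsub>k\<^esub> \<Longrightarrow> m \<in> W" by blast
qed

lemma supp_mult:
  assumes f: "f \<in> carrier (FX M)" and g: "g \<in> carrier (FX M)"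
    and V: "\<And>m. f m \<noteq> \<zero>\<^bsub>k\<^esub> \<Longrightarrow> m \<in> V" "\<And>x y. x \<in> V \<Longrightarrow> x \<in> M \<Longrightarrow> y \<in> M \<Longrightarrow> mu x y \<in> V"
  shows "(f \<otimes>\<^bsub>A\<^esub> g) m \<noteq> \<zero>\<^bsub>k\<^esub> \<Longrightarrow> m \<in> V"
proof -
  interpret F: lmod k "FX M" by (rule FX_lmod)
  have "\<forall>m. (f \<otimes>\<^bsub>A\<^esub> g) m \<noteq> \<zero>\<^bsub>k\<^esub> \<longrightarrow> m \<in> V"
    unfolding A_mult lin_ext_def
  proof (rule F.M.finsum_induct_closed[OF free_module_finite[OF f]])
    fix x assume "x \<in> {x. f x \<noteq> \<zero>\<^bsub>k\<^esub>}"
    then have x: "x \<in> M" "x \<in> V" "f x \<in> carrier k" using free_module_support[OF f] f V by auto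
    have l: "lmul x g m \<noteq> \<zero>\<^bsub>k\<^esub> \<Longrightarrow> m \<in> V" for m
      by (rule supp_lmul[OF x(1) g]) (use x V(2) free_module_support[OF g] in auto)
    show "f x \<odot>\<^bsub>FX M\<^esub> lmul x g \<in> carrier (FX M) \<and> (\<forall>m. (f x \<odot>\<^bsub>FX M\<^esub> lmul x g) m \<noteq> \<zero>\<^bsub>k\<^esub> \<longrightarrow> m \<in> V)"
    proof (intro conjI allI impI)
      show "f x \<odot>\<^bsub>FX M\<^esub> lmul x g \<in> carrier (FX M)" by (rule F.smult_closed[OF x(3) lmul_closed[OF x(1) g]])
      fix m assume "(f x \<odot>\<^bsub>FX M\<^esub> lmul x g) m \<noteq> \<zero>\<^bsub>k\<^esub>"
      then have "lmul x g m \<noteq> \<zero>\<^bsub>k\<^esub>" using x by auto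
      then show "m \<in> V" by (rule l)
    qed
  qed (auto, metis k.l_zero k.zero_closed)
  then show "(f \<otimes>\<^bsub>A\<^esub> g) m \<noteq> \<zero>\<^bsub>k\<^esub> \<Longrightarrow> m \<in> V" by blast
qed

text \<open>A linear map between free left modules multiplies the coefficients on the right by the
  entries of its matrix. Hence it preserves every support condition that is stable under right
  multiplication; this applies to ranks and, up to higher rank, to labels.\<close>

lemma supp_in_lin_map:
  assumes L: "lin_map A (FA Y) (FA Z) L" and f: "f \<in> carrier (FA Y)" and s: "supp_in V f"
    and V: "\<And>x y. x \<in> V \<Longrightarrow> x \<in> M \<Longrightarrow> y \<in> M \<Longrightarrow> mu x y \<in> V"
  shows "supp_in V (L f)"
proof -
  interpret F: lmod A "FA Z" by (rule FA_lmod)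
  have Lb: "y \<in> Y \<Longrightarrow> L (basis_vec A y) \<in> carrier (FA Z)" for y using lin_map_closed[OF L] by simp
  show ?thesis
    unfolding A.lin_map_free_eq_lin_ext[OF FA_lmod L f] lin_ext_def
  proof (rule F.M.finsum_induct_closed[OF free_module_finite[OF f]])
    fix y assume "y \<in> {y. f y \<noteq> \<zero>\<^bsub>A\<^esub>}"
    then have y: "y \<in> Y" using free_module_support[OF f] by auto
    have "supp_in V (f y \<odot>\<^bsub>FA Z\<^esub> L (basis_vec A y))"
      unfolding supp_in_def free_module_simps
    proof (intro allI impI)
      fix z m assume "(f y \<otimes>\<^bsub>A\<^esub> L (basis_vec A y) z) m \<noteq> \<zero>\<^bsub>k\<^esub>"
      from supp_mult[OF FA_value[OF f] FA_value[OF Lb[OF y]] _ V this] s show "m \<in> V"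
        by (auto simp: supp_in_def)
    qed
    moreover have "f y \<odot>\<^bsub>FA Z\<^esub> L (basis_vec A y) \<in> carrier (FA Z)"
      by (rule F.smult_closed[OF A.free_module_value[OF f] Lb[OF y]])
    ultimately show "f y \<odot>\<^bsub>FA Z\<^esub> L (basis_vec A y) \<in> carrier (FA Z) \<and> supp_in V (f y \<odot>\<^bsub>FA Z\<^esub> L (basis_vec A y))"
      by simp
  qed (auto simp: supp_in_zero[simplified] intro: supp_in_add[unfolded FA_add])
qed

lemma supp_in_basis_smult:
  assumes x: "x \<in> M" and f: "f \<in> carrier (FA Y)" and s: "supp_in V f"
    and W: "\<And>y. y \<in> V \<Longrightarrow> y \<in> M \<Longrightarrow> mu x y \<in> W"
  shows "supp_in W (b x \<odot>\<^bsub>FA Y\<^esub> f)"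
  unfolding supp_in_def
proof (intro allI impI)
  fix y m assume m: "(b x \<odot>\<^bsub>FA Y\<^esub> f) y m \<noteq> \<zero>\<^bsub>k\<^esub>"
  have fy: "f y \<in> carrier (FX M)" by (rule FA_value[OF f])
  have "lmul x (f y) m \<noteq> \<zero>\<^bsub>k\<^esub>" using m by (simp add: basis_mult[OF x fy])
  moreover have "f y z \<noteq> \<zero>\<^bsub>k\<^esub> \<Longrightarrow> mu x z \<in> W" for z
    using s W free_module_support[OF fy] by (auto simp: supp_in_def)
  ultimately show "m \<in> W" using supp_lmul[OF x fy] by blast
qed

lemma basis_smult_fixed:
  assumes x: "x \<in> M" and f: "f \<in> carrier (FA Y)" and s: "supp_in V f"
    and V: "\<And>y. y \<in> V \<Longrightarrow> y \<in> M \<Longrightarrow> mu x y = y \<and> c x y = \<one>\<^bsub>k\<^esub>"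
  shows "b x \<odot>\<^bsub>FA Y\<^esub> f = f"
proof -
  interpret F: lmod k "FX M" by (rule FX_lmod)
  have "lmul x (f y) = f y" for y
  proof -
    have fy: "f y \<in> carrier (FX M)" by (rule FA_value[OF f])
    have "lmul x (f y) = lin_ext k (FX M) (\<lambda>z. b z) (f y)"
      unfolding lmul_def lin_ext_def
    proof (rule F.M.finsum_cong')
      fix z assume "z \<in> {z. f y z \<noteq> \<zero>\<^bsub>k\<^esub>}"
      then have "z \<in> M" "z \<in> V" using s free_module_support[OF fy] by (auto simp: supp_in_def)
      then show "f y z \<odot>\<^bsub>FX M\<^esub> (c x z \<odot>\<^bsub>FX M\<^esub> b (mu x z)) = f y z \<odot>\<^bsub>FX M\<^esub> b z"
        using V[of z] F.smult_one[OF k.basis_vec_closed] by (simp del: free_module_simps)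
    qed (use free_module_support[OF fy] f in \<open>auto simp del: free_module_simps intro!: F.smult_closed k.free_module_value[OF fy]\<close>)
    also have "\<dots> = f y"
      using k.lin_map_free_eq_lin_ext[OF FX_lmod lin_map_id fy] by simp
    finally show ?thesis .
  qed
  then show ?thesis using basis_mult[OF x FA_value[OF f]] by simp
qed

end

section \<open>The canonical resolution and its exactness in positive rank\<close>

context twisted_algebra
begin

lemma basis_A_closed: "x \<in> M \<Longrightarrow> b x \<in> carrier A" by simp

lemma FA_smult_closed: "a \<in> carrier A \<Longrightarrow> f \<in> carrier (FA Y) \<Longrightarrow> a \<odot>\<^bsub>FA Y\<^esub> f \<in> carrier (FA Y)"
  by (rule lmod.smult_closed[OF FA_lmod])

definition gens :: "nat \<Rightarrow> ('x \<Rightarrow> 'k, 'k) gen set" where "gens = res_gens A N"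

definition D :: "nat \<Rightarrow> (('x \<Rightarrow> 'k, 'k) gen \<Rightarrow> 'x \<Rightarrow> 'k) \<Rightarrow> ('x \<Rightarrow> 'k, 'k) gen \<Rightarrow> 'x \<Rightarrow> 'k" where
  "D i = res_diff A (gens i)"

definition aug :: "(('x \<Rightarrow> 'k, 'k) gen \<Rightarrow> 'x \<Rightarrow> 'k) \<Rightarrow> 'k" where "aug = res_aug A N"

abbreviation C where "C i \<equiv> FA (gens i)"

lemma aug_lin_A: "lin_map A (C 0) N aug"
  unfolding gens_def aug_def res_aug_def
  by (rule A.lin_ext_lin_map[OF N_lmod]) (auto simp: inv_into_f_f inj_on_def simp del: N_simps(1))

lemma aug_basis: "s \<in> carrier k \<Longrightarrow> aug (basis_vec A (Base s)) = s"
  unfolding aug_def res_aug_def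
  by (subst A.lin_ext_basis[OF N_lmod]) (auto simp: inv_into_f_f inj_on_def)

lemma D_lin: "lin_map A (C (Suc i)) (C i) (D i)"
  unfolding D_def by (rule A.res_diff_lin) (cases i; auto simp: gens_def simp del: A_simps)

lemma D_closed: "f \<in> carrier (C (Suc i)) \<Longrightarrow> D i f \<in> carrier (C i)"
  by (rule lin_map_closed[OF D_lin])

text \<open>The counterpart of \<open>cyc\<close> over \<open>A\<close>: the augmentation again
  stands in for a differential out of degree 0.\<close>

definition is_cyc :: "nat \<Rightarrow> (('x \<Rightarrow> 'k, 'k) gen \<Rightarrow> 'x \<Rightarrow> 'k) \<Rightarrow> bool" where
  "is_cyc i f \<longleftrightarrow> (case i of 0 \<Rightarrow> aug f = \<zero>\<^bsub>k\<^esub> | Suc j \<Rightarrow> D j f = (\<lambda>y m. \<zero>\<^bsub>k\<^esub>))"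

lemma is_cyc_iff:
  assumes "f \<in> carrier (C i)"
  shows "is_cyc i f \<longleftrightarrow> f \<in> D i ` carrier (C (Suc i))"
proof (cases i)
  case 0
  have "aug f = \<zero>\<^bsub>N\<^esub> \<longleftrightarrow> f \<in> res_diff A (gens 0) ` carrier (C (Suc 0))"
    by (rule A.res_diff_exact[OF aug_lin_A N_lmod])
      (use assms 0 in \<open>simp_all add: gens_def aug_def del: A_simps N_simps\<close>)
  then show ?thesis by (simp add: 0 is_cyc_def D_def)
next
  case (Suc j)
  have "D j f = \<zero>\<^bsub>C j\<^esub> \<longleftrightarrow> f \<in> res_diff A (gens (Suc j)) ` carrier (C (Suc (Suc j)))"
    by (rule A.res_diff_exact[OF D_lin FA_lmod])
      (use assms Suc in \<open>simp_all add: gens_def D_def del: A_simps N_simps\<close>)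
  then show ?thesis by (simp add: Suc is_cyc_def D_def)
qed

lemma is_cyc_D: "f \<in> carrier (C (Suc i)) \<Longrightarrow> is_cyc i (D i f)"
  by (simp add: is_cyc_iff D_closed)

lemma is_cyc_minus:
  assumes "f \<in> carrier (C i)" "g \<in> carrier (C i)" "is_cyc i f" "is_cyc i g"
  shows "is_cyc i (f \<ominus>\<^bsub>C i\<^esub> g)"
proof -
  obtain p q where pq: "p \<in> carrier (C (Suc i))" "q \<in> carrier (C (Suc i))" "f = D i p" "g = D i q"
    using assms by (auto simp: is_cyc_iff)
  interpret F: lmod A "C (Suc i)" by (rule FA_lmod)
  have "f \<ominus>\<^bsub>C i\<^esub> g = D i (p \<ominus>\<^bsub>C (Suc i)\<^esub> q)"
    using pq lin_map_minus[OF FA_lmod FA_lmod D_lin] by simp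
  then show ?thesis using pq F.M.minus_closed by (simp add: is_cyc_D)
qed

abbreviation ideal_from :: "nat \<Rightarrow> 'x set" where "ideal_from j \<equiv> {m. j \<le> rk m}"

text \<open>The augmentation is linear over \<open>A\<close>, and coefficients of positive rank act
  as zero on the trivial module.\<close>

lemma aug_ideal:
  assumes f: "f \<in> carrier (C 0)" and s: "supp_in (ideal_from 1) f"
  shows "aug f = \<zero>\<^bsub>k\<^esub>"
proof -
  interpret N: lmod A N by (rule N_lmod)
  have z: "eps (f y) = \<zero>\<^bsub>k\<^esub>" for y
  proof -
    have "{x. f y x \<noteq> \<zero>\<^bsub>k\<^esub> \<and> U x} = {}"
      using s free_module_support[OF FA_value[OF f]] by (fastforce simp: supp_in_def U_iff)
    then show ?thesis unfolding eps_def by (simp only: k.finsum_empty)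
  qed
  have c: "y \<in> gens 0 \<Longrightarrow> aug (basis_vec A y) \<in> carrier k" for y
    using lin_map_closed[OF aug_lin_A, of "basis_vec A y"] by simp
  have "aug f = (\<Oplus>\<^bsub>N\<^esub>y\<in>{y. f y \<noteq> \<zero>\<^bsub>A\<^esub>}. f y \<odot>\<^bsub>N\<^esub> aug (basis_vec A y))"
    unfolding A.lin_map_free_eq_lin_ext[OF N_lmod aug_lin_A f] lin_ext_def ..
  also have "\<dots> = (\<Oplus>\<^bsub>N\<^esub>y\<in>{y. f y \<noteq> \<zero>\<^bsub>A\<^esub>}. \<zero>\<^bsub>N\<^esub>)"
    by (rule N.M.finsum_cong') (use z c free_module_support[OF f] in auto)
  also have "\<dots> = \<zero>\<^bsub>k\<^esub>" using N.M.finsum_zero[of "{y. f y \<noteq> \<zero>\<^bsub>A\<^esub>}"] by simp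
  finally show ?thesis .
qed

lemma is_cyc_ideal_iff:
  "f \<in> carrier (C 0) \<Longrightarrow> supp_in (ideal_from 1) f \<Longrightarrow> is_cyc 0 f"
  by (simp add: is_cyc_def aug_ideal)

lemma ideal_from_right: "x \<in> ideal_from j \<Longrightarrow> x \<in> M \<Longrightarrow> y \<in> M \<Longrightarrow> mu x y \<in> ideal_from j"
  using rk_left[of x y] by simp

lemma FA_restrict:
  assumes f: "f \<in> carrier (FA Y)"
  shows "(\<lambda>y m. if P m then f y m else \<zero>\<^bsub>k\<^esub>) \<in> carrier (FA Y)"
proof (rule A.free_moduleI[OF _ _ free_module_finite[OF f] free_module_support[OF f]])
  show "(\<lambda>m. if P m then f y m else \<zero>\<^bsub>k\<^esub>) \<in> carrier A" for y
    using FA_value[OF f, of y] by simp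
qed auto

text \<open>Left multiplication by the listed elements, the last one first. Written without
  reference to a set of generators, it is the same constant on both ends of a linear map.\<close>

definition act_list :: "'x list \<Rightarrow> ('y \<Rightarrow> 'x \<Rightarrow> 'k) \<Rightarrow> 'y \<Rightarrow> 'x \<Rightarrow> 'k" where
  "act_list es f = foldr (\<lambda>d f y. b d \<otimes>\<^bsub>A\<^esub> f y) es f"

lemma act_list_simps [simp]:
  "act_list [] f = f" "act_list (d # es) f = b d \<odot>\<^bsub>FA Y\<^esub> act_list es f"
  by (simp_all add: act_list_def)

lemma act_list_closed:
  "set es \<subseteq> M \<Longrightarrow> f \<in> carrier (FA Y) \<Longrightarrow> act_list es f \<in> carrier (FA Y)"
proof (induct es)
  case (Cons d es)
  then show ?case unfolding act_list_simps(2)[where Y = Y] by (intro FA_smult_closed basis_A_closed) auto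
qed simp

lemma act_list_lin_map:
  assumes L: "lin_map A (FA Y) (FA Z) L" and "set es \<subseteq> M" and f: "f \<in> carrier (FA Y)"
  shows "L (act_list es f) = act_list es (L f)"
  using assms(2)
proof (induct es)
  case (Cons d es)
  have "act_list es f \<in> carrier (FA Y)" using Cons(2) f by (intro act_list_closed) auto
  then show ?case
    unfolding act_list_simps(2)[where Y = Y and f = f] act_list_simps(2)[where Y = Z and f = "L f"]
    using Cons lin_map_smult[OF L basis_A_closed] by simp
qed simp

lemma act_list_minus:
  assumes "set es \<subseteq> M" "f \<in> carrier (FA Y)" "g \<in> carrier (FA Y)"
  shows "act_list es (f \<ominus>\<^bsub>FA Y\<^esub> g) = act_list es f \<ominus>\<^bsub>FA Y\<^esub> act_list es g"
  using assms(1)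
proof (induct es)
  case (Cons d es)
  interpret F: lmod A "FA Y" by (rule FA_lmod)
  have "act_list es f \<in> carrier (FA Y)" "act_list es g \<in> carrier (FA Y)"
    using Cons(2) assms by (auto intro: act_list_closed)
  then have "b d \<odot>\<^bsub>FA Y\<^esub> (act_list es f \<ominus>\<^bsub>FA Y\<^esub> act_list es g) =
      b d \<odot>\<^bsub>FA Y\<^esub> act_list es f \<ominus>\<^bsub>FA Y\<^esub> b d \<odot>\<^bsub>FA Y\<^esub> act_list es g"
    using Cons(2) basis_A_closed[of d] F.smult_closed
    by (simp add: a_minus_def F.smult_r_distr F.smult_r_minus del: free_module_simps A_simps)
  then show ?case unfolding act_list_simps(2)[where Y = Y] using Cons by simp
qed simp

lemma act_list_fixed:
  assumes "set es \<subseteq> M" "f \<in> carrier (FA Y)" "supp_in V f"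
    and "\<And>y d. y \<in> V \<Longrightarrow> y \<in> M \<Longrightarrow> d \<in> set es \<Longrightarrow> mu d y = y \<and> c d y = \<one>\<^bsub>k\<^esub>"
  shows "act_list es f = f"
  using assms(1,4)
proof (induct es)
  case (Cons d es)
  then have "act_list es f = f" by auto
  then show ?case unfolding act_list_simps(2)[where Y = Y]
    using basis_smult_fixed[OF _ assms(2,3), of d] Cons by auto
qed simp

lemma foldr_mu_closed: "set es \<subseteq> M \<Longrightarrow> y \<in> M \<Longrightarrow> foldr mu es y \<in> M"
  by (induct es) auto

text \<open>The scalars met on the way can only remove basis elements, so the support is controlled
  by \<open>foldr mu es\<close> alone.\<close>

lemma act_list_supp:
  assumes "set es \<subseteq> M" "f \<in> carrier (FA Y)" "supp_in V f" "\<And>y. y \<in> V \<Longrightarrow> y \<in> M \<Longrightarrow> foldr mu es y \<in> W"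
  shows "supp_in W (act_list es f)"
  using assms(1,4)
proof (induct es arbitrary: W)
  case Nil
  then show ?case using assms(2,3) FA_outside[OF assms(2)] by (fastforce simp: supp_in_def)
next
  case (Cons d es)
  have s: "supp_in (foldr mu es ` (V \<inter> M)) (act_list es f)" using Cons(2) by (intro Cons(1)) auto
  have "act_list es f \<in> carrier (FA Y)" using Cons(2) assms(2) by (intro act_list_closed) auto
  from supp_in_basis_smult[OF _ this s] show ?case
    unfolding act_list_simps(2)[where Y = Y] using Cons(2,3) by auto
qed

lemma supp_in_split:
  assumes f: "f \<in> carrier (FA Y)"
  shows "f \<ominus>\<^bsub>FA Y\<^esub> (\<lambda>y m. if P m then f y m else \<zero>\<^bsub>k\<^esub>) = (\<lambda>y m. if P m then \<zero>\<^bsub>k\<^esub> else f y m)"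
  using f by (subst FA_minus[OF f FA_restrict[OF f]]) (auto simp: fun_eq_iff k.minus_eq k.r_neg)

lemma foldr_mu_rk: "set es \<subseteq> M \<Longrightarrow> y \<in> M \<Longrightarrow> rk y \<le> rk (foldr mu es y)"
  by (induct es) (auto intro: order_trans[OF _ rk_right] foldr_mu_closed)

text \<open>
  Peel off the basis elements of rank exactly \<open>j\<close> one label \<open>r\<close> at a time. The part \<open>f\<^sub>r\<close> of a
  cycle \<open>f\<close> has boundary of rank greater than \<open>j\<close>, hence is a cycle up to a term \<open>w\<close> of rank
  greater than \<open>j\<close>; acting on a preimage of \<open>f\<^sub>r - w\<close> by elements that fix \<open>f\<^sub>r\<close> yields a preimage
  of \<open>f\<^sub>r\<close> inside the ideal, up to terms of rank greater than \<open>j\<close>.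
\<close>

lemma ideal_exact_step:
  assumes j: "j \<ge> 1"
    and IH: "\<And>i f. \<lbrakk>f \<in> carrier (C i); supp_in (ideal_from (Suc j)) f; is_cyc i f\<rbrakk> \<Longrightarrow>
      \<exists>z\<in>carrier (C (Suc i)). supp_in (ideal_from (Suc j)) z \<and> D i z = f"
    and f: "f \<in> carrier (C i)" "supp_in (ideal_from j) f" "is_cyc i f"
  shows "\<exists>z\<in>carrier (C (Suc i)). supp_in (ideal_from j) z \<and> D i z = f"
  using f
\<comment> \<open>The measure counts the labels of rank exactly \<open>j\<close> that occur in
  \<open>f\<close>; each round removes one of them.\<close>
proof (induct "card {lam m | y m. f y m \<noteq> \<zero>\<^bsub>k\<^esub> \<and> rk m = j}" arbitrary: f rule: less_induct)
  case (less f)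
  let ?L = "\<lambda>f. {lam m | y m. f y m \<noteq> \<zero>\<^bsub>k\<^esub> \<and> rk m = j}"
  interpret Ci: lmod A "C i" by (rule FA_lmod)
  interpret Cs: lmod A "C (Suc i)" by (rule FA_lmod)
  note f = less(2-4)
  have fin: "finite (?L f)"
  proof -
    have "?L f \<subseteq> lam ` (\<Union>y\<in>{y. f y \<noteq> \<zero>\<^bsub>A\<^esub>}. {m. f y m \<noteq> \<zero>\<^bsub>k\<^esub>})" by (auto simp: fun_eq_iff)
    moreover have "finite (\<Union>y\<in>{y. f y \<noteq> \<zero>\<^bsub>A\<^esub>}. {m. f y m \<noteq> \<zero>\<^bsub>k\<^esub>})"
      using free_module_finite[OF f(1)] free_module_finite[OF FA_value[OF f(1)]] by (intro finite_UN_I)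
    ultimately show ?thesis by (rule finite_surj[rotated])
  qed
  show ?case
  \<comment> \<open>If no such label is left, the support has rank greater than \<open>j\<close> and
    \<open>IH\<close> applies.\<close>
  proof (cases "?L f = {}")
    case True
    have "m \<in> ideal_from (Suc j)" if "f y m \<noteq> \<zero>\<^bsub>k\<^esub>" for y m
    proof -
      have "j \<le> rk m" using f(2) that by (auto simp: supp_in_def)
      moreover have "rk m \<noteq> j" using True that by blast
      ultimately show ?thesis by simp
    qed
    then have "supp_in (ideal_from (Suc j)) f" by (simp add: supp_in_def)
    from IH[OF f(1) this f(3)] obtain z where z: "z \<in> carrier (C (Suc i))"
      "supp_in (ideal_from (Suc j)) z" "D i z = f" by blast
    moreover have "supp_in (ideal_from j) z" by (rule supp_in_mono[OF z(2)]) auto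
    ultimately show ?thesis by blast
  next
    case False
    then obtain m0 y0 where m0: "f y0 m0 \<noteq> \<zero>\<^bsub>k\<^esub>" "rk m0 = j" by blast
    then have m0M: "m0 \<in> M" using FA_outside[OF f(1)] by blast
    let ?r = "lam m0"
    obtain es where es: "set es \<subseteq> M"
      and es_fix: "\<And>y d. \<lbrakk>y \<in> M; lam y = ?r; d \<in> set es\<rbrakk> \<Longrightarrow> mu d y = y \<and> c d y = \<one>\<^bsub>k\<^esub>"
      and es_rk: "\<And>y. y \<in> M \<Longrightarrow> j \<le> rk (foldr mu es y)"
      using fixers[OF m0M] m0 j by auto
    define fr where "fr = (\<lambda>y m. if lam m = ?r then f y m else \<zero>\<^bsub>k\<^esub>)"
    define f' where "f' = (\<lambda>y m. if lam m = ?r then \<zero>\<^bsub>k\<^esub> else f y m)"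
    have fr: "fr \<in> carrier (C i)" unfolding fr_def by (rule FA_restrict[OF f(1)])
    have f'_eq: "f' = f \<ominus>\<^bsub>C i\<^esub> fr" unfolding fr_def f'_def by (rule supp_in_split[OF f(1), symmetric])
    have f': "f' \<in> carrier (C i)" unfolding f'_eq using f fr by simp
    have fr_supp: "supp_in {m. lam m = ?r} fr" by (simp add: supp_in_def fr_def)
    have fr_supp1: "supp_in (ideal_from j) fr" using f(2) by (simp add: supp_in_def fr_def)
    have f'_supp: "supp_in (ideal_from j) f'" using f(2) by (simp add: supp_in_def f'_def)
    have "\<exists>w\<in>carrier (C i). supp_in (ideal_from (Suc j)) w \<and> is_cyc i (fr \<ominus>\<^bsub>C i\<^esub> w)"
    proof (cases i)
      case 0
      \<comment> \<open>In degree 0 the cycles are the kernel of the augmentation, which contains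
        everything of positive rank, so the correction \<open>w\<close> is zero.\<close>
      have "is_cyc i fr" using fr supp_in_mono[OF fr_supp1, of "ideal_from 1"] j
        by (simp add: 0 is_cyc_ideal_iff subset_iff)
      moreover have "fr \<ominus>\<^bsub>C i\<^esub> \<zero>\<^bsub>C i\<^esub> = fr" using fr by (simp add: a_minus_def del: free_module_simps)
      ultimately show ?thesis using supp_in_zero Ci.M.zero_closed
        by (intro bexI[of _ "\<zero>\<^bsub>C i\<^esub>"]) auto
    next
      case (Suc i')
      let ?g = "D i' fr"
      interpret Cp: lmod A "C i'" by (rule FA_lmod)
      have frS: "fr \<in> carrier (C (Suc i'))" and f'S: "f' \<in> carrier (C (Suc i'))"
        and fS: "f \<in> carrier (C (Suc i'))" using fr f' f Suc by auto
      have g: "?g \<in> carrier (C i')" by (rule D_closed[OF frS])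
      \<comment> \<open>The boundary of \<open>fr\<close> has only elements with label
        \<open>?r\<close> or of rank greater than \<open>j\<close>, because a change of label raises
        the rank. The boundary of \<open>f'\<close> has only elements with another label or of rank
        greater than \<open>j\<close>. The two boundaries add up to zero, so both are supported in
        rank greater than \<open>j\<close>.\<close>
      let ?V = "{m. m \<in> M \<longrightarrow> lam m = ?r \<or> Suc j \<le> rk m}"
      let ?W = "{m. m \<in> M \<longrightarrow> lam m \<noteq> ?r \<and> j \<le> rk m \<or> Suc j \<le> rk m}"
      have "supp_in ?V ?g"
      proof (rule supp_in_lin_map[OF D_lin frS])
        show "supp_in ?V fr" using fr_supp by (rule supp_in_mono) auto
        fix x y assume "x \<in> ?V" "x \<in> M" "y \<in> M"
        then show "mu x y \<in> ?V" using lam_mu[of x y] rk_left[of x y] lam_rk[of x m0] m0 m0M by auto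
      qed
      moreover have "supp_in ?W (D i' f')"
      proof (rule supp_in_lin_map[OF D_lin f'S])
        show "supp_in ?W f'" using f(2) by (auto simp: supp_in_def f'_def)
        fix x y assume "x \<in> ?W" "x \<in> M" "y \<in> M"
        then show "mu x y \<in> ?W" using lam_mu[of x y] rk_left[of x y] by auto
      qed
      moreover have "D i' f' = (\<lambda>y m. \<ominus>\<^bsub>k\<^esub> ?g y m)"
      proof -
        have "D i' f' = D i' f \<ominus>\<^bsub>C i'\<^esub> ?g"
          unfolding f'_eq using lin_map_minus[OF FA_lmod FA_lmod D_lin fS frS] Suc by simp
        also have "D i' f = \<zero>\<^bsub>C i'\<^esub>" using f(3) Suc by (simp add: is_cyc_def)
        finally show ?thesis using FA_minus[OF Cp.M.zero_closed g] g by (simp add: k.minus_eq)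
      qed
      ultimately have gs: "supp_in (ideal_from (Suc j)) ?g"
        unfolding supp_in_def
      proof (intro allI impI)
        assume V: "\<forall>y m. ?g y m \<noteq> \<zero>\<^bsub>k\<^esub> \<longrightarrow> m \<in> ?V" and W: "\<forall>y m. D i' f' y m \<noteq> \<zero>\<^bsub>k\<^esub> \<longrightarrow> m \<in> ?W"
          and eq: "D i' f' = (\<lambda>y m. \<ominus>\<^bsub>k\<^esub> ?g y m)"
        fix y m assume n: "?g y m \<noteq> \<zero>\<^bsub>k\<^esub>"
        have mM: "m \<in> M" using n FA_outside[OF g] by blast
        have "D i' f' y m \<noteq> \<zero>\<^bsub>k\<^esub>"
          using n FA_value2[OF g, of y m] unfolding eq by simp
        then have "m \<in> ?W" using W by blast
        moreover have "m \<in> ?V" using V n by blast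
        ultimately show "m \<in> ideal_from (Suc j)" using mM by auto
      qed
      obtain w where w: "w \<in> carrier (C (Suc i'))" "supp_in (ideal_from (Suc j)) w" "D i' w = ?g"
        using IH[OF g gs is_cyc_D[OF frS]] by blast
      have "D i' (fr \<ominus>\<^bsub>C (Suc i')\<^esub> w) = ?g \<ominus>\<^bsub>C i'\<^esub> ?g"
        using lin_map_minus[OF FA_lmod FA_lmod D_lin frS w(1)] w(3) by simp
      also have "\<dots> = (\<lambda>y m. \<zero>\<^bsub>k\<^esub>)" using g by (simp add: FA_minus k.minus_eq k.r_neg)
      finally show ?thesis using w Suc by (auto simp: is_cyc_def)
    qed
    then obtain w where w: "w \<in> carrier (C i)" "supp_in (ideal_from (Suc j)) w" "is_cyc i (fr \<ominus>\<^bsub>C i\<^esub> w)"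
      by blast
    have frw: "fr \<ominus>\<^bsub>C i\<^esub> w \<in> carrier (C i)" using fr w by simp
    then obtain z' where z': "z' \<in> carrier (C (Suc i))" "D i z' = fr \<ominus>\<^bsub>C i\<^esub> w"
      using w(3) by (auto simp: is_cyc_iff)
    define z where "z = act_list es z'"
    define w' where "w' = act_list es w"
    have z: "z \<in> carrier (C (Suc i))" unfolding z_def by (rule act_list_closed[OF es z'(1)])
    have w': "w' \<in> carrier (C i)" unfolding w'_def by (rule act_list_closed[OF es w(1)])
    have zs: "supp_in (ideal_from j) z" unfolding z_def
      by (rule act_list_supp[OF es z'(1), of UNIV]) (auto simp: supp_in_def es_rk)
    have w's: "supp_in (ideal_from (Suc j)) w'" unfolding w'_def
      by (rule act_list_supp[OF es w(1,2)]) (use foldr_mu_rk[OF es] in \<open>auto intro: le_trans\<close>)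
    have "act_list es fr = fr"
      by (rule act_list_fixed[OF es fr fr_supp]) (use es_fix in auto)
    then have Dz: "D i z = fr \<ominus>\<^bsub>C i\<^esub> w'"
      unfolding z_def w'_def using act_list_lin_map[OF D_lin es z'(1)] z'(2) act_list_minus[OF es fr w(1)] by simp
    define f2 where "f2 = f \<ominus>\<^bsub>C i\<^esub> D i z"
    have Dzc: "D i z \<in> carrier (C i)" by (rule D_closed[OF z])
    have f2: "f2 \<in> carrier (C i)" unfolding f2_def using f Dzc by simp
    have f2_eq: "f2 = f' \<oplus>\<^bsub>C i\<^esub> w'"
      unfolding f2_def Dz f'_eq using f(1) fr w'
      by (simp add: a_minus_def Ci.M.minus_add Ci.M.a_assoc del: free_module_simps)
    have w's': "supp_in (ideal_from j) w'" by (rule supp_in_mono[OF w's]) auto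
    have f2s: "supp_in (ideal_from j) f2"
      unfolding f2_eq by (rule supp_in_add[OF f' w' f'_supp w's'])
    have f2c: "is_cyc i f2" unfolding f2_def by (rule is_cyc_minus[OF f(1) Dzc f(3) is_cyc_D[OF z]])
    \<comment> \<open>In \<open>f2\<close> the part with label \<open>?r\<close> has been replaced
      by \<open>w'\<close>, which has no element of rank \<open>j\<close>. So that label is gone at
      rank \<open>j\<close> and no other has appeared.\<close>
    have key: "f y m \<noteq> \<zero>\<^bsub>k\<^esub>  \<and> lam m \<noteq> ?r" if "f2 y m \<noteq> \<zero>\<^bsub>k\<^esub>" "rk m = j" for y m
    proof -
      have "\<not> m \<in> ideal_from (Suc j)" using that(2) by simp
      then have "w' y m = \<zero>\<^bsub>k\<^esub>" using w's unfolding supp_in_def by blast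
      then have "f2 y m = f' y m" using f' by (simp add: f2_eq)
      then show ?thesis using that(1) unfolding f'_def by presburger
    qed
    have "?r \<in> ?L f" using m0 by blast
    moreover have "?r \<notin> ?L f2"
    proof
      assume "?r \<in> ?L f2"
      then obtain y m where "f2 y m \<noteq> \<zero>\<^bsub>k\<^esub>" "rk m = j" "lam m = ?r" by auto
      then show False using key by blast
    qed
    moreover have "?L f2 \<subseteq> ?L f"
    proof
      fix l assume "l \<in> ?L f2"
      then obtain y m where "f2 y m \<noteq> \<zero>\<^bsub>k\<^esub>" "rk m = j" "l = lam m" by auto
      then show "l \<in> ?L f" using key by blast
    qed
    ultimately have "?L f2 \<subset> ?L f" by blast
    then have "card (?L f2) < card (?L f)" by (rule psubset_card_mono[OF fin])
    from less(1)[OF this f2 f2s f2c] obtain z2 where z2: "z2 \<in> carrier (C (Suc i))"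
      "supp_in (ideal_from j) z2" "D i z2 = f2" by blast
    have "D i (z \<oplus>\<^bsub>C (Suc i)\<^esub> z2) = D i z \<oplus>\<^bsub>C i\<^esub> (f \<ominus>\<^bsub>C i\<^esub> D i z)"
      using lin_map_add[OF D_lin z z2(1)] z2(3) by (simp add: f2_def)
    also have "\<dots> = f"
      using f(1) Dzc Ci.M.minus_add_cancel[of f "D i z"] Ci.M.a_comm[of "D i z" "f \<ominus>\<^bsub>C i\<^esub> D i z"]
      by (simp del: free_module_simps)
    finally have "D i (z \<oplus>\<^bsub>C (Suc i)\<^esub> z2) = f" .
    moreover have "supp_in (ideal_from j) (z \<oplus>\<^bsub>C (Suc i)\<^esub> z2)" by (rule supp_in_add[OF z z2(1) zs z2(2)])
    ultimately show ?thesis using Cs.M.a_closed[OF z z2(1)] by blast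
  qed
qed

text \<open>Descending induction on the rank. It starts above \<open>bound\<close>, where an element
  with the required support is zero.\<close>

lemma ideal_exact:
  assumes "f \<in> carrier (C i)" "supp_in (ideal_from 1) f" "is_cyc i f"
  shows "\<exists>z\<in>carrier (C (Suc i)). supp_in (ideal_from 1) z \<and> D i z = f"
proof -
  have "\<forall>i f. f \<in> carrier (C i) \<longrightarrow> supp_in (ideal_from j) f \<longrightarrow> is_cyc i f \<longrightarrow>
      (\<exists>z\<in>carrier (C (Suc i)). supp_in (ideal_from j) z \<and> D i z = f)"
    if "1 \<le> j" "j \<le> Suc bound" for j
    using that(2,1)
  proof (induct j rule: inc_induct)
    case base
    show ?case
    proof (intro allI impI)
      fix i f assume f: "f \<in> carrier (C i)" "supp_in (ideal_from (Suc bound)) f"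
      have "f = \<zero>\<^bsub>C i\<^esub>"
      proof -
        have "f y m = \<zero>\<^bsub>k\<^esub>" for y m
        proof (cases "m \<in> M")
          case True
          then have "m \<notin> ideal_from (Suc bound)" using rk_bound[of m] by simp
          then show ?thesis using f(2) unfolding supp_in_def by blast
        qed (rule FA_outside[OF f(1)])
        then show ?thesis by (simp add: fun_eq_iff)
      qed
      moreover have "D i \<zero>\<^bsub>C (Suc i)\<^esub> = \<zero>\<^bsub>C i\<^esub>" by (rule lin_map_zero[OF FA_lmod FA_lmod D_lin])
      moreover have "supp_in (ideal_from (Suc bound)) \<zero>\<^bsub>C (Suc i)\<^esub>" by (simp add: supp_in_def)
      ultimately have "supp_in (ideal_from (Suc bound)) \<zero>\<^bsub>C (Suc i)\<^esub> \<and> D i \<zero>\<^bsub>C (Suc i)\<^esub> = f"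
        by (simp only: simp_thms)
      moreover have "\<zero>\<^bsub>C (Suc i)\<^esub> \<in> carrier (C (Suc i))"
        using A.free_module_zero_closed by (simp only: free_module_simps)
      ultimately show "\<exists>z\<in>carrier (C (Suc i)). supp_in (ideal_from (Suc bound)) z \<and> D i z = f"
        by (intro bexI)
    qed
  next
    case (step j)
    show ?case
    proof (intro allI impI)
      fix i f assume f: "f \<in> carrier (C i)" "supp_in (ideal_from j) f" "is_cyc i f"
      show "\<exists>z\<in>carrier (C (Suc i)). supp_in (ideal_from j) z \<and> D i z = f"
      proof (rule ideal_exact_step[OF _ _ f])
        show "1 \<le> j" by (rule step.prems)
        show "\<exists>z\<in>carrier (C (Suc i)). supp_in (ideal_from (Suc j)) z \<and> D i z = g"
          if "g \<in> carrier (C i)" "supp_in (ideal_from (Suc j)) g" "is_cyc i g" for i g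
          by (rule step.hyps(3)[rule_format, OF _ that]) (use step.prems in simp)
      qed
    qed
  qed
  from this[of 1, rule_format, OF _ _ assms] show ?thesis by simp
qed

end

text \<open>The target need not be known as a complex: linearity of its differential and
  \<open>d d = 0\<close> are carried over along the bijections \<open>T\<close>. This spares a
  direct treatment of the maps between tensor products, which are unions of cosets.\<close>

lemma homology_transport:
  assumes cc: "chain_complex R C D" and C': "\<And>i. module R (C' i)"
    and T: "\<And>i. lin_map R (C i) (C' i) (T i)" and bij: "\<And>i. bij_betw (T i) (carrier (C i)) (carrier (C' i))"
    and comm: "\<And>i x. x \<in> carrier (C (Suc i)) \<Longrightarrow> D' i (T (Suc i) x) = T i (D i x)"
  shows "chain_complex R C' D'" and "mod_isomorphic R (homology C D i) (homology C' D' i)"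
proof -
  note L = cc_module[OF cc, THEN module_imp_lmod] C'[THEN module_imp_lmod]
  have ex: "\<exists>x\<in>carrier (C i). y = T i x" if "y \<in> carrier (C' i)" for i y
    using bij[of i] that by (auto simp: bij_betw_def)
  have Dc: "x \<in> carrier (C (Suc i)) \<Longrightarrow> D i x \<in> carrier (C i)" for i x
    by (rule lin_map_closed[OF cc_lin[OF cc]])
  have T0: "T i \<zero>\<^bsub>C i\<^esub> = \<zero>\<^bsub>C' i\<^esub>" for i by (rule lin_map_zero[OF L T])
  show cc': "chain_complex R C' D'"
    unfolding chain_complex_def
  proof (intro conjI allI ballI C')
    fix i
    interpret Ci: lmod R "C (Suc i)" by (rule L)
    show "lin_map R (C' (Suc i)) (C' i) (D' i)"
    proof (rule lin_mapI)
      fix x assume "x \<in> carrier (C' (Suc i))"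
      then obtain u where "u \<in> carrier (C (Suc i))" "x = T (Suc i) u" using ex by blast
      then show "D' i x \<in> carrier (C' i)" using lin_map_closed[OF T Dc] by (simp add: comm)
    next
      fix x y assume "x \<in> carrier (C' (Suc i))" "y \<in> carrier (C' (Suc i))"
      then obtain u v where u: "u \<in> carrier (C (Suc i))" "x = T (Suc i) u" and v: "v \<in> carrier (C (Suc i))" "y = T (Suc i) v"
        using ex by metis
      have "D' i (T (Suc i) (u \<oplus>\<^bsub>C (Suc i)\<^esub> v)) = T i (D i u) \<oplus>\<^bsub>C' i\<^esub> T i (D i v)"
        using u v comm[of "u \<oplus>\<^bsub>C (Suc i)\<^esub> v" i] lin_map_add[OF cc_lin[OF cc]] lin_map_add[OF T Dc Dc] by simp
      then show "D' i (x \<oplus>\<^bsub>C' (Suc i)\<^esub> y) = D' i x \<oplus>\<^bsub>C' i\<^esub> D' i y"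
        using u v by (simp add: comm lin_map_add[OF T])
    next
      fix a x assume a: "a \<in> carrier R" and "x \<in> carrier (C' (Suc i))"
      then obtain u where u: "u \<in> carrier (C (Suc i))" "x = T (Suc i) u" using ex by blast
      have "D' i (T (Suc i) (a \<odot>\<^bsub>C (Suc i)\<^esub> u)) = a \<odot>\<^bsub>C' i\<^esub> T i (D i u)"
        using u a comm[of "a \<odot>\<^bsub>C (Suc i)\<^esub> u" i] lin_map_smult[OF cc_lin[OF cc]] lin_map_smult[OF T a Dc] by simp
      then show "D' i (a \<odot>\<^bsub>C' (Suc i)\<^esub> x) = a \<odot>\<^bsub>C' i\<^esub> D' i x"
        using u a by (simp add: comm lin_map_smult[OF T])
    qed
    fix x assume "x \<in> carrier (C' (Suc (Suc i)))"
    then obtain u where u: "u \<in> carrier (C (Suc (Suc i)))" "x = T (Suc (Suc i)) u" using ex by blast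
    then show "D' i (D' (Suc i) x) = \<zero>\<^bsub>C' i\<^esub>"
      using comm[OF Dc] cc_comp[OF cc] T0 by (simp add: comm)
  qed
  have inj: "x = y" if "T i x = T i y" "x \<in> carrier (C i)" "y \<in> carrier (C i)" for i x y
    using that bij[of i] by (auto simp: bij_betw_def inj_on_def)
  show "mod_isomorphic R (homology C D i) (homology C' D' i)"
  proof (rule homology_mod_isomorphic[OF cc cc' T comm])
    fix x assume x: "x \<in> cycles C D i" and "T i x \<in> D' i ` carrier (C' (Suc i))"
    then obtain v where v: "v \<in> carrier (C' (Suc i))" "T i x = D' i v" by blast
    obtain u where u: "u \<in> carrier (C (Suc i))" "v = T (Suc i) u" using ex[OF v(1)] by (rule bexE)
    have "T i x = T i (D i u)" using v u comm[OF u(1)] by (simp only:)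
    moreover have "x \<in> carrier (C i)" using x cycles_subset[OF cc] by blast
    ultimately have "x = D i u" using inj Dc[OF u(1)] by (simp only:)
    then show "x \<in> D i ` carrier (C (Suc i))" using u by blast
  next
    fix y assume y: "y \<in> cycles C' D' i"
    then have "y \<in> carrier (C' i)" using cycles_subset[OF cc'] by blast
    then obtain x where x: "x \<in> carrier (C i)" "y = T i x" using ex by blast
    have a: "x \<in> cycles C D i"
    proof (cases i)
      case (Suc j)
      interpret Cj: lmod R "C j" by (rule L)
      have "T j (D j x) = T j \<zero>\<^bsub>C j\<^esub>" using y x comm[of x j] T0 Suc by simp
      then have "D j x = \<zero>\<^bsub>C j\<^esub>" using inj[of j] Dc[of x j] x Suc by simp
      then show ?thesis using x Suc by simp
    qed (use x in simp)
    have b: "y = D' i \<zero>\<^bsub>C' (Suc i)\<^esub> \<oplus>\<^bsub>C' i\<^esub> T i x"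
    proof -
      interpret Ci: lmod R "C' i" by (rule L)
      show ?thesis using lin_map_zero[OF L(2) L(2) cc_lin[OF cc']] x lin_map_closed[OF T x(1)] by simp
    qed
    have z: "\<zero>\<^bsub>C' (Suc i)\<^esub> \<in> carrier (C' (Suc i))"
      by (rule abelian_monoid.zero_closed[OF abelian_group.axioms(1)[OF lmod.axioms(2)[OF L(2)]]])
    show "\<exists>x\<in>cycles C D i. \<exists>b\<in>carrier (C' (Suc i)). y = D' i b \<oplus>\<^bsub>C' i\<^esub> T i x"
      by (rule bexI[of _ x], rule bexI[of _ "\<zero>\<^bsub>C' (Suc i)\<^esub>"]) (rule a b z)+
  qed
qed

section \<open>Reduction modulo the ideal of positive rank\<close>

context twisted_algebra
begin

lemma phi_closed: "h \<in> carrier H \<Longrightarrow> phi h \<in> M" "h \<in> carrier H \<Longrightarrow> rk (phi h) = 0"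
  using phi_bij by (auto simp: bij_betw_def)

lemma FA_minus_zero:
  assumes f: "f \<in> carrier (FA Y)"
  shows "f \<ominus>\<^bsub>FA Y\<^esub> \<zero>\<^bsub>FA Y\<^esub> = f"
proof -
  interpret F: lmod A "FA Y" by (rule FA_lmod)
  show ?thesis
    using F.M.minus_add_cancel[OF f F.M.zero_closed] F.M.r_zero[OF F.M.minus_closed[OF f F.M.zero_closed]]
    by (rule trans[OF sym, rotated])
qed

lemma phi_inj: "g \<in> carrier H \<Longrightarrow> h \<in> carrier H \<Longrightarrow> phi g = phi h \<longleftrightarrow> g = h"
  using phi_bij by (auto simp: bij_betw_def inj_on_def)

lemma phi_surj: "x \<in> M \<Longrightarrow> rk x = 0 \<Longrightarrow> \<exists>h\<in>carrier H. x = phi h"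
  using phi_bij by (auto simp: bij_betw_def)

text \<open>The quotient map of \<open>FA Y\<close> by its part of positive rank: the coefficients
  at elements of rank 0 are kept and read as coefficients of group elements.\<close>

definition red :: "('y \<Rightarrow> 'x \<Rightarrow> 'k) \<Rightarrow> 'h \<times> 'y \<Rightarrow> 'k" where
  "red f = (\<lambda>(h, y). if h \<in> carrier H then f y (phi h) else \<zero>\<^bsub>k\<^esub>)"

text \<open>The section of \<open>red\<close> that extends by zero to positive rank. In general it
  does not respect the action of \<open>A\<close>; that \<open>dhat\<close> and \<open>ahat\<close>
  nevertheless have the expected values on all representatives is \<open>dhat_red\<close> and
  \<open>ahat_red\<close>.\<close>

definition iota :: "('h \<times> 'y \<Rightarrow> 'k) \<Rightarrow> 'y \<Rightarrow> 'x \<Rightarrow> 'k" where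
  "iota g = (\<lambda>y m. if m \<in> phi ` carrier H then g (inv_into (carrier H) phi m, y) else \<zero>\<^bsub>k\<^esub>)"

lemma inv_phi: "h \<in> carrier H \<Longrightarrow> inv_into (carrier H) phi (phi h) = h"
  using phi_bij by (simp add: bij_betw_def inv_into_f_f)

lemma red_closed:
  assumes f: "f \<in> carrier (FA Y)"
  shows "red f \<in> carrier (FH Y)"
proof (rule k.free_moduleI)
  let ?S = "(\<Union>y\<in>{y. f y \<noteq> \<zero>\<^bsub>A\<^esub>}. (\<lambda>m. (inv_into (carrier H) phi m, y)) ` {m. f y m \<noteq> \<zero>\<^bsub>k\<^esub>}) \<inter> carrier H \<times> Y"
  show "finite ?S"
    using free_module_finite[OF f] free_module_finite[OF FA_value[OF f]] by (intro finite_Int disjI1 finite_UN_I finite_imageI)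
  show "?S \<subseteq> carrier H \<times> Y" by blast
  show "red f z \<in> carrier k" for z using f by (auto simp: red_def split: prod.split)
  show "red f z = \<zero>\<^bsub>k\<^esub>" if z: "z \<notin> ?S" for z
  proof (rule ccontr)
    assume n: "red f z \<noteq> \<zero>\<^bsub>k\<^esub>"
    obtain h y where hy: "z = (h, y)" by (cases z)
    have h: "h \<in> carrier H" "f y (phi h) \<noteq> \<zero>\<^bsub>k\<^esub>" using n by (auto simp: red_def hy split: if_splits)
    then have fy: "f y \<noteq> \<zero>\<^bsub>A\<^esub>" by auto
    then have "y \<in> Y" using free_module_support[OF f] by blast
    moreover have "z = (\<lambda>m. (inv_into (carrier H) phi m, y)) (phi h)" using h by (simp add: hy inv_phi)
    ultimately have "z \<in> ?S" using fy h hy by (intro IntI UN_I[of y] image_eqI[of _ _ "phi h"]) auto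
    then show False using z by blast
  qed
qed

lemma iota_closed:
  assumes g: "g \<in> carrier (FH Y)"
  shows "iota g \<in> carrier (FA Y)"
proof (rule A.free_moduleI)
  let ?S = "snd ` {z. g z \<noteq> \<zero>\<^bsub>k\<^esub>}"
  show "finite ?S" using free_module_finite[OF g] by blast
  show "?S \<subseteq> Y" using free_module_support[OF g] by auto
  show "iota g y \<in> carrier A" for y
    unfolding A_simps
  proof (rule k.free_moduleI)
    let ?T = "phi ` (fst ` {z. g z \<noteq> \<zero>\<^bsub>k\<^esub>})"
    show "finite ?T" using free_module_finite[OF g] by blast
    show "?T \<subseteq> M" using free_module_support[OF g] phi_closed(1) by force
    show "iota g y m \<in> carrier k" for m using g by (simp add: iota_def)
    show "iota g y m = \<zero>\<^bsub>k\<^esub>" if m: "m \<notin> ?T" for m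
    proof (rule ccontr)
      assume "iota g y m \<noteq> \<zero>\<^bsub>k\<^esub>"
      then obtain h where h: "h \<in> carrier H" "m = phi h" "g (h, y) \<noteq> \<zero>\<^bsub>k\<^esub>"
        by (auto simp: iota_def inv_phi split: if_splits)
      then have "phi (fst (h, y)) \<in> ?T" by blast
      then show False using m h by simp
    qed
  qed
  show "iota g y = \<zero>\<^bsub>A\<^esub>" if "y \<notin> ?S" for y
  proof -
    have "g (h, y) = \<zero>\<^bsub>k\<^esub>" for h using that by force
    then show ?thesis by (simp add: iota_def fun_eq_iff)
  qed
qed

lemma red_iota: "g \<in> carrier (FH Y) \<Longrightarrow> red (iota g) = g"
  using free_module_outside[of g k "carrier H \<times> Y"] by (auto simp: red_def iota_def inv_phi fun_eq_iff)

lemma red_add: "red (f \<oplus>\<^bsub>FA Y\<^esub> g) = red f \<oplus>\<^bsub>FH Y\<^esub> red g"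
  by (auto simp: red_def fun_eq_iff)

lemma red_minus:
  assumes "f \<in> carrier (FA Y)" "g \<in> carrier (FA Y)"
  shows "red (f \<ominus>\<^bsub>FA Y\<^esub> g) = red f \<ominus>\<^bsub>FH Y\<^esub> red g"
  unfolding k.free_module_minus[OF red_closed[OF assms(1)] red_closed[OF assms(2)]]
  using assms by (auto simp: red_def FA_minus fun_eq_iff k.minus_eq)

lemma scalar_mult: "s \<in> carrier k \<Longrightarrow> a \<in> carrier (FX M) \<Longrightarrow> (s \<odot>\<^bsub>A\<^esub> b e) \<otimes>\<^bsub>A\<^esub> a = s \<odot>\<^bsub>FX M\<^esub> a"
  using lin_map_smult[OF A_mult_lin_left, of a s "b e"] A_one_left[of a] by (simp del: free_module_simps)

lemma scalar_closed: "s \<in> carrier k \<Longrightarrow> s \<odot>\<^bsub>A\<^esub> b e \<in> carrier A"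
  using lmod.smult_closed[OF FX_lmod, of s "b e" M] by simp

lemma eps_scalar: "s \<in> carrier k \<Longrightarrow> eps (s \<odot>\<^bsub>A\<^esub> b e) = s"
  using lin_map_smult[OF eps_lin, of s "b e"] by (simp add: eps_one del: free_module_simps)

lemma red_scalar:
  assumes "s \<in> carrier k" "f \<in> carrier (FA Y)"
  shows "red ((s \<odot>\<^bsub>A\<^esub> b e) \<odot>\<^bsub>FA Y\<^esub> f) = s \<odot>\<^bsub>FH Y\<^esub> red f"
proof -
  have "((s \<odot>\<^bsub>A\<^esub> b e) \<odot>\<^bsub>FA Y\<^esub> f) y m = s \<otimes>\<^bsub>k\<^esub> f y m" for y m
    using scalar_mult[OF assms(1) FA_value[OF assms(2)], of y] by simp
  then show ?thesis using assms by (simp add: red_def fun_eq_iff del: free_module_simps(3), simp)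
qed

lemma eval_lin: "lin_map k (FX Z) (scalar_module k) (\<lambda>f. f z)"
  by (rule lin_mapI) auto

text \<open>Multiplication by \<open>phi h\<close> translates the elements of rank 0 and keeps
  positive ranks positive, so the coefficient at \<open>phi g\<close> can only come from one
  element.\<close>

lemma lmul_phi:
  assumes h: "h \<in> carrier H" and g: "g \<in> carrier H" and a: "a \<in> carrier (FX M)"
  shows "lmul (phi h) a (phi g) = a (phi (inv\<^bsub>H\<^esub> h \<otimes>\<^bsub>H\<^esub> g))"
proof (rule k.lin_map_free_eqI[OF k.scalar_module_lmod lin_map_comp[OF lmul_lin eval_lin] eval_lin _ a])
  show "phi h \<in> M" using phi_closed h by blast
  fix x assume x: "x \<in> M"
  show "lmul (phi h) (b x) (phi g) = b x (phi (inv\<^bsub>H\<^esub> h \<otimes>\<^bsub>H\<^esub> g))"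
  proof (cases "rk x = 0")
    case True
    then obtain x' where x': "x' \<in> carrier H" "x = phi x'" using phi_surj x by blast
    have "g = h \<otimes>\<^bsub>H\<^esub> x' \<longleftrightarrow> inv\<^bsub>H\<^esub> h \<otimes>\<^bsub>H\<^esub> g = x'"
      using h g x' H.inv_solve_left'[of x' h g] by simp
    then have "b (phi (h \<otimes>\<^bsub>H\<^esub> x')) (phi g) = b x (phi (inv\<^bsub>H\<^esub> h \<otimes>\<^bsub>H\<^esub> g))"
      using h g x' by (simp add: basis_vec_def phi_inj)
    then show ?thesis
      using h g x x' c_unit[of "phi h" "phi x'"] phi_closed
      by (simp add: lmul_basis phi_mult fun_cong[OF one_basis])
  next
    case False
    then have "rk (mu (phi h) x) \<noteq> 0" using rk_right[of "phi h" x] x h phi_closed by auto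
    then have "mu (phi h) x \<noteq> phi g" using phi_closed(2)[OF g] by metis
    moreover have "x \<noteq> phi (inv\<^bsub>H\<^esub> h \<otimes>\<^bsub>H\<^esub> g)" using False phi_closed(2)[of "inv\<^bsub>H\<^esub> h \<otimes>\<^bsub>H\<^esub> g"] h g by auto
    ultimately have "b (mu (phi h) x) (phi g) = \<zero>\<^bsub>k\<^esub>" "b x (phi (inv\<^bsub>H\<^esub> h \<otimes>\<^bsub>H\<^esub> g)) = \<zero>\<^bsub>k\<^esub>"
      by (auto simp: basis_vec_def)
    then show ?thesis using h x phi_closed by (simp add: lmul_basis)
  qed
qed

lemma red_hact:
  assumes h: "h \<in> carrier H" and f: "f \<in> carrier (FA Y)"
  shows "red (b (phi h) \<odot>\<^bsub>FA Y\<^esub> f) = hact h (red f)"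
  using h lmul_phi[OF h _ FA_value[OF f]] basis_mult[OF phi_closed(1)[OF h] FA_value[OF f]]
  by (auto simp: red_def hact_def fun_eq_iff)

lemma red_zero_iff:
  assumes f: "f \<in> carrier (FA Y)"
  shows "red f = (\<lambda>z. \<zero>\<^bsub>k\<^esub>) \<longleftrightarrow> supp_in (ideal_from 1) f"
proof
  assume r: "red f = (\<lambda>z. \<zero>\<^bsub>k\<^esub>)"
  show "supp_in (ideal_from 1) f"
    unfolding supp_in_def
  proof (intro allI impI, rule ccontr)
    fix y m assume n: "f y m \<noteq> \<zero>\<^bsub>k\<^esub>" and "m \<notin> ideal_from 1"
    then have "rk m = 0" "m \<in> M" using FA_outside[OF f] by auto
    then obtain h where "h \<in> carrier H" "m = phi h" using phi_surj by blast
    then show False using n fun_cong[OF r, of "(h, y)"] by (simp add: red_def)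
  qed
next
  assume "supp_in (ideal_from 1) f"
  then have "f y (phi h) = \<zero>\<^bsub>k\<^esub>" if "h \<in> carrier H" for h y
    using phi_closed(2)[OF that] by (force simp: supp_in_def)
  then show "red f = (\<lambda>z. \<zero>\<^bsub>k\<^esub>)" by (auto simp: red_def)
qed

text \<open>The difference of \<open>f\<close> and \<open>g\<close> has positive rank, and the
  differential preserves positive rank because it multiplies coefficients on the right.\<close>

lemma red_D_cong:
  assumes f: "f \<in> carrier (C (Suc i))" and g: "g \<in> carrier (C (Suc i))" and eq: "red f = red g"
  shows "red (D i f) = red (D i g)"
proof -
  interpret F: lmod A "C (Suc i)" by (rule FA_lmod)
  have fg: "f \<ominus>\<^bsub>C (Suc i)\<^esub> g \<in> carrier (C (Suc i))" using f g by simp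
  have "red (f \<ominus>\<^bsub>C (Suc i)\<^esub> g) = (\<lambda>z. \<zero>\<^bsub>k\<^esub>)"
    using red_closed[OF g] by (simp add: red_minus[OF f g] eq k.free_module_minus k.minus_eq k.r_neg)
  then have "supp_in (ideal_from 1) (f \<ominus>\<^bsub>C (Suc i)\<^esub> g)" using red_zero_iff[OF fg] by simp
  then have "supp_in (ideal_from 1) (D i (f \<ominus>\<^bsub>C (Suc i)\<^esub> g))"
    by (rule supp_in_lin_map[OF D_lin fg]) (rule ideal_from_right)
  then have "red (D i (f \<ominus>\<^bsub>C (Suc i)\<^esub> g)) = (\<lambda>z. \<zero>\<^bsub>k\<^esub>)" using red_zero_iff[OF D_closed[OF fg]] by simp
  then have "red (D i f) \<ominus>\<^bsub>FH (gens i)\<^esub> red (D i g) = \<zero>\<^bsub>FH (gens i)\<^esub>"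
    using lin_map_minus[OF FA_lmod FA_lmod D_lin f g] red_minus[OF D_closed[OF f] D_closed[OF g]] by simp
  then show ?thesis
    using abelian_group.minus_eq_zero_iff[OF FH_abelian_group red_closed[OF D_closed[OF f]] red_closed[OF D_closed[OF g]]]
    by simp
qed

definition dhat :: "nat \<Rightarrow> ('h \<times> ('x \<Rightarrow> 'k, 'k) gen \<Rightarrow> 'k) \<Rightarrow> 'h \<times> ('x \<Rightarrow> 'k, 'k) gen \<Rightarrow> 'k" where
  "dhat i g = red (D i (iota g))"

definition ahat :: "('h \<times> ('x \<Rightarrow> 'k, 'k) gen \<Rightarrow> 'k) \<Rightarrow> 'k" where
  "ahat g = aug (iota g)"

lemma dhat_red: "f \<in> carrier (C (Suc i)) \<Longrightarrow> dhat i (red f) = red (D i f)"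
  unfolding dhat_def by (rule red_D_cong) (simp_all add: iota_closed red_closed red_iota[OF red_closed])

lemma ahat_red:
  assumes f: "f \<in> carrier (C 0)"
  shows "ahat (red f) = aug f"
proof -
  let ?g = "iota (red f)"
  have g: "?g \<in> carrier (C 0)" by (rule iota_closed[OF red_closed[OF f]])
  interpret F: lmod A "C 0" by (rule FA_lmod)
  have fg: "?g \<ominus>\<^bsub>C 0\<^esub> f \<in> carrier (C 0)" using f g by simp
  have "red (?g \<ominus>\<^bsub>C 0\<^esub> f) = (\<lambda>z. \<zero>\<^bsub>k\<^esub>)"
    using red_closed[OF f] by (simp add: red_minus[OF g f] red_iota[OF red_closed[OF f]] k.free_module_minus k.minus_eq k.r_neg)
  then have "aug (?g \<ominus>\<^bsub>C 0\<^esub> f) = \<zero>\<^bsub>k\<^esub>" using red_zero_iff[OF fg] aug_ideal[OF fg] by simp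
  then have "aug ?g \<ominus>\<^bsub>N\<^esub> aug f = \<zero>\<^bsub>N\<^esub>" using lin_map_minus[OF FA_lmod N_lmod aug_lin_A g f] by simp
  then show ?thesis
    using abelian_group.minus_eq_zero_iff[OF lmod.axioms(2)[OF N_lmod] lin_map_closed[OF aug_lin_A g] lin_map_closed[OF aug_lin_A f]]
    by (simp add: ahat_def)
qed

lemma red_ex: "g \<in> carrier (FH Y) \<Longrightarrow> \<exists>f\<in>carrier (FA Y). g = red f"
  by (rule bexI[OF _ iota_closed]) (simp_all add: red_iota)

text \<open>Every element of \<open>FH Y\<close> is some \<open>red f\<close>, and both kinds of
  scalars come from \<open>A\<close>: \<open>s\<close> acts as a multiple of the unit and
  \<open>h\<close> as the basis vector at \<open>phi h\<close>. So linearity over \<open>A\<close>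
  descends to equivariance.\<close>

lemma lin_map_redI:
  assumes L: "lin_map A (FA Y) (FA Z) L" and L': "\<And>f. f \<in> carrier (FA Y) \<Longrightarrow> L' (red f) = red (L f)"
  shows "equivariant Y Z L'"
  unfolding equivariant_def
proof (intro conjI ballI lin_mapI)
  interpret F: lmod A "FA Y" by (rule FA_lmod)
  note Lc = lin_map_closed[OF L]
  fix g assume "g \<in> carrier (FH Y)"
  then obtain f where f: "f \<in> carrier (FA Y)" "g = red f" using red_ex by blast
  show "L' g \<in> carrier (FH Z)" using f by (simp add: L' red_closed[OF Lc])
  {
    fix g' assume "g' \<in> carrier (FH Y)"
    then obtain f' where f': "f' \<in> carrier (FA Y)" "g' = red f'" using red_ex by blast
    have "L' (red (f \<oplus>\<^bsub>FA Y\<^esub> f')) = red (L f \<oplus>\<^bsub>FA Z\<^esub> L f')"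
      using f f' L'[OF F.M.a_closed] lin_map_add[OF L] by simp
    then show "L' (g \<oplus>\<^bsub>FH Y\<^esub> g') = L' g \<oplus>\<^bsub>FH Z\<^esub> L' g'"
      using f f' unfolding red_add by (simp only: L')
  next
    fix s assume s: "s \<in> carrier k"
    have "L' (red ((s \<odot>\<^bsub>A\<^esub> b e) \<odot>\<^bsub>FA Y\<^esub> f)) = red ((s \<odot>\<^bsub>A\<^esub> b e) \<odot>\<^bsub>FA Z\<^esub> L f)"
      using L'[OF F.smult_closed[OF scalar_closed[OF s] f(1)]] lin_map_smult[OF L scalar_closed[OF s] f(1)] by (simp only:)
    then show "L' (s \<odot>\<^bsub>FH Y\<^esub> g) = s \<odot>\<^bsub>FH Z\<^esub> L' g"
      using f unfolding red_scalar[OF s f(1)] red_scalar[OF s Lc[OF f(1)]] by (simp only: L')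
  next
    fix h assume h: "h \<in> carrier H"
    note bh = basis_A_closed[OF phi_closed(1)[OF h]]
    have "L' (red (b (phi h) \<odot>\<^bsub>FA Y\<^esub> f)) = red (b (phi h) \<odot>\<^bsub>FA Z\<^esub> L f)"
      using L'[OF F.smult_closed[OF bh f(1)]] lin_map_smult[OF L bh f(1)] by (simp only:)
    then show "L' (hact h g) = hact h (L' g)"
      using f unfolding red_hact[OF h f(1)] red_hact[OF h Lc[OF f(1)]] by (simp only: L')
  }
qed

lemma dhat_equivariant: "equivariant (gens (Suc i)) (gens i) (dhat i)"
  by (rule lin_map_redI[OF D_lin dhat_red])

text \<open>The predicate \<open>P\<close> stands for being a cycle of the reduced complex. The
  hypothesis \<open>cyc\<close> lifts such a cycle to a genuine one after subtracting an element of
  positive rank, which \<open>red\<close> does not see; genuine cycles are boundaries.\<close>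

lemma dhat_exact:
  assumes cyc: "\<And>f. f \<in> carrier (C i) \<Longrightarrow> P (red f) \<longleftrightarrow> (\<exists>z\<in>carrier (C i). supp_in (ideal_from 1) z \<and> is_cyc i (f \<ominus>\<^bsub>C i\<^esub> z))"
    and g: "g \<in> carrier (FH (gens i))"
  shows "P g \<longleftrightarrow> g \<in> dhat i ` carrier (FH (gens (Suc i)))"
proof -
  interpret F: lmod A "C i" by (rule FA_lmod)
  obtain f where f: "f \<in> carrier (C i)" "g = red f" using red_ex[OF g] by blast
  have red_diff: "red (f \<ominus>\<^bsub>C i\<^esub> z) = red f" if "z \<in> carrier (C i)" "supp_in (ideal_from 1) z" for z
    using that f red_closed[OF f(1)] red_zero_iff[OF that(1)]
    by (simp add: red_minus k.free_module_minus[OF red_closed k.free_module_zero_closed] k.minus_eq)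
  show ?thesis
  proof
    assume "P g"
    then obtain z where z: "z \<in> carrier (C i)" "supp_in (ideal_from 1) z" "is_cyc i (f \<ominus>\<^bsub>C i\<^esub> z)"
      using cyc f by blast
    then obtain u where u: "u \<in> carrier (C (Suc i))" "f \<ominus>\<^bsub>C i\<^esub> z = D i u"
      using f is_cyc_iff[of "f \<ominus>\<^bsub>C i\<^esub> z" i] by auto
    then have "g = dhat i (red u)" using red_diff[OF z(1,2)] f by (simp add: dhat_red)
    then show "g \<in> dhat i ` carrier (FH (gens (Suc i)))" using red_closed[OF u(1)] by blast
  next
    assume "g \<in> dhat i ` carrier (FH (gens (Suc i)))"
    then obtain u where u: "u \<in> carrier (C (Suc i))" "g = red (D i u)" using red_ex dhat_red by force
    have "supp_in (ideal_from 1) \<zero>\<^bsub>C i\<^esub>" by (simp add: supp_in_def)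
    moreover have "is_cyc i (D i u \<ominus>\<^bsub>C i\<^esub> \<zero>\<^bsub>C i\<^esub>)"
      using is_cyc_D[OF u(1)] FA_minus_zero[OF D_closed[OF u(1)]] by simp
    ultimately show "P g" using cyc[OF D_closed[OF u(1)]] u F.M.zero_closed by blast
  qed
qed

lemma canonical_free_resolution: "free_resolution k H gens dhat ahat"
proof
  show "equivariant (gens (Suc i)) (gens i) (dhat i)" for i by (rule dhat_equivariant)
  show "lin_map k (FH (gens 0)) (scalar_module k) ahat"
  proof (rule lin_mapI)
    fix g assume "g \<in> carrier (FH (gens 0))"
    then obtain f where f: "f \<in> carrier (C 0)" "g = red f" using red_ex by blast
    interpret F: lmod A "C 0" by (rule FA_lmod)
    show "ahat g \<in> carrier (scalar_module k)" using lin_map_closed[OF aug_lin_A f(1)] f by (simp add: ahat_red)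
    {
      fix g' assume "g' \<in> carrier (FH (gens 0))"
      then obtain f' where f': "f' \<in> carrier (C 0)" "g' = red f'" using red_ex by blast
      have "ahat (red (f \<oplus>\<^bsub>C 0\<^esub> f')) = aug f \<oplus>\<^bsub>k\<^esub> aug f'"
        using ahat_red[OF F.M.a_closed[OF f(1) f'(1)]] lin_map_add[OF aug_lin_A f(1) f'(1)] by (simp only: N_simps)
      then show "ahat (g \<oplus>\<^bsub>FH (gens 0)\<^esub> g') = ahat g \<oplus>\<^bsub>scalar_module k\<^esub> ahat g'"
        using f f' unfolding red_add by (simp only: ahat_red scalar_module_simps)
    next
      fix s assume s: "s \<in> carrier k"
      have "ahat (red ((s \<odot>\<^bsub>A\<^esub> b e) \<odot>\<^bsub>C 0\<^esub> f)) = s \<otimes>\<^bsub>k\<^esub> aug f"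
        using ahat_red[OF F.smult_closed[OF scalar_closed[OF s] f(1)]] lin_map_smult[OF aug_lin_A scalar_closed[OF s] f(1)]
        by (simp only: N_simps eps_scalar[OF s])
      then show "ahat (s \<odot>\<^bsub>FH (gens 0)\<^esub> g) = s \<odot>\<^bsub>scalar_module k\<^esub> ahat g"
        using f unfolding red_scalar[OF s f(1)] by (simp only: ahat_red scalar_module_simps)
    }
  qed
  show "ahat (hact h g) = ahat g" if h: "h \<in> carrier H" and g: "g \<in> carrier (FH (gens 0))" for h g
  proof -
    obtain f where f: "f \<in> carrier (C 0)" "g = red f" using red_ex[OF g] by blast
    note bh = basis_A_closed[OF phi_closed(1)[OF h]]
    have "ahat (red (b (phi h) \<odot>\<^bsub>C 0\<^esub> f)) = \<one>\<^bsub>k\<^esub> \<otimes>\<^bsub>k\<^esub> aug f"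
      using ahat_red[OF FA_smult_closed[OF bh f(1)]] lin_map_smult[OF aug_lin_A bh f(1)] phi_closed[OF h]
      by (simp only: N_simps eps_basis U_iff if_True simp_thms)
    then show ?thesis using f lin_map_closed[OF aug_lin_A f(1)]
      unfolding red_hact[OF h f(1)] by (simp add: ahat_red)
  qed
  show "\<exists>u\<in>carrier (FH (gens 0)). ahat u = \<one>\<^bsub>k\<^esub>"
  proof -
    have "basis_vec A (Base \<one>\<^bsub>k\<^esub>) \<in> carrier (C 0)" by (simp add: gens_def)
    then show ?thesis using red_closed ahat_red aug_basis[of "\<one>\<^bsub>k\<^esub>"] by force
  qed
next
  fix g assume g: "g \<in> carrier (FH (gens 0))"
  show "ahat g = \<zero>\<^bsub>k\<^esub> \<longleftrightarrow> g \<in> dhat 0 ` carrier (FH (gens (Suc 0)))"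
  proof (rule dhat_exact[OF _ g])
    fix f assume f: "f \<in> carrier (C 0)"
    interpret F: lmod A "C 0" by (rule FA_lmod)
    show "ahat (red f) = \<zero>\<^bsub>k\<^esub> \<longleftrightarrow> (\<exists>z\<in>carrier (C 0). supp_in (ideal_from 1) z \<and> is_cyc 0 (f \<ominus>\<^bsub>C 0\<^esub> z))"
    proof
      assume "ahat (red f) = \<zero>\<^bsub>k\<^esub>"
      then have "is_cyc 0 (f \<ominus>\<^bsub>C 0\<^esub> \<zero>\<^bsub>C 0\<^esub>)"
        using FA_minus_zero[OF f] f by (simp add: ahat_red is_cyc_def)
      moreover have "supp_in (ideal_from 1) \<zero>\<^bsub>C 0\<^esub>" by (simp add: supp_in_def)
      ultimately show "\<exists>z\<in>carrier (C 0). supp_in (ideal_from 1) z \<and> is_cyc 0 (f \<ominus>\<^bsub>C 0\<^esub> z)"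
        using F.M.zero_closed by blast
    next
      assume "\<exists>z\<in>carrier (C 0). supp_in (ideal_from 1) z \<and> is_cyc 0 (f \<ominus>\<^bsub>C 0\<^esub> z)"
      then obtain z where z: "z \<in> carrier (C 0)" "supp_in (ideal_from 1) z" "is_cyc 0 (f \<ominus>\<^bsub>C 0\<^esub> z)" by blast
      interpret N: lmod A N by (rule N_lmod)
      have "aug f \<ominus>\<^bsub>N\<^esub> aug z = \<zero>\<^bsub>N\<^esub>"
        using z lin_map_minus[OF FA_lmod N_lmod aug_lin_A f z(1)] by (simp add: is_cyc_def)
      then have "aug f = aug z" using N.M.minus_eq_zero_iff lin_map_closed[OF aug_lin_A] f z by blast
      then show "ahat (red f) = \<zero>\<^bsub>k\<^esub>" using f z by (simp add: ahat_red aug_ideal)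
    qed
  qed
next
  fix g i assume g: "g \<in> carrier (FH (gens (Suc i)))"
  show "dhat i g = (\<lambda>z. \<zero>\<^bsub>k\<^esub>) \<longleftrightarrow> g \<in> dhat (Suc i) ` carrier (FH (gens (Suc (Suc i))))"
  proof (rule dhat_exact[OF _ g])
    fix f assume f: "f \<in> carrier (C (Suc i))"
    interpret F: lmod A "C (Suc i)" by (rule FA_lmod)
    interpret Fi: lmod A "C i" by (rule FA_lmod)
    have Df: "D i f \<in> carrier (C i)" by (rule D_closed[OF f])
    have "dhat i (red f) = (\<lambda>z. \<zero>\<^bsub>k\<^esub>) \<longleftrightarrow> supp_in (ideal_from 1) (D i f)"
      by (simp add: dhat_red[OF f] red_zero_iff[OF Df])
    also have "\<dots> \<longleftrightarrow> (\<exists>z\<in>carrier (C (Suc i)). supp_in (ideal_from 1) z \<and> is_cyc (Suc i) (f \<ominus>\<^bsub>C (Suc i)\<^esub> z))"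
    proof
      assume "supp_in (ideal_from 1) (D i f)"
      \<comment> \<open>The point of exactness in positive rank: \<open>D i f\<close> is a cycle of
        positive rank, so it is also the boundary of some \<open>z\<close> of positive rank, and
        \<open>f - z\<close> is a cycle with the same reduction as \<open>f\<close>.\<close>
      then obtain z where z: "z \<in> carrier (C (Suc i))" "supp_in (ideal_from 1) z" "D i z = D i f"
        using ideal_exact[OF Df _ is_cyc_D[OF f]] by blast
      have "is_cyc (Suc i) (f \<ominus>\<^bsub>C (Suc i)\<^esub> z)"
        using lin_map_minus[OF FA_lmod FA_lmod D_lin f z(1)] z(3) Df
        by (simp add: is_cyc_def FA_minus k.minus_eq k.r_neg)
      then show "\<exists>z\<in>carrier (C (Suc i)). supp_in (ideal_from 1) z \<and> is_cyc (Suc i) (f \<ominus>\<^bsub>C (Suc i)\<^esub> z)"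
        using z by blast
    next
      assume "\<exists>z\<in>carrier (C (Suc i)). supp_in (ideal_from 1) z \<and> is_cyc (Suc i) (f \<ominus>\<^bsub>C (Suc i)\<^esub> z)"
      then obtain z where z: "z \<in> carrier (C (Suc i))" "supp_in (ideal_from 1) z" "is_cyc (Suc i) (f \<ominus>\<^bsub>C (Suc i)\<^esub> z)"
        by blast
      have "D i f \<ominus>\<^bsub>C i\<^esub> D i z = \<zero>\<^bsub>C i\<^esub>"
        using z lin_map_minus[OF FA_lmod FA_lmod D_lin f z(1)] by (simp add: is_cyc_def)
      then have "D i f = D i z" using Fi.M.minus_eq_zero_iff Df D_closed[OF z(1)] by blast
      moreover have "supp_in (ideal_from 1) (D i z)"
        by (rule supp_in_lin_map[OF D_lin z(1,2)]) (rule ideal_from_right)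
      ultimately show "supp_in (ideal_from 1) (D i f)" by simp
    qed
    finally show "dhat i (red f) = (\<lambda>z. \<zero>\<^bsub>k\<^esub>) \<longleftrightarrow>
        (\<exists>z\<in>carrier (C (Suc i)). supp_in (ideal_from 1) z \<and> is_cyc (Suc i) (f \<ominus>\<^bsub>C (Suc i)\<^esub> z))" .
  qed
qed

end

section \<open>The tensor product with the trivial module\<close>

context twisted_algebra
begin

text \<open>On each coefficient this is the augmentation \<open>eps\<close>. It is written through
  \<open>red\<close> so as to meet the coinvariants of the reduced resolution.\<close>

definition E :: "'y set \<Rightarrow> ('y \<Rightarrow> 'x \<Rightarrow> 'k) \<Rightarrow> 'y \<Rightarrow> 'k" where
  "E Y f = coinv Y (red f)"

lemma E_closed: "f \<in> carrier (FA Y) \<Longrightarrow> E Y f \<in> carrier (FX Y)"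
  unfolding E_def by (rule lin_map_closed[OF coinv_lin red_closed])

lemma E_add: "f \<in> carrier (FA Y) \<Longrightarrow> g \<in> carrier (FA Y) \<Longrightarrow> E Y (f \<oplus>\<^bsub>FA Y\<^esub> g) = E Y f \<oplus>\<^bsub>FX Y\<^esub> E Y g"
  unfolding E_def red_add[where Y = Y] by (rule lin_map_add[OF coinv_lin red_closed red_closed])

lemma E_scalar:
  "s \<in> carrier k \<Longrightarrow> f \<in> carrier (FA Y) \<Longrightarrow> E Y ((s \<odot>\<^bsub>A\<^esub> b e) \<odot>\<^bsub>FA Y\<^esub> f) = s \<odot>\<^bsub>FX Y\<^esub> E Y f"
  unfolding E_def red_scalar[where Y = Y] by (rule lin_map_smult[OF coinv_lin _ red_closed])

text \<open>A basis element of rank 0 acts as a translation, which \<open>coinv\<close> forgets; one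
  of positive rank is killed by \<open>red\<close>. These are the two values of \<open>eps\<close>
  on the basis.\<close>

lemma E_smult:
  assumes a: "a \<in> carrier (FX M)" and f: "f \<in> carrier (FA Y)"
  shows "E Y (a \<odot>\<^bsub>FA Y\<^esub> f) = eps a \<odot>\<^bsub>FX Y\<^esub> E Y f"
proof (rule k.lin_map_free_eqI[OF FX_lmod _ _ _ a])
  interpret F: lmod A "FA Y" by (rule FA_lmod)
  have c: "a \<in> carrier (FX M) \<Longrightarrow> a \<odot>\<^bsub>FA Y\<^esub> f \<in> carrier (FA Y)" for a
    by (rule F.smult_closed[OF _ f]) simp
  show "lin_map k (FX M) (FX Y) (\<lambda>a. E Y (a \<odot>\<^bsub>FA Y\<^esub> f))"
  proof (rule lin_mapI)
    fix a assume a: "a \<in> carrier (FX M)"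
    then have aA: "a \<in> carrier A" by simp
    show "E Y (a \<odot>\<^bsub>FA Y\<^esub> f) \<in> carrier (FX Y)" by (rule E_closed[OF c[OF a]])
    {
      fix a' assume a': "a' \<in> carrier (FX M)"
      then have aA': "a' \<in> carrier A" by simp
      have "(a \<oplus>\<^bsub>A\<^esub> a') \<odot>\<^bsub>FA Y\<^esub> f = a \<odot>\<^bsub>FA Y\<^esub> f \<oplus>\<^bsub>FA Y\<^esub> a' \<odot>\<^bsub>FA Y\<^esub> f"
        by (rule F.smult_l_distr[OF aA aA' f])
      then show "E Y ((a \<oplus>\<^bsub>FX M\<^esub> a') \<odot>\<^bsub>FA Y\<^esub> f) = E Y (a \<odot>\<^bsub>FA Y\<^esub> f) \<oplus>\<^bsub>FX Y\<^esub> E Y (a' \<odot>\<^bsub>FA Y\<^esub> f)"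
        using E_add[OF c[OF a] c[OF a']] by (simp only: A_simps)
    next
      fix s assume s: "s \<in> carrier k"
      have "(s \<odot>\<^bsub>FX M\<^esub> a) \<odot>\<^bsub>FA Y\<^esub> f = (s \<odot>\<^bsub>A\<^esub> b e) \<odot>\<^bsub>FA Y\<^esub> (a \<odot>\<^bsub>FA Y\<^esub> f)"
        using F.smult_assoc1[OF scalar_closed[OF s] aA f] scalar_mult[OF s a] by (simp only:)
      then show "E Y ((s \<odot>\<^bsub>FX M\<^esub> a) \<odot>\<^bsub>FA Y\<^esub> f) = s \<odot>\<^bsub>FX Y\<^esub> E Y (a \<odot>\<^bsub>FA Y\<^esub> f)"
        using E_scalar[OF s c[OF a]] by (simp only:)
    }
  qed
  show "lin_map k (FX M) (FX Y) (\<lambda>a. eps a \<odot>\<^bsub>FX Y\<^esub> E Y f)"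
    by (rule lmod.lin_map_scalar_smult[OF FX_lmod eps_lin E_closed[OF f]])
  fix x assume x: "x \<in> M"
  interpret G: lmod k "FX Y" by (rule FX_lmod)
  show "E Y (b x \<odot>\<^bsub>FA Y\<^esub> f) = eps (b x) \<odot>\<^bsub>FX Y\<^esub> E Y f"
  proof (cases "U x")
    case True
    then obtain h where h: "h \<in> carrier H" "x = phi h" using x phi_surj by (auto simp: U_iff)
    have "E Y (b x \<odot>\<^bsub>FA Y\<^esub> f) = E Y f"
      unfolding E_def h(2) red_hact[OF h(1) f] by (rule coinv_hact[OF h(1) red_closed[OF f]])
    then show ?thesis using G.smult_one[OF E_closed[OF f]] True x by (simp only: eps_basis if_True)
  next
    case False
    then have "1 \<le> rk x" using x by (simp add: U_iff)
    then have "supp_in (ideal_from 1) (b x \<odot>\<^bsub>FA Y\<^esub> f)"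
      using rk_left[OF x] by (intro supp_in_basis_smult[OF x f, of UNIV]) (auto simp: supp_in_def intro: le_trans)
    then have "red (b x \<odot>\<^bsub>FA Y\<^esub> f) = \<zero>\<^bsub>FH Y\<^esub>"
      using red_zero_iff[OF c] x by simp
    then have "E Y (b x \<odot>\<^bsub>FA Y\<^esub> f) = \<zero>\<^bsub>FX Y\<^esub>"
      unfolding E_def using lin_map_zero[OF FH_lmod FX_lmod coinv_lin] by (simp only:)
    then show ?thesis using G.smult_l_null[OF E_closed[OF f]] False x by (simp only: eps_basis if_False)
  qed
qed

lemma E_basis:
  assumes y: "y \<in> Y"
  shows "E Y (basis_vec A y) = b y"
proof -
  have "b e (phi h) = (if h = \<one>\<^bsub>H\<^esub> then \<one>\<^bsub>k\<^esub> else \<zero>\<^bsub>k\<^esub>)" if "h \<in> carrier H" for h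
    using phi_inj[OF that H.one_closed] by (simp add: basis_vec_def phi_one)
  then have "red (basis_vec A y) = b (\<one>\<^bsub>H\<^esub>, y)"
    by (auto simp: red_def basis_vec_def[of A] basis_vec_def[of k "(\<one>\<^bsub>H\<^esub>, y)"] fun_eq_iff)
  then show ?thesis using y by (simp add: E_def coinv_basis)
qed

abbreviation FT :: "'y set \<Rightarrow> ('k, 'k \<times> ('y \<Rightarrow> 'x \<Rightarrow> 'k) \<Rightarrow> 'k) module" where
  "FT Y \<equiv> free_module k (carrier k \<times> carrier (FA Y))"

text \<open>The candidate for the isomorphism, before the tensor relations are divided out: a pair
  \<open>(s, q)\<close> is sent to \<open>s\<close> times \<open>E Y q\<close>. The lemmas below
  identify its kernel with \<open>rels Y\<close>.\<close>

definition Phi :: "'y set \<Rightarrow> ('k \<times> ('y \<Rightarrow> 'x \<Rightarrow> 'k) \<Rightarrow> 'k) \<Rightarrow> 'y \<Rightarrow> 'k" where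
  "Phi Y = lin_ext k (FX Y) (\<lambda>(s, q). s \<odot>\<^bsub>FX Y\<^esub> E Y q)"

definition sec :: "'y set \<Rightarrow> ('y \<Rightarrow> 'k) \<Rightarrow> ('k \<times> ('y \<Rightarrow> 'x \<Rightarrow> 'k) \<Rightarrow> 'k)" where
  "sec Y = lin_ext k (FT Y) (\<lambda>y. b (\<one>\<^bsub>k\<^esub>, basis_vec A y))"

lemma FT_lmod: "lmod k (FT Y)" and FT_module: "module k (FT Y)"
  by (rule k.free_module_lmod k.lmod_imp_module)+

lemma sE_closed: "s \<in> carrier k \<Longrightarrow> q \<in> carrier (FA Y) \<Longrightarrow> s \<odot>\<^bsub>FX Y\<^esub> E Y q \<in> carrier (FX Y)"
  by (rule lmod.smult_closed[OF FX_lmod _ E_closed])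

lemma Phi_lin: "lin_map k (FT Y) (FX Y) (Phi Y)"
  unfolding Phi_def
  by (rule k.lin_ext_lin_map[OF FX_lmod]) (use sE_closed in \<open>auto simp del: free_module_simps\<close>)

lemma Phi_basis: "s \<in> carrier k \<Longrightarrow> q \<in> carrier (FA Y) \<Longrightarrow> Phi Y (b (s, q)) = s \<odot>\<^bsub>FX Y\<^esub> E Y q"
  unfolding Phi_def
  by (subst k.lin_ext_basis[OF FX_lmod]) (use sE_closed in \<open>auto simp del: free_module_simps\<close>)

lemma sec_lin: "lin_map k (FX Y) (FT Y) (sec Y)"
  unfolding sec_def by (rule k.lin_ext_lin_map[OF FT_lmod]) simp

lemma sec_basis: "y \<in> Y \<Longrightarrow> sec Y (b y) = b (\<one>\<^bsub>k\<^esub>, basis_vec A y)"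
  unfolding sec_def by (subst k.lin_ext_basis[OF FT_lmod]) simp_all

lemma Phi_sec:
  assumes g: "g \<in> carrier (FX Y)"
  shows "Phi Y (sec Y g) = g"
  by (rule k.lin_map_free_eqI[OF FX_lmod lin_map_comp[OF sec_lin Phi_lin] lin_map_id _ g])
    (simp add: sec_basis Phi_basis E_basis one_basis)

text \<open>The four families of \<open>tensor_rels\<close> with the operations of \<open>A\<close>
  and of the trivial module unfolded.\<close>

definition tensor_gens :: "'y set \<Rightarrow> ('k \<times> ('y \<Rightarrow> 'x \<Rightarrow> 'k) \<Rightarrow> 'k) set" where
  "tensor_gens Y =
     {b (m \<oplus>\<^bsub>k\<^esub> m', p) \<ominus>\<^bsub>FT Y\<^esub> (b (m, p) \<oplus>\<^bsub>FT Y\<^esub> b (m', p)) | m m' p.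
        m \<in> carrier k \<and> m' \<in> carrier k \<and> p \<in> carrier (FA Y)} \<union>
     {b (m, p \<oplus>\<^bsub>FA Y\<^esub> p') \<ominus>\<^bsub>FT Y\<^esub> (b (m, p) \<oplus>\<^bsub>FT Y\<^esub> b (m, p')) | m p p'.
        m \<in> carrier k \<and> p \<in> carrier (FA Y) \<and> p' \<in> carrier (FA Y)} \<union>
     {b (eps a \<otimes>\<^bsub>k\<^esub> m, p) \<ominus>\<^bsub>FT Y\<^esub> b (m, a \<odot>\<^bsub>FA Y\<^esub> p) | a m p.
        a \<in> carrier (FX M) \<and> m \<in> carrier k \<and> p \<in> carrier (FA Y)} \<union>
     {s \<odot>\<^bsub>FT Y\<^esub> b (m, p) \<ominus>\<^bsub>FT Y\<^esub> b (eps (s \<odot>\<^bsub>FX M\<^esub> b e) \<otimes>\<^bsub>k\<^esub> m, p) | s m p.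
        s \<in> carrier k \<and> m \<in> carrier k \<and> p \<in> carrier (FA Y)}"

abbreviation rels where "rels Y \<equiv> tensor_rels k A N (FA Y)"

lemma rels_eq: "rels Y = mod_span k (FT Y) (tensor_gens Y)"
  unfolding tensor_rels_def tensor_gens_def Let_def N_simps A_simps ..

lemma Phi_kernel_submodule: "submodule {f \<in> carrier (FT Y). Phi Y f = \<zero>\<^bsub>FX Y\<^esub>} k (FT Y)"
proof -
  interpret F: module k "FT Y" by (rule FT_module)
  interpret G: module k "FX Y" by (rule FX_module)
  note L = FT_lmod[of Y] FX_lmod[of Y] Phi_lin[of Y]
  show ?thesis
  proof (rule F.submoduleI)
    show "{f \<in> carrier (FT Y). Phi Y f = \<zero>\<^bsub>FX Y\<^esub>} \<subseteq> carrier (FT Y)" by blast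
    show "\<zero>\<^bsub>FT Y\<^esub> \<in> {f \<in> carrier (FT Y). Phi Y f = \<zero>\<^bsub>FX Y\<^esub>}"
      using lin_map_zero[OF L] F.M.zero_closed by blast
  qed (auto simp: lin_map_neg[OF L] lin_map_add[OF L(3)] lin_map_smult[OF L(3)] simp del: free_module_simps)
qed

lemma Phi_zero_minusI:
  assumes "f \<in> carrier (FT Y)" "g \<in> carrier (FT Y)" "Phi Y f = Phi Y g"
  shows "f \<ominus>\<^bsub>FT Y\<^esub> g \<in> {f \<in> carrier (FT Y). Phi Y f = \<zero>\<^bsub>FX Y\<^esub>}"
proof -
  interpret F: lmod k "FT Y" by (rule FT_lmod)
  interpret G: lmod k "FX Y" by (rule FX_lmod)
  have "Phi Y (f \<ominus>\<^bsub>FT Y\<^esub> g) = \<zero>\<^bsub>FX Y\<^esub>"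
    using assms lin_map_minus[OF FT_lmod FX_lmod Phi_lin assms(1,2)] G.M.minus_eq_zero_iff lin_map_closed[OF Phi_lin assms(2)]
    by (simp del: free_module_simps)
  then show ?thesis using F.M.minus_closed[OF assms(1,2)] by blast
qed

lemma tensor_gens_Phi: "tensor_gens Y \<subseteq> {f \<in> carrier (FT Y). Phi Y f = \<zero>\<^bsub>FX Y\<^esub>}"
proof -
  interpret F: lmod k "FT Y" by (rule FT_lmod)
  interpret G: lmod k "FX Y" by (rule FX_lmod)
  interpret P: lmod A "FA Y" by (rule FA_lmod)
  have bc: "m \<in> carrier k \<Longrightarrow> p \<in> carrier (FA Y) \<Longrightarrow> b (m, p) \<in> carrier (FT Y)" for m p by simp
  have ac: "a \<in> carrier (FX M) \<Longrightarrow> p \<in> carrier (FA Y) \<Longrightarrow> a \<odot>\<^bsub>FA Y\<^esub> p \<in> carrier (FA Y)" for a p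
    by (rule P.smult_closed) simp_all
  have sc: "s \<in> carrier k \<Longrightarrow> s \<odot>\<^bsub>FX M\<^esub> b e \<in> carrier (FX M)" for s
    using scalar_closed[of s] by simp
  have es: "s \<in> carrier k \<Longrightarrow> eps (s \<odot>\<^bsub>FX M\<^esub> b e) = s" for s using eps_scalar[of s] by simp
  have 1: "Phi Y (b (m \<oplus>\<^bsub>k\<^esub> m', p)) = Phi Y (b (m, p) \<oplus>\<^bsub>FT Y\<^esub> b (m', p))"
    if "m \<in> carrier k" "m' \<in> carrier k" "p \<in> carrier (FA Y)" for m m' p
    using that bc lin_map_add[OF Phi_lin bc bc] G.smult_l_distr[OF that(1,2) E_closed]
    by (simp add: Phi_basis del: free_module_simps)
  have 2: "Phi Y (b (m, p \<oplus>\<^bsub>FA Y\<^esub> p')) = Phi Y (b (m, p) \<oplus>\<^bsub>FT Y\<^esub> b (m, p'))"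
    if "m \<in> carrier k" "p \<in> carrier (FA Y)" "p' \<in> carrier (FA Y)" for m p p'
    using that bc lin_map_add[OF Phi_lin bc bc] G.smult_r_distr[OF that(1) E_closed E_closed]
    by (simp add: Phi_basis E_add del: free_module_simps)
  have 3: "Phi Y (b (eps a \<otimes>\<^bsub>k\<^esub> m, p)) = Phi Y (b (m, a \<odot>\<^bsub>FA Y\<^esub> p))"
    if "a \<in> carrier (FX M)" "m \<in> carrier k" "p \<in> carrier (FA Y)" for a m p
    using that ac G.smult_assoc1[symmetric, OF _ _ E_closed]
    by (simp add: Phi_basis E_smult k.m_comm del: free_module_simps)
  have 4: "Phi Y (s \<odot>\<^bsub>FT Y\<^esub> b (m, p)) = Phi Y (b (eps (s \<odot>\<^bsub>FX M\<^esub> b e) \<otimes>\<^bsub>k\<^esub> m, p))"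
    if "s \<in> carrier k" "m \<in> carrier k" "p \<in> carrier (FA Y)" for s m p
    using that bc lin_map_smult[OF Phi_lin _ bc] G.smult_assoc1[symmetric, OF _ _ E_closed]
    by (simp add: Phi_basis es del: free_module_simps)
  note cl = bc ac sc eps_closed F.M.a_closed F.smult_closed P.M.a_closed k.a_closed k.m_closed
  let ?K = "{f \<in> carrier (FT Y). Phi Y f = \<zero>\<^bsub>FX Y\<^esub>}"
  have g1: "b (m \<oplus>\<^bsub>k\<^esub> m', p) \<ominus>\<^bsub>FT Y\<^esub> (b (m, p) \<oplus>\<^bsub>FT Y\<^esub> b (m', p)) \<in> ?K"
    if "m \<in> carrier k" "m' \<in> carrier k" "p \<in> carrier (FA Y)" for m m' p
    by (rule Phi_zero_minusI[OF _ _ 1[OF that]]) (intro cl that)+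
  have g2: "b (m, p \<oplus>\<^bsub>FA Y\<^esub> p') \<ominus>\<^bsub>FT Y\<^esub> (b (m, p) \<oplus>\<^bsub>FT Y\<^esub> b (m, p')) \<in> ?K"
    if "m \<in> carrier k" "p \<in> carrier (FA Y)" "p' \<in> carrier (FA Y)" for m p p'
    by (rule Phi_zero_minusI[OF _ _ 2[OF that]]) (intro cl that)+
  have g3: "b (eps a \<otimes>\<^bsub>k\<^esub> m, p) \<ominus>\<^bsub>FT Y\<^esub> b (m, a \<odot>\<^bsub>FA Y\<^esub> p) \<in> ?K"
    if "a \<in> carrier (FX M)" "m \<in> carrier k" "p \<in> carrier (FA Y)" for a m p
    by (rule Phi_zero_minusI[OF _ _ 3[OF that]]) (intro cl that)+
  have g4: "s \<odot>\<^bsub>FT Y\<^esub> b (m, p) \<ominus>\<^bsub>FT Y\<^esub> b (eps (s \<odot>\<^bsub>FX M\<^esub> b e) \<otimes>\<^bsub>k\<^esub> m, p) \<in> ?K"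
    if "s \<in> carrier k" "m \<in> carrier k" "p \<in> carrier (FA Y)" for s m p
    by (rule Phi_zero_minusI[OF _ _ 4[OF that]]) (intro cl that)+
  show ?thesis
    unfolding tensor_gens_def
    by (intro Un_least subsetI; elim CollectE exE conjE; hypsubst) (rule g1 g2 g3 g4; assumption)+
qed

text \<open>Modulo any submodule that contains the relations, every pair is congruent to an element
  in the image of \<open>sec\<close>, and so every \<open>f\<close> is congruent to
  \<open>sec Y (Phi Y f)\<close>. This is zero on the kernel of \<open>Phi\<close>.\<close>

lemma Phi_kernel_minimal:
  assumes K: "submodule K k (FT Y)" and gK: "tensor_gens Y \<subseteq> K"
    and f: "f \<in> carrier (FT Y)" "Phi Y f = \<zero>\<^bsub>FX Y\<^esub>"
  shows "f \<in> K"
proof -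
  interpret F: lmod k "FT Y" by (rule FT_lmod)
  interpret K: submod k "FT Y" K by (intro submod.intro FT_module K)
  interpret P: lmod A "FA Y" by (rule FA_lmod)
  interpret G: lmod k "FX Y" by (rule FX_lmod)
  let ?Q = "quot_module (FT Y) K" and ?pi = "\<lambda>f. K +>\<^bsub>FT Y\<^esub> f"
  interpret Q: lmod k ?Q by (rule module_imp_lmod[OF K.quot_module_module])
  note pi = K.coset_lin_map
  have bc: "m \<in> carrier k \<Longrightarrow> p \<in> carrier (FA Y) \<Longrightarrow> b (m, p) \<in> carrier (FT Y)" for m p by simp
  have eqI: "?pi u = ?pi v" if "u \<in> carrier (FT Y)" "v \<in> carrier (FT Y)" "u \<ominus>\<^bsub>FT Y\<^esub> v \<in> tensor_gens Y" for u v
    unfolding K.coset_eq_iff[OF that(1,2)]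
    by (rule bexI[of _ "u \<ominus>\<^bsub>FT Y\<^esub> v"], rule F.M.minus_add_cancel[OF that(1,2), symmetric],
        rule subsetD[OF gK that(3)])
  have es: "s \<in> carrier k \<Longrightarrow> eps (s \<odot>\<^bsub>FX M\<^esub> b e) = s" for s using eps_scalar[of s] by simp
  have be: "b e \<in> carrier A" by simp
  have padd: "?pi (b (m, p \<oplus>\<^bsub>FA Y\<^esub> p')) = ?pi (b (m, p)) \<oplus>\<^bsub>?Q\<^esub> ?pi (b (m, p'))"
    if "m \<in> carrier k" "p \<in> carrier (FA Y)" "p' \<in> carrier (FA Y)" for m p p'
  proof -
    have "?pi (b (m, p \<oplus>\<^bsub>FA Y\<^esub> p')) = ?pi (b (m, p) \<oplus>\<^bsub>FT Y\<^esub> b (m, p'))"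
    proof (intro eqI bc F.M.a_closed P.M.a_closed that)
      show "b (m, p \<oplus>\<^bsub>FA Y\<^esub> p') \<ominus>\<^bsub>FT Y\<^esub> (b (m, p) \<oplus>\<^bsub>FT Y\<^esub> b (m, p')) \<in> tensor_gens Y"
        unfolding tensor_gens_def using that by blast
    qed
    then show ?thesis using lin_map_add[OF pi bc bc] that by (simp only:)
  qed
  have pscal: "?pi (b (s \<otimes>\<^bsub>k\<^esub> m, p)) = s \<odot>\<^bsub>?Q\<^esub> ?pi (b (m, p))"
    if "s \<in> carrier k" "m \<in> carrier k" "p \<in> carrier (FA Y)" for s m p
  proof -
    have "?pi (s \<odot>\<^bsub>FT Y\<^esub> b (m, p)) = ?pi (b (eps (s \<odot>\<^bsub>FX M\<^esub> b e) \<otimes>\<^bsub>k\<^esub> m, p))"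
    proof (intro eqI bc F.smult_closed)
      show "s \<odot>\<^bsub>FT Y\<^esub> b (m, p) \<ominus>\<^bsub>FT Y\<^esub> b (eps (s \<odot>\<^bsub>FX M\<^esub> b e) \<otimes>\<^bsub>k\<^esub> m, p) \<in> tensor_gens Y"
        unfolding tensor_gens_def using that by blast
    qed (use that es in \<open>auto simp del: free_module_simps\<close>)
    then show ?thesis using lin_map_smult[OF pi _ bc] that by (simp only: es)
  qed
  have pact: "?pi (b (m, a \<odot>\<^bsub>FA Y\<^esub> p)) = ?pi (b (eps a \<otimes>\<^bsub>k\<^esub> m, p))"
    if "a \<in> carrier (FX M)" "m \<in> carrier k" "p \<in> carrier (FA Y)" for a m p
  proof (rule eqI[symmetric])
    show "b (m, a \<odot>\<^bsub>FA Y\<^esub> p) \<in> carrier (FT Y)" using that P.smult_closed[of a p] by (intro bc) simp_all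
    show "b (eps a \<otimes>\<^bsub>k\<^esub> m, p) \<ominus>\<^bsub>FT Y\<^esub> b (m, a \<odot>\<^bsub>FA Y\<^esub> p) \<in> tensor_gens Y"
      unfolding tensor_gens_def using that by blast
  qed (use that in simp)
  have sec_c: "g \<in> carrier (FX Y) \<Longrightarrow> sec Y g \<in> carrier (FT Y)" for g by (rule lin_map_closed[OF sec_lin])
  \<comment> \<open>Additivity in \<open>q\<close> and moving algebra elements across the tensor
    sign reduce \<open>q\<close> to a basis vector; there the element moved across becomes the
    scalar \<open>eps a\<close>.\<close>
  have main: "?pi (b (\<one>\<^bsub>k\<^esub>, q)) = ?pi (sec Y (E Y q))" if q: "q \<in> carrier (FA Y)" for q
    using q
  proof (induct rule: A.free_induct)
    case zero
    have z: "(\<lambda>y. \<zero>\<^bsub>A\<^esub>) \<in> carrier (FA Y)" by (rule A.free_module_zero_closed)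
    have "?pi (b (\<one>\<^bsub>k\<^esub>, \<lambda>y. \<zero>\<^bsub>A\<^esub>)) = ?pi (b (\<one>\<^bsub>k\<^esub>, \<lambda>y. \<zero>\<^bsub>A\<^esub>)) \<oplus>\<^bsub>?Q\<^esub> ?pi (b (\<one>\<^bsub>k\<^esub>, \<lambda>y. \<zero>\<^bsub>A\<^esub>))"
      using padd[OF k.one_closed z z] by simp
    then have "?pi (b (\<one>\<^bsub>k\<^esub>, \<lambda>y. \<zero>\<^bsub>A\<^esub>)) = \<zero>\<^bsub>?Q\<^esub>"
      using lin_map_closed[OF pi bc[OF k.one_closed z]] by (metis Q.M.add.r_cancel_one')
    moreover have "E Y (\<lambda>y. \<zero>\<^bsub>A\<^esub>) = \<zero>\<^bsub>FX Y\<^esub>"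
    proof -
      have "red (\<lambda>y::'a. \<zero>\<^bsub>A\<^esub>) = \<zero>\<^bsub>FH Y\<^esub>" by (auto simp: red_def)
      then show ?thesis unfolding E_def using lin_map_zero[OF FH_lmod FX_lmod coinv_lin] by (simp only:)
    qed
    ultimately show ?case
      using lin_map_zero[OF FX_lmod FT_lmod sec_lin, of Y] lin_map_zero[OF FT_lmod Q.lmod_axioms pi] by (simp only:)
  next
    case (add f a y)
    let ?v = "basis_vec A y"
    have a: "a \<in> carrier (FX M)" and v: "?v \<in> carrier (FA Y)" using add by simp_all
    have av: "a \<odot>\<^bsub>FA Y\<^esub> ?v \<in> carrier (FA Y)" by (rule P.smult_closed[OF add(2) v])
    have "?pi (b (\<one>\<^bsub>k\<^esub>, f \<oplus>\<^bsub>FA Y\<^esub> a \<odot>\<^bsub>FA Y\<^esub> ?v)) = ?pi (b (\<one>\<^bsub>k\<^esub>, f)) \<oplus>\<^bsub>?Q\<^esub> ?pi (b (\<one>\<^bsub>k\<^esub>, a \<odot>\<^bsub>FA Y\<^esub> ?v))"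
      by (rule padd[OF k.one_closed add(1) av])
    also have "?pi (b (\<one>\<^bsub>k\<^esub>, a \<odot>\<^bsub>FA Y\<^esub> ?v)) = eps a \<odot>\<^bsub>?Q\<^esub> ?pi (b (\<one>\<^bsub>k\<^esub>, ?v))"
      using pact[OF a k.one_closed v] pscal[OF eps_closed[OF a] k.one_closed v] by (simp only:)
    also have "b (\<one>\<^bsub>k\<^esub>, ?v) = sec Y (E Y ?v)" using add(3) by (simp add: E_basis sec_basis)
    also have "?pi (b (\<one>\<^bsub>k\<^esub>, f)) = ?pi (sec Y (E Y f))" by (rule add(4))
    also have "?pi (sec Y (E Y f)) \<oplus>\<^bsub>?Q\<^esub> eps a \<odot>\<^bsub>?Q\<^esub> ?pi (sec Y (E Y ?v)) = ?pi (sec Y (E Y f \<oplus>\<^bsub>FX Y\<^esub> eps a \<odot>\<^bsub>FX Y\<^esub> E Y ?v))"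
      using lin_map_add[OF lin_map_comp[OF sec_lin pi] E_closed[OF add(1)] sE_closed[OF eps_closed[OF a] v]]
        lin_map_smult[OF lin_map_comp[OF sec_lin pi] eps_closed[OF a] E_closed[OF v]] by (simp only:)
    also have "E Y f \<oplus>\<^bsub>FX Y\<^esub> eps a \<odot>\<^bsub>FX Y\<^esub> E Y ?v = E Y (f \<oplus>\<^bsub>FA Y\<^esub> a \<odot>\<^bsub>FA Y\<^esub> ?v)"
      using E_add[OF add(1) av] E_smult[OF a v] by (simp only:)
    finally show ?case by simp
  qed
  have "?pi f = ?pi (sec Y (Phi Y f))"
  proof (rule k.lin_map_free_eqI[OF Q.lmod_axioms pi lin_map_comp[OF lin_map_comp[OF Phi_lin sec_lin] pi] _ f(1)])
    fix z assume "z \<in> carrier k \<times> carrier (FA Y)"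
    then obtain m q where z: "z = (m, q)" "m \<in> carrier k" "q \<in> carrier (FA Y)" by blast
    have "?pi (b (m, q)) = m \<odot>\<^bsub>?Q\<^esub> ?pi (b (\<one>\<^bsub>k\<^esub>, q))" using pscal[OF z(2) k.one_closed z(3)] z by simp
    also have "\<dots> = m \<odot>\<^bsub>?Q\<^esub> ?pi (sec Y (E Y q))" using main[OF z(3)] by simp
    also have "\<dots> = ?pi (sec Y (m \<odot>\<^bsub>FX Y\<^esub> E Y q))"
      using lin_map_smult[OF lin_map_comp[OF sec_lin pi] z(2) E_closed[OF z(3)]] by (simp only:)
    finally show "?pi (b z) = ?pi (sec Y (Phi Y (b z)))" using z by (simp only: Phi_basis)
  qed
  also have "\<dots> = \<zero>\<^bsub>?Q\<^esub>"
    using f(2) lin_map_zero[OF FX_lmod FT_lmod sec_lin, of Y] lin_map_zero[OF FT_lmod Q.lmod_axioms pi] by (simp only:)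
  finally show "f \<in> K" using K.coset_eq_self_iff[OF f(1)] by (simp add: quot_module_def)
qed

lemma rels_Phi: "rels Y = {f \<in> carrier (FT Y). Phi Y f = \<zero>\<^bsub>FX Y\<^esub>}"
  unfolding rels_eq mod_span_def
  using Phi_kernel_submodule tensor_gens_Phi Phi_kernel_minimal by blast

lemma rels_submod: "submod k (FT Y) (rels Y)"
  unfolding rels_Phi by (intro submod.intro FT_module Phi_kernel_submodule)

lemma tensor_eq: "tensor k A N (FA Y) = quot_module (FT Y) (rels Y)"
  by (simp add: tensor_def)

lemma coset_eq_Phi:
  assumes "f \<in> carrier (FT Y)" "g \<in> carrier (FT Y)"
  shows "rels Y +>\<^bsub>FT Y\<^esub> f = rels Y +>\<^bsub>FT Y\<^esub> g \<longleftrightarrow> Phi Y f = Phi Y g"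
proof -
  interpret F: lmod k "FT Y" by (rule FT_lmod)
  interpret R: submod k "FT Y" "rels Y" by (rule rels_submod)
  interpret G: lmod k "FX Y" by (rule FX_lmod)
  note pc = lin_map_closed[OF Phi_lin]
  show ?thesis
  proof
    assume "rels Y +>\<^bsub>FT Y\<^esub> f = rels Y +>\<^bsub>FT Y\<^esub> g"
    from this[unfolded R.coset_eq_iff[OF assms]] obtain n where n: "f = n \<oplus>\<^bsub>FT Y\<^esub> g" "n \<in> rels Y"
      by (rule bexE)
    then have "n \<in> carrier (FT Y)" "Phi Y n = \<zero>\<^bsub>FX Y\<^esub>" unfolding rels_Phi by simp_all
    then show "Phi Y f = Phi Y g"
      using lin_map_add[OF Phi_lin _ assms(2), of n] G.M.l_zero[OF pc[OF assms(2)]] n(1) by (simp only:)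
  next
    assume "Phi Y f = Phi Y g"
    then have d: "f \<ominus>\<^bsub>FT Y\<^esub> g \<in> rels Y" using Phi_zero_minusI[OF assms] unfolding rels_Phi by blast
    show "rels Y +>\<^bsub>FT Y\<^esub> f = rels Y +>\<^bsub>FT Y\<^esub> g"
      unfolding R.coset_eq_iff[OF assms]
      by (rule bexI[of _ "f \<ominus>\<^bsub>FT Y\<^esub> g"], rule F.M.minus_add_cancel[OF assms, symmetric], rule d)
  qed
qed

text \<open>The inverse of the isomorphism induced by \<open>Phi\<close>. This direction is the
  convenient one, since it starts from functions and not from cosets.\<close>

definition tens :: "'y set \<Rightarrow> ('y \<Rightarrow> 'k) \<Rightarrow> ('k \<times> ('y \<Rightarrow> 'x \<Rightarrow> 'k) \<Rightarrow> 'k) set" where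
  "tens Y g = rels Y +>\<^bsub>FT Y\<^esub> sec Y g"

lemma tens_lin: "lin_map k (FX Y) (tensor k A N (FA Y)) (tens Y)"
  unfolding tens_def tensor_eq
  by (rule lin_map_comp[OF sec_lin submod.coset_lin_map[OF rels_submod]])

lemma tens_Phi: "f \<in> carrier (FT Y) \<Longrightarrow> rels Y +>\<^bsub>FT Y\<^esub> f = tens Y (Phi Y f)"
  unfolding tens_def
  by (subst coset_eq_Phi) (simp_all add: Phi_sec lin_map_closed[OF Phi_lin] lin_map_closed[OF sec_lin])

lemma tens_bij: "bij_betw (tens Y) (carrier (FX Y)) (carrier (tensor k A N (FA Y)))"
  unfolding bij_betw_def
proof
  show "inj_on (tens Y) (carrier (FX Y))"
  proof (rule inj_onI)
    fix f g assume f: "f \<in> carrier (FX Y)" and g: "g \<in> carrier (FX Y)" and "tens Y f = tens Y g"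
    then have "Phi Y (sec Y f) = Phi Y (sec Y g)"
      unfolding tens_def by (simp add: coset_eq_Phi lin_map_closed[OF sec_lin])
    then show "f = g" using f g by (simp add: Phi_sec)
  qed
  interpret R: submod k "FT Y" "rels Y" by (rule rels_submod)
  show "tens Y ` carrier (FX Y) = carrier (tensor k A N (FA Y))"
  proof (intro equalityI subsetI)
    fix c assume "c \<in> tens Y ` carrier (FX Y)"
    then show "c \<in> carrier (tensor k A N (FA Y))" using lin_map_closed[OF tens_lin] by blast
  next
    fix c assume "c \<in> carrier (tensor k A N (FA Y))"
    then obtain f where "f \<in> carrier (FT Y)" "c = rels Y +>\<^bsub>FT Y\<^esub> f"
      unfolding tensor_eq R.quot_carrier by blast
    then show "c \<in> tens Y ` carrier (FX Y)" using tens_Phi lin_map_closed[OF Phi_lin] by blast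
  qed
qed

text \<open>Any description \<open>L'\<close> of \<open>L\<close> after augmenting the coefficients
  gives the map induced on tensor products.\<close>

lemma tensor_map_tens:
  assumes L: "lin_map A (FA Y) (FA Z) L" and L': "lin_map k (FX Y) (FX Z) L'"
    and comm: "\<And>q. q \<in> carrier (FA Y) \<Longrightarrow> E Z (L q) = L' (E Y q)"
    and g: "g \<in> carrier (FX Y)"
  shows "tensor_map k A N (FA Z) L (tens Y g) = tens Z (L' g)"
proof -
  let ?m = "lin_ext k (FT Z) (\<lambda>(m, q). b (m, L q))"
  have Lc: "q \<in> carrier (FA Y) \<Longrightarrow> L q \<in> carrier (FA Z)" for q by (rule lin_map_closed[OF L])
  have m: "lin_map k (FT Y) (FT Z) ?m"
    by (rule k.lin_ext_lin_map[OF FT_lmod]) (auto simp: Lc)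
  have Phi_m: "Phi Z (?m f) = L' (Phi Y f)" if f: "f \<in> carrier (FT Y)" for f
  proof (rule k.lin_map_free_eqI[OF FX_lmod lin_map_comp[OF m Phi_lin] lin_map_comp[OF Phi_lin L'] _ f])
    fix z assume "z \<in> carrier k \<times> carrier (FA Y)"
    then obtain s q where z: "z = (s, q)" "s \<in> carrier k" "q \<in> carrier (FA Y)" by blast
    have "?m (b z) = b (s, L q)"
      using z Lc by (subst k.lin_ext_basis[OF FT_lmod]) auto
    then show "Phi Z (?m (b z)) = L' (Phi Y (b z))"
      using z Lc lin_map_smult[OF L' z(2) E_closed[OF z(3)]] comm by (simp add: Phi_basis del: free_module_simps)
  qed
  interpret F: lmod k "FT Y" by (rule FT_lmod)
  have sg: "sec Y g \<in> carrier (FT Y)" by (rule lin_map_closed[OF sec_lin g])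
  interpret R: submod k "FT Y" "rels Y" by (rule rels_submod)
  \<comment> \<open>All representatives of the coset have the same value under \<open>Phi\<close>,
    so the union in \<open>tensor_map\<close> is a union of equal cosets.\<close>
  have "rels Z +>\<^bsub>FT Z\<^esub> ?m f = tens Z (L' g)" if "f \<in> tens Y g" for f
  proof -
    have f: "f \<in> carrier (FT Y)"
      using that F.M.a_r_coset_subset_G R.sub.a_subset sg unfolding tens_def by blast
    then have "rels Y +>\<^bsub>FT Y\<^esub> f = rels Y +>\<^bsub>FT Y\<^esub> sec Y g"
      using that R.sub.a_repr_independence' sg unfolding tens_def by metis
    then have "Phi Y f = g" using coset_eq_Phi[OF f sg] Phi_sec[OF g] by simp
    then show ?thesis using tens_Phi[OF lin_map_closed[OF m f]] Phi_m[OF f] by simp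
  qed
  moreover have "tens Y g \<noteq> {}" using R.coset_self[OF sg] unfolding tens_def by blast
  ultimately have "(\<Union>f\<in>tens Y g. rels Z +>\<^bsub>FT Z\<^esub> ?m f) = tens Z (L' g)" by auto
  then show ?thesis unfolding tensor_map_def Let_def N_simps by simp
qed

interpretation res: free_resolution k H gens dhat ahat by (rule canonical_free_resolution)

lemma E_D:
  assumes q: "q \<in> carrier (C (Suc i))"
  shows "E (gens i) (D i q) = res.cdiff i (E (gens (Suc i)) q)"
  unfolding E_def coinv_map_def
  using coinv_equivariant[OF dhat_equivariant red_closed[OF q]] dhat_red[OF q] by simp

text \<open>The tensored resolution is the complex of coinvariants of the reduced resolution, and
  the latter has the homology of the bar complex. The module structure is recorded because inverting
  \<open>mod_isomorphic\<close> requires it.\<close>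

theorem Tor_isomorphic_group_homology:
  "module k (Tor k A N N i)" "mod_isomorphic k (Tor k A N N i) (group_homology k H i)"
proof -
  interpret pair: free_resolution_pair k H bar_basis bar_res bar_aug gens dhat ahat
    by (intro free_resolution_pair.intro bar_resolution canonical_free_resolution)
  have T: "Tor k A N N i = homology (\<lambda>i. tensor k A N (C i)) (\<lambda>i. tensor_map k A N (C i) (D i)) i"
    by (simp only: Tor_def gens_def[symmetric] D_def)
  have m: "module k (tensor k A N (C i))" for i
    unfolding tensor_eq by (rule submod.quot_module_module[OF rels_submod])
  have comm: "tensor_map k A N (C i) (D i) (tens (gens (Suc i)) x) = tens (gens i) (res.cdiff i x)"
    if "x \<in> carrier (FX (gens (Suc i)))" for i x
    by (rule tensor_map_tens[OF D_lin coinv_map_lin[OF dhat_equivariant] E_D that])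
  note tr = homology_transport[of k "\<lambda>i. FX (gens i)" res.cdiff "\<lambda>i. tensor k A N (C i)" "\<lambda>i. tens (gens i)",
      OF res.coinv_complex m tens_lin tens_bij comm]
  show mT: "module k (Tor k A N N i)" unfolding T by (rule homology_module[OF tr(1)])
  have "mod_isomorphic k (group_homology k H i) (Tor k A N N i)"
    unfolding T group_homology_eq
    by (rule mod_isomorphic_trans[OF pair.coinv_homology_isomorphic tr(2)])
  moreover have "module k (group_homology k H i)"
    unfolding group_homology_eq by (rule homology_module[OF pair.P.coinv_complex])
  ultimately show "mod_isomorphic k (Tor k A N N i) (group_homology k H i)"
    by (rule mod_isomorphic_sym[rotated])
qed

end

section \<open>Components of labelled graphs\<close>

text \<open>The node type is arbitrary: products of two diagrams live on \<open>node\<close>, triple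
  products on numbered columns.\<close>

definition conn :: "('v set \<times> 'g) set \<Rightarrow> ('v \<times> 'v) set" where
  "conn D = {(u, v). \<exists>d\<in>D. u \<in> fst d \<and> v \<in> fst d}\<^sup>*"

lemma conn_refl [simp]: "(u, u) \<in> conn D"
  by (simp add: conn_def)

lemma conn_sym: "(u, v) \<in> conn D \<Longrightarrow> (v, u) \<in> conn D"
proof -
  have "sym {(u, v). \<exists>d\<in>D. u \<in> fst d \<and> v \<in> fst d}" by (auto intro: symI)
  then show "(u, v) \<in> conn D \<Longrightarrow> (v, u) \<in> conn D" unfolding conn_def by (meson sym_rtrancl symE)
qed

lemma conn_trans: "(u, v) \<in> conn D \<Longrightarrow> (v, w) \<in> conn D \<Longrightarrow> (u, w) \<in> conn D"
  unfolding conn_def by (rule rtrancl_trans)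

lemma conn_edge: "d \<in> D \<Longrightarrow> u \<in> fst d \<Longrightarrow> v \<in> fst d \<Longrightarrow> (u, v) \<in> conn D"
  unfolding conn_def by blast

lemma conn_mono: "D \<subseteq> D' \<Longrightarrow> (u, v) \<in> conn D \<Longrightarrow> (u, v) \<in> conn D'"
  unfolding conn_def by (rule subsetD[OF rtrancl_mono]) auto

lemma conn_induct [consumes 1, case_names refl step]:
  assumes "(u, v) \<in> conn D" "P u"
    and "\<And>v w d. \<lbrakk>(u, v) \<in> conn D; P v; d \<in> D; v \<in> fst d; w \<in> fst d\<rbrakk> \<Longrightarrow> P w"
  shows "P v"
  using assms(1)[unfolded conn_def]
proof (induct rule: rtrancl_induct)
  case (step y z)
  then show ?case using assms(3)[of y] unfolding conn_def by blast
qed (rule assms(2))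

definition comps :: "'v set \<Rightarrow> ('v set \<times> 'g) set \<Rightarrow> 'v set set" where
  "comps V D = V // conn D"

definition edges_in :: "'v set \<Rightarrow> ('v set \<times> 'g) set \<Rightarrow> bool" where
  "edges_in V D \<longleftrightarrow> (\<forall>d\<in>D. fst d \<subseteq> V \<and> fst d \<noteq> {})"

lemma conn_closed:
  assumes "edges_in V D" "(u, v) \<in> conn D" "u \<in> V"
  shows "v \<in> V"
  using assms(2)
proof (induct rule: conn_induct)
  case (step v w d)
  then show ?case using assms(1) by (auto simp: edges_in_def)
qed (rule assms(3))

lemma comps_iff: "C \<in> comps V D \<longleftrightarrow> (\<exists>u\<in>V. C = conn D `` {u})"
  by (auto simp: comps_def quotient_def)

lemma comps_sub: "edges_in V D \<Longrightarrow> C \<in> comps V D \<Longrightarrow> C \<subseteq> V"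
  by (auto simp: comps_iff intro: conn_closed)

lemma comps_eq: "C \<in> comps V D \<Longrightarrow> u \<in> C \<Longrightarrow> C = conn D `` {u}"
  by (auto simp: comps_iff intro: conn_trans conn_sym)

lemma comps_disjoint: "C \<in> comps V D \<Longrightarrow> C' \<in> comps V D \<Longrightarrow> u \<in> C \<Longrightarrow> u \<in> C' \<Longrightarrow> C = C'"
  using comps_eq by metis

lemma comps_nonempty: "C \<in> comps V D \<Longrightarrow> C \<noteq> {}"
  by (metis comps_iff conn_refl Image_singleton_iff empty_iff)

lemma comps_of: "u \<in> V \<Longrightarrow> conn D `` {u} \<in> comps V D \<and> u \<in> conn D `` {u}"
  by (auto simp: comps_iff)

lemma comps_edge:
  assumes "C \<in> comps V D" "d \<in> D" "u \<in> fst d" "u \<in> C"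
  shows "fst d \<subseteq> C"
  using comps_eq[OF assms(1,4)] conn_edge[OF assms(2,3)] by blast

lemma comps_finite: "finite V \<Longrightarrow> finite (comps V D)"
  unfolding comps_def by (simp add: quotient_def)

context comm_monoid
begin

definition wt :: "('v set \<times> 'a) set \<Rightarrow> 'v set \<Rightarrow> 'a" where
  "wt D C = finprod G snd {d \<in> D. fst d \<subseteq> C}"

definition labelled :: "('v set \<times> 'a) set \<Rightarrow> bool" where
  "labelled D \<longleftrightarrow> finite D \<and> (\<forall>d\<in>D. snd d \<in> carrier G)"

lemma wt_closed [simp]: "labelled D \<Longrightarrow> wt D C \<in> carrier G"
  by (auto simp: wt_def labelled_def intro!: finprod_closed)

text \<open>An edge is nonempty and the blocks are disjoint, so every edge inside \<open>E\<close>
  lies in exactly one block.\<close>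

lemma wt_union:
  assumes lab: "labelled D" and ed: "\<And>d. d \<in> D \<Longrightarrow> fst d \<noteq> {}"
    and fin: "finite \<C>" and dis: "\<And>C C' u. \<lbrakk>C \<in> \<C>; C' \<in> \<C>; u \<in> C; u \<in> C'\<rbrakk> \<Longrightarrow> C = C'"
    and cov: "\<And>d. \<lbrakk>d \<in> D; fst d \<subseteq> E\<rbrakk> \<Longrightarrow> \<exists>C\<in>\<C>. fst d \<subseteq> C" and sub: "\<And>C. C \<in> \<C> \<Longrightarrow> C \<subseteq> E"
  shows "wt D E = (\<Otimes>C\<in>\<C>. wt D C)"
proof -
  have eq: "{d \<in> D. fst d \<subseteq> E} = (\<Union>C\<in>\<C>. {d \<in> D. fst d \<subseteq> C})"
  proof (intro equalityI subsetI)
    fix d assume "d \<in> {d \<in> D. fst d \<subseteq> E}"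
    then show "d \<in> (\<Union>C\<in>\<C>. {d \<in> D. fst d \<subseteq> C})" using cov[of d] by auto
  next
    fix d assume "d \<in> (\<Union>C\<in>\<C>. {d \<in> D. fst d \<subseteq> C})"
    then obtain C where "C \<in> \<C>" "d \<in> D" "fst d \<subseteq> C" by blast
    then show "d \<in> {d \<in> D. fst d \<subseteq> E}" using sub[of C] by simp
  qed
  show ?thesis unfolding wt_def eq
  proof (rule finprod_UN_disjoint[OF fin])
    show "pairwise (\<lambda>i j. disjnt {d \<in> D. fst d \<subseteq> i} {d \<in> D. fst d \<subseteq> j}) \<C>"
    proof (rule pairwiseI)
      fix C C' assume C: "C \<in> \<C>" "C' \<in> \<C>" "C \<noteq> C'"
      have "fst d = {}" if "fst d \<subseteq> C" "fst d \<subseteq> C'" for d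
        using that dis[OF C(1,2)] C(3) by blast
      then show "disjnt {d \<in> D. fst d \<subseteq> C} {d \<in> D. fst d \<subseteq> C'}"
        unfolding disjnt_def using ed by blast
    qed
  qed (use lab in \<open>auto simp: labelled_def\<close>)
qed

text \<open>
  Two graphs \<open>X\<close>, \<open>Y\<close> on \<open>V1\<close> are composed by contracting their components to the outer nodes \<open>O1\<close>.
  Gluing a third graph \<open>Z\<close> on \<open>V2\<close> to the result has the components of the union of all three graphs.
\<close>

lemma contraction:
  fixes X Y Z :: "('v set \<times> 'a) set" and V1 V2 O1 :: "'v set"
  defines "D \<equiv> X \<union> Y"
  defines "P \<equiv> {(C \<inter> O1, wt X C \<otimes> wt Y C) | C. C \<in> comps V1 D \<and> C \<inter> O1 \<noteq> {}}"
  assumes X: "edges_in V1 X" and Y: "edges_in V1 Y" and Z: "edges_in V2 Z"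
    and fin: "finite V1"
    and O: "O1 \<subseteq> V1" "V1 \<inter> V2 \<subseteq> O1"
    and lab: "labelled X" "labelled Y" "labelled Z"
  shows contraction_comps: "comps (O1 \<union> V2) (P \<union> Z) =
      (\<lambda>E. E \<inter> (O1 \<union> V2)) ` {E \<in> comps (V1 \<union> V2) (D \<union> Z). E \<inter> (O1 \<union> V2) \<noteq> {}}"
    and contraction_loops: "{E \<in> comps (V1 \<union> V2) (D \<union> Z). E \<inter> (O1 \<union> V2) = {}} = {C \<in> comps V1 D. C \<inter> O1 = {}}"
    and contraction_wt: "\<And>E. E \<in> comps (V1 \<union> V2) (D \<union> Z) \<Longrightarrow> E \<inter> (O1 \<union> V2) \<noteq> {} \<Longrightarrow>
      wt P (E \<inter> (O1 \<union> V2)) = wt X E \<otimes> wt Y E"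
    and contraction_wt': "\<And>E. E \<in> comps (V1 \<union> V2) (D \<union> Z) \<Longrightarrow> wt Z (E \<inter> (O1 \<union> V2)) = wt Z E"
proof -
  have D1: "edges_in V1 D" using X Y by (auto simp: edges_in_def D_def)
  have DZ: "edges_in (V1 \<union> V2) (D \<union> Z)" using D1 Z by (auto simp: edges_in_def)
  have PZ: "edges_in (O1 \<union> V2) (P \<union> Z)" using Z by (auto simp: edges_in_def P_def)
  have P_conn: "(u, v) \<in> conn (P \<union> Z)" if "(u, v) \<in> conn D" "u \<in> O1" "v \<in> O1" for u v
  proof -
    let ?C = "conn D `` {u}"
    have "?C \<in> comps V1 D" using that O by (auto simp: comps_iff)
    then have "(?C \<inter> O1, wt X ?C \<otimes> wt Y ?C) \<in> P \<union> Z" using that by (auto simp: P_def)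
    then show ?thesis by (rule conn_edge) (use that in auto)
  qed
  have fwd: "(u, v) \<in> conn (D \<union> Z)" if "(u, v) \<in> conn (P \<union> Z)" for u v
    using that
  proof (induct rule: conn_induct)
    case (step v w d)
    have "(v, w) \<in> conn (D \<union> Z)"
    proof (cases "d \<in> Z")
      case True
      then show ?thesis using step conn_edge[of d "D \<union> Z"] by blast
    next
      case False
      then obtain C where C: "C \<in> comps V1 D" "v \<in> C" "w \<in> C" using step by (auto simp: P_def)
      then have "(v, w) \<in> conn D" using comps_eq[OF C(1,2)] by blast
      then show ?thesis by (rule conn_mono[rotated]) auto
    qed
    with step show ?case by (blast intro: conn_trans)
  qed simp
  have bwd: "(u, v) \<in> conn (P \<union> Z)" if uv: "(u, v) \<in> conn (D \<union> Z)" and u: "u \<in> O1 \<union> V2" and v: "v \<in> O1 \<union> V2" for u v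
  proof -
    \<comment> \<open>The invariant along a walk: \<open>w\<close> is a retained node reached in the
      contracted graph, and the current node is either \<open>w\<close> or joined to
      \<open>w\<close> by edges of \<open>D\<close> alone.\<close>
    have "\<exists>w\<in>O1 \<union> V2. (u, w) \<in> conn (P \<union> Z) \<and> (w = v \<or> w \<in> O1 \<and> (w, v) \<in> conn D)"
      using uv
    proof (induct rule: conn_induct)
      case refl
      then show ?case using u by (intro bexI[of _ u]) auto
    next
      case (step v v2 d)
      then obtain w where w: "w \<in> O1 \<union> V2" "(u, w) \<in> conn (P \<union> Z)" "w = v \<or> w \<in> O1 \<and> (w, v) \<in> conn D"
        by blast
      show ?case
      proof (cases "d \<in> D")
        case True
        then have vV: "v \<in> V1" "(v, v2) \<in> conn D"
          using step D1 conn_edge[OF True] by (auto simp: edges_in_def)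
        then have "w \<in> O1 \<and> (w, v2) \<in> conn D" using w O by (auto intro: conn_trans)
        then show ?thesis using w by blast
      next
        case False
        then have d: "d \<in> Z" using step by blast
        then have v2: "v \<in> V2" "v2 \<in> V2" using step Z by (auto simp: edges_in_def)
        have "(u, v) \<in> conn (P \<union> Z)"
        proof (cases "w = v")
          case True
          then show ?thesis using w by simp
        next
          case False
          then have wv: "w \<in> O1" "(w, v) \<in> conn D" using w by auto
          then have "v \<in> O1" using conn_closed[OF D1 wv(2)] v2 O by blast
          then show ?thesis using P_conn[OF wv(2,1)] w(2) by (blast intro: conn_trans)
        qed
        moreover have "(v, v2) \<in> conn (P \<union> Z)" using d step conn_edge[of d "P \<union> Z"] by blast
        ultimately show ?thesis using v2 by (blast intro: conn_trans)
      qed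
    qed
    then obtain w where w: "w \<in> O1 \<union> V2" "(u, w) \<in> conn (P \<union> Z)" "w = v \<or> w \<in> O1 \<and> (w, v) \<in> conn D"
      by blast
    show ?thesis
    proof (cases "w = v")
      case False
      then have wv: "w \<in> O1" "(w, v) \<in> conn D" using w by auto
      then have "v \<in> O1" using conn_closed[OF D1 wv(2)] v O by blast
      then show ?thesis using P_conn[OF wv(2,1)] w(2) by (blast intro: conn_trans)
    qed (use w in simp)
  qed
  have img: "conn (P \<union> Z) `` {u} = conn (D \<union> Z) `` {u} \<inter> (O1 \<union> V2)" if u: "u \<in> O1 \<union> V2" for u
    using fwd bwd[OF _ u] conn_closed[OF PZ _ u] by blast
  show comps: "comps (O1 \<union> V2) (P \<union> Z) =
      (\<lambda>E. E \<inter> (O1 \<union> V2)) ` {E \<in> comps (V1 \<union> V2) (D \<union> Z). E \<inter> (O1 \<union> V2) \<noteq> {}}"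
  proof (intro equalityI subsetI)
    fix C assume "C \<in> comps (O1 \<union> V2) (P \<union> Z)"
    then obtain u where u: "u \<in> O1 \<union> V2" "C = conn (D \<union> Z) `` {u} \<inter> (O1 \<union> V2)"
      using img by (auto simp: comps_iff)
    have "conn (D \<union> Z) `` {u} \<in> comps (V1 \<union> V2) (D \<union> Z)" using comps_of[of u] u O by blast
    moreover have "u \<in> conn (D \<union> Z) `` {u} \<inter> (O1 \<union> V2)" using u by simp
    ultimately show "C \<in> (\<lambda>E. E \<inter> (O1 \<union> V2)) ` {E \<in> comps (V1 \<union> V2) (D \<union> Z). E \<inter> (O1 \<union> V2) \<noteq> {}}"
      using u(2) by blast
  next
    fix C assume "C \<in> (\<lambda>E. E \<inter> (O1 \<union> V2)) ` {E \<in> comps (V1 \<union> V2) (D \<union> Z). E \<inter> (O1 \<union> V2) \<noteq> {}}"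
    then obtain E u where E: "E \<in> comps (V1 \<union> V2) (D \<union> Z)" "C = E \<inter> (O1 \<union> V2)" "u \<in> E" "u \<in> O1 \<union> V2" by blast
    then have "C = conn (P \<union> Z) `` {u}" using comps_eq[OF E(1,3)] img[OF E(4)] by simp
    then show "C \<in> comps (O1 \<union> V2) (P \<union> Z)" using E by (auto simp: comps_iff)
  qed
  \<comment> \<open>Edges of \<open>Z\<close> can be entered from \<open>V1\<close> only at nodes of
    \<open>O1\<close>, so a component of \<open>D\<close> without such nodes does not grow.\<close>
  have local: "conn (D \<union> Z) `` {u} = conn D `` {u}"
    if u: "u \<in> V1" and e: "conn D `` {u} \<inter> O1 = {}" for u
  proof -
    have "(u, v) \<in> conn D" if "(u, v) \<in> conn (D \<union> Z)" for v
      using that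
    proof (induct rule: conn_induct)
      case (step v w d)
      show ?case
      proof (cases "d \<in> D")
        case True
        then show ?thesis using step conn_edge[OF True] by (blast intro: conn_trans)
      next
        case False
        then have "v \<in> V2" using step Z by (auto simp: edges_in_def)
        moreover have "v \<in> V1" using conn_closed[OF D1 step(2) u] .
        ultimately show ?thesis using e step O by blast
      qed
    qed simp
    then show ?thesis using conn_mono[of D "D \<union> Z"] by blast
  qed
  show loops: "{E \<in> comps (V1 \<union> V2) (D \<union> Z). E \<inter> (O1 \<union> V2) = {}} = {C \<in> comps V1 D. C \<inter> O1 = {}}"
  proof (intro equalityI subsetI)
    fix E assume "E \<in> {E \<in> comps (V1 \<union> V2) (D \<union> Z). E \<inter> (O1 \<union> V2) = {}}"
    then have E: "E \<in> comps (V1 \<union> V2) (D \<union> Z)" "E \<inter> (O1 \<union> V2) = {}" by auto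
    then obtain u where u: "u \<in> V1 \<union> V2" "E = conn (D \<union> Z) `` {u}" by (auto simp: comps_iff)
    then have uV: "u \<in> V1" using E(2) by auto
    have "conn D `` {u} \<inter> O1 = {}" using E(2) u conn_mono[of D "D \<union> Z"] by blast
    with local[OF uV this] u uV show "E \<in> {C \<in> comps V1 D. C \<inter> O1 = {}}" by (auto simp: comps_iff)
  next
    fix C assume "C \<in> {C \<in> comps V1 D. C \<inter> O1 = {}}"
    then have C: "C \<in> comps V1 D" "C \<inter> O1 = {}" by auto
    then obtain u where u: "u \<in> V1" "C = conn D `` {u}" by (auto simp: comps_iff)
    have "C \<inter> V2 = {}" using comps_sub[OF D1 C(1)] C(2) O by blast
    with local[OF u(1)] u C show "C \<in> {E \<in> comps (V1 \<union> V2) (D \<union> Z). E \<inter> (O1 \<union> V2) = {}}"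
      by (auto simp: comps_iff)
  qed
  fix E assume E: "E \<in> comps (V1 \<union> V2) (D \<union> Z)"
  show "wt Z (E \<inter> (O1 \<union> V2)) = wt Z E"
    unfolding wt_def by (rule arg_cong[where f = "finprod G snd"]) (use Z in \<open>auto simp: edges_in_def\<close>)
  assume ne: "E \<inter> (O1 \<union> V2) \<noteq> {}"
  let ?K = "{C \<in> comps V1 D. C \<subseteq> E}"
  \<comment> \<open>A component of \<open>D\<close> inside \<open>E\<close> without nodes in
    \<open>O1\<close> would be a whole component of the union by \<open>loops\<close>, hence equal
    to \<open>E\<close>, which meets the retained nodes.\<close>
  have meet: "C \<inter> O1 \<noteq> {}" if C: "C \<in> ?K" for C
  proof
    assume "C \<inter> O1 = {}"
    then have "C \<in> comps (V1 \<union> V2) (D \<union> Z)" "C \<inter> (O1 \<union> V2) = {}" using loops C by blast+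
    then show False using comps_disjoint[OF _ E] C comps_nonempty ne by (metis (no_types, lifting) ex_in_conv mem_Collect_eq subset_iff)
  qed
  have conn_sub: "C \<subseteq> E" if C: "C \<in> comps V1 D" and u: "u \<in> C" "u \<in> E" for C u
    using comps_eq[OF C u(1)] comps_eq[OF E u(2)] conn_mono[of D "D \<union> Z"] by blast
  have finK: "finite ?K" using comps_finite[OF fin, of D] by simp
  have wtK: "wt W E = (\<Otimes>C\<in>?K. wt W C)" if W: "W \<subseteq> D" "labelled W" for W
  proof (rule wt_union[OF W(2) _ finK])
    show "fst d \<noteq> {}" if "d \<in> W" for d using that W D1 by (auto simp: edges_in_def)
    show "\<exists>C\<in>?K. fst d \<subseteq> C" if dW: "d \<in> W" "fst d \<subseteq> E" for d
    proof -
      obtain u where u: "u \<in> fst d" "u \<in> V1" using dW W D1 unfolding edges_in_def by blast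
      have C: "conn D `` {u} \<in> comps V1 D" "u \<in> conn D `` {u}" using comps_of[OF u(2)] by auto
      then show ?thesis using conn_sub[OF C] comps_edge[OF C(1) _ u(1) C(2)] dW W u by blast
    qed
    show "C = C'" if "C \<in> ?K" "C' \<in> ?K" "u \<in> C" "u \<in> C'" for C C' u
      using that comps_disjoint[of C V1 D C' u] by simp
  qed auto
  have "{d \<in> P. fst d \<subseteq> E \<inter> (O1 \<union> V2)} = (\<lambda>C. (C \<inter> O1, wt X C \<otimes> wt Y C)) ` ?K"
  proof (intro equalityI subsetI)
    fix d assume "d \<in> {d \<in> P. fst d \<subseteq> E \<inter> (O1 \<union> V2)}"
    then have d: "d \<in> P" "fst d \<subseteq> E" by auto
    from d(1) obtain C where C: "C \<in> comps V1 D" "C \<inter> O1 \<noteq> {}" "d = (C \<inter> O1, wt X C \<otimes> wt Y C)"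
      unfolding P_def by blast
    then have "C \<inter> O1 \<subseteq> E" using d(2) by simp
    then have "C \<in> ?K" using conn_sub[OF C(1)] C(1,2) by blast
    then show "d \<in> (\<lambda>C. (C \<inter> O1, wt X C \<otimes> wt Y C)) ` ?K" using C by blast
  next
    fix d assume "d \<in> (\<lambda>C. (C \<inter> O1, wt X C \<otimes> wt Y C)) ` ?K"
    then obtain C where C: "C \<in> ?K" "d = (C \<inter> O1, wt X C \<otimes> wt Y C)" by blast
    then show "d \<in> {d \<in> P. fst d \<subseteq> E \<inter> (O1 \<union> V2)}" using meet[OF C(1)] by (auto simp: P_def)
  qed
  \<comment> \<open>Different components leave disjoint nonempty traces on \<open>O1\<close>, so no
    two of them yield the same edge of \<open>P\<close> and no label is lost from the
    product.\<close>
  moreover have "inj_on (\<lambda>C. (C \<inter> O1, wt X C \<otimes> wt Y C)) ?K"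
  proof (rule inj_onI)
    fix C C' assume C: "C \<in> ?K" "C' \<in> ?K" "(C \<inter> O1, wt X C \<otimes> wt Y C) = (C' \<inter> O1, wt X C' \<otimes> wt Y C')"
    then obtain u where "u \<in> C" "u \<in> C'" using meet[OF C(1)] by blast
    then show "C = C'" using comps_disjoint[of C V1 D C' u] C by simp
  qed
  moreover have "finprod G snd ((\<lambda>C. (C \<inter> O1, wt X C \<otimes> wt Y C)) ` ?K) =
      (\<Otimes>C\<in>?K. snd (C \<inter> O1, wt X C \<otimes> wt Y C))"
    if "inj_on (\<lambda>C. (C \<inter> O1, wt X C \<otimes> wt Y C)) ?K"
    by (rule finprod_reindex[OF _ that]) (use lab in auto)
  ultimately have "wt P (E \<inter> (O1 \<union> V2)) = (\<Otimes>C\<in>?K. wt X C \<otimes> wt Y C)"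
    unfolding wt_def[of P] by simp
  also have "\<dots> = wt X E \<otimes> wt Y E"
    using lab by (simp add: wtK[of X] wtK[of Y] D_def)
  finally show "wt P (E \<inter> (O1 \<union> V2)) = wt X E \<otimes> wt Y E" .
qed

end

text \<open>A connected graph has at least one edge fewer than it has nodes; edges are counted by
  their node sets, so parallel ones count once. Take a largest set \<open>W\<close> containing
  \<open>v\<close> for which the bound holds; an edge leaving \<open>W\<close> would allow it to be
  enlarged.\<close>

lemma connected_card_le:
  assumes fin: "finite C" "finite \<E>" and c2: "\<And>d. d \<in> \<E> \<Longrightarrow> card (fst d) = 2"
    and C: "C = conn \<E> `` {v}"
  shows "card C \<le> card (fst ` {d \<in> \<E>. fst d \<subseteq> C}) + 1"
proof -
  define Q where "Q W \<longleftrightarrow> W \<subseteq> C \<and> v \<in> W \<and> card W \<le> card (fst ` {d \<in> \<E>. fst d \<subseteq> W}) + 1" for W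
  have v: "Q {v}" using C by (auto simp: Q_def)
  have bd: "\<forall>W. Q W \<longrightarrow> card W < Suc (card C)"
    using card_mono[OF fin(1)] by (auto simp: Q_def less_Suc_eq_le)
  obtain W where Q: "Q W" and max: "\<And>W'. Q W' \<Longrightarrow> card W' \<le> card W"
    using ex_has_greatest_nat[of Q, OF v bd] by blast
  then have W: "W \<subseteq> C" "v \<in> W" "card W \<le> card (fst ` {d \<in> \<E>. fst d \<subseteq> W}) + 1"
    by (simp_all add: Q_def)
  have "C \<subseteq> W"
  proof (rule ccontr)
    assume "\<not> C \<subseteq> W"
    then obtain z where z: "(v, z) \<in> conn \<E>" "z \<notin> W" using C by blast
    \<comment> \<open>A walk from \<open>v\<close> to \<open>z\<close> leaves \<open>W\<close> by
      some edge. Adding its far end adds one node and at least one edge, so the bound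
      persists.\<close>
    have "\<exists>u w d. u \<in> W \<and> w \<in> C - W \<and> d \<in> \<E> \<and> u \<in> fst d \<and> w \<in> fst d"
    proof (rule ccontr)
      assume n: "\<not> ?thesis"
      have "z \<in> W" using z(1)
      proof (induct rule: conn_induct)
        case (step y w d)
        have "(v, w) \<in> conn \<E>" using step conn_edge[OF step(3)] by (blast intro: conn_trans)
        then show ?case using n step C by blast
      qed (use W in blast)
      then show False using z by blast
    qed
    then obtain u w d where uwd: "u \<in> W" "w \<in> C" "w \<notin> W" "d \<in> \<E>" "u \<in> fst d" "w \<in> fst d" by blast
    obtain a b where "fst d = {a, b}" using c2[OF uwd(4)] by (auto simp: card_2_iff)
    moreover have "u \<noteq> w" using uwd by blast
    ultimately have "fst d = {u, w}" using uwd(5,6) by auto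
    then have d: "fst d \<subseteq> insert w W" "\<not> fst d \<subseteq> W" using uwd by auto
    have finW: "finite W" using W fin finite_subset by blast
    have "card (insert (fst d) (fst ` {d \<in> \<E>. fst d \<subseteq> W})) \<le> card (fst ` {d \<in> \<E>. fst d \<subseteq> insert w W})"
      by (rule card_mono) (use fin d uwd in auto)
    moreover have "fst d \<notin> fst ` {d \<in> \<E>. fst d \<subseteq> W}" using d by auto
    ultimately have "Q (insert w W)" using W uwd fin finW by (simp add: Q_def)
    then show False using max[of "insert w W"] uwd finW by auto
  qed
  then have "C = W" using W by blast
  then show ?thesis using W by blast
qed

context comm_monoid
begin

lemma wt_empty: "edges_in V D \<Longrightarrow> wt D {} = \<one>"
  unfolding wt_def by (auto simp: edges_in_def intro!: finprod_one_eqI)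

text \<open>The right-hand sides refer only to the union of the three graphs, so they do not depend
  on which two are composed first. The function \<open>f\<close> stands for the loop factor of a
  label.\<close>

lemma
  fixes X Y Z :: "('v set \<times> 'a) set" and V1 V2 O1 B :: "'v set" and K :: "('k, 'e) monoid_scheme" and f :: "'a \<Rightarrow> 'k"
  defines "D \<equiv> X \<union> Y"
  defines "P \<equiv> {(C \<inter> O1, wt X C \<otimes> wt Y C) | C. C \<in> comps V1 D \<and> C \<inter> O1 \<noteq> {}}"
  assumes X: "edges_in V1 X" and Y: "edges_in V1 Y" and Z: "edges_in V2 Z"
    and fin: "finite V1" "finite V2"
    and O: "O1 \<subseteq> V1" "V1 \<inter> V2 \<subseteq> O1"
    and lab: "labelled X" "labelled Y" "labelled Z"
    and B: "B \<subseteq> O1 \<union> V2"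
  shows contraction_assoc: "{(C \<inter> B, wt P C \<otimes> wt Z C) | C. C \<in> comps (O1 \<union> V2) (P \<union> Z) \<and> C \<inter> B \<noteq> {}} =
      {(E \<inter> B, (wt X E \<otimes> wt Y E) \<otimes> wt Z E) | E. E \<in> comps (V1 \<union> V2) (D \<union> Z) \<and> E \<inter> B \<noteq> {}}"
    and contraction_cocycle: "\<lbrakk>comm_monoid K; \<And>g. g \<in> carrier G \<Longrightarrow> f g \<in> carrier K\<rbrakk> \<Longrightarrow>
      finprod K (\<lambda>C. f (wt X C \<otimes> wt Y C)) {C \<in> comps V1 D. C \<inter> O1 = {}} \<otimes>\<^bsub>K\<^esub>
      finprod K (\<lambda>C. f (wt P C \<otimes> wt Z C)) {C \<in> comps (O1 \<union> V2) (P \<union> Z). C \<inter> B = {}} =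
      finprod K (\<lambda>E. f ((wt X E \<otimes> wt Y E) \<otimes> wt Z E)) {E \<in> comps (V1 \<union> V2) (D \<union> Z). E \<inter> B = {}}"
proof -
  let ?W = "O1 \<union> V2" and ?T = "comps (V1 \<union> V2) (D \<union> Z)"
  note con = contraction[OF X Y Z fin(1) O lab, folded D_def, folded P_def]
  have labP: "labelled P"
  proof -
    have "P = (\<lambda>C. (C \<inter> O1, wt X C \<otimes> wt Y C)) ` {C \<in> comps V1 D. C \<inter> O1 \<noteq> {}}" by (auto simp: P_def)
    then have "finite P" "\<forall>d\<in>P. snd d \<in> carrier G" using comps_finite[OF fin(1), of D] lab by simp_all
    then show ?thesis by (simp add: labelled_def)
  qed
  have EB: "(E \<inter> ?W) \<inter> B = E \<inter> B" for E :: "'v set" using B by blast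
  have wP: "wt P (E \<inter> ?W) \<otimes> wt Z (E \<inter> ?W) = (wt X E \<otimes> wt Y E) \<otimes> wt Z E"
    if "E \<in> ?T" "E \<inter> ?W \<noteq> {}" for E
    using con(3)[OF that] con(4)[OF that(1)] by simp
  show "{(C \<inter> B, wt P C \<otimes> wt Z C) | C. C \<in> comps ?W (P \<union> Z) \<and> C \<inter> B \<noteq> {}} =
      {(E \<inter> B, (wt X E \<otimes> wt Y E) \<otimes> wt Z E) | E. E \<in> ?T \<and> E \<inter> B \<noteq> {}}" (is "?L = ?R")
  proof (intro equalityI subsetI)
    fix p assume "p \<in> ?L"
    then obtain C where C: "C \<in> comps ?W (P \<union> Z)" "C \<inter> B \<noteq> {}" "p = (C \<inter> B, wt P C \<otimes> wt Z C)" by blast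
    then obtain E where E: "E \<in> ?T" "E \<inter> ?W \<noteq> {}" "C = E \<inter> ?W" unfolding con(1) by blast
    have "p = (E \<inter> B, (wt X E \<otimes> wt Y E) \<otimes> wt Z E)" using C(3) wP[OF E(1,2)] EB[of E] E(3) by simp
    moreover have "E \<inter> B \<noteq> {}" using C(2) EB[of E] E(3) by simp
    ultimately show "p \<in> ?R" using E(1) by blast
  next
    fix p assume "p \<in> ?R"
    then obtain E where E: "E \<in> ?T" "E \<inter> B \<noteq> {}" "p = (E \<inter> B, (wt X E \<otimes> wt Y E) \<otimes> wt Z E)" by blast
    then have ne: "E \<inter> ?W \<noteq> {}" using B by blast
    have "E \<inter> ?W \<in> comps ?W (P \<union> Z)" unfolding con(1) using E ne by blast
    moreover have "p = ((E \<inter> ?W) \<inter> B, wt P (E \<inter> ?W) \<otimes> wt Z (E \<inter> ?W))" using E(3) wP[OF E(1) ne] EB[of E] by simp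
    moreover have "(E \<inter> ?W) \<inter> B \<noteq> {}" using E(2) EB[of E] by simp
    ultimately show "p \<in> ?L" by blast
  qed
  assume K: "comm_monoid K" and f: "\<And>g. g \<in> carrier G \<Longrightarrow> f g \<in> carrier K"
  interpret K: comm_monoid K by fact
  let ?h = "\<lambda>E. f ((wt X E \<otimes> wt Y E) \<otimes> wt Z E)"
  \<comment> \<open>The loops of the triple product fall into those closed up by the first gluing,
    which miss all retained nodes, and those closed up by the second.\<close>
  let ?A = "{E \<in> ?T. E \<inter> ?W = {}}" and ?A' = "{E \<in> ?T. E \<inter> ?W \<noteq> {} \<and> E \<inter> B = {}}"
  have h: "?h E \<in> carrier K" for E using lab by (intro f) simp
  have finT: "finite ?T" using comps_finite fin by blast
  have "finprod K (\<lambda>C. f (wt X C \<otimes> wt Y C)) {C \<in> comps V1 D. C \<inter> O1 = {}} = finprod K ?h ?A"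
    unfolding con(2)[symmetric]
  proof (rule K.finprod_cong')
    fix E assume E: "E \<in> ?A"
    have "wt Z E = \<one>" using con(4)[of E] E wt_empty[OF Z] by simp
    then show "f (wt X E \<otimes> wt Y E) = ?h E" using lab by simp
  qed (use h in auto)
  moreover have "finprod K (\<lambda>C. f (wt P C \<otimes> wt Z C)) {C \<in> comps ?W (P \<union> Z). C \<inter> B = {}} = finprod K ?h ?A'"
  proof -
    have im: "{C \<in> comps ?W (P \<union> Z). C \<inter> B = {}} = (\<lambda>E. E \<inter> ?W) ` ?A'"
    proof (intro equalityI subsetI)
      fix C assume C: "C \<in> {C \<in> comps ?W (P \<union> Z). C \<inter> B = {}}"
      then obtain E where E: "E \<in> ?T" "E \<inter> ?W \<noteq> {}" "C = E \<inter> ?W" unfolding con(1) by blast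
      then have "E \<inter> B = {}" using C EB[of E] by simp
      then show "C \<in> (\<lambda>E. E \<inter> ?W) ` ?A'" using E by blast
    next
      fix C assume "C \<in> (\<lambda>E. E \<inter> ?W) ` ?A'"
      then obtain E where E: "E \<in> ?T" "E \<inter> ?W \<noteq> {}" "E \<inter> B = {}" "C = E \<inter> ?W" by blast
      then have "C \<in> comps ?W (P \<union> Z)" unfolding con(1) by blast
      moreover have "C \<inter> B = {}" using E(3,4) EB[of E] by simp
      ultimately show "C \<in> {C \<in> comps ?W (P \<union> Z). C \<inter> B = {}}" by simp
    qed
    have inj: "inj_on (\<lambda>E. E \<inter> ?W) ?A'"
    proof (rule inj_onI)
      fix E E' assume E: "E \<in> ?A'" "E' \<in> ?A'" "E \<inter> ?W = E' \<inter> ?W"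
      then obtain u where "u \<in> E" "u \<in> E'" by blast
      then show "E = E'" using comps_disjoint[of E "V1 \<union> V2" "D \<union> Z" E' u] E by simp
    qed
    have "finprod K (\<lambda>C. f (wt P C \<otimes> wt Z C)) {C \<in> comps ?W (P \<union> Z). C \<inter> B = {}} =
        finprod K (\<lambda>E. f (wt P (E \<inter> ?W) \<otimes> wt Z (E \<inter> ?W))) ?A'"
      unfolding im by (rule K.finprod_reindex[of "\<lambda>C. f (wt P C \<otimes> wt Z C)" "\<lambda>E. E \<inter> ?W" ?A', OF _ inj])
        (use labP lab f in auto)
    also have "\<dots> = finprod K ?h ?A'"
      by (rule K.finprod_cong') (use wP h in auto)
    finally show ?thesis .
  qed
  moreover have "{E \<in> ?T. E \<inter> B = {}} = ?A \<union> ?A'" using B by blast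
  moreover have "finprod K ?h (?A \<union> ?A') = finprod K ?h ?A \<otimes>\<^bsub>K\<^esub> finprod K ?h ?A'"
    by (rule K.finprod_Un_disjoint) (use finT h in auto)
  ultimately show "finprod K (\<lambda>C. f (wt X C \<otimes> wt Y C)) {C \<in> comps V1 D. C \<inter> O1 = {}} \<otimes>\<^bsub>K\<^esub>
      finprod K (\<lambda>C. f (wt P C \<otimes> wt Z C)) {C \<in> comps ?W (P \<union> Z). C \<inter> B = {}} =
      finprod K ?h {E \<in> ?T. E \<inter> B = {}}" by simp
qed

end

section \<open>Brauer diagrams\<close>

text \<open>The same as \<open>relabel\<close>, but between arbitrary node types, as the passage to
  columns requires.\<close>

definition move :: "('u \<Rightarrow> 'v) \<Rightarrow> ('u set \<times> 'g) set \<Rightarrow> ('v set \<times> 'g) set" where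
  "move r D = (\<lambda>(e, g). (r ` e, g)) ` D"

lemma relabel_eq_move: "relabel = move"
  by (simp add: fun_eq_iff relabel_def move_def)

lemma move_iff: "d \<in> move r D \<longleftrightarrow> (\<exists>d'\<in>D. d = (r ` fst d', snd d'))"
  by (force simp: move_def)

lemma moveI: "d \<in> D \<Longrightarrow> (r ` fst d, snd d) \<in> move r D"
  by (auto simp: move_iff)

lemma move_move: "move r (move s D) = move (\<lambda>u. r (s u)) D"
  by (force simp: move_def image_image)

lemma move_Un: "move r (D \<union> D') = move r D \<union> move r D'"
  by (simp add: move_def image_Un)

lemma move_cong:
  assumes "\<And>d u. d \<in> D \<Longrightarrow> u \<in> fst d \<Longrightarrow> r u = s u"
  shows "move r D = move s D"
  unfolding move_def
proof (rule image_cong[OF refl])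
  fix d assume "d \<in> D"
  then show "(\<lambda>(e, g). (r ` e, g)) d = (\<lambda>(e, g). (s ` e, g)) d"
    using assms[of d] by (cases d) (auto intro!: image_cong)
qed

lemma move_inj: "inj r \<Longrightarrow> move r D = move r D' \<Longrightarrow> D = D'"
proof -
  assume r: "inj r" and eq: "move r D = move r D'"
  have i: "inj (\<lambda>(e, g). (r ` e, g))" using inj_image_eq_iff[OF r] by (auto intro!: injI)
  show "D = D'" using eq unfolding move_def inj_image_eq_iff[OF i] .
qed

lemma edges_in_mono: "edges_in V D \<Longrightarrow> V \<subseteq> W \<Longrightarrow> edges_in W D"
  by (auto simp: edges_in_def)

lemma edges_in_move: "edges_in V D \<Longrightarrow> edges_in (r ` V) (move r D)"
  by (fastforce simp: edges_in_def move_iff)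

lemma conn_move:
  assumes r: "inj r"
  shows "(r u, v') \<in> conn (move r D) \<longleftrightarrow> (\<exists>v. v' = r v \<and> (u, v) \<in> conn D)"
proof
  assume "(r u, v') \<in> conn (move r D)"
  then show "\<exists>v. v' = r v \<and> (u, v) \<in> conn D"
  proof (induct rule: conn_induct)
    case (step y z d)
    then obtain v d' where v: "y = r v" "(u, v) \<in> conn D" and d': "d' \<in> D" "d = (r ` fst d', snd d')"
      by (auto simp: move_iff)
    then obtain w where w: "z = r w" "w \<in> fst d'" using step by auto
    have "v \<in> fst d'" using step v d' r by (auto dest: injD)
    then have "(u, w) \<in> conn D" using conn_edge[OF d'(1) _ w(2)] v(2) by (blast intro: conn_trans)
    then show ?case using w by blast
  qed auto
next
  assume "\<exists>v. v' = r v \<and> (u, v) \<in> conn D"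
  then obtain v where v: "v' = r v" "(u, v) \<in> conn D" by blast
  from v(2) have "(r u, r v) \<in> conn (move r D)"
  proof (induct rule: conn_induct)
    case (step y z d)
    have "(r y, r z) \<in> conn (move r D)" by (rule conn_edge[OF moveI[OF step(3)]]) (use step in auto)
    then show ?case using step by (blast intro: conn_trans)
  qed simp
  then show "(r u, v') \<in> conn (move r D)" using v by simp
qed

lemma comps_move:
  assumes r: "inj r"
  shows "comps (r ` V) (move r D) = (`) r ` comps V D"
proof -
  have im: "conn (move r D) `` {r u} = r ` (conn D `` {u})" for u
    using conn_move[OF r, of u _ D] by auto
  show ?thesis unfolding comps_def quotient_def by (auto simp: im)
qed

context comm_monoid
begin

lemma labelled_move: "labelled D \<Longrightarrow> labelled (move r D)"
  by (auto simp: labelled_def move_def)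

lemma wt_move:
  assumes r: "inj r" and lab: "labelled D"
  shows "wt (move r D) (r ` C) = wt D C"
proof -
  let ?m = "\<lambda>(e, g :: 'a). (r ` e, g)"
  have inj: "inj ?m" using inj_image_eq_iff[OF r] by (auto intro!: injI)
  have "{d \<in> move r D. fst d \<subseteq> r ` C} = ?m ` {d \<in> D. fst d \<subseteq> C}"
  proof (intro equalityI subsetI)
    fix d assume "d \<in> {d \<in> move r D. fst d \<subseteq> r ` C}"
    then obtain d' where d': "d' \<in> D" "d = (r ` fst d', snd d')" "r ` fst d' \<subseteq> r ` C"
      by (auto simp: move_iff)
    then have "d' \<in> {d \<in> D. fst d \<subseteq> C}" "d = ?m d'"
      using inj_image_subset_iff[OF r] by (simp_all add: case_prod_unfold)
    then show "d \<in> ?m ` {d \<in> D. fst d \<subseteq> C}" by blast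
  next
    fix d assume "d \<in> ?m ` {d \<in> D. fst d \<subseteq> C}"
    then obtain d' where "d' \<in> D" "fst d' \<subseteq> C" "d = (r ` fst d', snd d')" by (auto simp: case_prod_unfold)
    then show "d \<in> {d \<in> move r D. fst d \<subseteq> r ` C}" using moveI[of d' D r] by auto
  qed
  then have "wt (move r D) (r ` C) = finprod G snd (?m ` {d \<in> D. fst d \<subseteq> C})" by (simp only: wt_def)
  also have "\<dots> = finprod G (\<lambda>d. snd (?m d)) {d \<in> D. fst d \<subseteq> C}"
    by (rule finprod_reindex[OF _ inj_on_subset[OF inj subset_UNIV]]) (use lab in \<open>auto simp: labelled_def\<close>)
  also have "(\<lambda>d. snd (?m d)) = snd" by (auto simp: fun_eq_iff)
  finally show ?thesis by (simp add: wt_def)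
qed

end

locale brauer = comm_group G + K: cring k
  for G :: "('g, 'c) monoid_scheme" (structure) and k :: "('k, 'd) ring_scheme" +
  fixes act :: "'g \<Rightarrow> 'k \<Rightarrow> 'k" and \<delta> :: 'k and n :: nat
  assumes act_closed: "g \<in> carrier G \<Longrightarrow> act g \<delta> \<in> carrier k"
begin

abbreviation "dgs \<equiv> brauer_diagrams G n"
abbreviation "outer \<equiv> outer_nodes n"
abbreviation "nodes \<equiv> outer_nodes n \<union> Mid ` {1..n}"
abbreviation "cmp \<equiv> brauer_compose G n"
abbreviation "lf \<equiv> loop_factor G k act \<delta> n"
abbreviation "xm \<equiv> move right_to_mid"
abbreviation "ym \<equiv> move left_to_mid"

lemma dg_edge:
  assumes "x \<in> dgs" "d \<in> x"
  shows "fst d \<subseteq> outer" "card (fst d) = 2" "snd d \<in> carrier G" "fst d \<noteq> {}"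
proof -
  have "\<forall>d\<in>x. fst d \<subseteq> outer \<and> card (fst d) = 2 \<and> snd d \<in> carrier G"
    using assms(1) by (simp add: brauer_diagrams_def case_prod_unfold)
  then show "fst d \<subseteq> outer" "card (fst d) = 2" "snd d \<in> carrier G" "fst d \<noteq> {}"
    using assms(2) by force+
qed

lemma dg_ex1: "x \<in> dgs \<Longrightarrow> v \<in> outer \<Longrightarrow> \<exists>!d. d \<in> x \<and> v \<in> fst d"
  by (simp add: brauer_diagrams_def)

lemma dg_ex: "x \<in> dgs \<Longrightarrow> v \<in> outer \<Longrightarrow> \<exists>d\<in>x. v \<in> fst d"
  using dg_ex1[of x v] by blast

lemma dg_unique: "x \<in> dgs \<Longrightarrow> d \<in> x \<Longrightarrow> d' \<in> x \<Longrightarrow> v \<in> fst d \<Longrightarrow> v \<in> fst d' \<Longrightarrow> d = d'"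
  using dg_ex1[of x v] dg_edge(1)[of x d] by blast

lemma dgI:
  assumes "\<And>d. d \<in> x \<Longrightarrow> fst d \<subseteq> outer \<and> card (fst d) = 2 \<and> snd d \<in> carrier G"
    and "\<And>v. v \<in> outer \<Longrightarrow> \<exists>d\<in>x. v \<in> fst d"
    and "\<And>d d' v. d \<in> x \<Longrightarrow> d' \<in> x \<Longrightarrow> v \<in> fst d \<Longrightarrow> v \<in> fst d' \<Longrightarrow> d = d'"
  shows "x \<in> dgs"
  unfolding brauer_diagrams_def mem_Collect_eq case_prod_unfold
proof (intro conjI ballI)
  fix v assume "v \<in> outer"
  then obtain d where d: "d \<in> x" "v \<in> fst d" using assms(2) by blast
  show "\<exists>!d. d \<in> x \<and> v \<in> fst d" by (rule ex1I[of _ d]) (use d assms(3) in blast)+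
qed (use assms(1) in blast)+

lemma outer_finite [simp]: "finite outer" by (simp add: outer_nodes_def)

lemma dg_finite: "x \<in> dgs \<Longrightarrow> finite x"
proof -
  assume x: "x \<in> dgs"
  have "inj_on fst x"
  proof (rule inj_onI)
    fix d d' assume d: "d \<in> x" "d' \<in> x" "fst d = fst d'"
    obtain v where "v \<in> fst d" using dg_edge(4)[OF x d(1)] by blast
    then show "d = d'" using dg_unique[OF x d(1,2)] d(3) by simp
  qed
  moreover have "fst ` x \<subseteq> Pow outer" using dg_edge(1)[OF x] by auto
  ultimately show "finite x" using finite_imageD[of fst x] finite_subset[of "fst ` x" "Pow outer"] by simp
qed

lemma dg_labelled: "x \<in> dgs \<Longrightarrow> labelled x"
  using dg_finite dg_edge(3) by (auto simp: labelled_def)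

lemma dg_edges_in: "x \<in> dgs \<Longrightarrow> edges_in outer x"
  using dg_edge(1,4) by (auto simp: edges_in_def)

lemma glued_eq: "glued_components n x y = comps nodes (xm x \<union> ym y)"
  by (simp add: glued_components_def comps_def conn_def relabel_eq_move)

lemma label_eq: "component_label G x y C = wt (xm x) C \<otimes> wt (ym y) C"
  by (simp add: component_label_def wt_def relabel_eq_move)

lemma cmp_eq: "cmp x y = {(C \<inter> outer, wt (xm x) C \<otimes> wt (ym y) C) | C.
    C \<in> comps nodes (xm x \<union> ym y) \<and> C \<inter> outer \<noteq> {}}"
  by (simp add: brauer_compose_def glued_eq label_eq)

lemma lf_eq: "lf x y = finprod k (\<lambda>C. act (wt (xm x) C \<otimes> wt (ym y) C) \<delta>)
    {C \<in> comps nodes (xm x \<union> ym y). C \<inter> outer = {}}"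
  by (simp add: loop_factor_def glued_eq label_eq)

lemma xm_edges_in: "x \<in> dgs \<Longrightarrow> edges_in nodes (xm x)"
  by (rule edges_in_mono[OF edges_in_move[OF dg_edges_in]]) (auto simp: outer_nodes_def)

lemma ym_edges_in: "x \<in> dgs \<Longrightarrow> edges_in nodes (ym x)"
  by (rule edges_in_mono[OF edges_in_move[OF dg_edges_in]]) (auto simp: outer_nodes_def)

lemma lf_closed: "x \<in> dgs \<Longrightarrow> y \<in> dgs \<Longrightarrow> lf x y \<in> carrier k"
  unfolding lf_eq by (auto intro!: K.finprod_closed act_closed simp: dg_labelled labelled_move)

text \<open>Products and loop factors may be computed after any injective renaming of the nodes;
  this places the two factors in any three columns.\<close>

lemma cmp_move:
  assumes r: "inj r" and x: "x \<in> dgs" and y: "y \<in> dgs"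
  defines "X \<equiv> move r (xm x)" and "Y \<equiv> move r (ym y)"
  shows "move r (cmp x y) = {(C \<inter> r ` outer, wt X C \<otimes> wt Y C) | C.
      C \<in> comps (r ` nodes) (X \<union> Y) \<and> C \<inter> r ` outer \<noteq> {}}"
    and "lf x y = finprod k (\<lambda>C. act (wt X C \<otimes> wt Y C) \<delta>) {C \<in> comps (r ` nodes) (X \<union> Y). C \<inter> r ` outer = {}}"
proof -
  have XY: "X \<union> Y = move r (xm x \<union> ym y)" by (simp add: X_def Y_def move_Un)
  have w: "wt X (r ` C) = wt (xm x) C" "wt Y (r ` C) = wt (ym y) C" for C
    by (simp_all add: X_def Y_def wt_move[OF r] labelled_move dg_labelled x y)
  have io: "r ` C \<inter> r ` outer = r ` (C \<inter> outer)" for C by (rule image_Int[OF r, symmetric])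
  show "move r (cmp x y) = {(C \<inter> r ` outer, wt X C \<otimes> wt Y C) | C.
      C \<in> comps (r ` nodes) (X \<union> Y) \<and> C \<inter> r ` outer \<noteq> {}}" (is "_ = ?R")
  proof (intro equalityI subsetI)
    fix p assume "p \<in> move r (cmp x y)"
    then obtain d where d: "d \<in> cmp x y" "p = (r ` fst d, snd d)" by (auto simp: move_iff)
    then obtain C where C: "C \<in> comps nodes (xm x \<union> ym y)" "C \<inter> outer \<noteq> {}"
      "d = (C \<inter> outer, wt (xm x) C \<otimes> wt (ym y) C)" unfolding cmp_eq by blast
    have "r ` C \<in> comps (r ` nodes) (X \<union> Y)" unfolding XY comps_move[OF r] using C(1) by blast
    moreover have "p = (r ` C \<inter> r ` outer, wt X (r ` C) \<otimes> wt Y (r ` C))" using d(2) C(3) by (simp add: w io)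
    moreover have "r ` C \<inter> r ` outer \<noteq> {}" using C(2) by (simp add: io)
    ultimately show "p \<in> ?R" by blast
  next
    fix p assume "p \<in> ?R"
    then obtain C' where C': "C' \<in> comps (r ` nodes) (X \<union> Y)" "C' \<inter> r ` outer \<noteq> {}"
      "p = (C' \<inter> r ` outer, wt X C' \<otimes> wt Y C')" by blast
    then obtain C where C: "C \<in> comps nodes (xm x \<union> ym y)" "C' = r ` C" unfolding XY comps_move[OF r] by blast
    then have "(C \<inter> outer, wt (xm x) C \<otimes> wt (ym y) C) \<in> cmp x y" using C'(2) unfolding cmp_eq by (auto simp: io)
    from moveI[OF this] show "p \<in> move r (cmp x y)" using C'(3) C(2) by (simp add: w io)
  qed
  let ?L = "{C \<in> comps nodes (xm x \<union> ym y). C \<inter> outer = {}}"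
  have "{C \<in> comps (r ` nodes) (X \<union> Y). C \<inter> r ` outer = {}} = (`) r ` ?L"
    unfolding XY comps_move[OF r] using io by auto
  then have "finprod k (\<lambda>C. act (wt X C \<otimes> wt Y C) \<delta>) {C \<in> comps (r ` nodes) (X \<union> Y). C \<inter> r ` outer = {}} =
      finprod k (\<lambda>C. act (wt X C \<otimes> wt Y C) \<delta>) ((`) r ` ?L)" by (simp only:)
  also have "\<dots> = finprod k (\<lambda>C. act (wt X (r ` C) \<otimes> wt Y (r ` C)) \<delta>) ?L"
  proof (rule K.finprod_reindex)
    show "inj_on ((`) r) ?L" by (rule inj_onI) (simp only: inj_image_eq_iff[OF r])
    show "(\<lambda>C. act (wt X C \<otimes> wt Y C) \<delta>) \<in> (`) r ` ?L \<rightarrow> carrier k"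
      using act_closed by (auto simp: X_def Y_def labelled_move dg_labelled x y)
  qed
  finally show "lf x y = finprod k (\<lambda>C. act (wt X C \<otimes> wt Y C) \<delta>) {C \<in> comps (r ` nodes) (X \<union> Y). C \<inter> r ` outer = {}}"
    unfolding lf_eq by (simp only: w)
qed

text \<open>Triple products live on the four columns \<open>0, 1, 2, 3\<close> of \<open>{1..n}\<close>.\<close>

fun colmap :: "nat \<Rightarrow> nat \<Rightarrow> nat \<Rightarrow> node \<Rightarrow> nat \<times> nat" where
  "colmap p m q (Lft i) = (p, i)"
| "colmap p m q (Mid i) = (m, i)"
| "colmap p m q (Rgt i) = (q, i)"

definition col :: "nat \<Rightarrow> (nat \<times> nat) set" where "col p = {p} \<times> {1..n}"

text \<open>Diagrams have no middle nodes, so 4 is a dummy column. It differs from the columns 0 to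
  3 in order that the map of nodes is injective and the diagram can be recovered.\<close>

definition place :: "nat \<Rightarrow> nat \<Rightarrow> 'g diagram \<Rightarrow> ((nat \<times> nat) set \<times> 'g) set" where
  "place p q = move (colmap p 4 q)"

lemma colmap_inj: "distinct [p, m, q] \<Longrightarrow> inj (colmap p m q)"
proof (rule injI)
  fix u v assume "distinct [p, m, q]" "colmap p m q u = colmap p m q v"
  then show "u = v" by (cases u; cases v) auto
qed

lemma colmap_outer: "colmap p m q ` outer = col p \<union> col q"
  by (auto simp: outer_nodes_def col_def image_Un image_image)

lemma colmap_nodes: "colmap p m q ` nodes = col p \<union> col m \<union> col q"
  by (auto simp: outer_nodes_def col_def image_Un image_image)

lemma place_edges_in: "x \<in> dgs \<Longrightarrow> edges_in (col p \<union> col q) (place p q x)"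
  unfolding place_def using edges_in_move[OF dg_edges_in] by (metis colmap_outer)

lemma place_labelled: "x \<in> dgs \<Longrightarrow> labelled (place p q x)"
  unfolding place_def by (intro labelled_move dg_labelled)

lemma move_outer_cong:
  assumes "edges_in outer D" "\<And>u. u \<in> outer \<Longrightarrow> r u = s u"
  shows "move r D = move s D"
  by (rule move_cong) (use assms in \<open>auto simp: edges_in_def\<close>)

lemma outer_cases: "u \<in> outer \<Longrightarrow> (\<And>i. i \<in> {1..n} \<Longrightarrow> u = Lft i \<Longrightarrow> Q) \<Longrightarrow> (\<And>i. i \<in> {1..n} \<Longrightarrow> u = Rgt i \<Longrightarrow> Q) \<Longrightarrow> Q"
  by (auto simp: outer_nodes_def)

lemma place_xm: "x \<in> dgs \<Longrightarrow> move (colmap p m q) (xm x) = place p m x"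
  unfolding place_def move_move by (rule move_outer_cong[OF dg_edges_in]) (auto elim!: outer_cases)

lemma place_ym: "x \<in> dgs \<Longrightarrow> move (colmap p m q) (ym x) = place m q x"
  unfolding place_def move_move by (rule move_outer_cong[OF dg_edges_in]) (auto elim!: outer_cases)

lemma cmp_edges_in: "edges_in outer (cmp x y)"
  by (auto simp: edges_in_def cmp_eq)

lemma place_cmp:
  assumes "distinct [p, m, q]" "x \<in> dgs" "y \<in> dgs"
  shows "place p q (cmp x y) = {(C \<inter> (col p \<union> col q), wt (place p m x) C \<otimes> wt (place m q y) C) | C.
      C \<in> comps (col p \<union> col m \<union> col q) (place p m x \<union> place m q y) \<and> C \<inter> (col p \<union> col q) \<noteq> {}}"
    and "lf x y = finprod k (\<lambda>C. act (wt (place p m x) C \<otimes> wt (place m q y) C) \<delta>)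
      {C \<in> comps (col p \<union> col m \<union> col q) (place p m x \<union> place m q y). C \<inter> (col p \<union> col q) = {}}"
proof -
  have "place p q (cmp x y) = move (colmap p m q) (cmp x y)"
    unfolding place_def by (rule move_outer_cong[OF cmp_edges_in]) (auto elim!: outer_cases)
  then show "place p q (cmp x y) = {(C \<inter> (col p \<union> col q), wt (place p m x) C \<otimes> wt (place m q y) C) | C.
      C \<in> comps (col p \<union> col m \<union> col q) (place p m x \<union> place m q y) \<and> C \<inter> (col p \<union> col q) \<noteq> {}}"
    using cmp_move(1)[OF colmap_inj[OF assms(1)] assms(2,3)]
    unfolding place_xm[OF assms(2)] place_ym[OF assms(3)] colmap_outer colmap_nodes by (simp only:)
  show "lf x y = finprod k (\<lambda>C. act (wt (place p m x) C \<otimes> wt (place m q y) C) \<delta>)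
      {C \<in> comps (col p \<union> col m \<union> col q) (place p m x \<union> place m q y). C \<inter> (col p \<union> col q) = {}}"
    using cmp_move(2)[OF colmap_inj[OF assms(1)] assms(2,3)]
    unfolding place_xm[OF assms(2)] place_ym[OF assms(3)] colmap_outer colmap_nodes by (simp only:)
qed

lemma col_finite: "finite (col p)"
  by (simp add: col_def)

text \<open>Both bracketings are contractions of the same graph on four columns: one contracts
  column 1 first, the other column 2. That the partial products are diagrams again is a hypothesis
  here and is supplied by \<open>cmp_closed\<close>.\<close>

lemma
  assumes x: "x \<in> dgs" and y: "y \<in> dgs" and z: "z \<in> dgs"
    and xy: "cmp x y \<in> dgs" and yz: "cmp y z \<in> dgs"
  shows cmp_assoc: "cmp (cmp x y) z = cmp x (cmp y z)"
    and lf_cocycle: "lf x y \<otimes>\<^bsub>k\<^esub> lf (cmp x y) z = lf y z \<otimes>\<^bsub>k\<^esub> lf x (cmp y z)"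
proof -
  let ?X = "place 0 1 x" and ?Y = "place 1 2 y" and ?Z = "place 2 3 z" and ?f = "\<lambda>g. act g \<delta>"
  let ?V = "col 0 \<union> col 1 \<union> col 2 \<union> col 3" and ?B = "col 0 \<union> col 3"
  note lab = place_labelled[OF x, of 0 1] place_labelled[OF y, of 1 2] place_labelled[OF z, of 2 3]
  note e = place_edges_in[OF x, of 0 1] place_edges_in[OF y, of 1 2] place_edges_in[OF z, of 2 3]
  have e1: "edges_in (col 0 \<union> col 1 \<union> col 2) ?X" "edges_in (col 0 \<union> col 1 \<union> col 2) ?Y" "edges_in (col 2 \<union> col 3) ?Z"
    and e2: "edges_in (col 1 \<union> col 2 \<union> col 3) ?Y" "edges_in (col 1 \<union> col 2 \<union> col 3) ?Z" "edges_in (col 0 \<union> col 1) ?X"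
    using e by (auto elim!: edges_in_mono)
  have fin: "finite (col 0 \<union> col 1 \<union> col 2)" "finite (col 2 \<union> col 3)"
    "finite (col 1 \<union> col 2 \<union> col 3)" "finite (col 0 \<union> col 1)" by (simp_all add: col_finite)
  have s: "col 0 \<union> col 2 \<subseteq> col 0 \<union> col 1 \<union> col 2" "(col 0 \<union> col 1 \<union> col 2) \<inter> (col 2 \<union> col 3) \<subseteq> col 0 \<union> col 2"
    "col 1 \<union> col 3 \<subseteq> col 1 \<union> col 2 \<union> col 3" "(col 1 \<union> col 2 \<union> col 3) \<inter> (col 0 \<union> col 1) \<subseteq> col 1 \<union> col 3"
    and B: "?B \<subseteq> col 0 \<union> col 2 \<union> (col 2 \<union> col 3)" "?B \<subseteq> col 1 \<union> col 3 \<union> (col 0 \<union> col 1)"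
    by (auto simp: col_def)
  have S: "col 0 \<union> col 1 \<union> col 2 \<union> (col 2 \<union> col 3) = ?V" "col 1 \<union> col 2 \<union> col 3 \<union> (col 0 \<union> col 1) = ?V"
    "col 0 \<union> col 2 \<union> (col 2 \<union> col 3) = col 0 \<union> col 2 \<union> col 3"
    "col 1 \<union> col 3 \<union> (col 0 \<union> col 1) = col 0 \<union> col 1 \<union> col 3"
    "?Y \<union> ?Z \<union> ?X = ?X \<union> ?Y \<union> ?Z" "place 1 3 (cmp y z) \<union> ?X = ?X \<union> place 1 3 (cmp y z)" by auto
  have d: "distinct [0, 1, 2 :: nat]" "distinct [1, 2, 3 :: nat]" "distinct [0, 2, 3 :: nat]" "distinct [0, 1, 3 :: nat]"
    by simp_all
  note K = K.comm_monoid_axioms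
  note l = contraction_assoc[OF e1 fin(1,2) s(1,2) lab B(1), folded place_cmp(1)[OF d(1) x y], unfolded S,
      folded place_cmp(1)[OF d(3) xy z]]
  note r = contraction_assoc[OF e2 fin(3,4) s(3,4) lab(2,3,1) B(2), folded place_cmp(1)[OF d(2) y z], unfolded S]
  note cl = contraction_cocycle[where f = ?f and K = k, OF e1 fin(1,2) s(1,2) lab B(1) K act_closed, folded place_cmp(1)[OF d(1) x y], unfolded S,
      folded place_cmp(2)[OF d(1) x y] place_cmp(2)[OF d(3) xy z]]
  note cr = contraction_cocycle[where f = ?f and K = k, OF e2 fin(3,4) s(3,4) lab(2,3,1) B(2) K act_closed, folded place_cmp(1)[OF d(2) y z], unfolded S,
      folded place_cmp(2)[OF d(2) y z]]
  \<comment> \<open>The second contraction names the edges of \<open>x\<close> last; commutativity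
    of \<open>G\<close> brings the labels into the order of the first.\<close>
  have c1: "wt (place 1 3 (cmp y z)) C \<otimes> wt ?X C = wt ?X C \<otimes> wt (place 1 3 (cmp y z)) C" for C
    using place_labelled[OF yz, of 1 3] lab by (simp add: m_comm)
  have c2: "wt ?Y C \<otimes> wt ?Z C \<otimes> wt ?X C = wt ?X C \<otimes> wt ?Y C \<otimes> wt ?Z C" for C
    using lab by (simp add: m_ac)
  have "place 0 3 (cmp (cmp x y) z) = place 0 3 (cmp x (cmp y z))"
    using l r unfolding c1 c2 place_cmp(1)[OF d(4) x yz, symmetric] by simp
  then show "cmp (cmp x y) z = cmp x (cmp y z)"
    unfolding place_def by (rule move_inj[OF colmap_inj, rotated]) simp
  show "lf x y \<otimes>\<^bsub>k\<^esub> lf (cmp x y) z = lf y z \<otimes>\<^bsub>k\<^esub> lf x (cmp y z)"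
    using cl cr unfolding c1 c2 place_cmp(2)[OF d(4) x yz, symmetric] by (simp only:)
qed

end

section \<open>Perfect matchings and the closure of diagrams under composition\<close>

definition matching :: "'v set \<Rightarrow> ('v set \<times> 'g) set \<Rightarrow> bool" where
  "matching V D \<longleftrightarrow> finite V \<and> finite D \<and> (\<forall>d\<in>D. fst d \<subseteq> V \<and> card (fst d) = 2) \<and>
     (\<forall>v\<in>V. \<exists>d\<in>D. v \<in> fst d) \<and> (\<forall>d\<in>D. \<forall>d'\<in>D. fst d \<inter> fst d' \<noteq> {} \<longrightarrow> d = d')"

lemma matching_card:
  assumes D: "matching V D" and S: "S \<subseteq> V"
  shows "card S = (\<Sum>d\<in>D. card (fst d \<inter> S))"
proof -
  have fV: "finite V" and fD: "finite D" using D by (auto simp: matching_def)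
  have "S = (\<Union>d\<in>D. fst d \<inter> S)"
  proof (intro equalityI subsetI)
    fix v assume v: "v \<in> S"
    then obtain d where "d \<in> D" "v \<in> fst d" using D S unfolding matching_def by blast
    then show "v \<in> (\<Union>d\<in>D. fst d \<inter> S)" using v by blast
  qed auto
  moreover have "card (\<Union>d\<in>D. fst d \<inter> S) = (\<Sum>d\<in>D. card (fst d \<inter> S))"
  proof (rule card_UN_disjoint[OF fD])
    show "\<forall>d\<in>D. finite (fst d \<inter> S)" using finite_subset[OF S fV] by simp
    show "\<forall>d\<in>D. \<forall>d'\<in>D. d \<noteq> d' \<longrightarrow> fst d \<inter> S \<inter> (fst d' \<inter> S) = {}"
      using D unfolding matching_def by blast
  qed
  ultimately show ?thesis by simp
qed

text \<open>A set closed under the edges of a perfect matching consists of whole edges, two nodes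
  each. It is applied to the two factors of a product separately.\<close>

lemma matching_closed_card:
  assumes D: "matching V D" and C: "\<And>d. d \<in> D \<Longrightarrow> fst d \<inter> C \<noteq> {} \<Longrightarrow> fst d \<subseteq> C"
  shows "card (V \<inter> C) = 2 * card {d \<in> D. fst d \<subseteq> C}"
proof -
  have fD: "finite D" using D by (auto simp: matching_def)
  have "card (fst d \<inter> (V \<inter> C)) = (if fst d \<subseteq> C then 2 else 0)" if d: "d \<in> D" for d
  proof (cases "fst d \<subseteq> C")
    case True
    then have "fst d \<inter> (V \<inter> C) = fst d" using D d by (auto simp: matching_def)
    then show ?thesis using True D d by (simp add: matching_def)
  next
    case False
    then have "fst d \<inter> (V \<inter> C) = {}" using C[OF d] by blast
    then show ?thesis using False by simp
  qed
  then have "card (V \<inter> C) = (\<Sum>d\<in>D. if fst d \<subseteq> C then 2 else 0)"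
    using matching_card[OF D, of "V \<inter> C"] by simp
  also have "\<dots> = (\<Sum>d\<in>{d \<in> D. fst d \<subseteq> C}. 2)" by (rule sum.inter_filter[OF fD, symmetric])
  finally show ?thesis by simp
qed

lemma matching_move:
  assumes D: "matching V D" and r: "inj_on r V"
  shows "matching (r ` V) (move r D)"
proof -
  have f: "fst d \<subseteq> V" "card (fst d) = 2" if "d \<in> D" for d using that D by (auto simp: matching_def)
  have c: "card (r ` fst d) = 2" if "d \<in> D" for d
    using f[OF that] card_image[OF inj_on_subset[OF r]] by simp
  have u: "d = d'" if dd: "d \<in> D" "d' \<in> D" "r ` fst d \<inter> r ` fst d' \<noteq> {}" for d d'
  proof -
    obtain v v' where v: "v \<in> fst d" "v' \<in> fst d'" "r v = r v'" using dd(3) by blast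
    then have "v = v'" using r f[OF dd(1)] f[OF dd(2)] by (auto dest: inj_onD)
    then have "fst d \<inter> fst d' \<noteq> {}" using v by blast
    then show ?thesis using D dd unfolding matching_def by blast
  qed
  show ?thesis
    unfolding matching_def
  proof (intro conjI ballI impI)
    show "finite (r ` V)" "finite (move r D)" using D by (auto simp: matching_def move_def)
    show "fst d \<subseteq> r ` V" "card (fst d) = 2" if dm: "d \<in> move r D" for d
    proof -
      obtain d' where "d' \<in> D" "d = (r ` fst d', snd d')" using dm by (auto simp: move_iff)
      then show "fst d \<subseteq> r ` V" "card (fst d) = 2" using f(1) c by (simp_all add: image_mono)
    qed
    show "\<exists>d\<in>move r D. v \<in> fst d" if "v \<in> r ` V" for v
    proof -
      obtain w d where w: "w \<in> V" "v = r w" "d \<in> D" "w \<in> fst d"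
        using \<open>v \<in> r ` V\<close> D unfolding matching_def by blast
      then show ?thesis by (intro bexI[OF _ moveI[OF w(3)]]) auto
    qed
    show "d = d'" if "d \<in> move r D" "d' \<in> move r D" "fst d \<inter> fst d' \<noteq> {}" for d d'
    proof -
      obtain p q where pq: "p \<in> D" "d = (r ` fst p, snd p)" "q \<in> D" "d' = (r ` fst q, snd q)"
        using \<open>d \<in> move r D\<close> \<open>d' \<in> move r D\<close> unfolding move_iff by blast
      then have "p = q" using u[of p q] \<open>fst d \<inter> fst d' \<noteq> {}\<close> by simp
      then show ?thesis using pq by simp
    qed
  qed
qed

lemma move_image: "move r ((\<lambda>i. (E i, L i)) ` I) = (\<lambda>i. (r ` E i, L i)) ` I"
  by (simp add: move_def image_image)

lemma compsI:
  assumes u: "u \<in> V" "u \<in> C" and cl: "\<And>d. d \<in> D \<Longrightarrow> fst d \<inter> C \<noteq> {} \<Longrightarrow> fst d \<subseteq> C"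
    and co: "\<And>v. v \<in> C \<Longrightarrow> (u, v) \<in> conn D"
  shows "C \<in> comps V D"
proof -
  have "v \<in> C" if "(u, v) \<in> conn D" for v
    using that
  proof (induct rule: conn_induct)
    case (step v w d)
    then show ?case using cl[of d] by blast
  qed (rule u(2))
  then have "C = conn D `` {u}" using co by blast
  then show ?thesis using u(1) by (auto simp: comps_iff)
qed

context comm_monoid
begin

text \<open>Further edges inside \<open>C\<close> may occur if they carry the unit label, as the
  strands of an identity diagram do.\<close>

lemma wt_unique:
  assumes D: "labelled D" and d: "d \<in> D" "fst d \<subseteq> C"
    and u: "\<And>d'. d' \<in> D \<Longrightarrow> fst d' \<subseteq> C \<Longrightarrow> d' = d \<or> snd d' = \<one>"
  shows "wt D C = snd d"
proof -
  have "wt D C = finprod G snd {d}"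
    unfolding wt_def
    by (rule finprod_mono_neutral_cong_right) (use assms in \<open>auto simp: labelled_def\<close>)
  then show ?thesis using D d by (auto simp: labelled_def)
qed

lemma wt_two:
  assumes D: "labelled D" and d: "d \<in> D" "fst d \<subseteq> C" "e \<in> D" "fst e \<subseteq> C" "d \<noteq> e"
    and u: "\<And>d'. d' \<in> D \<Longrightarrow> fst d' \<subseteq> C \<Longrightarrow> d' = d \<or> d' = e \<or> snd d' = \<one>"
  shows "wt D C = snd d \<otimes> snd e"
proof -
  have "wt D C = finprod G snd {d, e}"
    unfolding wt_def
    by (rule finprod_mono_neutral_cong_right) (use assms in \<open>auto simp: labelled_def\<close>)
  then show ?thesis using D d by (auto simp: labelled_def)
qed

lemma wt_one: "(\<And>d. d \<in> D \<Longrightarrow> fst d \<subseteq> C \<Longrightarrow> snd d = \<one>) \<Longrightarrow> wt D C = \<one>"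
  unfolding wt_def by (rule finprod_one_eqI) auto

end

context brauer
begin

lemma dg_matching: "x \<in> dgs \<Longrightarrow> matching outer x"
  unfolding matching_def
proof (intro conjI ballI impI)
  assume x: "x \<in> dgs"
  show "finite x" by (rule dg_finite[OF x])
  show "fst d \<subseteq> outer" "card (fst d) = 2" if "d \<in> x" for d using dg_edge[OF x that] by blast+
  show "\<exists>d\<in>x. v \<in> fst d" if "v \<in> outer" for v by (rule dg_ex[OF x that])
  show "d = d'" if dd: "d \<in> x" "d' \<in> x" "fst d \<inter> fst d' \<noteq> {}" for d d'
  proof -
    obtain v where "v \<in> fst d" "v \<in> fst d'" using dd(3) by blast
    then show ?thesis by (rule dg_unique[OF x dd(1,2)])
  qed
qed simp

lemma xm_matching: "x \<in> dgs \<Longrightarrow> matching (Lft ` {1..n} \<union> Mid ` {1..n}) (xm x)"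
proof -
  assume x: "x \<in> dgs"
  have "inj_on right_to_mid outer" by (auto simp: inj_on_def outer_nodes_def)
  moreover have "right_to_mid ` outer = Lft ` {1..n} \<union> Mid ` {1..n}"
    by (auto simp: outer_nodes_def image_Un image_image)
  ultimately show ?thesis using matching_move[OF dg_matching[OF x]] by metis
qed

lemma ym_matching: "x \<in> dgs \<Longrightarrow> matching (Mid ` {1..n} \<union> Rgt ` {1..n}) (ym x)"
proof -
  assume x: "x \<in> dgs"
  have "inj_on left_to_mid outer" by (auto simp: inj_on_def outer_nodes_def)
  moreover have "left_to_mid ` outer = Mid ` {1..n} \<union> Rgt ` {1..n}"
    by (auto simp: outer_nodes_def image_Un image_image)
  ultimately show ?thesis using matching_move[OF dg_matching[OF x]] by metis
qed

lemma labelled_xm: "x \<in> dgs \<Longrightarrow> labelled (xm x)" and labelled_ym: "x \<in> dgs \<Longrightarrow> labelled (ym x)"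
  by (simp_all add: labelled_move dg_labelled)

text \<open>
  Every node of a component \<open>C\<close> has degree 2 in the middle and degree 1 outside, so a connected \<open>C\<close>
  has at most two outer nodes, and their number is even.
\<close>

lemma component_outer_card:
  assumes x: "x \<in> dgs" and y: "y \<in> dgs" and C: "C \<in> comps nodes (xm x \<union> ym y)" and ne: "C \<inter> outer \<noteq> {}"
  shows "card (C \<inter> outer) = 2"
proof -
  let ?D = "xm x \<union> ym y"
  have D: "edges_in nodes ?D" using xm_edges_in[OF x] ym_edges_in[OF y] by (auto simp: edges_in_def)
  have fn: "finite nodes" by simp
  have Cn: "C \<subseteq> nodes" by (rule comps_sub[OF D C])
  have fC: "finite C" using finite_subset[OF Cn fn] .
  obtain v where v: "C = conn ?D `` {v}" using C by (auto simp: comps_iff)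
  have fin: "finite (xm x)" "finite (ym y)" using labelled_xm[OF x] labelled_ym[OF y] by (auto simp: labelled_def)
  let ?L = "Lft ` {1..n}" and ?M = "Mid ` {1..n}" and ?R = "Rgt ` {1..n}"
  let ?X = "{d \<in> xm x. fst d \<subseteq> C}" and ?Y = "{d \<in> ym y. fst d \<subseteq> C}"
  have cl: "fst d \<subseteq> C" if "d \<in> ?D" "fst d \<inter> C \<noteq> {}" for d
    using comps_edge[OF C that(1)] that(2) by blast
  have X: "card ((?L \<union> ?M) \<inter> C) = 2 * card ?X"
    by (rule matching_closed_card[OF xm_matching[OF x]]) (use cl in blast)
  have Y: "card ((?M \<union> ?R) \<inter> C) = 2 * card ?Y"
    by (rule matching_closed_card[OF ym_matching[OF y]]) (use cl in blast)
  \<comment> \<open>An edge of \<open>x\<close> and an edge of \<open>y\<close> may have the same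
    node set, so this is only an inequality.\<close>
  have "card (fst ` {d \<in> ?D. fst d \<subseteq> C}) \<le> card (?X \<union> ?Y)"
    using card_image_le[of "?X \<union> ?Y" fst] fin by (simp add: Collect_disj_eq[symmetric] conj_disj_distribR[symmetric])
  also have "\<dots> \<le> card ?X + card ?Y" by (rule card_Un_le)
  finally have e: "card (fst ` {d \<in> ?D. fst d \<subseteq> C}) \<le> card ?X + card ?Y" .
  have t: "card C \<le> card (fst ` {d \<in> ?D. fst d \<subseteq> C}) + 1"
  proof (rule connected_card_le[OF fC _ _ v])
    show "finite ?D" using fin by simp
    show "card (fst d) = 2" if "d \<in> ?D" for d
      using that xm_matching[OF x] ym_matching[OF y] by (auto simp: matching_def)
  qed
  have LM: "card ((?L \<union> ?M) \<inter> C) = card (?L \<inter> C) + card (?M \<inter> C)"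
    unfolding Int_Un_distrib2 by (rule card_Un_disjoint) (use fC in auto)
  have MR: "card ((?M \<union> ?R) \<inter> C) = card (?M \<inter> C) + card (?R \<inter> C)"
    unfolding Int_Un_distrib2 by (rule card_Un_disjoint) (use fC in auto)
  have o: "card (C \<inter> outer) = card (?L \<inter> C) + card (?R \<inter> C)"
  proof -
    have "C \<inter> outer = (?L \<inter> C) \<union> (?R \<inter> C)" by (auto simp: outer_nodes_def)
    moreover have "card ((?L \<inter> C) \<union> (?R \<inter> C)) = card (?L \<inter> C) + card (?R \<inter> C)"
      by (rule card_Un_disjoint) (use fC in auto)
    ultimately show ?thesis by simp
  qed
  have c: "card C = card (C \<inter> outer) + card (?M \<inter> C)"
  proof -
    have "C = (C \<inter> outer) \<union> (?M \<inter> C)" using Cn by blast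
    moreover have "card ((C \<inter> outer) \<union> (?M \<inter> C)) = card (C \<inter> outer) + card (?M \<inter> C)"
      by (rule card_Un_disjoint) (use fC in \<open>auto simp: outer_nodes_def\<close>)
    ultimately show ?thesis by simp
  qed
  have n0: "card (C \<inter> outer) \<noteq> 0" using ne fC by simp
  \<comment> \<open>The two degree counts add up to \<open>o' + 2 m = 2 X' + 2 Y'\<close>, so
    \<open>o'\<close> is even; doubling \<open>o' + m \<le> X' + Y' + 1\<close> then gives
    \<open>o' \<le> 2\<close>.\<close>
  have "o' = 2" if "c' \<le> e' + 1" "e' \<le> X' + Y'" "l + m = 2 * X'" "m + r = 2 * Y'" "o' = l + r" "c' = o' + m" "o' \<noteq> 0"
    for c' e' X' Y' l m r o' :: nat
    using that by presburger
  from this[OF t e trans[OF LM[symmetric] X] trans[OF MR[symmetric] Y] o c n0] show ?thesis .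
qed

lemma cmp_closed:
  assumes x: "x \<in> dgs" and y: "y \<in> dgs"
  shows "cmp x y \<in> dgs"
proof (rule dgI)
  fix d assume "d \<in> cmp x y"
  then obtain C where C: "C \<in> comps nodes (xm x \<union> ym y)" "C \<inter> outer \<noteq> {}" "d = (C \<inter> outer, wt (xm x) C \<otimes> wt (ym y) C)"
    unfolding cmp_eq by blast
  then show "fst d \<subseteq> outer \<and> card (fst d) = 2 \<and> snd d \<in> carrier G"
    using component_outer_card[OF x y C(1,2)] labelled_xm[OF x] labelled_ym[OF y] by simp
next
  fix v assume v: "v \<in> outer"
  let ?C = "conn (xm x \<union> ym y) `` {v}"
  have C: "?C \<in> comps nodes (xm x \<union> ym y)" "v \<in> ?C \<inter> outer"
    using comps_of[of v nodes "xm x \<union> ym y"] v by auto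
  then have "(?C \<inter> outer, wt (xm x) ?C \<otimes> wt (ym y) ?C) \<in> cmp x y" unfolding cmp_eq by blast
  then show "\<exists>d\<in>cmp x y. v \<in> fst d" by (rule bexI[rotated]) (use C in simp)
next
  fix d d' v assume "d \<in> cmp x y" "d' \<in> cmp x y" and v: "v \<in> fst d" "v \<in> fst d'"
  then obtain C C' where C: "C \<in> comps nodes (xm x \<union> ym y)" "d = (C \<inter> outer, wt (xm x) C \<otimes> wt (ym y) C)"
    "C' \<in> comps nodes (xm x \<union> ym y)" "d' = (C' \<inter> outer, wt (xm x) C' \<otimes> wt (ym y) C')"
    unfolding cmp_eq by blast
  then have "C = C'" using comps_disjoint[OF C(1,3), of v] v by simp
  then show "d = d'" using C by simp
qed

text \<open>
  To compute a product \<open>w\<close>, exhibit a map \<open>\<kappa>\<close> that sends each node to the edge of \<open>w\<close> whose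
  component it lies in.
\<close>

lemma
  assumes x: "x \<in> dgs" and y: "y \<in> dgs" and w: "w \<in> dgs"
    and const: "\<And>d u v. \<lbrakk>d \<in> xm x \<union> ym y; u \<in> fst d; v \<in> fst d\<rbrakk> \<Longrightarrow> \<kappa> u = \<kappa> v"
    and out: "\<And>v. v \<in> outer \<Longrightarrow> \<kappa> v \<in> w \<and> v \<in> fst (\<kappa> v)"
    and mid: "\<And>i. i \<in> {1..n} \<Longrightarrow> \<exists>u\<in>outer. (u, Mid i) \<in> conn (xm x \<union> ym y)"
    and con: "\<And>d u v. \<lbrakk>d \<in> w; u \<in> fst d; v \<in> fst d\<rbrakk> \<Longrightarrow> (u, v) \<in> conn (xm x \<union> ym y)"
    and lab: "\<And>d. d \<in> w \<Longrightarrow> wt (xm x) {v \<in> nodes. \<kappa> v = d} \<otimes> wt (ym y) {v \<in> nodes. \<kappa> v = d} = snd d"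
  shows cmp_eqI: "cmp x y = w" and lf_eq_oneI: "lf x y = \<one>\<^bsub>k\<^esub>"
proof -
  let ?D = "xm x \<union> ym y"
  have D: "edges_in nodes ?D" using xm_edges_in[OF x] ym_edges_in[OF y] by (auto simp: edges_in_def)
  have kc: "\<kappa> u = \<kappa> v" if "(u, v) \<in> conn ?D" for u v
    using that
  proof (induct rule: conn_induct)
    case (step v w d)
    then show ?case using const[of d v w] by simp
  qed simp
  have node_outer: "\<exists>u\<in>outer. (u, v) \<in> conn ?D" if vn: "v \<in> nodes" for v
  proof (cases "v \<in> outer")
    case True
    then show ?thesis by (intro bexI[of _ v]) simp_all
  next
    case False
    then obtain i where "i \<in> {1..n}" "v = Mid i" using vn by blast
    then show ?thesis using mid by blast
  qed
  have cls: "conn ?D `` {u} \<inter> outer = fst (\<kappa> u)" "conn ?D `` {u} = {v \<in> nodes. \<kappa> v = \<kappa> u}" if u: "u \<in> outer" for u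
  proof -
    have ku: "\<kappa> u \<in> w" "u \<in> fst (\<kappa> u)" using out[OF u] by auto
    show "conn ?D `` {u} \<inter> outer = fst (\<kappa> u)"
    proof (intro equalityI subsetI)
      fix v assume "v \<in> conn ?D `` {u} \<inter> outer"
      then have "\<kappa> u = \<kappa> v" "v \<in> outer" using kc by auto
      then show "v \<in> fst (\<kappa> u)" using out by simp
    next
      fix v assume v: "v \<in> fst (\<kappa> u)"
      then show "v \<in> conn ?D `` {u} \<inter> outer" using con[OF ku v] dg_edge(1)[OF w ku(1)] by auto
    qed
    show "conn ?D `` {u} = {v \<in> nodes. \<kappa> v = \<kappa> u}"
    proof (intro equalityI subsetI)
      fix v assume "v \<in> conn ?D `` {u}"
      then have uv: "(u, v) \<in> conn ?D" by simp
      then show "v \<in> {v \<in> nodes. \<kappa> v = \<kappa> u}" using kc[OF uv] conn_closed[OF D uv] u by simp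
    next
      fix v assume v: "v \<in> {v \<in> nodes. \<kappa> v = \<kappa> u}"
      then obtain v' where v': "v' \<in> outer" "(v', v) \<in> conn ?D" using node_outer by blast
      then have "v' \<in> fst (\<kappa> u)" using out[OF v'(1)] kc[OF v'(2)] v by simp
      then have "(u, v') \<in> conn ?D" using con[OF ku] by blast
      then show "v \<in> conn ?D `` {u}" using v'(2) by (auto intro: conn_trans)
    qed
  qed
  have comp_outer: "\<exists>u\<in>outer. C = conn ?D `` {u}" if C: "C \<in> comps nodes ?D" for C
  proof -
    obtain v where v: "v \<in> nodes" "C = conn ?D `` {v}" using C by (auto simp: comps_iff)
    obtain u where u: "u \<in> outer" "(u, v) \<in> conn ?D" using node_outer[OF v(1)] by blast
    have "u \<in> C" using conn_sym[OF u(2)] v(2) by simp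
    from comps_eq[OF C this] u(1) show ?thesis by (intro bexI[of _ u])
  qed
  have "{C \<in> comps nodes ?D. C \<inter> outer = {}} = {}"
  proof -
    have "C \<inter> outer \<noteq> {}" if Cc: "C \<in> comps nodes ?D" for C
    proof -
      obtain u where "u \<in> outer" "C = conn ?D `` {u}" using comp_outer[OF Cc] by blast
      then have "u \<in> C \<inter> outer" by simp
      then show ?thesis by blast
    qed
    then show ?thesis by blast
  qed
  then show "lf x y = \<one>\<^bsub>k\<^esub>" unfolding lf_eq by (simp only: K.finprod_empty)
  have edge: "(conn ?D `` {u} \<inter> outer, wt (xm x) (conn ?D `` {u}) \<otimes> wt (ym y) (conn ?D `` {u})) = \<kappa> u"
    if u: "u \<in> outer" for u
    using out[OF u] lab[of "\<kappa> u"] cls[OF u] by (simp add: prod_eq_iff)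
  show "cmp x y = w"
  proof (intro equalityI subsetI)
    fix d assume "d \<in> cmp x y"
    then obtain C where C: "C \<in> comps nodes ?D" "d = (C \<inter> outer, wt (xm x) C \<otimes> wt (ym y) C)"
      unfolding cmp_eq by blast
    then obtain u where u: "u \<in> outer" "C = conn ?D `` {u}" using comp_outer by blast
    then show "d \<in> w" using C(2) edge[OF u(1)] out[OF u(1)] by simp
  next
    fix d assume d: "d \<in> w"
    then obtain u where u: "u \<in> fst d" "u \<in> outer" using dg_edge(1,4)[OF w] by blast
    have "\<kappa> u = d" using dg_unique[OF w _ d _ u(1)] out[OF u(2)] by blast
    moreover have "conn ?D `` {u} \<in> comps nodes ?D" "u \<in> conn ?D `` {u} \<inter> outer"
      using comps_of[of u nodes ?D] u by auto
    ultimately show "d \<in> cmp x y" unfolding cmp_eq using edge[OF u(2), symmetric] by blast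
  qed
qed

section \<open>The edge at a node, and the identity diagram\<close>

definition edge :: "'g diagram \<Rightarrow> node \<Rightarrow> node set \<times> 'g" where
  "edge x v = (THE d. d \<in> x \<and> v \<in> fst d)"

lemma edge_in: "x \<in> dgs \<Longrightarrow> v \<in> outer \<Longrightarrow> edge x v \<in> x" "x \<in> dgs \<Longrightarrow> v \<in> outer \<Longrightarrow> v \<in> fst (edge x v)"
  unfolding edge_def using theI'[OF dg_ex1, of x v] by auto

lemma edge_eq: "x \<in> dgs \<Longrightarrow> d \<in> x \<Longrightarrow> v \<in> fst d \<Longrightarrow> edge x v = d"
  using edge_in[of x v] dg_unique dg_edge(1) by (metis subsetD)

lemma outer_iff [simp]: "Lft i \<in> outer \<longleftrightarrow> i \<in> {1..n}" "Rgt i \<in> outer \<longleftrightarrow> i \<in> {1..n}" "Mid i \<notin> outer"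
  by (auto simp: outer_nodes_def)

abbreviation "ident \<equiv> brauer_id G n"

lemma ident_closed: "ident \<in> dgs"
  by (rule dgI) (auto simp: brauer_id_def elim!: outer_cases)

text \<open>Every strand of the identity attaches \<open>Mid i\<close> to \<open>Lft i\<close>, so
  the middle node \<open>i\<close> lies in the component of the edge of \<open>y\<close> at its left
  node \<open>i\<close>; this is the choice of \<open>\<kappa>\<close>.\<close>

lemma
  assumes y: "y \<in> dgs"
  shows cmp_ident_left: "cmp ident y = y" and lf_ident_left: "lf ident y = \<one>\<^bsub>k\<^esub>"
proof -
  define \<kappa> where "\<kappa> v = (case v of Lft i \<Rightarrow> edge y (Lft i) | Mid i \<Rightarrow> edge y (Lft i) | Rgt i \<Rightarrow> edge y (Rgt i))" for v
  let ?D = "xm ident \<union> ym y"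
  have xi: "d \<in> xm ident \<longleftrightarrow> (\<exists>i\<in>{1..n}. d = ({Lft i, Mid i}, \<one>))" for d
    by (auto simp: brauer_id_def move_image)
  have ky: "\<kappa> (left_to_mid u) = d" if "d \<in> y" "u \<in> fst d" for d u
    using edge_eq[OF y that] dg_edge(1)[OF y that(1)] that(2) by (cases u) (auto simp: \<kappa>_def)
  have lm: "(u, left_to_mid u) \<in> conn ?D" if u: "u \<in> outer" for u
    using u
  proof (rule outer_cases)
    fix i assume i: "i \<in> {1..n}" "u = Lft i"
    have "({Lft i, Mid i}, \<one>) \<in> ?D" using i xi by blast
    from conn_edge[OF this] show ?thesis using i by simp
  qed simp
  have yc: "(u, v) \<in> conn ?D" if d: "d \<in> y" "u \<in> fst d" "v \<in> fst d" for d u v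
  proof -
    have "(left_to_mid ` fst d, snd d) \<in> ?D" using moveI[OF d(1)] by blast
    from conn_edge[OF this, of "left_to_mid u" "left_to_mid v"]
    have "(left_to_mid u, left_to_mid v) \<in> conn ?D" using d by simp
    moreover have "u \<in> outer" "v \<in> outer" using dg_edge(1)[OF y d(1)] d by auto
    ultimately show ?thesis using lm conn_sym conn_trans by metis
  qed
  have a: "\<kappa> u = \<kappa> v" if "d \<in> ?D" "u \<in> fst d" "v \<in> fst d" for d u v
  proof (cases "d \<in> xm ident")
    case True
    then show ?thesis using that by (auto simp: xi \<kappa>_def)
  next
    case False
    then have "d \<in> ym y" using that by blast
    then obtain d' where d': "d' \<in> y" "d = (left_to_mid ` fst d', snd d')" by (auto simp: move_iff)
    then have "u \<in> left_to_mid ` fst d'" "v \<in> left_to_mid ` fst d'" using that by simp_all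
    then obtain u' v' where "u' \<in> fst d'" "u = left_to_mid u'" "v' \<in> fst d'" "v = left_to_mid v'" by blast
    then show ?thesis using ky[OF d'(1)] by simp
  qed
  have o: "\<kappa> v \<in> y \<and> v \<in> fst (\<kappa> v)" if "v \<in> outer" for v
    using that edge_in[OF y that] by (auto simp: \<kappa>_def elim!: outer_cases)
  have m: "\<exists>u\<in>outer. (u, Mid i) \<in> conn ?D" if "i \<in> {1..n}" for i
    using lm[of "Lft i"] that by (intro bexI[of _ "Lft i"]) auto
  have l: "wt (xm ident) {v \<in> nodes. \<kappa> v = d} \<otimes> wt (ym y) {v \<in> nodes. \<kappa> v = d} = snd d" if d: "d \<in> y" for d
  proof -
    have "wt (xm ident) {v \<in> nodes. \<kappa> v = d} = \<one>" by (rule wt_one) (auto simp: xi)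
    moreover have "wt (ym y) {v \<in> nodes. \<kappa> v = d} = snd (left_to_mid ` fst d, snd d)"
    proof (rule wt_unique[OF labelled_ym[OF y] moveI[OF d]])
      have "left_to_mid ` fst d \<subseteq> nodes" using bspec[OF ym_edges_in[OF y, unfolded edges_in_def] moveI[OF d]] by simp
      then show "fst (left_to_mid ` fst d, snd d) \<subseteq> {v \<in> nodes. \<kappa> v = d}" using ky[OF d] by auto
      fix d' assume d': "d' \<in> ym y" "fst d' \<subseteq> {v \<in> nodes. \<kappa> v = d}"
      from d'(1) obtain d'' where d'': "d'' \<in> y" "d' = (left_to_mid ` fst d'', snd d'')"
        unfolding move_iff by blast
      then have s: "left_to_mid ` fst d'' \<subseteq> {v. \<kappa> v = d}" using d'(2) by auto
      obtain u where "u \<in> fst d''" using dg_edge(4)[OF y d''(1)] by blast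
      then have "d'' = d" using ky[OF d''(1)] s by blast
      then show "d' = (left_to_mid ` fst d, snd d) \<or> snd d' = \<one>" using d'' by simp
    qed
    ultimately show ?thesis using dg_edge(3)[OF y d] by simp
  qed
  show "cmp ident y = y" by (rule cmp_eqI[OF ident_closed y y a o m yc l])
  show "lf ident y = \<one>\<^bsub>k\<^esub>" by (rule lf_eq_oneI[OF ident_closed y y a o m yc l])
qed

lemma
  assumes x: "x \<in> dgs"
  shows cmp_ident_right: "cmp x ident = x" and lf_ident_right: "lf x ident = \<one>\<^bsub>k\<^esub>"
proof -
  define \<kappa> where "\<kappa> v = (case v of Lft i \<Rightarrow> edge x (Lft i) | Mid i \<Rightarrow> edge x (Rgt i) | Rgt i \<Rightarrow> edge x (Rgt i))" for v
  let ?D = "xm x \<union> ym ident"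
  have yi: "d \<in> ym ident \<longleftrightarrow> (\<exists>i\<in>{1..n}. d = ({Mid i, Rgt i}, \<one>))" for d
    by (auto simp: brauer_id_def move_image)
  have kx: "\<kappa> (right_to_mid u) = d" if "d \<in> x" "u \<in> fst d" for d u
    using edge_eq[OF x that] dg_edge(1)[OF x that(1)] that(2) by (cases u) (auto simp: \<kappa>_def)
  have lm: "(u, right_to_mid u) \<in> conn ?D" if u: "u \<in> outer" for u
    using u
  proof (rule outer_cases)
    fix i assume i: "i \<in> {1..n}" "u = Rgt i"
    have "({Mid i, Rgt i}, \<one>) \<in> ?D" using i yi by blast
    from conn_edge[OF this] show ?thesis using i by simp
  qed simp
  have xc: "(u, v) \<in> conn ?D" if d: "d \<in> x" "u \<in> fst d" "v \<in> fst d" for d u v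
  proof -
    have "(right_to_mid ` fst d, snd d) \<in> ?D" using moveI[OF d(1)] by blast
    from conn_edge[OF this, of "right_to_mid u" "right_to_mid v"]
    have "(right_to_mid u, right_to_mid v) \<in> conn ?D" using d by simp
    moreover have "u \<in> outer" "v \<in> outer" using dg_edge(1)[OF x d(1)] d by auto
    ultimately show ?thesis using lm conn_sym conn_trans by metis
  qed
  have a: "\<kappa> u = \<kappa> v" if "d \<in> ?D" "u \<in> fst d" "v \<in> fst d" for d u v
  proof (cases "d \<in> ym ident")
    case True
    then show ?thesis using that by (auto simp: yi \<kappa>_def)
  next
    case False
    then have "d \<in> xm x" using that by blast
    then obtain d' where d': "d' \<in> x" "d = (right_to_mid ` fst d', snd d')" by (auto simp: move_iff)
    then have "u \<in> right_to_mid ` fst d'" "v \<in> right_to_mid ` fst d'" using that by simp_all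
    then obtain u' v' where "u' \<in> fst d'" "u = right_to_mid u'" "v' \<in> fst d'" "v = right_to_mid v'" by blast
    then show ?thesis using kx[OF d'(1)] by simp
  qed
  have o: "\<kappa> v \<in> x \<and> v \<in> fst (\<kappa> v)" if "v \<in> outer" for v
    using that edge_in[OF x that] by (auto simp: \<kappa>_def elim!: outer_cases)
  have m: "\<exists>u\<in>outer. (u, Mid i) \<in> conn ?D" if "i \<in> {1..n}" for i
    using lm[of "Rgt i"] that by (intro bexI[of _ "Rgt i"]) auto
  have l: "wt (xm x) {v \<in> nodes. \<kappa> v = d} \<otimes> wt (ym ident) {v \<in> nodes. \<kappa> v = d} = snd d" if d: "d \<in> x" for d
  proof -
    have "wt (ym ident) {v \<in> nodes. \<kappa> v = d} = \<one>" by (rule wt_one) (auto simp: yi)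
    moreover have "wt (xm x) {v \<in> nodes. \<kappa> v = d} = snd (right_to_mid ` fst d, snd d)"
    proof (rule wt_unique[OF labelled_xm[OF x] moveI[OF d]])
      have "right_to_mid ` fst d \<subseteq> nodes" using bspec[OF xm_edges_in[OF x, unfolded edges_in_def] moveI[OF d]] by simp
      then show "fst (right_to_mid ` fst d, snd d) \<subseteq> {v \<in> nodes. \<kappa> v = d}" using kx[OF d] by auto
      fix d' assume d': "d' \<in> xm x" "fst d' \<subseteq> {v \<in> nodes. \<kappa> v = d}"
      from d'(1) obtain d'' where d'': "d'' \<in> x" "d' = (right_to_mid ` fst d'', snd d'')"
        unfolding move_iff by blast
      then have s: "right_to_mid ` fst d'' \<subseteq> {v. \<kappa> v = d}" using d'(2) by auto
      obtain u where "u \<in> fst d''" using dg_edge(4)[OF x d''(1)] by blast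
      then have "d'' = d" using kx[OF d''(1)] s by blast
      then show "d' = (right_to_mid ` fst d, snd d) \<or> snd d' = \<one>" using d'' by simp
    qed
    ultimately show ?thesis using dg_edge(3)[OF x d] by simp
  qed
  show "cmp x ident = x" by (rule cmp_eqI[OF x ident_closed x a o m xc l])
  show "lf x ident = \<one>\<^bsub>k\<^esub>" by (rule lf_eq_oneI[OF x ident_closed x a o m xc l])
qed

section \<open>Left and right links, and the number of left links\<close>

definition llinks :: "'g diagram \<Rightarrow> 'g diagram" where "llinks x = {d \<in> x. fst d \<subseteq> range Lft}"
definition rlinks :: "'g diagram \<Rightarrow> 'g diagram" where "rlinks x = {d \<in> x. fst d \<subseteq> range Rgt}"

text \<open>A left link of the left factor touches no middle node, so it is a whole component of the
  glued graph and keeps its label.\<close>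

lemma llinks_cmp:
  assumes x: "x \<in> dgs" and y: "y \<in> dgs"
  shows "llinks x \<subseteq> llinks (cmp x y)"
proof
  fix d assume "d \<in> llinks x"
  then have d: "d \<in> x" "fst d \<subseteq> range Lft" by (auto simp: llinks_def)
  have rd: "right_to_mid ` fst d = fst d" using d(2) by force
  then have dX: "d \<in> xm x" using moveI[OF d(1), of right_to_mid] by simp
  have uX: "d' = d" if "d' \<in> xm x" "fst d' \<inter> fst d \<noteq> {}" for d'
    using that dX xm_matching[OF x] unfolding matching_def by blast
  have nY: "fst d' \<inter> fst d = {}" if "d' \<in> ym y" for d'
  proof -
    have "fst d' \<subseteq> Mid ` {1..n} \<union> Rgt ` {1..n}" using that ym_matching[OF y] by (auto simp: matching_def)
    then show ?thesis using d(2) by blast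
  qed
  obtain u where u: "u \<in> fst d" using dg_edge(4)[OF x d(1)] by blast
  have "fst d \<in> comps nodes (xm x \<union> ym y)"
  proof (rule compsI[OF _ u])
    show "u \<in> nodes" using u dg_edge(1)[OF x d(1)] by blast
    show "fst d' \<subseteq> fst d" if "d' \<in> xm x \<union> ym y" "fst d' \<inter> fst d \<noteq> {}" for d'
      using that uX nY by blast
    show "(u, v) \<in> conn (xm x \<union> ym y)" if "v \<in> fst d" for v
      using conn_edge[OF _ u that] dX by blast
  qed
  moreover have "fst d \<inter> outer = fst d" using dg_edge(1)[OF x d(1)] by blast
  moreover have "wt (xm x) (fst d) = snd d"
    by (rule wt_unique[OF labelled_xm[OF x] dX subset_refl])
      (use uX xm_edges_in[OF x] in \<open>unfold edges_in_def, blast\<close>)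
  moreover have "wt (ym y) (fst d) = \<one>"
    by (rule wt_one) (use nY ym_edges_in[OF y] in \<open>unfold edges_in_def, blast\<close>)
  ultimately have "d \<in> cmp x y"
    unfolding cmp_eq using u dg_edge(3)[OF x d(1)] by (intro CollectI exI[of _ "fst d"]) auto
  then show "d \<in> llinks (cmp x y)" using d by (simp add: llinks_def)
qed

lemma rlinks_cmp:
  assumes x: "x \<in> dgs" and y: "y \<in> dgs"
  shows "rlinks y \<subseteq> rlinks (cmp x y)"
proof
  fix d assume "d \<in> rlinks y"
  then have d: "d \<in> y" "fst d \<subseteq> range Rgt" by (auto simp: rlinks_def)
  have rd: "left_to_mid ` fst d = fst d" using d(2) by force
  then have dY: "d \<in> ym y" using moveI[OF d(1), of left_to_mid] by simp
  have uY: "d' = d" if "d' \<in> ym y" "fst d' \<inter> fst d \<noteq> {}" for d'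
    using that dY ym_matching[OF y] unfolding matching_def by blast
  have nX: "fst d' \<inter> fst d = {}" if "d' \<in> xm x" for d'
  proof -
    have "fst d' \<subseteq> Lft ` {1..n} \<union> Mid ` {1..n}" using that xm_matching[OF x] by (auto simp: matching_def)
    then show ?thesis using d(2) by blast
  qed
  obtain u where u: "u \<in> fst d" using dg_edge(4)[OF y d(1)] by blast
  have "fst d \<in> comps nodes (xm x \<union> ym y)"
  proof (rule compsI[OF _ u])
    show "u \<in> nodes" using u dg_edge(1)[OF y d(1)] by blast
    show "fst d' \<subseteq> fst d" if "d' \<in> xm x \<union> ym y" "fst d' \<inter> fst d \<noteq> {}" for d'
      using that uY nX by blast
    show "(u, v) \<in> conn (xm x \<union> ym y)" if "v \<in> fst d" for v
      using conn_edge[OF _ u that] dY by blast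
  qed
  moreover have "fst d \<inter> outer = fst d" using dg_edge(1)[OF y d(1)] by blast
  moreover have "wt (ym y) (fst d) = snd d"
    by (rule wt_unique[OF labelled_ym[OF y] dY subset_refl])
      (use uY ym_edges_in[OF y] in \<open>unfold edges_in_def, blast\<close>)
  moreover have "wt (xm x) (fst d) = \<one>"
    by (rule wt_one) (use nX xm_edges_in[OF x] in \<open>unfold edges_in_def, blast\<close>)
  ultimately have "d \<in> cmp x y"
    unfolding cmp_eq using u dg_edge(3)[OF y d(1)] by (intro CollectI exI[of _ "fst d"]) auto
  then show "d \<in> rlinks (cmp x y)" using d by (simp add: rlinks_def)
qed

lemma llinks_finite: "x \<in> dgs \<Longrightarrow> finite (llinks x)"
  using dg_finite by (simp add: llinks_def)

text \<open>Both sides are 2 for a link and 1 for an edge across. Summed over all edges, with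
  \<open>n\<close> nodes in either column, this shows that there are as many left as right
  links.\<close>

lemma edge_sides:
  assumes x: "x \<in> dgs" and d: "d \<in> x"
  shows "card (fst d \<inter> Lft ` {1..n}) + (if d \<in> rlinks x then 2 else 0) =
    card (fst d \<inter> Rgt ` {1..n}) + (if d \<in> llinks x then 2 else 0)"
proof -
  obtain u v where uv: "fst d = {u, v}" "u \<noteq> v" using dg_edge(2)[OF x d] by (auto simp: card_2_iff)
  then have "u \<in> outer" "v \<in> outer" using dg_edge(1)[OF x d] by auto
  then show ?thesis using uv d
    by (elim outer_cases) (auto simp: llinks_def rlinks_def Int_insert_left card_insert_if)
qed

lemma card_llinks_rlinks: "x \<in> dgs \<Longrightarrow> card (llinks x) = card (rlinks x)"
proof -
  assume x: "x \<in> dgs"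
  have c: "card (Lft ` {1..n}) = n" "card (Rgt ` {1..n}) = n" by (simp_all add: card_image inj_on_def)
  have "(\<Sum>d\<in>x. card (fst d \<inter> Lft ` {1..n}) + (if d \<in> rlinks x then 2 else 0)) =
      (\<Sum>d\<in>x. card (fst d \<inter> Rgt ` {1..n}) + (if d \<in> llinks x then 2 else 0))"
    by (rule sum.cong) (use edge_sides[OF x] in auto)
  moreover have "(\<Sum>d\<in>x. card (fst d \<inter> Lft ` {1..n})) = n" "(\<Sum>d\<in>x. card (fst d \<inter> Rgt ` {1..n})) = n"
    using matching_card[OF dg_matching[OF x], of "Lft ` {1..n}"]
      matching_card[OF dg_matching[OF x], of "Rgt ` {1..n}"] c by (simp_all add: outer_nodes_def)
  moreover have "(\<Sum>d\<in>x. if d \<in> llinks x then 2 else (0::nat)) = 2 * card (llinks x)"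
    "(\<Sum>d\<in>x. if d \<in> rlinks x then 2 else (0::nat)) = 2 * card (rlinks x)"
    using dg_finite[OF x] by (simp_all add: llinks_def rlinks_def flip: sum.inter_filter)
  ultimately show ?thesis by (simp add: sum.distrib)
qed

text \<open>Left links cover an even number of the left nodes, and \<open>n\<close> is odd.\<close>

lemma free_node:
  assumes x: "x \<in> dgs" and odd: "odd n"
  shows "\<exists>f\<in>{1..n}. \<forall>d\<in>llinks x. Lft f \<notin> fst d"
proof (rule ccontr)
  assume "\<not> ?thesis"
  then have a: "\<exists>d\<in>llinks x. Lft f \<in> fst d" if "f \<in> {1..n}" for f using that by blast
  have "card (fst d \<inter> Lft ` {1..n}) = (if d \<in> llinks x then 2 else 0)" if d: "d \<in> x" for d
  proof (cases "d \<in> llinks x")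
    case True
    then have "fst d \<inter> Lft ` {1..n} = fst d" using dg_edge(1)[OF x d] by (auto simp: llinks_def outer_nodes_def)
    then show ?thesis using True dg_edge(2)[OF x d] by simp
  next
    case False
    have "fst d \<inter> Lft ` {1..n} = {}"
    proof (rule ccontr)
      assume "fst d \<inter> Lft ` {1..n} \<noteq> {}"
      then obtain f where f: "f \<in> {1..n}" "Lft f \<in> fst d" by blast
      then obtain d' where "d' \<in> llinks x" "Lft f \<in> fst d'" using a by blast
      then show False using dg_unique[OF x d _ f(2), of d'] False by (auto simp: llinks_def)
    qed
    then show ?thesis using False by simp
  qed
  then have "n = (\<Sum>d\<in>x. if d \<in> llinks x then 2 else 0)"
    using matching_card[OF dg_matching[OF x], of "Lft ` {1..n}"]
    by (simp add: outer_nodes_def card_image inj_on_def cong: sum.cong)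
  also have "\<dots> = 2 * card (llinks x)" using dg_finite[OF x] by (simp add: llinks_def flip: sum.inter_filter)
  finally show False using odd by simp
qed

end

section \<open>Diagrams that restore left links\<close>

context brauer
begin

text \<open>
  Composing with \<open>fixd i j f g\<close> on the left restores the left link between \<open>i\<close> and \<open>j\<close> with label
  \<open>g\<close>; the path from the left node \<open>f\<close> runs back and forth through that link.
\<close>

definition fixd :: "nat \<Rightarrow> nat \<Rightarrow> nat \<Rightarrow> 'g \<Rightarrow> 'g diagram" where
  "fixd i j f g = {({Lft i, Lft j}, g), ({Rgt j, Rgt f}, inv g), ({Lft f, Rgt i}, \<one>)} \<union>
     (\<lambda>a. ({Lft a, Rgt a}, \<one>)) ` ({1..n} - {i, j, f})"

lemma xm_fixd: "xm (fixd i j f g) = {({Lft i, Lft j}, g), ({Mid j, Mid f}, inv g), ({Lft f, Mid i}, \<one>)} \<union>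
     (\<lambda>a. ({Lft a, Mid a}, \<one>)) ` ({1..n} - {i, j, f})"
  unfolding fixd_def move_Un move_image by (simp add: move_def)

context
  fixes i j f g
  assumes ijf: "i \<in> {1..n}" "j \<in> {1..n}" "f \<in> {1..n}" "i \<noteq> j" "i \<noteq> f" "j \<noteq> f" and g: "g \<in> carrier G"
begin

lemma fixd_closed: "fixd i j f g \<in> dgs"
proof (rule dgI)
  fix v assume "v \<in> outer"
  then show "\<exists>d\<in>fixd i j f g. v \<in> fst d"
  proof (rule outer_cases)
    fix a assume a: "a \<in> {1..n}" "v = Lft a"
    show ?thesis using a ijf by (cases "a = i \<or> a = j"; cases "a = f") (auto simp: fixd_def)
  next
    fix a assume a: "a \<in> {1..n}" "v = Rgt a"
    show ?thesis using a ijf by (cases "a = f \<or> a = j"; cases "a = i") (auto simp: fixd_def)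
  qed
qed (use ijf g in \<open>auto simp: fixd_def\<close>)

text \<open>The copy in the middle of the link of \<open>y\<close> is not closed to a loop, because
  the right link of the left factor leads from \<open>j\<close> to \<open>f\<close> and not back to
  \<open>i\<close>. The strand from \<open>Lft f\<close> runs through \<open>Mid i\<close>,
  \<open>Mid j\<close> and \<open>Mid f\<close> into the edge of \<open>y\<close> at
  \<open>Lft f\<close>; on the way it collects \<open>g\<close> and \<open>inv g\<close>, which
  cancel. The link itself is supplied anew by the left factor.\<close>

lemma
  assumes y: "y \<in> dgs" and l: "({Lft i, Lft j}, g) \<in> y"
  shows cmp_fixd: "cmp (fixd i j f g) y = y" and lf_fixd: "lf (fixd i j f g) y = \<one>\<^bsub>k\<^esub>"
proof -
  let ?x = "fixd i j f g" and ?l = "({Lft i, Lft j}, g)"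
  let ?D = "xm ?x \<union> ym y"
  define df where "df = edge y (Lft f)"
  have df: "df \<in> y" "Lft f \<in> fst df" using edge_in[OF y, of "Lft f"] ijf by (simp_all add: df_def)
  have dfl: "df \<noteq> ?l" using df(2) ijf by auto
  \<comment> \<open>The middle nodes \<open>i\<close> and \<open>j\<close> lie on the detour of the
    strand from \<open>Lft f\<close>, hence in the component of \<open>df\<close> and not in that of
    the link.\<close>
  define \<kappa> where "\<kappa> v = (case v of Lft a \<Rightarrow> edge y (Lft a)
    | Mid a \<Rightarrow> if a = i \<or> a = j then df else edge y (Lft a) | Rgt a \<Rightarrow> edge y (Rgt a))" for v
  have el: "edge y (Lft i) = ?l" "edge y (Lft j) = ?l" using edge_eq[OF y l] by simp_all
  have ky: "\<kappa> (left_to_mid u) = d" if d: "d \<in> y" "d \<noteq> ?l" "u \<in> fst d" for d u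
  proof -
    have "u \<in> outer" using dg_edge(1)[OF y d(1)] d(3) by blast
    moreover have "u \<noteq> Lft i" "u \<noteq> Lft j" using dg_unique[OF y d(1) l d(3)] d(2) by auto
    moreover have "edge y u = d" by (rule edge_eq[OF y d(1,3)])
    ultimately show ?thesis by (elim outer_cases) (auto simp: \<kappa>_def)
  qed
  have kl: "\<kappa> (Mid i) = df" "\<kappa> (Mid j) = df" "\<kappa> (Lft i) = ?l" "\<kappa> (Lft j) = ?l" "\<kappa> (Mid f) = df" "\<kappa> (Lft f) = df"
    using ijf by (simp_all add: \<kappa>_def el df_def)
  have mm: "({Mid i, Mid j}, g) \<in> ym y" using moveI[OF l, of left_to_mid] by simp
  have c_fi: "(Lft f, Mid i) \<in> conn ?D" by (rule conn_edge[of "({Lft f, Mid i}, \<one>)"]) (auto simp: xm_fixd)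
  have c_ij: "(Mid i, Mid j) \<in> conn ?D" by (rule conn_edge[of "({Mid i, Mid j}, g)"]) (use mm in auto)
  have c_jf: "(Mid j, Mid f) \<in> conn ?D" by (rule conn_edge[of "({Mid j, Mid f}, inv g)"]) (auto simp: xm_fixd)
  have c_fj: "(Lft f, Mid j) \<in> conn ?D" by (rule conn_trans[OF c_fi c_ij])
  have lm: "(u, left_to_mid u) \<in> conn ?D" if u: "u \<in> outer" "u \<noteq> Lft i" "u \<noteq> Lft j" for u
    using u(1)
  proof (rule outer_cases)
    fix a assume a: "a \<in> {1..n}" "u = Lft a"
    show ?thesis
    proof (cases "a = f")
      case True
      then show ?thesis using conn_trans[OF c_fj c_jf] a by simp
    next
      case False
      then have "({Lft a, Mid a}, \<one>) \<in> ?D" using a u by (auto simp: xm_fixd)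
      from conn_edge[OF this] show ?thesis using a by simp
    qed
  qed simp
  have yc: "(u, v) \<in> conn ?D" if d: "d \<in> y" "u \<in> fst d" "v \<in> fst d" for d u v
  proof (cases "d = ?l")
    case True
    have "?l \<in> ?D" by (simp add: xm_fixd)
    from conn_edge[OF this, of u v] show ?thesis using d True by simp
  next
    case False
    have "(left_to_mid ` fst d, snd d) \<in> ?D" using moveI[OF d(1)] by blast
    from conn_edge[OF this, of "left_to_mid u" "left_to_mid v"]
    have "(left_to_mid u, left_to_mid v) \<in> conn ?D" using d by simp
    moreover have "u \<in> outer" "v \<in> outer" using dg_edge(1)[OF y d(1)] d by auto
    moreover have "u \<noteq> Lft i" "u \<noteq> Lft j" "v \<noteq> Lft i" "v \<noteq> Lft j"
      using dg_unique[OF y d(1) l d(2)] dg_unique[OF y d(1) l d(3)] False by auto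
    ultimately show ?thesis using lm conn_sym conn_trans by metis
  qed
  have a: "\<kappa> u = \<kappa> v" if d: "d \<in> ?D" "u \<in> fst d" "v \<in> fst d" for d u v
  proof (cases "d \<in> xm ?x")
    case True
    then consider "d = ?l" | "d = ({Mid j, Mid f}, inv g)" | "d = ({Lft f, Mid i}, \<one>)"
      | b where "b \<notin> {i, j, f}" "d = ({Lft b, Mid b}, \<one>)"
      unfolding xm_fixd by blast
    then show ?thesis
    proof cases
      case 4
      then have "\<kappa> (Mid b) = \<kappa> (Lft b)" by (simp add: \<kappa>_def)
      then show ?thesis using d 4 by auto
    qed (use d kl in auto)
  next
    case False
    then have "d \<in> ym y" using d by blast
    then obtain d' where d': "d' \<in> y" "d = (left_to_mid ` fst d', snd d')" unfolding move_iff by blast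
    show ?thesis
    proof (cases "d' = ?l")
      case True
      then have "u \<in> {Mid i, Mid j}" "v \<in> {Mid i, Mid j}" using d d' by simp_all
      then show ?thesis using kl by auto
    next
      case False
      have "u \<in> left_to_mid ` fst d'" "v \<in> left_to_mid ` fst d'" using d d' by simp_all
      then obtain u' v' where "u' \<in> fst d'" "u = left_to_mid u'" "v' \<in> fst d'" "v = left_to_mid v'" by blast
      then show ?thesis using ky[OF d'(1) False] by simp
    qed
  qed
  have o: "\<kappa> v \<in> y \<and> v \<in> fst (\<kappa> v)" if "v \<in> outer" for v
    using that edge_in[OF y that] by (auto simp: \<kappa>_def elim!: outer_cases)
  have m: "\<exists>u\<in>outer. (u, Mid a) \<in> conn ?D" if a: "a \<in> {1..n}" for a
  proof (cases "a = i \<or> a = j")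
    case True
    then show ?thesis using c_fi c_fj ijf by (intro bexI[of _ "Lft f"]) auto
  next
    case False
    then show ?thesis using lm[of "Lft a"] a by (intro bexI[of _ "Lft a"]) auto
  qed
  have lab: "wt (xm ?x) {v \<in> nodes. \<kappa> v = d} \<otimes> wt (ym y) {v \<in> nodes. \<kappa> v = d} = snd d" if d: "d \<in> y" for d
  proof -
    let ?S = "{v \<in> nodes. \<kappa> v = d}"
    have sd: "snd d \<in> carrier G" by (rule dg_edge(3)[OF y d])
    have xs: "d' = ?l \<and> d = ?l \<or> d' = ({Mid j, Mid f}, inv g) \<and> d = df \<or> snd d' = \<one>"
      if "d' \<in> xm ?x" "fst d' \<subseteq> ?S" for d'
      using that kl unfolding xm_fixd by auto
    have ys: "\<exists>d''\<in>y. d' = (left_to_mid ` fst d'', snd d'') \<and> (if d'' = ?l then d = df else d'' = d)"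
      if d': "d' \<in> ym y" "fst d' \<subseteq> ?S" for d'
    proof -
      obtain d'' where d'': "d'' \<in> y" "d' = (left_to_mid ` fst d'', snd d'')" using d'(1) unfolding move_iff by blast
      have "if d'' = ?l then d = df else d'' = d"
      proof (cases "d'' = ?l")
        case True
        then have "Mid i \<in> ?S" using d'(2) d''(2) by auto
        then show ?thesis using True kl by simp
      next
        case False
        obtain u where u: "u \<in> fst d''" using dg_edge(4)[OF y d''(1)] by blast
        then have "\<kappa> (left_to_mid u) = d" using d'(2) d''(2) by auto
        then show ?thesis using False ky[OF d''(1) False u] by simp
      qed
      then show ?thesis using d'' by blast
    qed
    have dS: "left_to_mid ` fst d \<subseteq> ?S" if "d \<noteq> ?l"
    proof -
      have "left_to_mid ` fst d \<subseteq> nodes" using bspec[OF ym_edges_in[OF y, unfolded edges_in_def] moveI[OF d]] by simp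
      then show ?thesis using ky[OF d that] by auto
    qed
    consider "d = ?l" | "d = df" | "d \<noteq> ?l" "d \<noteq> df" by blast
    then show ?thesis
    proof cases
      case 1
      have "wt (xm ?x) ?S = snd ?l"
        by (rule wt_unique[OF labelled_xm[OF fixd_closed]]) (use xs 1 dfl kl ijf in \<open>auto simp: xm_fixd\<close>)
      moreover have "wt (ym y) ?S = \<one>"
      proof (rule wt_one)
        fix d' assume "d' \<in> ym y" "fst d' \<subseteq> ?S"
        from ys[OF this] show "snd d' = \<one>" using 1 dfl by (auto split: if_splits)
      qed
      ultimately show ?thesis using 1 g by simp
    next
      case 2
      then have dl: "d \<noteq> ?l" using dfl by simp
      have "wt (xm ?x) ?S = snd ({Mid j, Mid f}, inv g)"
      proof (rule wt_unique[OF labelled_xm[OF fixd_closed]])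
        show "fst ({Mid j, Mid f}, inv g) \<subseteq> ?S" using kl ijf 2 by auto
        show "d' = ({Mid j, Mid f}, inv g) \<or> snd d' = \<one>" if "d' \<in> xm ?x" "fst d' \<subseteq> ?S" for d'
          using xs[OF that] dl by blast
      qed (simp add: xm_fixd)
      moreover have "wt (ym y) ?S = snd (left_to_mid ` fst d, snd d) \<otimes> snd ({Mid i, Mid j}, g)"
      proof (rule wt_two[OF labelled_ym[OF y] moveI[OF d] _ mm])
        show "fst (left_to_mid ` fst d, snd d) \<subseteq> ?S" using dS[OF dl] by simp
        show "fst ({Mid i, Mid j}, g) \<subseteq> ?S" using kl ijf 2 by auto
        have "Mid f \<in> left_to_mid ` fst d" using df(2) 2 by force
        then show "(left_to_mid ` fst d, snd d) \<noteq> ({Mid i, Mid j}, g)" using ijf by auto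
        fix d' assume "d' \<in> ym y" "fst d' \<subseteq> ?S"
        from ys[OF this] show "d' = (left_to_mid ` fst d, snd d) \<or> d' = ({Mid i, Mid j}, g) \<or> snd d' = \<one>"
          by (auto split: if_splits)
      qed
      moreover have "inv g \<otimes> (snd d \<otimes> g) = snd d"
        by (subst m_comm[OF sd g], subst m_assoc[symmetric]) (use g sd in simp_all)
      ultimately show ?thesis by (simp only: snd_conv)
    next
      case 3
      have "wt (xm ?x) ?S = \<one>"
      proof (rule wt_one)
        fix d' assume "d' \<in> xm ?x" "fst d' \<subseteq> ?S"
        from xs[OF this] show "snd d' = \<one>" using 3 by (elim disjE conjE) simp_all
      qed
      moreover have "wt (ym y) ?S = snd (left_to_mid ` fst d, snd d)"
      proof (rule wt_unique[OF labelled_ym[OF y] moveI[OF d]])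
        show "fst (left_to_mid ` fst d, snd d) \<subseteq> ?S" using dS[OF 3(1)] by simp
        fix d' assume "d' \<in> ym y" "fst d' \<subseteq> ?S"
        from ys[OF this] show "d' = (left_to_mid ` fst d, snd d) \<or> snd d' = \<one>"
          using 3 by (auto split: if_splits)
      qed
      ultimately show ?thesis using sd by (simp only: snd_conv l_one)
    qed
  qed
  show "cmp ?x y = y" by (rule cmp_eqI[OF fixd_closed y y a o m yc lab])
  show "lf ?x y = \<one>\<^bsub>k\<^esub>" by (rule lf_eq_oneI[OF fixd_closed y y a o m yc lab])
qed

text \<open>Away from \<open>i\<close>, \<open>j\<close> and \<open>f\<close> the left factor
  consists of straight strands with unit label, which carry a link over unchanged.\<close>

lemma cmp_fixd_link:
  assumes z: "z \<in> dgs" and q: "({Lft a, Lft b}, h) \<in> z" and ab: "a \<notin> {i, j, f}" "b \<notin> {i, j, f}"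
  shows "({Lft a, Lft b}, h) \<in> cmp (fixd i j f g) z"
proof -
  let ?x = "fixd i j f g"
  let ?D = "xm ?x \<union> ym z" and ?C = "{Lft a, Lft b, Mid a, Mid b}"
  have n: "a \<in> {1..n}" "b \<in> {1..n}" and h: "h \<in> carrier G" using dg_edge(1,3)[OF z q] by auto
  have mm: "({Mid a, Mid b}, h) \<in> ym z" using moveI[OF q, of left_to_mid] by simp
  have uY: "d = ({Mid a, Mid b}, h)" if "d \<in> ym z" "fst d \<inter> ?C \<noteq> {}" for d
  proof -
    have "fst d \<subseteq> Mid ` {1..n} \<union> Rgt ` {1..n}" using that(1) ym_matching[OF z] by (auto simp: matching_def)
    then have "fst d \<inter> {Mid a, Mid b} \<noteq> {}" using that(2) by auto
    then show ?thesis using ym_matching[OF z] that(1) mm unfolding matching_def by auto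
  qed
  have uX: "d = ({Lft a, Mid a}, \<one>) \<or> d = ({Lft b, Mid b}, \<one>)" if d: "d \<in> xm ?x" "fst d \<inter> ?C \<noteq> {}" for d
  proof -
    have ne: "i \<noteq> a" "i \<noteq> b" "j \<noteq> a" "j \<noteq> b" "f \<noteq> a" "f \<noteq> b" using ab by auto
    consider "d = ({Lft i, Lft j}, g)" | "d = ({Mid j, Mid f}, inv g)" | "d = ({Lft f, Mid i}, \<one>)"
      | b' where "d = ({Lft b', Mid b'}, \<one>)"
      using d(1) unfolding xm_fixd by blast
    then show ?thesis
    proof cases
      case 4
      then have "b' = a \<or> b' = b" using d(2) by auto
      then show ?thesis using 4 by blast
    qed (use d(2) ne in simp_all)
  qed
  have ea: "({Lft a, Mid a}, \<one>) \<in> ?D" and eb: "({Lft b, Mid b}, \<one>) \<in> ?D" using ab n by (auto simp: xm_fixd)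
  have c1: "(Lft a, Mid a) \<in> conn ?D" by (rule conn_edge[OF ea]) auto
  have c2: "(Mid a, Mid b) \<in> conn ?D" by (rule conn_edge[of "({Mid a, Mid b}, h)"]) (use mm in auto)
  have c3: "(Mid b, Lft b) \<in> conn ?D" by (rule conn_edge[OF eb]) auto
  have C: "?C \<in> comps nodes ?D"
  proof (rule compsI[of "Lft a"])
    show "fst d \<subseteq> ?C" if "d \<in> ?D" "fst d \<inter> ?C \<noteq> {}" for d
      using that uX[of d] uY[of d] by auto
    show "(Lft a, v) \<in> conn ?D" if "v \<in> ?C" for v
      using that c1 conn_trans[OF c1 c2] conn_trans[OF conn_trans[OF c1 c2] c3] by auto
  qed (use n in auto)
  have "wt (xm ?x) ?C = \<one>"
  proof (rule wt_one)
    fix d assume d: "d \<in> xm ?x" "fst d \<subseteq> ?C"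
    have "fst d \<noteq> {}" using d(1) xm_edges_in[OF fixd_closed] by (auto simp: edges_in_def)
    then have "fst d \<inter> ?C \<noteq> {}" using d(2) by (simp only: Int_absorb2 not_False_eq_True)
    from uX[OF d(1) this] show "snd d = \<one>" by (elim disjE) simp_all
  qed
  moreover have "wt (ym z) ?C = snd ({Mid a, Mid b}, h)"
  proof (rule wt_unique[OF labelled_ym[OF z] mm])
    fix d assume d: "d \<in> ym z" "fst d \<subseteq> ?C"
    have "fst d \<noteq> {}" using d(1) ym_edges_in[OF z] by (auto simp: edges_in_def)
    then have "fst d \<inter> ?C \<noteq> {}" using d(2) by (simp only: Int_absorb2 not_False_eq_True)
    from uY[OF d(1) this] show "d = ({Mid a, Mid b}, h) \<or> snd d = \<one>" by (rule disjI1)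
  qed auto
  moreover have "?C \<inter> outer = {Lft a, Lft b}" using n by auto
  ultimately show ?thesis unfolding cmp_eq using C h by (intro CollectI exI[of _ ?C]) auto
qed

end

text \<open>Distinct links of \<open>x\<close> have no node in common and none of them uses
  \<open>f\<close>, so the diagram that restores \<open>q\<close> leaves the others alone. The last
  clause is what allows several of these diagrams to be applied in a row.\<close>

lemma fixer_exists:
  assumes x: "x \<in> dgs" and q: "q \<in> llinks x" and f: "f \<in> {1..n}" "\<And>d. d \<in> llinks x \<Longrightarrow> Lft f \<notin> fst d"
  shows "\<exists>u. u \<in> dgs \<and> (\<forall>y\<in>dgs. q \<in> y \<longrightarrow> cmp u y = y \<and> lf u y = \<one>\<^bsub>k\<^esub>) \<and> q \<in> llinks u \<and>
    (\<forall>z\<in>dgs. \<forall>q'\<in>z. q' \<in> llinks x \<and> q' \<noteq> q \<longrightarrow> q' \<in> cmp u z)"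
proof -
  have link: "\<exists>a b h. d = ({Lft a, Lft b}, h) \<and> a \<in> {1..n} \<and> b \<in> {1..n} \<and> a \<noteq> b \<and> a \<noteq> f \<and> b \<noteq> f \<and> h \<in> carrier G"
    if d: "d \<in> llinks x" for d
  proof -
    have dx: "d \<in> x" "fst d \<subseteq> range Lft" using d by (auto simp: llinks_def)
    obtain u v where uv: "fst d = {u, v}" "u \<noteq> v" using dg_edge(2)[OF x dx(1)] by (auto simp: card_2_iff)
    then obtain a b where ab: "u = Lft a" "v = Lft b" using dx(2) by auto
    then have "d = ({Lft a, Lft b}, snd d)" using uv by (simp add: prod_eq_iff)
    moreover have "a \<in> {1..n}" "b \<in> {1..n}" using dg_edge(1)[OF x dx(1)] uv ab by auto
    moreover have "a \<noteq> f" "b \<noteq> f" using f(2)[OF d] uv ab by auto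
    ultimately show ?thesis using uv ab dg_edge(3)[OF x dx(1)] by blast
  qed
  obtain i j g where ij: "q = ({Lft i, Lft j}, g)" "i \<in> {1..n}" "j \<in> {1..n}" "i \<noteq> j" "i \<noteq> f" "j \<noteq> f" "g \<in> carrier G"
    using link[OF q] by blast
  note c = ij(2,3) f(1) ij(4-7)
  have "q' \<in> cmp (fixd i j f g) z" if z: "z \<in> dgs" "q' \<in> z" "q' \<in> llinks x" "q' \<noteq> q" for z q'
  proof -
    obtain a b h where ab: "q' = ({Lft a, Lft b}, h)" "a \<noteq> f" "b \<noteq> f" using link[OF z(3)] by blast
    have "v \<notin> fst q" if "v \<in> fst q'" for v
      using dg_unique[OF x, of q' q v] z(3,4) q that by (auto simp: llinks_def)
    then have "a \<notin> {i, j, f}" "b \<notin> {i, j, f}" using ab ij(1) by auto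
    then show ?thesis using cmp_fixd_link[OF c z(1)] z(2) ab(1) by simp
  qed
  then show ?thesis
    using fixd_closed[OF c] cmp_fixd[OF c] lf_fixd[OF c] ij(1)
    by (intro exI[of _ "fixd i j f g"]) (auto simp: llinks_def fixd_def)
qed

text \<open>There is one factor for each left link of \<open>x\<close>, all of them built with the
  same free node. Each factor creates its own link, and the later ones keep it, so in the end every
  left link of \<open>x\<close> is present whatever \<open>y\<close> is.\<close>

lemma fixers_exist:
  assumes x: "x \<in> dgs" and odd: "odd n"
  shows "\<exists>es. set es \<subseteq> dgs \<and> (\<forall>y\<in>dgs. llinks y = llinks x \<longrightarrow> (\<forall>d\<in>set es. cmp d y = y \<and> lf d y = \<one>\<^bsub>k\<^esub>)) \<and>
    (\<forall>y\<in>dgs. card (llinks x) \<le> card (llinks (foldr cmp es y)))"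
proof -
  obtain f where f: "f \<in> {1..n}" "\<And>d. d \<in> llinks x \<Longrightarrow> Lft f \<notin> fst d" using free_node[OF x odd] by blast
  let ?P = "\<lambda>q u. u \<in> dgs \<and> (\<forall>y\<in>dgs. q \<in> y \<longrightarrow> cmp u y = y \<and> lf u y = \<one>\<^bsub>k\<^esub>) \<and> q \<in> llinks u \<and>
    (\<forall>z\<in>dgs. \<forall>q'\<in>z. q' \<in> llinks x \<and> q' \<noteq> q \<longrightarrow> q' \<in> cmp u z)"
  have "\<forall>q\<in>llinks x. \<exists>u. ?P q u" by (rule ballI) (rule fixer_exists[OF x _ f])
  then obtain E where E0: "\<forall>q\<in>llinks x. ?P q (E q)" by (rule bchoice[THEN exE])
  have E: "E q \<in> dgs" "y \<in> dgs \<Longrightarrow> q \<in> y \<Longrightarrow> cmp (E q) y = y \<and> lf (E q) y = \<one>\<^bsub>k\<^esub>" "q \<in> llinks (E q)"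
    "z \<in> dgs \<Longrightarrow> q' \<in> z \<Longrightarrow> q' \<in> llinks x \<Longrightarrow> q' \<noteq> q \<Longrightarrow> q' \<in> cmp (E q) z"
    if "q \<in> llinks x" for q y z q'
    using bspec[OF E0 that] by blast+
  obtain ls where ls: "set ls = llinks x" using finite_list[OF llinks_finite[OF x]] by blast
  \<comment> \<open>The invariant is that the links treated so far are links of the partial product;
    the new factor contributes its own link by \<open>llinks_cmp\<close>.\<close>
  have main: "foldr cmp (map E ls') y \<in> dgs \<and> set ls' \<subseteq> llinks (foldr cmp (map E ls') y)"
    if y: "y \<in> dgs" and "set ls' \<subseteq> llinks x" for y ls'
    using that(2)
  proof (induct ls')
    case Nil
    then show ?case using y by simp
  next
    case (Cons q ls')
    let ?z = "foldr cmp (map E ls') y"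
    have z: "?z \<in> dgs" "set ls' \<subseteq> llinks ?z" and q: "q \<in> llinks x" using Cons by auto
    have c: "cmp (E q) ?z \<in> dgs" by (rule cmp_closed[OF E(1)[OF q] z(1)])
    have "q' \<in> llinks (cmp (E q) ?z)" if q': "q' \<in> set (q # ls')" for q'
    proof (cases "q' = q")
      case True
      then show ?thesis using E(3)[OF q] llinks_cmp[OF E(1)[OF q] z(1)] by blast
    next
      case False
      then have "q' \<in> llinks ?z" "q' \<in> llinks x" using q' z Cons(2) by auto
      then show ?thesis using E(4)[OF q z(1) _ _ False] by (auto simp: llinks_def)
    qed
    then show ?case using c by auto
  qed
  show ?thesis
  proof (intro exI[of _ "map E ls"] conjI ballI impI)
    show "set (map E ls) \<subseteq> dgs" using E(1) ls by auto
    fix y assume y: "y \<in> dgs"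
    show "cmp d y = y" "lf d y = \<one>\<^bsub>k\<^esub>" if "llinks y = llinks x" "d \<in> set (map E ls)" for d
    proof -
      obtain q where q: "q \<in> llinks x" "d = E q" using \<open>d \<in> set (map E ls)\<close> ls by auto
      then have "q \<in> y" using \<open>llinks y = llinks x\<close> by (auto simp: llinks_def)
      then show "cmp d y = y" "lf d y = \<one>\<^bsub>k\<^esub>" using E(2)[OF q(1) y] q(2) by auto
    qed
    show "card (llinks x) \<le> card (llinks (foldr cmp (map E ls) y))"
      using main[OF y, of ls] ls by (intro card_mono llinks_finite) auto
  qed
qed

section \<open>Diagrams without links\<close>

text \<open>Right nodes are sent to left nodes so that gluing composes permutations as
  \<open>s \<circ> t\<close>. Labels are indexed by the left end of their edge; gluing therefore
  shifts the labels of the second factor by the inverse of \<open>s\<close>, exactly as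
  \<open>permute_factors\<close> does.\<close>

definition pdiag :: "(nat \<Rightarrow> 'g) \<times> (nat \<Rightarrow> nat) \<Rightarrow> 'g diagram" where
  "pdiag = (\<lambda>(a, s). (\<lambda>j. ({Lft (s j), Rgt j}, a (s j))) ` {1..n})"

lemma wreath_carrier: "(a, s) \<in> carrier (wreath G n) \<longleftrightarrow> a \<in> {1..n} \<rightarrow>\<^sub>E carrier G \<and> s permutes {1..n}"
  by (simp add: wreath_def semidirect_def sym_group_def)

lemma wreath_mult: "(a, s) \<otimes>\<^bsub>wreath G n\<^esub> (b, t) = (\<lambda>i\<in>{1..n}. a i \<otimes> b (inv_into UNIV s i), s \<circ> t)"
  by (auto simp: wreath_def semidirect_def sym_group_def permute_factors_def restrict_def fun_eq_iff)

lemma wreath_one: "\<one>\<^bsub>wreath G n\<^esub> = (\<lambda>i\<in>{1..n}. \<one>, id)"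
  by (simp add: wreath_def semidirect_def sym_group_def)

lemma pdiag_closed:
  assumes h: "h \<in> carrier (wreath G n)"
  shows "pdiag h \<in> dgs"
proof -
  obtain a s where as: "h = (a, s)" "a \<in> {1..n} \<rightarrow>\<^sub>E carrier G" "s permutes {1..n}"
    using h wreath_carrier by (metis surj_pair)
  have s: "s j \<in> {1..n} \<longleftrightarrow> j \<in> {1..n}" "s i = s j \<longleftrightarrow> i = j" for i j
    using permutes_in_image[OF as(3)] permutes_inj[OF as(3)] by (simp_all add: inj_eq)
  show ?thesis
    unfolding as(1) pdiag_def case_prod_conv
  proof (rule dgI)
    fix d assume "d \<in> (\<lambda>j. ({Lft (s j), Rgt j}, a (s j))) ` {1..n}"
    then obtain j where "j \<in> {1..n}" "d = ({Lft (s j), Rgt j}, a (s j))" by blast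
    then show "fst d \<subseteq> outer \<and> card (fst d) = 2 \<and> snd d \<in> carrier G"
      using s as(2) by (auto simp del: atLeastAtMost_iff)
  next
    fix v assume "v \<in> outer"
    then show "\<exists>d\<in>(\<lambda>j. ({Lft (s j), Rgt j}, a (s j))) ` {1..n}. v \<in> fst d"
    proof (rule outer_cases)
      fix i assume i: "i \<in> {1..n}" "v = Lft i"
      obtain j where "i = s j" using permutes_surj[OF as(3)] by (metis surjD)
      then show ?thesis using i s(1)[of j] by auto
    qed auto
  qed (use s in auto)
qed

lemma pdiag_one: "pdiag \<one>\<^bsub>wreath G n\<^esub> = ident"
  unfolding wreath_one pdiag_def brauer_id_def by (auto intro!: image_cong)

lemma pdiag_inj: "inj_on pdiag (carrier (wreath G n))"
proof (rule inj_onI)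
  fix h h' assume h: "h \<in> carrier (wreath G n)" "h' \<in> carrier (wreath G n)" and eq: "pdiag h = pdiag h'"
  obtain a s b t where as: "h = (a, s)" "a \<in> {1..n} \<rightarrow>\<^sub>E carrier G" "s permutes {1..n}"
    and bt: "h' = (b, t)" "b \<in> {1..n} \<rightarrow>\<^sub>E carrier G" "t permutes {1..n}"
    using h wreath_carrier by (metis surj_pair)
  have e: "s j = t j \<and> a (s j) = b (s j)" if j: "j \<in> {1..n}" for j
  proof -
    have "({Lft (s j), Rgt j}, a (s j)) \<in> pdiag (a, s)" using j unfolding pdiag_def case_prod_conv by blast
    then have "({Lft (s j), Rgt j}, a (s j)) \<in> pdiag h'" using eq as(1) by simp
    then obtain j' where j': "({Lft (s j), Rgt j}, a (s j)) = ({Lft (t j'), Rgt j'}, b (t j'))"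
      unfolding bt(1) pdiag_def case_prod_conv by blast
    have "{Lft (s j), Rgt j} = {Lft (t j'), Rgt j'}" "a (s j) = b (t j')" using j' by (simp_all only: prod.inject)
    then show ?thesis unfolding doubleton_eq_iff by auto
  qed
  have "s = t"
  proof
    fix j show "s j = t j" using e[of j] permutes_not_in[OF as(3), of j] permutes_not_in[OF bt(3), of j] by (cases "j \<in> {1..n}") auto
  qed
  moreover have "a = b"
  proof (rule PiE_ext[OF as(2) bt(2)])
    fix i assume i: "i \<in> {1..n}"
    obtain j where j: "i = s j" using permutes_surj[OF as(3)] by (metis surjD)
    then have "j \<in> {1..n}" using i permutes_in_image[OF as(3)] by simp
    then show "a i = b i" unfolding j by (rule e[THEN conjunct2])
  qed
  ultimately show "h = h'" using as bt by simp
qed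

lemma pdiag_llinks: "llinks (pdiag h) = {}"
  by (auto simp: llinks_def pdiag_def split: prod.split)

text \<open>Left and right links are equally many, so without left links every edge goes across; the
  permutation and the labels are then read off.\<close>

lemma pdiag_surj:
  assumes x: "x \<in> dgs" and l: "llinks x = {}"
  shows "x \<in> pdiag ` carrier (wreath G n)"
proof -
  have r: "rlinks x = {}"
    using card_llinks_rlinks[OF x] l dg_finite[OF x] by (simp add: rlinks_def)
  have thru: "\<exists>i j. d = ({Lft i, Rgt j}, snd d) \<and> i \<in> {1..n} \<and> j \<in> {1..n}" if d: "d \<in> x" for d
  proof -
    obtain u v where uv: "fst d = {u, v}" "u \<noteq> v" using dg_edge(2)[OF x d] by (auto simp: card_2_iff)
    have o: "u \<in> outer" "v \<in> outer" using uv dg_edge(1)[OF x d] by auto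
    have nl: "\<not> fst d \<subseteq> range Lft" "\<not> fst d \<subseteq> range Rgt" 
    proof -
      have "d \<notin> llinks x" "d \<notin> rlinks x" using l r by simp_all
      then show "\<not> fst d \<subseteq> range Lft" "\<not> fst d \<subseteq> range Rgt" using d unfolding llinks_def rlinks_def by blast+
    qed
    have "\<exists>i j. fst d = {Lft i, Rgt j} \<and> i \<in> {1..n} \<and> j \<in> {1..n}"
      using o nl unfolding uv(1) by (elim outer_cases) (auto simp del: atLeastAtMost_iff)
    then show ?thesis by (metis prod.collapse)
  qed
  have ex: "\<exists>i. i \<in> {1..n} \<and> ({Lft i, Rgt j}, snd (edge x (Rgt j))) \<in> x" if j: "j \<in> {1..n}" for j
  proof -
    have e: "edge x (Rgt j) \<in> x" "Rgt j \<in> fst (edge x (Rgt j))" using edge_in[OF x, of "Rgt j"] j by auto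
    obtain i j' where i: "edge x (Rgt j) = ({Lft i, Rgt j'}, snd (edge x (Rgt j)))" "i \<in> {1..n}" using thru[OF e(1)] by blast
    have "Rgt j \<in> {Lft i, Rgt j'}" using e(2) i(1) by (metis fst_conv)
    then have "j' = j" by simp
    then show ?thesis using i e(1) by metis
  qed
  then obtain s0 where s0: "\<And>j. j \<in> {1..n} \<Longrightarrow> s0 j \<in> {1..n} \<and> ({Lft (s0 j), Rgt j}, snd (edge x (Rgt j))) \<in> x"
    by metis
  define s where "s j = (if j \<in> {1..n} then s0 j else j)" for j
  define a where "a = (\<lambda>i\<in>{1..n}. snd (edge x (Lft i)))"
  have se: "s j \<in> {1..n}" "({Lft (s j), Rgt j}, snd (edge x (Rgt j))) \<in> x" if "j \<in> {1..n}" for j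
    using s0[OF that] that by (simp_all add: s_def)
  have "inj_on s {1..n}"
  proof (rule inj_onI)
    fix j j' assume j: "j \<in> {1..n}" "j' \<in> {1..n}" "s j = s j'"
    have "({Lft (s j), Rgt j}, snd (edge x (Rgt j))) = ({Lft (s j'), Rgt j'}, snd (edge x (Rgt j')))"
      by (rule dg_unique[OF x se(2)[OF j(1)] se(2)[OF j(2)], of "Lft (s j)"]) (use j in auto)
    then show "j = j'" using j(3) by (auto simp: doubleton_eq_iff)
  qed
  moreover have "s ` {1..n} \<subseteq> {1..n}" using se(1) by blast
  \<comment> \<open>An injective self-map of a finite set is onto; together with the value
    \<open>j\<close> outside \<open>{1..n}\<close> this makes \<open>s\<close> a
    permutation.\<close>
  ultimately have "bij_betw s {1..n} {1..n}" by (simp add: bij_betw_def endo_inj_surj)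
  then have sp: "s permutes {1..n}" by (rule bij_imp_permutes) (auto simp: s_def)
  have a: "a \<in> {1..n} \<rightarrow>\<^sub>E carrier G" using edge_in(1)[OF x] dg_edge(3)[OF x] by (auto simp: a_def)
  have asj: "a (s j) = snd (edge x (Rgt j))" if j: "j \<in> {1..n}" for j
    using edge_eq[OF x se(2)[OF j], of "Lft (s j)"] se(1)[OF j] by (simp add: a_def)
  have "x = pdiag (a, s)"
  proof (intro equalityI subsetI)
    fix d assume d: "d \<in> x"
    then obtain i j where ij: "d = ({Lft i, Rgt j}, snd d)" "j \<in> {1..n}" using thru by blast
    have "Rgt j \<in> fst d" using ij(1) by (metis fst_conv insertCI)
    then have "d = ({Lft (s j), Rgt j}, snd (edge x (Rgt j)))" using dg_unique[OF x d se(2)[OF ij(2)]] by auto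
    then show "d \<in> pdiag (a, s)" using ij(2) asj by (auto simp: pdiag_def)
  next
    fix d assume "d \<in> pdiag (a, s)"
    then obtain j where "j \<in> {1..n}" "d = ({Lft (s j), Rgt j}, a (s j))" by (auto simp: pdiag_def)
    then show "d \<in> x" using se(2) asj by simp
  qed
  then show ?thesis using a sp wreath_carrier by blast
qed

lemma wreath_mult_closed:
  "h \<in> carrier (wreath G n) \<Longrightarrow> h' \<in> carrier (wreath G n) \<Longrightarrow> h \<otimes>\<^bsub>wreath G n\<^esub> h' \<in> carrier (wreath G n)"
proof -
  assume h: "h \<in> carrier (wreath G n)" "h' \<in> carrier (wreath G n)"
  obtain a s b t where as: "h = (a, s)" "a \<in> {1..n} \<rightarrow>\<^sub>E carrier G" "s permutes {1..n}"
    and bt: "h' = (b, t)" "b \<in> {1..n} \<rightarrow>\<^sub>E carrier G" "t permutes {1..n}"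
    using h wreath_carrier by (metis surj_pair)
  have "inv_into UNIV s i \<in> {1..n}" if "i \<in> {1..n}" for i
    using permutes_in_image[OF permutes_inv[OF as(3)]] that by blast
  then have "(\<lambda>i\<in>{1..n}. a i \<otimes> b (inv_into UNIV s i)) \<in> {1..n} \<rightarrow>\<^sub>E carrier G"
    using as(2) bt(2) by (auto simp del: atLeastAtMost_iff)
  then show "h \<otimes>\<^bsub>wreath G n\<^esub> h' \<in> carrier (wreath G n)"
    unfolding as(1) bt(1) wreath_mult wreath_carrier using permutes_compose[OF bt(3) as(3)] by simp
qed

text \<open>The components are the paths from \<open>s (t j)\<close> on the left through
  \<open>t j\<close> in the middle to \<open>j\<close> on the right. They exhaust the middle nodes,
  so there are no loops.\<close>

lemma
  assumes h: "h \<in> carrier (wreath G n)" and h': "h' \<in> carrier (wreath G n)"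
  shows cmp_pdiag: "cmp (pdiag h) (pdiag h') = pdiag (h \<otimes>\<^bsub>wreath G n\<^esub> h')"
    and lf_pdiag: "lf (pdiag h) (pdiag h') = \<one>\<^bsub>k\<^esub>"
proof -
  obtain a s b t where as: "h = (a, s)" "a \<in> {1..n} \<rightarrow>\<^sub>E carrier G" "s permutes {1..n}"
    and bt: "h' = (b, t)" "b \<in> {1..n} \<rightarrow>\<^sub>E carrier G" "t permutes {1..n}"
    using h h' wreath_carrier by (metis surj_pair)
  let ?x = "pdiag h" and ?y = "pdiag h'" and ?w = "pdiag (h \<otimes>\<^bsub>wreath G n\<^esub> h')"
  let ?D = "xm ?x \<union> ym ?y"
  let ?s = "inv_into UNIV s" and ?t = "inv_into UNIV t"
  have sin: "s j \<in> {1..n} \<longleftrightarrow> j \<in> {1..n}" "t j \<in> {1..n} \<longleftrightarrow> j \<in> {1..n}" for j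
    using permutes_in_image[OF as(3)] permutes_in_image[OF bt(3)] by simp_all
  have iin: "?s j \<in> {1..n} \<longleftrightarrow> j \<in> {1..n}" "?t j \<in> {1..n} \<longleftrightarrow> j \<in> {1..n}" for j
    using permutes_in_image[OF permutes_inv[OF as(3)]] permutes_in_image[OF permutes_inv[OF bt(3)]] by simp_all
  have inv: "?s (s j) = j" "s (?s j) = j" "?t (t j) = j" "t (?t j) = j" for j
    using permutes_inverses[OF as(3)] permutes_inverses[OF bt(3)] by simp_all
  have ac: "i \<in> {1..n} \<Longrightarrow> a i \<in> carrier G" and bc: "i \<in> {1..n} \<Longrightarrow> b i \<in> carrier G" for i using as(2) bt(2) by auto
  define W where "W j = ({Lft (s (t j)), Rgt j}, a (s (t j)) \<otimes> b (t j))" for j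
  have w: "?w = W ` {1..n}"
    unfolding as(1) bt(1) wreath_mult pdiag_def case_prod_conv W_def
    by (rule image_cong) (use sin inv in \<open>simp_all add: restrict_def del: atLeastAtMost_iff\<close>)
  have X: "xm ?x = (\<lambda>j. ({Lft (s j), Mid j}, a (s j))) ` {1..n}"
    unfolding as(1) pdiag_def case_prod_conv move_image by simp
  have Y: "ym ?y = (\<lambda>j. ({Mid (t j), Rgt j}, b (t j))) ` {1..n}"
    unfolding bt(1) pdiag_def case_prod_conv move_image by simp
  define \<kappa> where "\<kappa> v = (case v of Lft i \<Rightarrow> W (?t (?s i)) | Mid i \<Rightarrow> W (?t i) | Rgt j \<Rightarrow> W j)" for v
  have kv: "\<kappa> (Lft (s j)) = W (?t j)" "\<kappa> (Mid j) = W (?t j)" "\<kappa> (Mid (t j)) = W j" "\<kappa> (Rgt j) = W j" for j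
    by (simp_all add: \<kappa>_def inv)
  have Winj: "W j = W j' \<longleftrightarrow> j = j'" for j j' by (auto simp: W_def doubleton_eq_iff)
  have a': "\<kappa> u = \<kappa> v" if "d \<in> ?D" "u \<in> fst d" "v \<in> fst d" for d u v
    using that kv unfolding X Y by auto
  have o: "\<kappa> v \<in> ?w \<and> v \<in> fst (\<kappa> v)" if "v \<in> outer" for v
    using that
  proof (rule outer_cases)
    fix i assume i: "i \<in> {1..n}" "v = Lft i"
    then have "?t (?s i) \<in> {1..n}" using iin by blast
    then have "W (?t (?s i)) \<in> ?w" unfolding w by (rule imageI)
    moreover have "\<kappa> v = W (?t (?s i))" "v \<in> fst (W (?t (?s i)))" using i(2) by (simp_all add: \<kappa>_def W_def inv)
    ultimately show ?thesis by simp
  next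
    fix j assume "j \<in> {1..n}" "v = Rgt j"
    then show ?thesis unfolding w by (auto simp: \<kappa>_def W_def simp del: atLeastAtMost_iff)
  qed
  have c1: "(Lft (s j), Mid j) \<in> conn ?D" if "j \<in> {1..n}" for j
    by (rule conn_edge[of "({Lft (s j), Mid j}, a (s j))"]) (use that X in auto)
  have c2: "(Mid (t j), Rgt j) \<in> conn ?D" if "j \<in> {1..n}" for j
    by (rule conn_edge[of "({Mid (t j), Rgt j}, b (t j))"]) (use that Y in auto)
  have m: "\<exists>u\<in>outer. (u, Mid i) \<in> conn ?D" if "i \<in> {1..n}" for i
    using c1[OF that] sin(1)[of i] that by (intro bexI[of _ "Lft (s i)"]) auto
  have yc: "(u, v) \<in> conn ?D" if d: "d \<in> ?w" "u \<in> fst d" "v \<in> fst d" for d u v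
  proof -
    obtain j where j: "j \<in> {1..n}" "d = W j" using d(1) unfolding w by blast
    have c: "(Lft (s (t j)), Rgt j) \<in> conn ?D"
      using conn_trans[OF c1[of "t j"] c2[OF j(1)]] sin(2)[of j] j by simp
    have "u \<in> {Lft (s (t j)), Rgt j}" "v \<in> {Lft (s (t j)), Rgt j}" using d j by (simp_all add: W_def)
    then show ?thesis using c conn_sym[OF c] by auto
  qed
  have lx: "labelled (xm ?x)" "labelled (ym ?y)"
    using labelled_xm[OF pdiag_closed[OF h]] labelled_ym[OF pdiag_closed[OF h']] by auto
  have lab: "wt (xm ?x) {v \<in> nodes. \<kappa> v = d} \<otimes> wt (ym ?y) {v \<in> nodes. \<kappa> v = d} = snd d" if d: "d \<in> ?w" for d
  proof -
    obtain j where j: "j \<in> {1..n}" "d = W j" using d unfolding w by blast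
    let ?S = "{v \<in> nodes. \<kappa> v = d}"
    have tj: "t j \<in> {1..n}" "s (t j) \<in> {1..n}" using sin j by blast+
    have "wt (xm ?x) ?S = snd ({Lft (s (t j)), Mid (t j)}, a (s (t j)))"
    proof (rule wt_unique[OF lx(1)])
      show "({Lft (s (t j)), Mid (t j)}, a (s (t j))) \<in> xm ?x" unfolding X using tj by blast
      show "fst ({Lft (s (t j)), Mid (t j)}, a (s (t j))) \<subseteq> ?S"
        using tj kv(1)[of "t j"] kv(3)[of j] j inv by auto
      fix d' assume d': "d' \<in> xm ?x" "fst d' \<subseteq> ?S"
      then obtain j' where j': "d' = ({Lft (s j'), Mid j'}, a (s j'))" unfolding X by blast
      then have "W (?t j') = W j" using d'(2) kv(2)[of j'] j by simp
      then have "j' = t j" using Winj inv by metis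
      then show "d' = ({Lft (s (t j)), Mid (t j)}, a (s (t j))) \<or> snd d' = \<one>" using j' by simp
    qed
    moreover have "wt (ym ?y) ?S = snd ({Mid (t j), Rgt j}, b (t j))"
    proof (rule wt_unique[OF lx(2)])
      show "({Mid (t j), Rgt j}, b (t j)) \<in> ym ?y" unfolding Y using j by blast
      show "fst ({Mid (t j), Rgt j}, b (t j)) \<subseteq> ?S" using tj kv(3,4)[of j] j by auto
      fix d' assume d': "d' \<in> ym ?y" "fst d' \<subseteq> ?S"
      then obtain j' where j': "d' = ({Mid (t j'), Rgt j'}, b (t j'))" unfolding Y by blast
      then have "W j' = W j" using d'(2) kv(4)[of j'] j by simp
      then show "d' = ({Mid (t j), Rgt j}, b (t j)) \<or> snd d' = \<one>" using j' Winj by simp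
    qed
    ultimately show ?thesis using j by (simp add: W_def)
  qed
  have wd: "?w \<in> dgs" by (rule pdiag_closed[OF wreath_mult_closed[OF h h']])
  show "cmp ?x ?y = ?w" by (rule cmp_eqI[OF pdiag_closed[OF h] pdiag_closed[OF h'] wd a' o m yc lab])
  show "lf ?x ?y = \<one>\<^bsub>k\<^esub>" by (rule lf_eq_oneI[OF pdiag_closed[OF h] pdiag_closed[OF h'] wd a' o m yc lab])
qed

text \<open>The left unit law and associativity are pulled back from the diagrams along
  \<open>pdiag\<close>, which is injective and multiplicative; only the inverses are computed
  directly.\<close>

lemma wreath_group: "group (wreath G n)"
proof (rule groupI)
  have one: "\<one>\<^bsub>wreath G n\<^esub> \<in> carrier (wreath G n)"
    unfolding wreath_one wreath_carrier by (auto simp: permutes_id)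
  show "\<one>\<^bsub>wreath G n\<^esub> \<in> carrier (wreath G n)" by (rule one)
  fix h assume h: "h \<in> carrier (wreath G n)"
  note inj = inj_onD[OF pdiag_inj]
  show "\<one>\<^bsub>wreath G n\<^esub> \<otimes>\<^bsub>wreath G n\<^esub> h = h"
  proof (rule inj[OF _ wreath_mult_closed[OF one h] h])
    show "pdiag (\<one>\<^bsub>wreath G n\<^esub> \<otimes>\<^bsub>wreath G n\<^esub> h) = pdiag h"
      using cmp_pdiag[OF one h] cmp_ident_left[OF pdiag_closed[OF h]] by (simp add: pdiag_one)
  qed
  show "\<exists>h'\<in>carrier (wreath G n). h' \<otimes>\<^bsub>wreath G n\<^esub> h = \<one>\<^bsub>wreath G n\<^esub>"
  proof -
    obtain a s where as: "h = (a, s)" "a \<in> {1..n} \<rightarrow>\<^sub>E carrier G" "s permutes {1..n}"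
      using h wreath_carrier by (metis surj_pair)
    let ?s = "inv_into UNIV s"
    have sp: "?s permutes {1..n}" by (rule permutes_inv[OF as(3)])
    have sin: "s j \<in> {1..n} \<longleftrightarrow> j \<in> {1..n}" for j using permutes_in_image[OF as(3)] .
    have ii: "inv_into UNIV ?s = s" using permutes_inv_inv[OF as(3)] .
    let ?b = "\<lambda>i\<in>{1..n}. inv (a (s i))"
    have b: "?b \<in> {1..n} \<rightarrow>\<^sub>E carrier G" using as(2) sin by (auto simp del: atLeastAtMost_iff)
    have "(?b, ?s) \<otimes>\<^bsub>wreath G n\<^esub> h = \<one>\<^bsub>wreath G n\<^esub>"
      unfolding as(1) wreath_mult wreath_one ii
    proof (intro prod_eqI; simp only: fst_conv snd_conv)
      show "?s \<circ> s = id" using permutes_inv_o(2)[OF as(3)] .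
      show "(\<lambda>i\<in>{1..n}. ?b i \<otimes> a (s i)) = (\<lambda>i\<in>{1..n}. \<one>)"
      proof (rule restrict_ext)
        fix i assume i: "i \<in> {1..n}"
        then have "a (s i) \<in> carrier G" using as(2) sin[of i] by blast
        then show "?b i \<otimes> a (s i) = \<one>" using i by (simp only: restrict_apply if_True l_inv)
      qed
    qed
    then show ?thesis using b sp wreath_carrier by blast
  qed
  fix h' assume h': "h' \<in> carrier (wreath G n)"
  show "h \<otimes>\<^bsub>wreath G n\<^esub> h' \<in> carrier (wreath G n)" by (rule wreath_mult_closed[OF h h'])
  fix h'' assume h'': "h'' \<in> carrier (wreath G n)"
  note cl = wreath_mult_closed
  show "h \<otimes>\<^bsub>wreath G n\<^esub> h' \<otimes>\<^bsub>wreath G n\<^esub> h'' = h \<otimes>\<^bsub>wreath G n\<^esub> (h' \<otimes>\<^bsub>wreath G n\<^esub> h'')"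
  proof (rule inj[OF _ cl[OF cl[OF h h'] h''] cl[OF h cl[OF h' h'']]])
    note p = pdiag_closed[OF h] pdiag_closed[OF h'] pdiag_closed[OF h'']
    have "cmp (cmp (pdiag h) (pdiag h')) (pdiag h'') = cmp (pdiag h) (cmp (pdiag h') (pdiag h''))"
      by (rule cmp_assoc[OF p cmp_closed[OF p(1,2)] cmp_closed[OF p(2,3)]])
    then show "pdiag (h \<otimes>\<^bsub>wreath G n\<^esub> h' \<otimes>\<^bsub>wreath G n\<^esub> h'') = pdiag (h \<otimes>\<^bsub>wreath G n\<^esub> (h' \<otimes>\<^bsub>wreath G n\<^esub> h''))"
      by (simp only: cmp_pdiag h h' h'' cl)
  qed
qed

end

section \<open>The Brauer algebra as a twisted algebra\<close>

context brauer
begin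

text \<open>Any bound that does not depend on \<open>x\<close> will do. This one holds because
  distinct links have distinct node sets.\<close>

lemma card_llinks_le: "x \<in> dgs \<Longrightarrow> card (llinks x) \<le> card (Pow outer)"
proof -
  assume x: "x \<in> dgs"
  have "inj_on fst (llinks x)"
  proof (rule inj_onI)
    fix d d' assume d: "d \<in> llinks x" "d' \<in> llinks x" "fst d = fst d'"
    then have dx: "d \<in> x" "d' \<in> x" by (simp_all add: llinks_def)
    obtain v where "v \<in> fst d" using dg_edge(4)[OF x dx(1)] by blast
    then show "d = d'" using dg_unique[OF x dx] d(3) by simp
  qed
  moreover have "fst ` llinks x \<subseteq> Pow outer" using dg_edge(1)[OF x] by (auto simp: llinks_def)
  ultimately show "card (llinks x) \<le> card (Pow outer)" by (rule card_inj_on_le) simp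
qed

lemma card_llinks_zero_iff: "x \<in> dgs \<Longrightarrow> card (llinks x) = 0 \<longleftrightarrow> llinks x = {}"
  using llinks_finite by simp

lemma no_links_iff:
  assumes x: "x \<in> dgs"
  shows "(\<forall>d\<in>x. \<not> fst d \<subseteq> range Lft \<and> \<not> fst d \<subseteq> range Rgt) \<longleftrightarrow> card (llinks x) = 0"
proof -
  have "finite (rlinks x)" using dg_finite[OF x] by (simp add: rlinks_def)
  then have "card (llinks x) = 0 \<longleftrightarrow> llinks x = {} \<and> rlinks x = {}"
    using card_llinks_rlinks[OF x] llinks_finite[OF x] by (metis card_0_eq)
  then show ?thesis unfolding llinks_def rlinks_def by blast
qed

lemma pdiag_bij: "bij_betw pdiag (carrier (wreath G n)) {x \<in> dgs. card (llinks x) = 0}"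
proof (rule bij_betw_imageI[OF pdiag_inj], intro equalityI subsetI)
  fix x assume "x \<in> pdiag ` carrier (wreath G n)"
  then show "x \<in> {x \<in> dgs. card (llinks x) = 0}" using pdiag_closed pdiag_llinks by auto
next
  fix x assume "x \<in> {x \<in> dgs. card (llinks x) = 0}"
  then have "x \<in> dgs" "llinks x = {}" using card_llinks_zero_iff by auto
  then show "x \<in> pdiag ` carrier (wreath G n)" by (rule pdiag_surj)
qed

lemma lf_no_links:
  assumes x: "x \<in> dgs" "card (llinks x) = 0" and y: "y \<in> dgs" "card (llinks y) = 0"
  shows "lf x y = \<one>\<^bsub>k\<^esub>"
proof -
  have "x \<in> pdiag ` carrier (wreath G n)" "y \<in> pdiag ` carrier (wreath G n)"
    using x y by (simp_all add: bij_betw_imp_surj_on[OF pdiag_bij])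
  then obtain g h where "x = pdiag g" "y = pdiag h" "g \<in> carrier (wreath G n)" "h \<in> carrier (wreath G n)"
    by blast
  then show ?thesis by (simp only: lf_pdiag)
qed

text \<open>Here the parity of \<open>n\<close> enters, through the fixing diagrams.\<close>

lemma twisted_algebra:
  assumes odd: "odd n"
  shows "twisted_algebra k (wreath G n) dgs cmp lf ident
    (\<lambda>D. \<forall>d\<in>D. \<not> fst d \<subseteq> range Lft \<and> \<not> fst d \<subseteq> range Rgt)
    pdiag (\<lambda>x. card (llinks x)) llinks (card (Pow outer))"
proof (intro twisted_algebra.intro kH.intro twisted_algebra_axioms.intro)
  show "cring k" by (rule K.cring_axioms)
  show "group (wreath G n)" by (rule wreath_group)
  show "ident \<in> dgs" by (rule ident_closed)
  show "bij_betw pdiag (carrier (wreath G n)) {x \<in> dgs. card (llinks x) = 0}" by (rule pdiag_bij)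
  show "pdiag \<one>\<^bsub>wreath G n\<^esub> = ident" by (rule pdiag_one)
  show "pdiag (g \<otimes>\<^bsub>wreath G n\<^esub> h) = cmp (pdiag g) (pdiag h)"
    if "g \<in> carrier (wreath G n)" "h \<in> carrier (wreath G n)" for g h
    by (rule cmp_pdiag[OF that, symmetric])
  fix x assume x: "x \<in> dgs"
  show "cmp ident x = x" "cmp x ident = x" "lf ident x = \<one>\<^bsub>k\<^esub>" "lf x ident = \<one>\<^bsub>k\<^esub>"
    by (rule cmp_ident_left[OF x] cmp_ident_right[OF x] lf_ident_left[OF x] lf_ident_right[OF x])+
  show "(\<forall>d\<in>x. \<not> fst d \<subseteq> range Lft \<and> \<not> fst d \<subseteq> range Rgt) = (card (llinks x) = 0)"
    by (rule no_links_iff[OF x])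
  show "card (llinks x) \<le> card (Pow outer)" by (rule card_llinks_le[OF x])
  show "\<exists>es. set es \<subseteq> dgs \<and> (\<forall>y\<in>dgs. llinks y = llinks x \<longrightarrow> (\<forall>d\<in>set es. cmp d y = y \<and> lf d y = \<one>\<^bsub>k\<^esub>)) \<and>
      (\<forall>y\<in>dgs. card (llinks x) \<le> card (llinks (foldr cmp es y)))"
    by (rule fixers_exist[OF x odd])
  fix y assume y: "y \<in> dgs"
  note c = cmp_closed[OF x y]
  show "cmp x y \<in> dgs" by (rule c)
  show "lf x y \<in> carrier k" by (rule lf_closed[OF x y])
  show "lf x y = \<one>\<^bsub>k\<^esub>" if "card (llinks x) = 0" "card (llinks y) = 0"
    by (rule lf_no_links[OF x that(1) y that(2)])
  show "card (llinks x) \<le> card (llinks (cmp x y))"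
    by (rule card_mono[OF llinks_finite[OF c] llinks_cmp[OF x y]])
  \<comment> \<open>The left links of a right factor need not survive in a product, but its right
    links do, and these are equally many.\<close>
  have "finite (rlinks (cmp x y))" using dg_finite[OF c] by (simp add: rlinks_def)
  then show "card (llinks y) \<le> card (llinks (cmp x y))"
    unfolding card_llinks_rlinks[OF c] card_llinks_rlinks[OF y] by (rule card_mono[OF _ rlinks_cmp[OF x y]])
  show "llinks (cmp x y) = llinks x \<or> card (llinks x) < card (llinks (cmp x y))"
    using psubset_card_mono[OF llinks_finite[OF c], of "llinks x"] llinks_cmp[OF x y] by auto
  show "card (llinks x) = card (llinks y)" if "llinks x = llinks y" using that by simp
  fix z assume z: "z \<in> dgs"
  show "cmp (cmp x y) z = cmp x (cmp y z)" by (rule cmp_assoc[OF x y z c cmp_closed[OF y z]])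
  show "lf x y \<otimes>\<^bsub>k\<^esub> lf (cmp x y) z = lf y z \<otimes>\<^bsub>k\<^esub> lf x (cmp y z)"
    by (rule lf_cocycle[OF x y z c cmp_closed[OF y z]])
qed

lemma Tor_brauer_isomorphic_group_homology:
  assumes "odd n"
  shows "mod_isomorphic k (Tor k (brauer_algebra G k act \<delta> n) (brauer_trivial k) (brauer_trivial k) i)
    (group_homology k (wreath G n) i)"
proof -
  interpret B: twisted_algebra k "wreath G n" dgs cmp lf ident
    "\<lambda>D. \<forall>d\<in>D. \<not> fst d \<subseteq> range Lft \<and> \<not> fst d \<subseteq> range Rgt" pdiag "\<lambda>x. card (llinks x)" llinks "card (Pow outer)"
    by (rule twisted_algebra[OF assms])
  show ?thesis using B.Tor_isomorphic_group_homology(2)[of i] by (simp only: B.A_def brauer_algebra_def brauer_trivial_def)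
qed

end

text \<open>The degenerate instance in which all scalars are one and all ranks are zero: the ideal
  vanishes and there is nothing to fix.\<close>

lemma Tor_group_algebra:
  fixes k :: "('k, 'c) ring_scheme" and H :: "('h, 'd) monoid_scheme"
  assumes k: "cring k" and H: "group H"
  shows "module k (Tor k (group_algebra k H) (group_trivial k) (group_trivial k) i)"
    and "mod_isomorphic k (Tor k (group_algebra k H) (group_trivial k) (group_trivial k) i) (group_homology k H i)"
proof -
  interpret k: cring k by (rule k)
  interpret H: group H by (rule H)
  interpret T: twisted_algebra k H "carrier H" "\<lambda>x y. x \<otimes>\<^bsub>H\<^esub> y" "\<lambda>_ _. \<one>\<^bsub>k\<^esub>" "\<one>\<^bsub>H\<^esub>" "\<lambda>_. True" "\<lambda>x. x" "\<lambda>_. 0"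
    "\<lambda>_. ()" 0
    by unfold_locales (auto simp: H.m_assoc bij_betw_def)
  \<comment> \<open>The product in \<open>group_algebra\<close> is written without a scalar, the one
    in \<open>T.A\<close> with the scalar one.\<close>
  have "\<one>\<^bsub>k\<^esub> \<odot>\<^bsub>free_module k (carrier H)\<^esub> basis_vec k x = basis_vec k x" for x
    by (auto simp: free_module_def basis_vec_def fun_eq_iff)
  then have "T.A = group_algebra k H" by (simp only: T.A_def group_algebra_def)
  with T.Tor_isomorphic_group_homology[of i]
  show "module k (Tor k (group_algebra k H) (group_trivial k) (group_trivial k) i)"
    "mod_isomorphic k (Tor k (group_algebra k H) (group_trivial k) (group_trivial k) i) (group_homology k H i)"
    by (simp_all only: group_trivial_def)
qed

theorem corollary11p7:
  fixes G :: "('g, 'c) monoid_scheme" and k :: "('k, 'd) ring_scheme"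
    and act :: "'g \<Rightarrow> 'k \<Rightarrow> 'k" and \<delta> :: 'k and n :: nat
  assumes "comm_group G" and "comm_G_ring G k act" and "\<delta> \<in> carrier k" and "odd n"
  shows "(\<forall>i. mod_isomorphic k
            (Tor k (brauer_algebra G k act \<delta> n) (brauer_trivial k) (brauer_trivial k) i)
            (Tor k (group_algebra k (wreath G n)) (group_trivial k) (group_trivial k) i))
       \<and> (\<forall>i. mod_isomorphic k
            (Tor k (group_algebra k (wreath G n)) (group_trivial k) (group_trivial k) i)
            (group_homology k (wreath G n) i))"
proof -
  interpret comm_G_ring G k act by (rule assms(2))
  interpret B: brauer G k act \<delta> n
  proof (intro brauer.intro brauer_axioms.intro assms(1))
    show "cring k" by (rule k.cring_axioms)
    show "act g \<delta> \<in> carrier k" if "g \<in> carrier G" for g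
      using act_aut[OF that] assms(3) by (auto simp: ring_iso_def ring_hom_def)
  qed
  have T: "module k (Tor k (group_algebra k (wreath G n)) (group_trivial k) (group_trivial k) i)"
    "mod_isomorphic k (Tor k (group_algebra k (wreath G n)) (group_trivial k) (group_trivial k) i)
      (group_homology k (wreath G n) i)" for i
    by (rule Tor_group_algebra[OF k.cring_axioms B.wreath_group])+
  \<comment> \<open>The first isomorphism runs through group homology, so the isomorphism for the
    group algebra is used in the reverse direction.\<close>
  show ?thesis
    using mod_isomorphic_trans[OF B.Tor_brauer_isomorphic_group_homology[OF assms(4)] mod_isomorphic_sym[OF T]] T(2)
    by blast
qed

end
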